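(* The two dg nonsymmetric operads $\mathrm{ncHyperCom}$ (with zero differential) and $\mathrm{ncBV}/_h\Delta$, the homotopy quotient of $\mathrm{ncBV}$ by $\Delta$, are quasi-isomorphic.
   Context: All operads are nonsymmetric (ns), in graded vector spaces or chain complexes over a field, with Koszul signs. $\mathrm{ncHyperCom}$ is the ns operad generated by operations $\nu_k$ of arity $k$ and degree $2k-4$, $k\ge2$, with relations $$\sum_{j=2}^{i}\nu_{n-j+1}\circ_{i-j+1}\nu_j=\sum_{k=2}^{n-i+1}\nu_{n-k+1}\circ_i\nu_k,\qquad n\ge 3,\ 2\le i\le n-1 .$$ $\mathrm{ncBV}$ is the ns operad generated by binary operations $m$ (degree $0$) and $b$ (degree $1$) and a unary operation $\Delta$ of degree $1$ with relations $\Delta\circ_1\Delta=0$, $m\circ_1m=m\circ_2m$, $m\circ_1b=b\circ_2m$, $b\circ_1m=m\circ_2b$, $b\circ_1b+b\circ_2b=0$, $\Delta\circ_1m-m\circ_1\Delta-m\circ_2\Delta=b$, $\Delta\circ_1b+b\circ_1\Delta+b\circ_2\Delta=0$. The homotopy quotient is represented by the following dg ns operad $\mathrm{ncBV}/_h\Delta$: freely adjoin to $\mathrm{ncBV}$ (which has zero differential) unary generators $a_1,a_2,\dots$, $|a_k|=2k$, with differential $\partial(a_k)=a_{k-1}\circ_1\Delta$, where $a_0:=\mathrm{id}$. Equivalently, an algebra over $\mathrm{ncBV}/_h\Delta$ is an $\mathrm{ncBV}$-algebra $A$ (in chain complexes with differential $\partial_A$) with unary operators $a_1,a_2,\dots$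 satisfying $a(z)\circ(\partial_A+\Delta z)=\partial_A\circ a(z)$, where $a(z)=1+a_1z+a_2z^2+\cdots$. Two dg operads are quasi-isomorphic if they are connected by a (zig-zag of) morphism(s) of dg ns operads inducing isomorphisms on homology. *)

theory Defs
  imports "HOL-Algebra.AbelCoset" "HOL-Algebra.Module" "HOL-Library.Poly_Mapping"
begin

section \<open>Differential graded nonsymmetric operads\<close>

definition ground_field :: "'k::field ring"
  where "ground_field = \<lparr>carrier = UNIV, mult = (*), one = 1, zero = 0, add = (+)\<rparr>"

text \<open>
  \<open>cmp P n d\<close> is the component of arity \<open>n\<close> and degree \<open>d\<close>; of its record only the additive group
  and the scalar multiplication matter, the fields \<open>mult\<close> and \<open>one\<close> inherited from rings are junk.
  \<open>pcomp P n d m e i\<close> is the partial composition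
  \<open>\<circ>\<^sub>i : P(n)\<^sub>d \<otimes> P(m)\<^sub>e \<rightarrow> P(n+m-1)\<^sub>d\<^sub>+\<^sub>e\<close>, with \<open>1 \<le> i \<le> n\<close>, and
  \<open>bdry P n d : P(n)\<^sub>d \<rightarrow> P(n)\<^sub>d\<^sub>-\<^sub>1\<close> the differential. The indices are kept
  because the carriers of different components need not be disjoint.
\<close>

record ('k, 'a) operad_data =
  cmp :: "nat \<Rightarrow> int \<Rightarrow> ('k, 'a) module"
  op_id :: 'a
  pcomp :: "nat \<Rightarrow> int \<Rightarrow> nat \<Rightarrow> int \<Rightarrow> nat \<Rightarrow> 'a \<Rightarrow> 'a \<Rightarrow> 'a"
  bdry :: "nat \<Rightarrow> int \<Rightarrow> 'a \<Rightarrow> 'a"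

definition linear_map :: "('k::field, 'a) module \<Rightarrow> ('k, 'b) module \<Rightarrow> ('a \<Rightarrow> 'b) \<Rightarrow> bool"
  where "linear_map V W f \<longleftrightarrow>
    (\<forall>x\<in>carrier V. f x \<in> carrier W) \<and>
    (\<forall>x\<in>carrier V. \<forall>y\<in>carrier V. f (x \<oplus>\<^bsub>V\<^esub> y) = f x \<oplus>\<^bsub>W\<^esub> f y) \<and>
    (\<forall>c. \<forall>x\<in>carrier V. f (c \<odot>\<^bsub>V\<^esub> x) = c \<odot>\<^bsub>W\<^esub> f x)"

locale dg_ns_operad =
  fixes P :: "('k::field, 'a) operad_data"
  assumes vector_space: "\<And>n d. module ground_field (cmp P n d)"
    and id_closed: "op_id P \<in> carrier (cmp P 1 0)"
    and pcomp_linear_left: "\<And>n d m e i y. \<lbrakk>1 \<le> i; i \<le> n; y \<in> carrier (cmp P m e)\<rbrakk> \<Longrightarrow>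
      linear_map (cmp P n d) (cmp P (n + m - 1) (d + e)) (\<lambda>x. pcomp P n d m e i x y)"
    and pcomp_linear_right: "\<And>n d m e i x. \<lbrakk>1 \<le> i; i \<le> n; x \<in> carrier (cmp P n d)\<rbrakk> \<Longrightarrow>
      linear_map (cmp P m e) (cmp P (n + m - 1) (d + e)) (\<lambda>y. pcomp P n d m e i x y)"
    and id_left: "\<And>n d x. x \<in> carrier (cmp P n d) \<Longrightarrow> pcomp P 1 0 n d 1 (op_id P) x = x"
    and id_right: "\<And>n d i x. \<lbrakk>1 \<le> i; i \<le> n; x \<in> carrier (cmp P n d)\<rbrakk> \<Longrightarrow>
      pcomp P n d 1 0 i x (op_id P) = x"
    and sequential: "\<And>l d m e n f i j x y z.
      \<lbrakk>1 \<le> i; i \<le> l; 1 \<le> j; j \<le> m;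
       x \<in> carrier (cmp P l d); y \<in> carrier (cmp P m e); z \<in> carrier (cmp P n f)\<rbrakk> \<Longrightarrow>
      pcomp P (l + m - 1) (d + e) n f (i - 1 + j) (pcomp P l d m e i x y) z =
      pcomp P l d (m + n - 1) (e + f) i x (pcomp P m e n f j y z)"
    and parallel: "\<And>l d m e n f i k x y z.
      \<lbrakk>1 \<le> i; i < k; k \<le> l;
       x \<in> carrier (cmp P l d); y \<in> carrier (cmp P m e); z \<in> carrier (cmp P n f)\<rbrakk> \<Longrightarrow>
      pcomp P (l + m - 1) (d + e) n f (k - 1 + m) (pcomp P l d m e i x y) z =
      ((-1) powi (e * f)) \<odot>\<^bsub>cmp P (l + m + n - 2) (d + e + f)\<^esub>
        pcomp P (l + n - 1) (d + f) m e i (pcomp P l d n f k x z) y"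
    and bdry_linear: "\<And>n d. linear_map (cmp P n d) (cmp P n (d - 1)) (bdry P n d)"
    and bdry_bdry: "\<And>n d x. x \<in> carrier (cmp P n d) \<Longrightarrow>
      bdry P n (d - 1) (bdry P n d x) = \<zero>\<^bsub>cmp P n (d - 2)\<^esub>"
    and bdry_pcomp: "\<And>n d m e i x y.
      \<lbrakk>1 \<le> i; i \<le> n; x \<in> carrier (cmp P n d); y \<in> carrier (cmp P m e)\<rbrakk> \<Longrightarrow>
      bdry P (n + m - 1) (d + e) (pcomp P n d m e i x y) =
      pcomp P n (d - 1) m e i (bdry P n d x) y
        \<oplus>\<^bsub>cmp P (n + m - 1) (d + e - 1)\<^esub>
      ((-1) powi d) \<odot>\<^bsub>cmp P (n + m - 1) (d + e - 1)\<^esub> pcomp P n d m (e - 1) i x (bdry P m e y)"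

locale dg_operad_morphism =
  fixes P :: "('k::field, 'a) operad_data" and Q :: "('k, 'b) operad_data"
    and f :: "nat \<Rightarrow> int \<Rightarrow> 'a \<Rightarrow> 'b"
  assumes linear: "\<And>n d. linear_map (cmp P n d) (cmp Q n d) (f n d)"
    and map_id: "f 1 0 (op_id P) = op_id Q"
    and map_pcomp: "\<And>n d m e i x y.
      \<lbrakk>1 \<le> i; i \<le> n; x \<in> carrier (cmp P n d); y \<in> carrier (cmp P m e)\<rbrakk> \<Longrightarrow>
      f (n + m - 1) (d + e) (pcomp P n d m e i x y) = pcomp Q n d m e i (f n d x) (f m e y)"
    and map_bdry: "\<And>n d x. x \<in> carrier (cmp P n d) \<Longrightarrow>
      f n (d - 1) (bdry P n d x) = bdry Q n d (f n d x)"

definition cycles :: "('k, 'a) operad_data \<Rightarrow> nat \<Rightarrow> int \<Rightarrow> 'a set"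
  where "cycles P n d = {x \<in> carrier (cmp P n d). bdry P n d x = \<zero>\<^bsub>cmp P n (d - 1)\<^esub>}"

definition boundaries :: "('k, 'a) operad_data \<Rightarrow> nat \<Rightarrow> int \<Rightarrow> 'a set"
  where "boundaries P n d = bdry P n (d + 1) ` carrier (cmp P n (d + 1))"

definition homology :: "('k, 'a) operad_data \<Rightarrow> nat \<Rightarrow> int \<Rightarrow> 'a set monoid"
  where "homology P n d = (cmp P n d)\<lparr>carrier := cycles P n d\<rparr> A_Mod boundaries P n d"

definition homology_map ::
    "('k, 'b) operad_data \<Rightarrow> (nat \<Rightarrow> int \<Rightarrow> 'a \<Rightarrow> 'b) \<Rightarrow> nat \<Rightarrow> int \<Rightarrow> 'a set \<Rightarrow> 'b set"
  where "homology_map Q f n d C = (\<Union>x\<in>C. boundaries Q n d +>\<^bsub>cmp Q n d\<^esub> f n d x)"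

definition quasi_iso_step :: "('k::field, 'a) operad_data \<Rightarrow> ('k, 'b) operad_data \<Rightarrow> bool"
  where "quasi_iso_step P Q \<longleftrightarrow> dg_ns_operad P \<and> dg_ns_operad Q \<and>
    (\<exists>f. dg_operad_morphism P Q f \<and>
      (\<forall>n d. homology_map Q f n d \<in> iso (homology P n d) (homology Q n d)))"

text \<open>
  All operads of a zig-zag have their elements in the one type \<open>'a\<close>. For the type used below this is
  no loss: it accommodates every operad of countable total dimension, in particular the bar-cobar
  resolutions of the two endpoints, through which any zig-zag can be replaced.
\<close>

definition quasi_isomorphic :: "('k::field, 'a) operad_data \<Rightarrow> ('k, 'a) operad_data \<Rightarrow> bool"
  where "quasi_isomorphic P Q \<longleftrightarrow>
    dg_ns_operad P \<and> dg_ns_operad Q \<and> equivclp quasi_iso_step P Q"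


section \<open>Operads presented by generators and relations\<close>

text \<open>
  The generators of both operads are taken from a single alphabet, so that the two presented operads
  have the same type. The symbol \<open>A 0\<close> is not used as a generator.
\<close>

datatype gen = Nu nat | Prod | Brk | Delta | A nat

fun gen_arity :: "gen \<Rightarrow> nat" where
  "gen_arity (Nu k) = k"
| "gen_arity Prod = 2"
| "gen_arity Brk = 2"
| "gen_arity Delta = 1"
| "gen_arity (A k) = 1"

fun gen_deg :: "gen \<Rightarrow> int" where
  "gen_deg (Nu k) = 2 * int k - 4"
| "gen_deg Prod = 0"
| "gen_deg Brk = 1"
| "gen_deg Delta = 1"
| "gen_deg (A k) = 2 * int k"

text \<open>
  \<open>Leaf\<close> is the trivial tree, i.e.\ the identity operation. A tree monomial
  \<open>Node g [t\<^sub>1, \<dots>, t\<^sub>r]\<close> stands for the iterated composite in which \<open>t\<^sub>1\<close>, then \<open>t\<^sub>2\<close>, \<dots> is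
  plugged into \<open>g\<close>; thus the generators are ordered by prefix traversal, which determines all
  Koszul signs below.
\<close>

datatype tree = Leaf | Node gen "tree list"

fun leaves :: "tree \<Rightarrow> nat" where
  "leaves Leaf = 1"
| "leaves (Node g ts) = sum_list (map leaves ts)"

fun tree_deg :: "tree \<Rightarrow> int" where
  "tree_deg Leaf = 0"
| "tree_deg (Node g ts) = gen_deg g + sum_list (map tree_deg ts)"

fun tree_over :: "gen set \<Rightarrow> tree \<Rightarrow> bool" where
  "tree_over G Leaf \<longleftrightarrow> True"
| "tree_over G (Node g ts) \<longleftrightarrow> g \<in> G \<and> length ts = gen_arity g \<and> (\<forall>t\<in>set ts. tree_over G t)"

text \<open>\<open>graft s i t\<close> glues \<open>t\<close> to the \<open>i\<close>-th leaf of \<open>s\<close>, for \<open>1 \<le> i \<le> leaves s\<close>.\<close>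

fun graft :: "tree \<Rightarrow> nat \<Rightarrow> tree \<Rightarrow> tree"
  and graft_list :: "tree list \<Rightarrow> nat \<Rightarrow> tree \<Rightarrow> tree list" where
  "graft Leaf i t = t"
| "graft (Node g ts) i t = Node g (graft_list ts i t)"
| "graft_list [] i t = []"
| "graft_list (s # ss) i t =
    (if i \<le> leaves s then graft s i t # ss else s # graft_list ss (i - leaves s) t)"

text \<open>The total degree of the vertices of a tree that come after its \<open>i\<close>-th leaf.\<close>

fun deg_after :: "tree \<Rightarrow> nat \<Rightarrow> int"
  and deg_after_list :: "tree list \<Rightarrow> nat \<Rightarrow> int" where
  "deg_after Leaf i = 0"
| "deg_after (Node g ts) i = deg_after_list ts i"
| "deg_after_list [] i = 0"
| "deg_after_list (s # ss) i =
    (if i \<le> leaves s then deg_after s i + sum_list (map tree_deg ss)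
     else deg_after_list ss (i - leaves s))"

definition scale :: "'k::field \<Rightarrow> ('b \<Rightarrow>\<^sub>0 'k) \<Rightarrow> 'b \<Rightarrow>\<^sub>0 'k"
  where "scale c x = Poly_Mapping.map ((*) c) x"

definition lin_ext :: "('b \<Rightarrow> ('c \<Rightarrow>\<^sub>0 'k::field)) \<Rightarrow> ('b \<Rightarrow>\<^sub>0 'k) \<Rightarrow> 'c \<Rightarrow>\<^sub>0 'k"
  where "lin_ext f x = (\<Sum>s\<in>Poly_Mapping.keys x. scale (Poly_Mapping.lookup x s) (f s))"

definition tcomp ::
    "(tree \<Rightarrow>\<^sub>0 'k::field) \<Rightarrow> nat \<Rightarrow> (tree \<Rightarrow>\<^sub>0 'k) \<Rightarrow> tree \<Rightarrow>\<^sub>0 'k"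
    (\<open>(_ \<circ>[_] _)\<close> [76, 0, 76] 75)
  where "x \<circ>[i] y = lin_ext (\<lambda>s. lin_ext (\<lambda>t.
    Poly_Mapping.single (graft s i t) ((-1) powi (deg_after s i * tree_deg t))) y) x"

definition tree_id :: "tree \<Rightarrow>\<^sub>0 'k::field"
  where "tree_id = Poly_Mapping.single Leaf 1"

definition corolla :: "gen \<Rightarrow> tree \<Rightarrow>\<^sub>0 'k::field"
  where "corolla g = Poly_Mapping.single (Node g (replicate (gen_arity g) Leaf)) 1"

text \<open>
  The derivation of the free operad that extends a map \<open>\<delta>\<close> on the generators.
  \<open>plug x 1 [t\<^sub>1, \<dots>, t\<^sub>r]\<close> plugs \<open>t\<^sub>1, \<dots>, t\<^sub>r\<close> into all inputs of \<open>x\<close>, and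
  \<open>diff_list\<close> is the Leibniz rule for \<open>t\<^sub>1 \<otimes> \<dots> \<otimes> t\<^sub>r\<close>.
\<close>

fun plug :: "(tree \<Rightarrow>\<^sub>0 'k::field) \<Rightarrow> nat \<Rightarrow> tree list \<Rightarrow> tree \<Rightarrow>\<^sub>0 'k" where
  "plug x p [] = x"
| "plug x p (t # ts) = plug (x \<circ>[p] Poly_Mapping.single t 1) (p + leaves t) ts"

fun diff_tree :: "(gen \<Rightarrow> (tree \<Rightarrow>\<^sub>0 'k::field)) \<Rightarrow> tree \<Rightarrow> tree \<Rightarrow>\<^sub>0 'k"
  and diff_list :: "(gen \<Rightarrow> (tree \<Rightarrow>\<^sub>0 'k::field)) \<Rightarrow> tree list \<Rightarrow> tree list \<Rightarrow>\<^sub>0 'k" where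
  "diff_tree \<delta> Leaf = 0"
| "diff_tree \<delta> (Node g ts) = plug (\<delta> g) 1 ts +
    lin_ext (\<lambda>ss. Poly_Mapping.single (Node g ss) ((-1) powi gen_deg g)) (diff_list \<delta> ts)"
| "diff_list \<delta> [] = 0"
| "diff_list \<delta> (t # ts) =
    lin_ext (\<lambda>s. Poly_Mapping.single (s # ts) 1) (diff_tree \<delta> t) +
    lin_ext (\<lambda>ss. Poly_Mapping.single (t # ss) ((-1) powi tree_deg t)) (diff_list \<delta> ts)"

definition free_cmp :: "gen set \<Rightarrow> nat \<Rightarrow> int \<Rightarrow> (tree \<Rightarrow>\<^sub>0 'k::field) set"
  where "free_cmp G n d =
    {x. \<forall>t\<in>Poly_Mapping.keys x. tree_over G t \<and> leaves t = n \<and> tree_deg t = d}"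

text \<open>The operadic ideal generated by a set \<open>R\<close> of homogeneous relators.\<close>

inductive in_ideal ::
    "gen set \<Rightarrow> (tree \<Rightarrow>\<^sub>0 'k::field) set \<Rightarrow> nat \<Rightarrow> int \<Rightarrow> (tree \<Rightarrow>\<^sub>0 'k) \<Rightarrow> bool"
  for G R where
  relator: "\<lbrakk>r \<in> R; r \<in> free_cmp G n d\<rbrakk> \<Longrightarrow> in_ideal G R n d r"
| zero: "in_ideal G R n d 0"
| add: "\<lbrakk>in_ideal G R n d x; in_ideal G R n d y\<rbrakk> \<Longrightarrow> in_ideal G R n d (x + y)"
| scale: "in_ideal G R n d x \<Longrightarrow> in_ideal G R n d (scale c x)"
| comp_left: "\<lbrakk>in_ideal G R n d x; y \<in> free_cmp G m e; 1 \<le> i; i \<le> n\<rbrakk> \<Longrightarrow>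
    in_ideal G R (n + m - 1) (d + e) (x \<circ>[i] y)"
| comp_right: "\<lbrakk>x \<in> free_cmp G n d; in_ideal G R m e y; 1 \<le> i; i \<le> n\<rbrakk> \<Longrightarrow>
    in_ideal G R (n + m - 1) (d + e) (x \<circ>[i] y)"

definition ideal_rel ::
    "gen set \<Rightarrow> (tree \<Rightarrow>\<^sub>0 'k::field) set \<Rightarrow> nat \<Rightarrow> int \<Rightarrow> (tree \<Rightarrow>\<^sub>0 'k) rel"
  where "ideal_rel G R n d =
    {(x, y). x \<in> free_cmp G n d \<and> y \<in> free_cmp G n d \<and> in_ideal G R n d (x - y)}"

definition presented_operad ::
    "gen set \<Rightarrow> (tree \<Rightarrow>\<^sub>0 'k::field) set \<Rightarrow> (gen \<Rightarrow> (tree \<Rightarrow>\<^sub>0 'k)) \<Rightarrow>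
      ('k, (tree \<Rightarrow>\<^sub>0 'k) set) operad_data"
  where "presented_operad G R \<delta> = \<lparr>
    cmp = (\<lambda>n d. \<lparr>
      carrier = free_cmp G n d // ideal_rel G R n d,
      mult = undefined, one = undefined,
      zero = ideal_rel G R n d `` {0},
      add = (\<lambda>X Y. \<Union>x\<in>X. \<Union>y\<in>Y. ideal_rel G R n d `` {x + y}),
      smult = (\<lambda>c X. \<Union>x\<in>X. ideal_rel G R n d `` {scale c x})\<rparr>),
    op_id = ideal_rel G R 1 0 `` {tree_id},
    pcomp = (\<lambda>n d m e i X Y. \<Union>x\<in>X. \<Union>y\<in>Y. ideal_rel G R (n + m - 1) (d + e) `` {x \<circ>[i] y}),
    bdry = (\<lambda>n d X. \<Union>x\<in>X. ideal_rel G R n (d - 1) `` {lin_ext (diff_tree \<delta>) x})\<rparr>"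


section \<open>The two operads\<close>

definition ncHyperCom_relators :: "(tree \<Rightarrow>\<^sub>0 'k::field) set"
  where "ncHyperCom_relators =
    {(\<Sum>j = 2..i. corolla (Nu (n - j + 1)) \<circ>[i - j + 1] corolla (Nu j)) -
     (\<Sum>k = 2..n - i + 1. corolla (Nu (n - k + 1)) \<circ>[i] corolla (Nu k))
     | n i. 3 \<le> n \<and> 2 \<le> i \<and> i \<le> n - 1}"

definition ncHyperCom :: "('k::field, (tree \<Rightarrow>\<^sub>0 'k) set) operad_data"
  where "ncHyperCom = presented_operad {Nu k | k. 2 \<le> k} ncHyperCom_relators (\<lambda>_. 0)"

definition ncBV_gens :: "gen set"
  where "ncBV_gens = {Prod, Brk, Delta}"

definition ncBV_relators :: "(tree \<Rightarrow>\<^sub>0 'k::field) set"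
  where "ncBV_relators = (let m = corolla Prod; b = corolla Brk; \<Delta> = corolla Delta in
    {\<Delta> \<circ>[1] \<Delta>,
     m \<circ>[1] m - m \<circ>[2] m,
     m \<circ>[1] b - b \<circ>[2] m,
     b \<circ>[1] m - m \<circ>[2] b,
     b \<circ>[1] b + b \<circ>[2] b,
     \<Delta> \<circ>[1] m - m \<circ>[1] \<Delta> - m \<circ>[2] \<Delta> - b,
     \<Delta> \<circ>[1] b + b \<circ>[1] \<Delta> + b \<circ>[2] \<Delta>})"

definition ncBV :: "('k::field, (tree \<Rightarrow>\<^sub>0 'k) set) operad_data"
  where "ncBV = presented_operad ncBV_gens ncBV_relators (\<lambda>_. 0)"

fun a_op :: "nat \<Rightarrow> tree \<Rightarrow>\<^sub>0 'k::field" where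
  "a_op 0 = tree_id"
| "a_op (Suc k) = corolla (A (Suc k))"

fun hq_diff :: "gen \<Rightarrow> tree \<Rightarrow>\<^sub>0 'k::field" where
  "hq_diff (A k) = a_op (k - 1) \<circ>[1] corolla Delta"
| "hq_diff _ = 0"

text \<open>
  Adjoining free generators to \<open>ncBV\<close> amounts to enlarging the generating set of its
  presentation and keeping the relators.
\<close>

definition ncBV_hquot_Delta :: "('k::field, (tree \<Rightarrow>\<^sub>0 'k) set) operad_data"
  where "ncBV_hquot_Delta =
    presented_operad (ncBV_gens \<union> {A k | k. 1 \<le> k}) ncBV_relators hq_diff"

end

(*
  The morphism sends nu_n to an explicit sum N = sum_j a_(j-1) E_j of composites of m and the a_k.
  The E_j are such that sum_j a_j E_j is the identity (a_0 = id) and the boundary of E_j is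
  - Delta E_(j+1), so that the boundary of N telescopes to zero.
  To see that it is a quasi-isomorphism, ncBV/_h Delta is rewritten to normal monomials in m, Delta
  and the a_k. An algebraic Morse matching pairs off monomials along a_k -> a_(k-1) Delta and leaves
  critical monomials. These are in bijection with the trees of ncHyperCom in which the first child of
  every vertex is a leaf: such trees span ncHyperCom by its relations, and their images are, up to
  sign, the critical monomials plus lower terms.
*)

theory Submission
  imports Defs "HOL-Library.List_Lexorder"
begin

section \<open>Linear maps between spaces of finitely supported functions\<close>

text \<open>The presented quotient consists of classes only, so every identity and every
  independence statement in it goes through a solution of its word problem: an element lies in the
  ideal iff its normal form vanishes. The bracket disappears there, and its compatibility with
  \<open>m\<close> becomes, up to signs, the second order rule
  \<open>Delta(xy)z = Delta(xyz) - x Delta(yz) + x Delta(y)z\<close>, which also drives the boundary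
  formula for the \<open>E_j\<close>. The relations of the \<open>nu_n\<close> come from a parallel
  computation: replacing an argument \<open>y\<close> once by all \<open>nu(..., y)\<close> and once
  by all \<open>nu(y, ...)\<close>, the difference for \<open>E_j\<close> consists of terms
  \<open>E_(j+1)\<close> that occur only when \<open>y\<close> is first or last, whereas the
  relators concern the inner positions. The matching leaves monomials over because
  \<open>Delta w\<close> is a reducible left factor when \<open>w\<close> is a product, so that
  \<open>a_1 w\<close> cannot be traded there. Independence in ncHyperCom is never proved
  separately: spanning trees whose images have distinct leading monomials, different from the
  leading monomials of boundaries, are independent even in homology.\<close>

abbreviation bas :: "'b \<Rightarrow> ('b \<Rightarrow>\<^sub>0 'k::field)"
  where "bas t \<equiv> Poly_Mapping.single t 1"

lemma lookup_scale [simp]: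
  "Poly_Mapping.lookup (scale c x) s = c * Poly_Mapping.lookup x s"
  by (simp add: scale_def Poly_Mapping.map.rep_eq when_def)

lemma scale_add_right: "scale c (x + y) = scale c x + scale c y"
  by (rule poly_mapping_eqI) (simp add: lookup_add algebra_simps)

lemma scale_add_left: "scale (c + d) x = scale c x + scale d x"
  by (rule poly_mapping_eqI) (simp add: lookup_add algebra_simps)

lemma scale_scale [simp]: "scale c (scale d x) = scale (c * d) x"
  by (rule poly_mapping_eqI) (simp add: algebra_simps)

lemma scale_one [simp]: "scale 1 x = x"
  by (rule poly_mapping_eqI) simp

lemma scale_zero_left [simp]: "scale 0 x = 0"
  by (rule poly_mapping_eqI) simp

lemma scale_zero_right [simp]: "scale c 0 = 0"
  by (rule poly_mapping_eqI) simp

lemma scale_minus_right: "scale c (- x) = - scale c x"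
  by (rule poly_mapping_eqI) simp

lemma scale_minus_left: "scale (- c) x = - scale c x"
  by (rule poly_mapping_eqI) simp

lemma scale_minus_one [simp]: "scale (- 1) x = - x"
  by (rule poly_mapping_eqI) simp

lemma scale_diff_right: "scale c (x - y) = scale c x - scale c y"
  by (rule poly_mapping_eqI) (simp add: lookup_minus algebra_simps)

lemma scale_sum: "scale c (sum f S) = (\<Sum>a\<in>S. scale c (f a))"
  by (rule poly_mapping_eqI) (simp add: lookup_sum sum_distrib_left)

lemma scale_single [simp]: "scale c (Poly_Mapping.single s d) = Poly_Mapping.single s (c * d)"
  by (rule poly_mapping_eqI) (simp add: lookup_single when_def)

lemma keys_scale: "Poly_Mapping.keys (scale c x) \<subseteq> Poly_Mapping.keys x"
  by (auto simp: in_keys_iff)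

lemma keys_sum: "Poly_Mapping.keys (sum f S) \<subseteq> (\<Union>a\<in>S. Poly_Mapping.keys (f a :: 'b \<Rightarrow>\<^sub>0 'k::field))"
proof (induction S rule: infinite_finite_induct)
  case (insert a S)
  then show ?case using keys_add[of "f a" "sum f S"] by auto
qed auto

lemma lin_ext_superset:
  assumes "finite S" "Poly_Mapping.keys x \<subseteq> S"
  shows "lin_ext f x = (\<Sum>s\<in>S. scale (Poly_Mapping.lookup x s) (f s))"
  unfolding lin_ext_def
  by (rule sum.mono_neutral_left) (use assms in \<open>auto simp: in_keys_iff\<close>)

lemma lin_ext_add: "lin_ext f (x + y) = lin_ext f x + lin_ext f y"
proof -
  let ?S = "Poly_Mapping.keys x \<union> Poly_Mapping.keys y"
  have "lin_ext f (x + y) = (\<Sum>s\<in>?S. scale (Poly_Mapping.lookup (x + y) s) (f s))"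
    by (rule lin_ext_superset) (use keys_add[of x y] in auto)
  moreover have "lin_ext f x = (\<Sum>s\<in>?S. scale (Poly_Mapping.lookup x s) (f s))"
    by (rule lin_ext_superset) auto
  moreover have "lin_ext f y = (\<Sum>s\<in>?S. scale (Poly_Mapping.lookup y s) (f s))"
    by (rule lin_ext_superset) auto
  ultimately show ?thesis by (simp add: lookup_add scale_add_left sum.distrib)
qed

lemma lin_ext_scale: "lin_ext f (scale c x) = scale c (lin_ext f x)"
proof -
  have "lin_ext f (scale c x) = (\<Sum>s\<in>Poly_Mapping.keys x. scale (Poly_Mapping.lookup (scale c x) s) (f s))"
    by (rule lin_ext_superset) (auto simp: keys_scale[THEN subsetD])
  then show ?thesis by (simp add: lin_ext_def scale_sum)
qed

lemma lin_ext_single [simp]: "lin_ext f (Poly_Mapping.single s c) = scale c (f s)"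
  by (cases "c = 0") (simp_all add: lin_ext_def)

lemma lin_ext_zero [simp]: "lin_ext f 0 = 0"
  by (simp add: lin_ext_def)

definition is_lin :: "(('b \<Rightarrow>\<^sub>0 'k::field) \<Rightarrow> ('c \<Rightarrow>\<^sub>0 'k)) \<Rightarrow> bool"
  where "is_lin f \<longleftrightarrow> (\<forall>x y. f (x + y) = f x + f y) \<and> (\<forall>c x. f (scale c x) = scale c (f x))"

lemma is_lin_add: "is_lin f \<Longrightarrow> f (x + y) = f x + f y"
  and is_lin_scale: "is_lin f \<Longrightarrow> f (scale c x) = scale c (f x)"
  by (auto simp: is_lin_def)

lemma is_lin_zero: "is_lin f \<Longrightarrow> f 0 = 0"
  using is_lin_scale[of f 0 0] by simp

lemma is_lin_minus: "is_lin f \<Longrightarrow> f (- x) = - f x"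
  using is_lin_scale[of f "-1" x] by simp

lemma is_lin_diff: "is_lin f \<Longrightarrow> f (x - y) = f x - f y"
  using is_lin_add[of f x "- y"] by (simp add: is_lin_minus)

lemma is_lin_sum: "is_lin f \<Longrightarrow> f (sum g S) = (\<Sum>a\<in>S. f (g a))"
  by (induction S rule: infinite_finite_induct) (auto simp: is_lin_zero is_lin_add)

lemma poly_mapping_sum_single:
  "x = (\<Sum>s\<in>Poly_Mapping.keys x. scale (Poly_Mapping.lookup x s) (bas s))"
proof (rule poly_mapping_eqI)
  fix s
  show "Poly_Mapping.lookup x s = Poly_Mapping.lookup
      (\<Sum>s\<in>Poly_Mapping.keys x. scale (Poly_Mapping.lookup x s) (bas s)) s"
    by (simp add: lookup_sum lookup_single when_def in_keys_iff)
qed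

lemma is_lin_lin_ext: "is_lin f \<Longrightarrow> f x = lin_ext (\<lambda>s. f (bas s)) x"
  by (subst poly_mapping_sum_single[of x])
    (simp only: is_lin_sum is_lin_scale lin_ext_def)

lemma lin_ext_cong:
  "(\<And>s. s \<in> Poly_Mapping.keys x \<Longrightarrow> f s = g s) \<Longrightarrow> lin_ext f x = lin_ext g x"
  by (simp add: lin_ext_def)

text \<open>Comparing only on basis elements in the support of \<open>x\<close> allows the arity,
  degree or normality of \<open>x\<close> to be used in the check.\<close>

lemma lin_eqI:
  assumes "is_lin f" "is_lin g" "\<And>s. s \<in> Poly_Mapping.keys x \<Longrightarrow> f (bas s) = g (bas s)"
  shows "f x = g x"
  using is_lin_lin_ext[OF assms(1)] is_lin_lin_ext[OF assms(2)] assms(3)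
  by (metis (no_types, lifting) lin_ext_cong)

text \<open>Linearity of composed expressions is discharged by these rules, so that an identity
  between multilinear expressions is reduced to basis elements one argument at a time.\<close>

named_theorems lin_intros

lemma is_lin_lin_extI [lin_intros, simp]: "is_lin (lin_ext f)"
  by (simp add: is_lin_def lin_ext_add lin_ext_scale)

lemma is_lin_id [lin_intros]: "is_lin (\<lambda>x. x)"
  by (simp add: is_lin_def)

lemma is_lin_const0 [lin_intros]: "is_lin (\<lambda>x. 0)"
  by (simp add: is_lin_def)

lemma is_lin_scaleI [lin_intros]: "is_lin f \<Longrightarrow> is_lin (\<lambda>x. scale c (f x))"
  by (simp add: is_lin_def scale_add_right mult.commute)

lemma is_lin_addI [lin_intros]: "is_lin f \<Longrightarrow> is_lin g \<Longrightarrow> is_lin (\<lambda>x. f x + g x)"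
  by (simp add: is_lin_def scale_add_right)

lemma is_lin_diffI [lin_intros]: "is_lin f \<Longrightarrow> is_lin g \<Longrightarrow> is_lin (\<lambda>x. f x - g x)"
  by (simp add: is_lin_def scale_diff_right)

lemma is_lin_uminusI [lin_intros]: "is_lin f \<Longrightarrow> is_lin (\<lambda>x. - f x)"
  by (simp add: is_lin_def scale_minus_right)

lemma is_lin_comp: "is_lin f \<Longrightarrow> is_lin g \<Longrightarrow> is_lin (\<lambda>x. f (g x))"
  by (simp add: is_lin_def)

lemma is_lin_lin_ext_comp [lin_intros]: "is_lin g \<Longrightarrow> is_lin (\<lambda>x. lin_ext f (g x))"
  by (rule is_lin_comp) simp_all

lemma lin_ext_fun_add: "lin_ext (\<lambda>s. f s + g s) x = lin_ext f x + lin_ext g x"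
  by (simp add: lin_ext_def scale_add_right sum.distrib)

lemma lin_ext_fun_scale: "lin_ext (\<lambda>s. scale c (f s)) x = scale c (lin_ext f x)"
  by (simp add: lin_ext_def scale_sum mult.commute)

lemma lin_ext_fun_zero [simp]: "lin_ext (\<lambda>s. 0) x = 0"
  by (simp add: lin_ext_def)

lemma lin_ext_fun_comp [lin_intros]:
  "(\<And>s. is_lin (f s)) \<Longrightarrow> is_lin (\<lambda>y. lin_ext (\<lambda>s. f s y) x)"
  unfolding is_lin_def by (simp add: lin_ext_fun_add lin_ext_fun_scale)

lemma is_lin_of_lin_ext: "is_lin g \<Longrightarrow> g (lin_ext f x) = lin_ext (\<lambda>s. g (f s)) x"
  by (simp add: lin_ext_def is_lin_sum is_lin_scale)

lemma lin_ext_lin_ext: "lin_ext g (lin_ext f x) = lin_ext (\<lambda>s. lin_ext g (f s)) x"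
  by (rule is_lin_of_lin_ext) simp

lemma lin_ext_id [simp]: "lin_ext bas x = x"
  using poly_mapping_sum_single[of x] by (simp add: lin_ext_def)

lemma keys_lin_ext:
  "Poly_Mapping.keys (lin_ext f x) \<subseteq> (\<Union>s\<in>Poly_Mapping.keys x. Poly_Mapping.keys (f s))"
  unfolding lin_ext_def
  by (rule order.trans[OF keys_sum]) (use keys_scale in fastforce)

lemma powi_minus_one: "(-1 :: 'k::field) powi e = (if even e then 1 else -1)"
proof (cases "even e")
  case True
  then obtain m where "e = 2 * m" by blast
  then show ?thesis by (simp add: power_int_mult)
next
  case False
  then obtain m where "e = 2 * m + 1" by (elim oddE)
  then show ?thesis by (simp add: power_int_add power_int_mult)
qed

lemma powi_minus_one_eqI: "even (a - b) \<Longrightarrow> (-1 :: 'k::field) powi a = (-1) powi b"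
  by (simp add: powi_minus_one)

lemma powi_minus_one_add: "(-1 :: 'k::field) powi (a + b) = (-1) powi a * (-1) powi b"
  by (simp add: powi_minus_one)


section \<open>Grafting of trees\<close>

lemma graft_Leaf [simp]:
  "graft s i Leaf = s" "graft_list ss i Leaf = ss"
  by (induction s i Leaf and ss i Leaf rule: graft_graft_list.induct) auto

text \<open>The additive form avoids the truncated subtraction in \<open>n + m - 1\<close>; index
  conditions then fall to linear arithmetic.\<close>

lemma leaves_graft:
  "\<lbrakk>1 \<le> i; i \<le> leaves s\<rbrakk> \<Longrightarrow> leaves (graft s i t) + 1 = leaves s + leaves t"
  "\<lbrakk>1 \<le> i; i \<le> sum_list (map leaves ss)\<rbrakk> \<Longrightarrow>
    sum_list (map leaves (graft_list ss i t)) + 1 = sum_list (map leaves ss) + leaves t"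
  by (induction s i t and ss i t rule: graft_graft_list.induct) auto

lemma leaves_graft_eq:
  "\<lbrakk>1 \<le> i; i \<le> leaves s\<rbrakk> \<Longrightarrow> leaves (graft s i t) = leaves s + leaves t - 1"
  "\<lbrakk>1 \<le> i; i \<le> sum_list (map leaves ss)\<rbrakk> \<Longrightarrow>
    sum_list (map leaves (graft_list ss i t)) = sum_list (map leaves ss) + leaves t - 1"
  using leaves_graft(1)[of i s t] leaves_graft(2)[of i ss t] by linarith+

lemma tree_deg_graft:
  "\<lbrakk>1 \<le> i; i \<le> leaves s\<rbrakk> \<Longrightarrow> tree_deg (graft s i t) = tree_deg s + tree_deg t"
  "\<lbrakk>1 \<le> i; i \<le> sum_list (map leaves ss)\<rbrakk> \<Longrightarrow>
    sum_list (map tree_deg (graft_list ss i t)) = sum_list (map tree_deg ss) + tree_deg t"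
  by (induction s i t and ss i t rule: graft_graft_list.induct) auto

lemma length_graft_list [simp]: "length (graft_list ss i t) = length ss"
  by (induction ss arbitrary: i) auto

lemma tree_over_graft:
  "\<lbrakk>tree_over G s; tree_over G t\<rbrakk> \<Longrightarrow> tree_over G (graft s i t)"
  "\<lbrakk>\<forall>s\<in>set ss. tree_over G s; tree_over G t\<rbrakk> \<Longrightarrow> \<forall>s\<in>set (graft_list ss i t). tree_over G s"
  by (induction s i t and ss i t rule: graft_graft_list.induct) auto

lemma graft_sequential:
  "\<lbrakk>1 \<le> i; i \<le> leaves s; 1 \<le> j; j \<le> leaves t\<rbrakk> \<Longrightarrow>
    graft (graft s i t) (i - 1 + j) u = graft s i (graft t j u)"
  "\<lbrakk>1 \<le> i; i \<le> sum_list (map leaves ss); 1 \<le> j; j \<le> leaves t\<rbrakk> \<Longrightarrow>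
    graft_list (graft_list ss i t) (i - 1 + j) u = graft_list ss i (graft t j u)"
proof (induction s i t and ss i t rule: graft_graft_list.induct)
  case (4 s ss i t)
  show ?case
  proof (cases "i \<le> leaves s")
    case True
    then have "i - 1 + j \<le> leaves (graft s i t)"
      using leaves_graft(1)[of i s t] 4(3-) by linarith
    then show ?thesis using True 4 by simp
  next
    case False
    then have "i - leaves s - 1 + j = i - 1 + j - leaves s" "\<not> i - 1 + j \<le> leaves s" "i - leaves s \<ge> 1"
      "i - leaves s \<le> sum_list (map leaves ss)"
      using 4(3-) by auto
    then show ?thesis using False 4 by simp
  qed
qed auto

lemma graft_parallel:
  "\<lbrakk>1 \<le> i; i < k; k \<le> leaves s\<rbrakk> \<Longrightarrow>
    graft (graft s i t) (k - 1 + leaves t) u = graft (graft s k u) i t"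
  "\<lbrakk>1 \<le> i; i < k; k \<le> sum_list (map leaves ss)\<rbrakk> \<Longrightarrow>
    graft_list (graft_list ss i t) (k - 1 + leaves t) u = graft_list (graft_list ss k u) i t"
proof (induction s i t and ss i t arbitrary: k and k rule: graft_graft_list.induct)
  case (4 s ss i t)
  show ?case
  proof (cases "i \<le> leaves s")
    case i: True
    note l = leaves_graft(1)[of i s t]
    show ?thesis
    proof (cases "k \<le> leaves s")
      case True
      then have "k - 1 + leaves t \<le> leaves (graft s i t)" "i \<le> leaves (graft s k u)"
        using l leaves_graft(1)[of k s u] 4(3-) i by linarith+
      then show ?thesis using True i 4 by simp
    next
      case False
      then have "\<not> k - 1 + leaves t \<le> leaves (graft s i t)"
        "k - 1 + leaves t - leaves (graft s i t) = k - leaves s"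
        using l 4(3-) i by linarith+
      then show ?thesis using False i by simp
    qed
  next
    case False
    then have "\<not> k \<le> leaves s" "\<not> k - 1 + leaves t \<le> leaves s"
      "k - leaves s - 1 + leaves t = k - 1 + leaves t - leaves s"
      "1 \<le> i - leaves s" "i - leaves s < k - leaves s" "k - leaves s \<le> sum_list (map leaves ss)"
      using 4(3-) by auto
    then show ?thesis using False 4(2)[of "k - leaves s"] by simp
  qed
qed auto

text \<open>A vertex after leaf \<open>j\<close> of the inserted \<open>t\<close> lies either in
  \<open>t\<close> after that leaf, or in \<open>s\<close> after the leaf \<open>i\<close> that
  \<open>t\<close> has replaced.\<close>

lemma deg_after_graft_in:
  "\<lbrakk>1 \<le> i; i \<le> leaves s; 1 \<le> j; j \<le> leaves t\<rbrakk> \<Longrightarrow>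
    deg_after (graft s i t) (i - 1 + j) = deg_after s i + deg_after t j"
  "\<lbrakk>1 \<le> i; i \<le> sum_list (map leaves ss); 1 \<le> j; j \<le> leaves t\<rbrakk> \<Longrightarrow>
    deg_after_list (graft_list ss i t) (i - 1 + j) = deg_after_list ss i + deg_after t j"
proof (induction s i t and ss i t rule: graft_graft_list.induct)
  case (4 s ss i t)
  show ?case
  proof (cases "i \<le> leaves s")
    case True
    then have "i - 1 + j \<le> leaves (graft s i t)"
      using leaves_graft(1)[of i s t] 4(3-) by linarith
    then show ?thesis using True 4 by simp
  next
    case False
    then have "i - leaves s - 1 + j = i - 1 + j - leaves s" "\<not> i - 1 + j \<le> leaves s" "i - leaves s \<ge> 1"
      "i - leaves s \<le> sum_list (map leaves ss)"
      using 4(3-) by auto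
    then show ?thesis using False 4 by simp
  qed
qed auto

text \<open>The vertices of \<open>t\<close>, inserted to the left of leaf \<open>k\<close>, precede
  that leaf in prefix order; only the number of the leaf shifts.\<close>

lemma deg_after_graft_right:
  "\<lbrakk>1 \<le> i; i < k; k \<le> leaves s\<rbrakk> \<Longrightarrow>
    deg_after (graft s i t) (k - 1 + leaves t) = deg_after s k"
  "\<lbrakk>1 \<le> i; i < k; k \<le> sum_list (map leaves ss)\<rbrakk> \<Longrightarrow>
    deg_after_list (graft_list ss i t) (k - 1 + leaves t) = deg_after_list ss k"
proof (induction s i t and ss i t arbitrary: k and k rule: graft_graft_list.induct)
  case (4 s ss i t)
  show ?case
  proof (cases "i \<le> leaves s")
    case i: True
    note l = leaves_graft(1)[of i s t]
    show ?thesis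
    proof (cases "k \<le> leaves s")
      case True
      then have "k - 1 + leaves t \<le> leaves (graft s i t)"
        using l 4(3-) i by linarith+
      then show ?thesis using True i 4 by simp
    next
      case False
      then have "\<not> k - 1 + leaves t \<le> leaves (graft s i t)"
        "k - 1 + leaves t - leaves (graft s i t) = k - leaves s"
        using l 4(3-) i by linarith+
      then show ?thesis using False i by simp
    qed
  next
    case False
    then have "\<not> k \<le> leaves s" "\<not> k - 1 + leaves t \<le> leaves s"
      "k - leaves s - 1 + leaves t = k - 1 + leaves t - leaves s"
      "1 \<le> i - leaves s" "i - leaves s < k - leaves s" "k - leaves s \<le> sum_list (map leaves ss)"
      using 4(3-) by auto
    then show ?thesis using False 4(2)[of "k - leaves s"] by simp
  qed
qed auto

text \<open>All of \<open>t\<close> is traversed after leaf \<open>j\<close>, so its whole degree is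
  added. The asymmetry between insertion to the left and to the right is the source of the Koszul
  sign in the parallel axiom.\<close>

lemma deg_after_graft_left:
  "\<lbrakk>1 \<le> j; j < i; i \<le> leaves s\<rbrakk> \<Longrightarrow>
    deg_after (graft s i t) j = deg_after s j + tree_deg t"
  "\<lbrakk>1 \<le> j; j < i; i \<le> sum_list (map leaves ss)\<rbrakk> \<Longrightarrow>
    deg_after_list (graft_list ss i t) j = deg_after_list ss j + tree_deg t"
proof (induction s i t and ss i t arbitrary: j and j rule: graft_graft_list.induct)
  case (4 s ss i t)
  show ?case
  proof (cases "i \<le> leaves s")
    case i: True
    then have "j \<le> leaves (graft s i t)" using leaves_graft(1)[of i s t] 4(3-) by linarith
    then show ?thesis using i 4 by simp
  next
    case i: False
    then have m: "i - leaves s \<le> sum_list (map leaves ss)" "1 \<le> i - leaves s" using 4(3-) by auto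
    show ?thesis
    proof (cases "j \<le> leaves s")
      case True
      then show ?thesis using i m tree_deg_graft(2)[of "i - leaves s" ss t] by simp
    next
      case False
      then show ?thesis using i m 4(2)[of "j - leaves s"] 4(3-) by simp
    qed
  qed
qed auto

section \<open>The free operad\<close>

lemma tcomp_bas:
  "bas s \<circ>[i] bas t = Poly_Mapping.single (graft s i t) ((-1) powi (deg_after s i * tree_deg t))"
  by (simp add: tcomp_def)

lemma is_lin_tcomp_left [lin_intros, simp]: "is_lin (\<lambda>x. x \<circ>[i] y)"
  unfolding tcomp_def by (intro lin_intros)

lemma is_lin_tcomp_right [lin_intros, simp]: "is_lin (\<lambda>y. x \<circ>[i] y)"
  unfolding tcomp_def by (intro lin_intros)

lemmas tcomp_add_left = is_lin_add[OF is_lin_tcomp_left]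
  and tcomp_diff_left = is_lin_diff[OF is_lin_tcomp_left]
  and tcomp_diff_right = is_lin_diff[OF is_lin_tcomp_right]
  and tcomp_scale_left = is_lin_scale[OF is_lin_tcomp_left]
  and tcomp_scale_right = is_lin_scale[OF is_lin_tcomp_right]
  and tcomp_zero_left [simp] = is_lin_zero[OF is_lin_tcomp_left]
  and tcomp_zero_right [simp] = is_lin_zero[OF is_lin_tcomp_right]

lemma is_lin_tcomp_left_comp [lin_intros]: "is_lin f \<Longrightarrow> is_lin (\<lambda>x. f x \<circ>[i] y)"
  by (rule is_lin_comp[OF is_lin_tcomp_left])

lemma is_lin_tcomp_right_comp [lin_intros]: "is_lin f \<Longrightarrow> is_lin (\<lambda>x. y \<circ>[i] f x)"
  by (rule is_lin_comp[OF is_lin_tcomp_right])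

lemma free_cmp_zero [simp]: "0 \<in> free_cmp G n d"
  by (simp add: free_cmp_def)

lemma free_cmp_add: "\<lbrakk>x \<in> free_cmp G n d; y \<in> free_cmp G n d\<rbrakk> \<Longrightarrow> x + y \<in> free_cmp G n d"
  using keys_add[of x y] by (auto simp: free_cmp_def)

lemma free_cmp_scale: "x \<in> free_cmp G n d \<Longrightarrow> scale c x \<in> free_cmp G n d"
  using keys_scale[of c x] by (auto simp: free_cmp_def)

lemma free_cmp_uminus: "x \<in> free_cmp G n d \<Longrightarrow> - x \<in> free_cmp G n d"
  by (auto simp: free_cmp_def)

lemma free_cmp_diff: "\<lbrakk>x \<in> free_cmp G n d; y \<in> free_cmp G n d\<rbrakk> \<Longrightarrow> x - y \<in> free_cmp G n d"
  using free_cmp_add[OF _ free_cmp_uminus, of x G n d y] by simp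

lemma free_cmp_sum: "(\<And>a. a \<in> S \<Longrightarrow> f a \<in> free_cmp G n d) \<Longrightarrow> sum f S \<in> free_cmp G n d"
  by (induction S rule: infinite_finite_induct) (auto intro: free_cmp_add)

lemma free_cmp_single:
  "tree_over G t \<Longrightarrow> leaves t = n \<Longrightarrow> tree_deg t = d \<Longrightarrow> Poly_Mapping.single t c \<in> free_cmp G n d"
  by (cases "c = 0") (simp_all add: free_cmp_def)

lemma free_cmp_lin_ext:
  "(\<And>s. s \<in> Poly_Mapping.keys x \<Longrightarrow> f s \<in> free_cmp G n d) \<Longrightarrow> lin_ext f x \<in> free_cmp G n d"
  unfolding lin_ext_def by (intro free_cmp_sum free_cmp_scale)

lemma free_cmp_keysD:
  "x \<in> free_cmp G n d \<Longrightarrow> t \<in> Poly_Mapping.keys x \<Longrightarrow> tree_over G t \<and> leaves t = n \<and> tree_deg t = d"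
  by (simp add: free_cmp_def)

lemma free_eqI:
  assumes "x \<in> free_cmp G n d" "is_lin f" "is_lin g"
    "\<And>s. \<lbrakk>tree_over G s; leaves s = n; tree_deg s = d\<rbrakk> \<Longrightarrow> f (bas s) = g (bas s)"
  shows "f x = g x"
  by (rule lin_eqI[OF assms(2,3)]) (use free_cmp_keysD[OF assms(1)] assms(4) in blast)

lemma free_cmp_linI:
  assumes "x \<in> free_cmp G n d" "is_lin f"
    "\<And>s. \<lbrakk>tree_over G s; leaves s = n; tree_deg s = d\<rbrakk> \<Longrightarrow> f (bas s) \<in> free_cmp G' n' d'"
  shows "f x \<in> free_cmp G' n' d'"
  using is_lin_lin_ext[OF assms(2), of x] free_cmp_keysD[OF assms(1)] assms(3)
  by (metis (no_types, lifting) free_cmp_lin_ext)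

lemma free_cmp_tcomp:
  assumes "x \<in> free_cmp G n d" "y \<in> free_cmp G m e" "1 \<le> i" "i \<le> n"
  shows "x \<circ>[i] y \<in> free_cmp G (n + m - 1) (d + e)"
proof (rule free_cmp_linI[OF assms(1) is_lin_tcomp_left])
  fix s assume s: "tree_over G s" "leaves s = n" "tree_deg s = d"
  show "bas s \<circ>[i] y \<in> free_cmp G (n + m - 1) (d + e)"
  proof (rule free_cmp_linI[OF assms(2) is_lin_tcomp_right])
    fix t assume "tree_over G t" "leaves t = m" "tree_deg t = e"
    then show "bas s \<circ>[i] bas t \<in> free_cmp G (n + m - 1) (d + e)"
      unfolding tcomp_bas using s assms(3,4)
      by (intro free_cmp_single) (auto simp: tree_over_graft leaves_graft_eq tree_deg_graft)
  qed
qed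

text \<open>The sign exponents of both sides are equal as integers, because \<open>deg_after\<close>
  and \<open>tree_deg\<close> are additive under grafting.\<close>

lemma tcomp_sequential:
  fixes x :: "tree \<Rightarrow>\<^sub>0 'k::field"
  assumes "x \<in> free_cmp G l d" "y \<in> free_cmp G m e" "1 \<le> i" "i \<le> l" "1 \<le> j" "j \<le> m"
  shows "(x \<circ>[i] y) \<circ>[i - 1 + j] z = x \<circ>[i] (y \<circ>[j] z)"
proof (rule free_eqI[OF assms(1)])
  fix s assume s: "tree_over G s" "leaves s = l" "tree_deg s = d"
  show "(bas s \<circ>[i] y) \<circ>[i - 1 + j] z = bas s \<circ>[i] (y \<circ>[j] z)"
  proof (rule free_eqI[OF assms(2)])
    fix t assume t: "tree_over G t" "leaves t = m" "tree_deg t = e"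
    show "(bas s \<circ>[i] bas t) \<circ>[i - 1 + j] z = bas s \<circ>[i] (bas t \<circ>[j] z)"
    proof (rule lin_eqI[where x = z])
      fix u
      have "deg_after (graft s i t) (i - 1 + j) = deg_after s i + deg_after t j"
        by (rule deg_after_graft_in) (use s t assms in auto)
      then have "deg_after s i * tree_deg t + deg_after (graft s i t) (i - 1 + j) * tree_deg u
          = deg_after t j * tree_deg u + deg_after s i * tree_deg (graft t j u)"
        using s t assms by (simp only: tree_deg_graft distrib_right distrib_left add_ac)
      then have "(-1 :: 'k) powi (deg_after s i * tree_deg t)
            * (-1) powi (deg_after (graft s i t) (i - 1 + j) * tree_deg u)
          = (-1) powi (deg_after t j * tree_deg u) * (-1) powi (deg_after s i * tree_deg (graft t j u))"
        by (metis powi_minus_one_add)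
      then show "((bas s :: tree \<Rightarrow>\<^sub>0 'k) \<circ>[i] bas t) \<circ>[i - 1 + j] bas u = bas s \<circ>[i] (bas t \<circ>[j] bas u)"
        using s t assms graft_sequential(1)[of i s j t u] by (simp add: tcomp_def)
    qed (intro lin_intros)+
  qed (intro lin_intros)+
qed (intro lin_intros)+

lemma tcomp_parallel:
  fixes x :: "tree \<Rightarrow>\<^sub>0 'k::field"
  assumes "x \<in> free_cmp G l d" "y \<in> free_cmp G m e" "z \<in> free_cmp G n f" "1 \<le> i" "i < k" "k \<le> l"
  shows "(x \<circ>[i] y) \<circ>[k - 1 + m] z = scale ((-1) powi (e * f)) ((x \<circ>[k] z) \<circ>[i] y)"
proof (rule free_eqI[OF assms(1)])
  fix s assume s: "tree_over G s" "leaves s = l" "tree_deg s = d"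
  show "(bas s \<circ>[i] y) \<circ>[k - 1 + m] z = scale ((-1) powi (e * f)) ((bas s \<circ>[k] z) \<circ>[i] y)"
  proof (rule free_eqI[OF assms(2)])
    fix t assume t: "tree_over G t" "leaves t = m" "tree_deg t = e"
    show "(bas s \<circ>[i] bas t) \<circ>[k - 1 + m] z = scale ((-1) powi (e * f)) ((bas s \<circ>[k] z) \<circ>[i] bas t)"
    proof (rule free_eqI[OF assms(3)])
      fix u assume u: "tree_over G u" "leaves u = n" "tree_deg u = f"
      \<comment> \<open>On the right, \<open>u\<close> is already present and stands after leaf
        \<open>i\<close>, which contributes \<open>f * e\<close>; together with the prefactor
        \<open>e * f\<close> this is even.\<close>
      have "deg_after s i * e + deg_after (graft s i t) (k - 1 + m) * f
          - (e * f + (deg_after s k * f + deg_after (graft s k u) i * e)) = - 2 * (e * f)"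
        using s t u assms deg_after_graft_right(1)[of i k s t] deg_after_graft_left(1)[of i k s u]
        by (simp add: algebra_simps)
      then have ev: "even (deg_after s i * e + deg_after (graft s i t) (k - 1 + m) * f
          - (e * f + (deg_after s k * f + deg_after (graft s k u) i * e)))"
        by (metis dvd_minus_iff dvd_triv_left mult_minus_left)
      have "(-1 :: 'k) powi (deg_after s i * e) * (-1) powi (deg_after (graft s i t) (k - 1 + m) * f)
          = (-1) powi (e * f) * ((-1) powi (deg_after s k * f) * (-1) powi (deg_after (graft s k u) i * e))"
        using powi_minus_one_eqI[OF ev, where 'k = 'k] by (simp only: powi_minus_one_add)
      then show "((bas s :: tree \<Rightarrow>\<^sub>0 'k) \<circ>[i] bas t) \<circ>[k - 1 + m] bas u
          = scale ((-1) powi (e * f)) ((bas s \<circ>[k] bas u) \<circ>[i] bas t)"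
        using s t u assms graft_parallel(1)[of i k s t u] by (simp add: tcomp_def)
    qed (intro lin_intros)+
  qed (intro lin_intros)+
qed (intro lin_intros)+

lemma tree_id_free: "tree_id \<in> free_cmp G 1 0"
  by (simp add: tree_id_def free_cmp_def)

lemma tcomp_id_left: "tree_id \<circ>[1] x = x"
  unfolding tree_id_def by (rule lin_eqI) (auto intro!: lin_intros simp: tcomp_def)

lemma tcomp_id_right: "x \<circ>[i] tree_id = x"
  unfolding tree_id_def by (rule lin_eqI) (auto intro!: lin_intros simp: tcomp_def)


section \<open>Derivations of the free operad\<close>

definition dif :: "(gen \<Rightarrow> (tree \<Rightarrow>\<^sub>0 'k::field)) \<Rightarrow> (tree \<Rightarrow>\<^sub>0 'k) \<Rightarrow> tree \<Rightarrow>\<^sub>0 'k"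
  where "dif \<delta> = lin_ext (diff_tree \<delta>)"

lemma is_lin_dif [lin_intros, simp]: "is_lin (dif \<delta>)"
  by (simp add: dif_def)

lemma is_lin_dif_comp [lin_intros]: "is_lin f \<Longrightarrow> is_lin (\<lambda>x. dif \<delta> (f x))"
  by (rule is_lin_comp) simp_all

lemma dif_bas [simp]: "dif \<delta> (bas t) = diff_tree \<delta> t"
  by (simp add: dif_def)

section \<open>Plugging a list of trees into the inputs of an operation\<close>

lemma is_lin_plug [lin_intros]: "is_lin f \<Longrightarrow> is_lin (\<lambda>x. plug (f x) p ts)"
  by (induction ts arbitrary: f p) (auto intro: lin_intros)

lemma bas_free: "tree_over G t \<Longrightarrow> bas t \<in> free_cmp G (leaves t) (tree_deg t)"
  by (simp add: free_cmp_single)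

lemma free_cmp_plug:
  assumes "x \<in> free_cmp G n d" "1 \<le> p" "p - 1 + length ts \<le> n" "\<forall>t\<in>set ts. tree_over G t"
  shows "plug x p ts \<in> free_cmp G (n - length ts + sum_list (map leaves ts)) (d + sum_list (map tree_deg ts))"
  using assms
proof (induction ts arbitrary: x p n d)
  case (Cons t ts)
  have "x \<circ>[p] bas t \<in> free_cmp G (n + leaves t - 1) (d + tree_deg t)"
    using Cons.prems by (intro free_cmp_tcomp bas_free) auto
  from Cons.IH[OF this, of "p + leaves t"] show ?case
    using Cons.prems by (simp add: algebra_simps)
qed simp

text \<open>Since \<open>t\<close> goes into an earlier slot, the parallel axiom lets it be composed
  before all of \<open>ss\<close>; it passes each of these trees once, which produces the
  sign.\<close>

lemma plug_tcomp_before: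
  assumes "y \<in> free_cmp G n d" "1 \<le> j" "j < p" "p - 1 + length ss \<le> n"
    "\<forall>s\<in>set ss. tree_over G s" "tree_over G t"
  shows "plug y p ss \<circ>[j] bas t =
    scale ((-1) powi (sum_list (map tree_deg ss) * tree_deg t)) (plug (y \<circ>[j] bas t) (p + leaves t - 1) ss)"
  using assms
proof (induction ss arbitrary: y p n d)
  case (Cons s ss)
  have mem: "y \<circ>[p] bas s \<in> free_cmp G (n + leaves s - 1) (d + tree_deg s)"
    using Cons.prems by (intro free_cmp_tcomp bas_free) auto
  have 1: "plug y p (s # ss) \<circ>[j] bas t =
    scale ((-1) powi (sum_list (map tree_deg ss) * tree_deg t))
      (plug ((y \<circ>[p] bas s) \<circ>[j] bas t) (p + leaves s + leaves t - 1) ss)"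
    using Cons.IH[OF mem, of "p + leaves s"] Cons.prems by simp
  have "(y \<circ>[j] bas t) \<circ>[p - 1 + leaves t] bas s =
      scale ((-1) powi (tree_deg t * tree_deg s)) ((y \<circ>[p] bas s) \<circ>[j] bas t)"
    by (rule tcomp_parallel[OF Cons.prems(1) bas_free bas_free]) (use Cons.prems in auto)
  then have "(y \<circ>[p] bas s) \<circ>[j] bas t = scale ((-1) powi (tree_deg t * tree_deg s)) ((y \<circ>[j] bas t) \<circ>[p - 1 + leaves t] bas s)"
    by (auto simp: powi_minus_one)
  then show ?case unfolding 1 using Cons.prems
    by (simp add: is_lin_scale[OF is_lin_plug[OF is_lin_id]] distrib_right powi_minus_one_add
        algebra_simps)
qed simp

text \<open>The composition is first moved past the trees plugged after the slot containing leaf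
  \<open>i\<close>, then into this slot by the sequential axiom; the two signs add up to
  \<open>deg_after_list\<close>.\<close>

lemma plug_tcomp_in:
  assumes "x \<in> free_cmp G n d" "1 \<le> p" "p - 1 + length ts \<le> n" "1 \<le> i" "i \<le> sum_list (map leaves ts)"
    "\<forall>s\<in>set ts. tree_over G s" "tree_over G t"
  shows "plug x p ts \<circ>[p - 1 + i] bas t =
    scale ((-1) powi (deg_after_list ts i * tree_deg t)) (plug x p (graft_list ts i t))"
  using assms
proof (induction ts arbitrary: x p n d i)
  case (Cons s ss)
  have mem: "x \<circ>[p] bas s \<in> free_cmp G (n + leaves s - 1) (d + tree_deg s)"
    using Cons.prems by (intro free_cmp_tcomp bas_free) auto
  show ?case
  proof (cases "i \<le> leaves s")
    case True
    have "plug x p (s # ss) \<circ>[p - 1 + i] bas t = scale ((-1) powi (sum_list (map tree_deg ss) * tree_deg t))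
        (plug ((x \<circ>[p] bas s) \<circ>[p - 1 + i] bas t) (p + leaves s + leaves t - 1) ss)"
      using plug_tcomp_before[OF mem, of "p - 1 + i" "p + leaves s" ss t] Cons.prems True by auto
    also have "(x \<circ>[p] bas s) \<circ>[p - 1 + i] bas t = x \<circ>[p] (bas s \<circ>[i] bas t)"
      by (rule tcomp_sequential[OF Cons.prems(1) bas_free]) (use Cons.prems True in auto)
    also have "bas s \<circ>[i] bas t = scale ((-1) powi (deg_after s i * tree_deg t)) (bas (graft s i t))"
      by (simp add: tcomp_bas)
    also have "p + leaves s + leaves t - 1 = p + leaves (graft s i t)"
      using leaves_graft(1)[of i s t] Cons.prems True by linarith
    finally show ?thesis using True
      by (simp add: is_lin_scale[OF is_lin_plug[OF is_lin_id]] tcomp_scale_right powi_minus_one_add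
          algebra_simps del: scale_single)
  next
    case False
    then have "p + leaves s - 1 + (i - leaves s) = p - 1 + i" using Cons.prems by auto
    then show ?thesis
      using Cons.IH[OF mem, of "p + leaves s" "i - leaves s"] Cons.prems False by auto
  qed
qed simp

text \<open>With \<open>cons_left\<close>, \<open>cons_right\<close> and \<open>lcomp\<close> below,
  the children of a vertex are treated as a tensor word, so that the mutually recursive clauses of
  the differential become identities between linear maps.\<close>

definition node_ext :: "gen \<Rightarrow> (tree list \<Rightarrow>\<^sub>0 'k::field) \<Rightarrow> tree \<Rightarrow>\<^sub>0 'k"
  where "node_ext g = lin_ext (\<lambda>ss. bas (Node g ss))"

definition cons_left :: "(tree \<Rightarrow>\<^sub>0 'k::field) \<Rightarrow> tree list \<Rightarrow> tree list \<Rightarrow>\<^sub>0 'k"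
  where "cons_left x ts = lin_ext (\<lambda>s. bas (s # ts)) x"

definition cons_right :: "tree \<Rightarrow> (tree list \<Rightarrow>\<^sub>0 'k::field) \<Rightarrow> tree list \<Rightarrow>\<^sub>0 'k"
  where "cons_right t = lin_ext (\<lambda>ss. bas (t # ss))"

definition lcomp :: "(tree list \<Rightarrow>\<^sub>0 'k::field) \<Rightarrow> nat \<Rightarrow> (tree \<Rightarrow>\<^sub>0 'k) \<Rightarrow> tree list \<Rightarrow>\<^sub>0 'k"
  where "lcomp xs i y = lin_ext (\<lambda>ss. lin_ext (\<lambda>t.
    Poly_Mapping.single (graft_list ss i t) ((-1) powi (deg_after_list ss i * tree_deg t))) y) xs"

lemma is_lin_list_ops [lin_intros]:
  "is_lin f \<Longrightarrow> is_lin (\<lambda>x. node_ext g (f x))"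
  "is_lin f' \<Longrightarrow> is_lin (\<lambda>x. cons_left (f' x) ts)"
  "is_lin f \<Longrightarrow> is_lin (\<lambda>x. cons_right t (f x))"
  "is_lin f \<Longrightarrow> is_lin (\<lambda>x. lcomp (f x) i y)"
  "is_lin f' \<Longrightarrow> is_lin (\<lambda>y. lcomp xs i (f' y))"
  unfolding node_ext_def cons_left_def cons_right_def lcomp_def by (intro lin_intros | assumption)+

lemma diff_tree_Node: "diff_tree \<delta> (Node g ts) = plug (\<delta> g) 1 ts +
    scale ((-1) powi gen_deg g) (node_ext g (diff_list \<delta> ts))"
  by (simp add: node_ext_def flip: lin_ext_fun_scale)

lemma diff_list_Cons: "diff_list \<delta> (t # ts) = cons_left (diff_tree \<delta> t) ts +
    scale ((-1) powi tree_deg t) (cons_right t (diff_list \<delta> ts))"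
  by (simp add: cons_left_def cons_right_def flip: lin_ext_fun_scale)

declare diff_tree.simps(2) [simp del] diff_list.simps(2) [simp del]

text \<open>No sign arises because the root comes first in prefix order, hence before every
  leaf.\<close>

lemma node_ext_lcomp: "node_ext g (lcomp xs i y) = node_ext g xs \<circ>[i] y"
proof (rule lin_eqI[where x = xs])
  fix ss show "node_ext g (lcomp (bas ss) i y) = node_ext g (bas ss) \<circ>[i] y"
    by (rule lin_eqI[where x = y]) (auto intro!: lin_intros simp: node_ext_def lcomp_def tcomp_def)
qed (intro lin_intros)+

definition list_cmp :: "gen set \<Rightarrow> nat \<Rightarrow> nat \<Rightarrow> int \<Rightarrow> (tree list \<Rightarrow>\<^sub>0 'k::field) set"
  where "list_cmp G l n d = {x. Poly_Mapping.keys x \<subseteq> {ts. length ts = l \<and> (\<forall>t\<in>set ts. tree_over G t) \<and>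
    sum_list (map leaves ts) = n \<and> sum_list (map tree_deg ts) = d}}"

lemma list_cmp_add: "x \<in> list_cmp G l n d \<Longrightarrow> y \<in> list_cmp G l n d \<Longrightarrow> x + y \<in> list_cmp G l n d"
  unfolding list_cmp_def mem_Collect_eq by (rule order.trans[OF keys_add]) (rule Un_least)

lemma list_cmp_scale: "x \<in> list_cmp G l n d \<Longrightarrow> scale c x \<in> list_cmp G l n d"
  unfolding list_cmp_def mem_Collect_eq by (rule order.trans[OF keys_scale])

lemma keys_lin_ext_bas: "Poly_Mapping.keys (lin_ext (\<lambda>s. bas (h s)) x) \<subseteq> h ` Poly_Mapping.keys x"
  by (rule order.trans[OF keys_lin_ext]) auto

lemma cons_left_list_cmp:
  "\<lbrakk>x \<in> free_cmp G n d; \<forall>t\<in>set ts. tree_over G t\<rbrakk> \<Longrightarrow>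
    cons_left x ts \<in> list_cmp G (Suc (length ts)) (n + sum_list (map leaves ts)) (d + sum_list (map tree_deg ts))"
  unfolding cons_left_def list_cmp_def mem_Collect_eq
  by (rule order.trans[OF keys_lin_ext_bas]) (auto simp: free_cmp_def)

lemma cons_right_list_cmp:
  "\<lbrakk>xs \<in> list_cmp G l n d; tree_over G t\<rbrakk> \<Longrightarrow>
    cons_right t xs \<in> list_cmp G (Suc l) (leaves t + n) (tree_deg t + d)"
  unfolding cons_right_def list_cmp_def mem_Collect_eq
  by (rule order.trans[OF keys_lin_ext_bas]) (fastforce dest: subsetD)

lemma node_ext_free:
  "\<lbrakk>xs \<in> list_cmp G (gen_arity g) n d; g \<in> G\<rbrakk> \<Longrightarrow> node_ext g xs \<in> free_cmp G n (gen_deg g + d)"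
  unfolding node_ext_def list_cmp_def free_cmp_def mem_Collect_eq
  by (rule ballI, drule subsetD[OF keys_lin_ext_bas]) (fastforce dest: subsetD)

lemma cons_left_lcomp_in:
  assumes "x \<in> free_cmp G n d" "i \<le> n"
  shows "lcomp (cons_left x ss) i (bas t) =
    scale ((-1) powi (sum_list (map tree_deg ss) * tree_deg t)) (cons_left (x \<circ>[i] bas t) ss)"
  by (rule free_eqI[OF assms(1)])
    (use assms in \<open>auto intro!: lin_intros simp: cons_left_def lcomp_def tcomp_def distrib_left powi_minus_one_add mult.commute\<close>)

lemma cons_right_lcomp_in:
  assumes "xs \<in> list_cmp G l n d" "i \<le> leaves s"
  shows "lcomp (cons_right s xs) i (bas t) =
    scale ((-1) powi ((deg_after s i + d) * tree_deg t)) (cons_right (graft s i t) xs)"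
  by (rule lin_eqI[where x = xs])
    (use assms in \<open>auto intro!: lin_intros simp: cons_right_def lcomp_def list_cmp_def\<close>)

lemma bas_Cons_lcomp_in:
  assumes "y \<in> free_cmp G n d" "i \<le> leaves s"
  shows "lcomp (bas (s # ss)) i y =
    scale ((-1) powi (sum_list (map tree_deg ss) * d)) (cons_left (bas s \<circ>[i] y) ss)"
  by (rule free_eqI[OF assms(1)])
    (use assms in \<open>auto intro!: lin_intros simp: cons_left_def lcomp_def tcomp_def distrib_left powi_minus_one_add mult.commute\<close>)

lemma cons_left_lcomp_out:
  assumes "x \<in> free_cmp G n d" "n < i"
  shows "lcomp (cons_left x ss) i (bas t) =
    scale ((-1) powi (deg_after_list ss (i - n) * tree_deg t)) (cons_left x (graft_list ss (i - n) t))"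
  by (rule free_eqI[OF assms(1)])
    (use assms in \<open>auto intro!: lin_intros simp: cons_left_def lcomp_def\<close>)

lemma cons_right_lcomp_out:
  assumes "leaves s < i"
  shows "lcomp (cons_right s xs) i y = cons_right s (lcomp xs (i - leaves s) y)"
proof (rule lin_eqI[where x = xs])
  fix ss show "lcomp (cons_right s (bas ss)) i y = cons_right s (lcomp (bas ss) (i - leaves s) y)"
    by (rule lin_eqI[where x = y])
      (use assms in \<open>auto intro!: lin_intros simp: cons_right_def lcomp_def\<close>)
qed (intro lin_intros)+

text \<open>Simultaneous induction that follows the mutual recursion of \<open>diff_tree\<close> and
  \<open>diff_list\<close>: a vertex gets one hypothesis about its whole list of children.\<close>

lemma tree_list_induct [case_names Leaf Node Nil Cons]:
  assumes "P Leaf" "\<And>g ts. Q ts \<Longrightarrow> P (Node g ts)" "Q []" "\<And>t ts. \<lbrakk>P t; Q ts\<rbrakk> \<Longrightarrow> Q (t # ts)"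
  shows "P t" "Q ts"
proof -
  have *: "Q ts" if "\<forall>t\<in>set ts. P t" for ts
    using that by (induction ts) (auto intro: assms)
  show P: "P t" for t
    by (induction t) (auto intro: assms *)
  show "Q ts" using P * by blast
qed

locale free_derivation =
  fixes G :: "gen set" and \<delta> :: "gen \<Rightarrow> (tree \<Rightarrow>\<^sub>0 'k::field)"
  assumes gen_closed: "\<And>g. g \<in> G \<Longrightarrow> \<delta> g \<in> free_cmp G (gen_arity g) (gen_deg g - 1)"
begin

lemma diff_free:
  "tree_over G t \<Longrightarrow> diff_tree \<delta> t \<in> free_cmp G (leaves t) (tree_deg t - 1)"
  "\<forall>t\<in>set ts. tree_over G t \<Longrightarrow>
    diff_list \<delta> ts \<in> list_cmp G (length ts) (sum_list (map leaves ts)) (sum_list (map tree_deg ts) - 1)"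
proof (induction t and ts rule: tree_list_induct)
  case (Node g ts)
  then have "plug (\<delta> g) 1 ts \<in> free_cmp G (leaves (Node g ts)) (tree_deg (Node g ts) - 1)"
    using free_cmp_plug[OF gen_closed, of g 1 ts] by (simp add: algebra_simps)
  moreover have "node_ext g (diff_list \<delta> ts) \<in> free_cmp G (leaves (Node g ts)) (tree_deg (Node g ts) - 1)"
    using node_ext_free[of "diff_list \<delta> ts" G g "sum_list (map leaves ts)" "sum_list (map tree_deg ts) - 1"] Node
    by (simp add: algebra_simps)
  ultimately show ?case unfolding diff_tree_Node
    by (intro free_cmp_add free_cmp_scale)
next
  case (Cons t ts)
  then have "cons_left (diff_tree \<delta> t) ts \<in> list_cmp G (length (t # ts)) (sum_list (map leaves (t # ts))) (sum_list (map tree_deg (t # ts)) - 1)"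
    using cons_left_list_cmp[of "diff_tree \<delta> t" G "leaves t" "tree_deg t - 1" ts] by (simp add: algebra_simps)
  moreover have "cons_right t (diff_list \<delta> ts) \<in> list_cmp G (length (t # ts)) (sum_list (map leaves (t # ts))) (sum_list (map tree_deg (t # ts)) - 1)"
    using cons_right_list_cmp[of "diff_list \<delta> ts" G "length ts" "sum_list (map leaves ts)" "sum_list (map tree_deg ts) - 1" t] Cons
    by (simp add: algebra_simps)
  ultimately show ?case unfolding diff_list_Cons
    by (intro list_cmp_add list_cmp_scale)
qed (auto simp: list_cmp_def)

text \<open>The Leibniz rule on tree monomials. The Koszul sign of the grafting is kept as a factor
  on the left, so that no sign has to be inverted.\<close>

lemma diff_graft:
  assumes t: "tree_over G t"
  shows "\<lbrakk>tree_over G s; 1 \<le> i; i \<le> leaves s\<rbrakk> \<Longrightarrow>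
    scale ((-1) powi (deg_after s i * tree_deg t)) (diff_tree \<delta> (graft s i t)) =
    diff_tree \<delta> s \<circ>[i] bas t + scale ((-1) powi tree_deg s) (bas s \<circ>[i] diff_tree \<delta> t)"
  and "\<lbrakk>\<forall>s\<in>set ss. tree_over G s; 1 \<le> i; i \<le> sum_list (map leaves ss)\<rbrakk> \<Longrightarrow>
    scale ((-1) powi (deg_after_list ss i * tree_deg t)) (diff_list \<delta> (graft_list ss i t)) =
    lcomp (diff_list \<delta> ss) i (bas t) + scale ((-1) powi sum_list (map tree_deg ss)) (lcomp (bas ss) i (diff_tree \<delta> t))"
proof (induction s and ss arbitrary: i and i rule: tree_list_induct)
  case Leaf
  then show ?case using tcomp_id_left[of "diff_tree \<delta> t"] by (simp add: tree_id_def le_antisym)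
next
  case (Node g ts)
  define e where "e = (-1 :: 'k) powi (deg_after_list ts i * tree_deg t)"
  have g: "g \<in> G" and len: "length ts = gen_arity g" and ts: "\<forall>s\<in>set ts. tree_over G s"
    and i: "1 \<le> i" "i \<le> sum_list (map leaves ts)" using Node by auto
  have p: "plug (\<delta> g) 1 ts \<circ>[i] bas t = scale e (plug (\<delta> g) 1 (graft_list ts i t))"
    using plug_tcomp_in[OF gen_closed[OF g], of 1 ts i t] i ts len t by (simp add: e_def)
  have IH: "scale e (diff_list \<delta> (graft_list ts i t)) =
    lcomp (diff_list \<delta> ts) i (bas t) + scale ((-1) powi sum_list (map tree_deg ts)) (lcomp (bas ts) i (diff_tree \<delta> t))"
    using Node by (simp add: e_def)
  have "scale e (diff_tree \<delta> (graft (Node g ts) i t)) =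
    plug (\<delta> g) 1 ts \<circ>[i] bas t + scale ((-1) powi gen_deg g) (node_ext g (scale e (diff_list \<delta> (graft_list ts i t))))"
    by (simp add: diff_tree_Node p[simplified] scale_add_right mult.commute
        is_lin_scale[OF is_lin_list_ops(1)[OF is_lin_id]])
  also have "\<dots> = plug (\<delta> g) 1 ts \<circ>[i] bas t + scale ((-1) powi gen_deg g) (node_ext g (diff_list \<delta> ts) \<circ>[i] bas t)
    + scale ((-1) powi (gen_deg g + sum_list (map tree_deg ts))) (node_ext g (bas ts) \<circ>[i] diff_tree \<delta> t)"
    unfolding IH by (simp add: scale_add_right powi_minus_one_add node_ext_lcomp
        is_lin_scale[OF is_lin_list_ops(1)[OF is_lin_id]] is_lin_add[OF is_lin_list_ops(1)[OF is_lin_id]])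
  also have "node_ext g (bas ts) = bas (Node g ts)" by (simp add: node_ext_def)
  finally show ?case by (simp add: diff_tree_Node tcomp_add_left tcomp_scale_left e_def)
next
  case (Cons s ss)
  define S where "S = sum_list (map tree_deg ss)"
  have s: "tree_over G s" and ss: "\<forall>s\<in>set ss. tree_over G s" using Cons by auto
  note ds = diff_free(1)[OF s] and dss = diff_free(2)[OF ss] and dt = diff_free(1)[OF t]
  show ?case
  proof (cases "i \<le> leaves s")
    case True
    let ?D = "diff_tree \<delta> s \<circ>[i] bas t" and ?E = "bas s \<circ>[i] diff_tree \<delta> t"
    have IH: "scale ((-1) powi (deg_after s i * tree_deg t)) (diff_tree \<delta> (graft s i t)) = ?D + scale ((-1) powi tree_deg s) ?E"
      using Cons True s by simp
    have dg: "tree_deg (graft s i t) = tree_deg s + tree_deg t"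
      using Cons True by (simp add: tree_deg_graft)
    have "scale ((-1) powi (deg_after_list (s # ss) i * tree_deg t)) (diff_list \<delta> (graft_list (s # ss) i t))
      = scale ((-1) powi (S * tree_deg t)) (cons_left (scale ((-1) powi (deg_after s i * tree_deg t)) (diff_tree \<delta> (graft s i t))) ss)
        + scale ((-1) powi ((deg_after s i + S) * tree_deg t + (tree_deg s + tree_deg t))) (cons_right (graft s i t) (diff_list \<delta> ss))"
      using True by (simp add: diff_list_Cons dg scale_add_right S_def distrib_left powi_minus_one_add mult.commute
          is_lin_scale[OF is_lin_list_ops(2)[OF is_lin_id]])
    also have "\<dots> = scale ((-1) powi (S * tree_deg t)) (cons_left ?D ss)
      + scale ((-1) powi (S * tree_deg t + tree_deg s)) (cons_left ?E ss)
      + scale ((-1) powi ((deg_after s i + S) * tree_deg t + (tree_deg s + tree_deg t))) (cons_right (graft s i t) (diff_list \<delta> ss))"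
      unfolding IH by (simp add: scale_add_right powi_minus_one_add
          is_lin_scale[OF is_lin_list_ops(2)[OF is_lin_id]] is_lin_add[OF is_lin_list_ops(2)[OF is_lin_id]])
    \<comment> \<open>The exponents are brought into the form produced by \<open>lcomp\<close>,
      where \<open>diff_tree \<delta> t\<close> has degree one less than \<open>t\<close> and the
      differentiated list has degree \<open>S - 1\<close>.\<close>
    also have "(-1 :: 'k) powi (S * tree_deg t + tree_deg s) = (-1) powi (tree_deg s + S + S * (tree_deg t - 1))"
      by (rule powi_minus_one_eqI) (simp add: algebra_simps)
    also have "(-1 :: 'k) powi ((deg_after s i + S) * tree_deg t + (tree_deg s + tree_deg t))
        = (-1) powi (tree_deg s + (deg_after s i + (S - 1)) * tree_deg t)"
      by (rule powi_minus_one_eqI) (simp add: algebra_simps)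
    finally show ?thesis
      using cons_left_lcomp_in[OF ds True, of ss t] cons_right_lcomp_in[OF dss True, of t] bas_Cons_lcomp_in[OF dt True, of ss]
      by (simp add: diff_list_Cons S_def[symmetric] powi_minus_one_add scale_add_right add_ac mult_ac
          is_lin_scale[OF is_lin_list_ops(4)[OF is_lin_id]] is_lin_add[OF is_lin_list_ops(4)[OF is_lin_id]])
  next
    case False
    define j where "j = i - leaves s"
    have j: "1 \<le> j" "j \<le> sum_list (map leaves ss)" using False Cons by (auto simp: j_def)
    have IH: "scale ((-1) powi (deg_after_list ss j * tree_deg t)) (diff_list \<delta> (graft_list ss j t)) =
      lcomp (diff_list \<delta> ss) j (bas t) + scale ((-1) powi S) (lcomp (bas ss) j (diff_tree \<delta> t))"
      using Cons False j ss by (simp add: j_def S_def)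
    have c: "lcomp (cons_right s xs) i y = cons_right s (lcomp xs j y)" for xs y
      using cons_right_lcomp_out[of s i xs y] False by (simp add: j_def)
    have b: "lcomp (bas (s # ss)) i y = cons_right s (lcomp (bas ss) j y)" for y
      using cons_right_lcomp_out[of s i "bas ss" y] False by (simp add: cons_right_def j_def)
    have "scale ((-1) powi (deg_after_list (s # ss) i * tree_deg t)) (diff_list \<delta> (graft_list (s # ss) i t))
      = scale ((-1) powi (deg_after_list ss j * tree_deg t)) (cons_left (diff_tree \<delta> s) (graft_list ss j t))
        + scale ((-1) powi tree_deg s) (cons_right s (scale ((-1) powi (deg_after_list ss j * tree_deg t)) (diff_list \<delta> (graft_list ss j t))))"
      using False by (simp add: diff_list_Cons j_def scale_add_right mult.commute
          is_lin_scale[OF is_lin_list_ops(3)[OF is_lin_id]])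
    then show ?thesis unfolding IH
      using cons_left_lcomp_out[OF ds, of i ss t] False
      by (simp add: diff_list_Cons S_def[symmetric] j_def[symmetric] b c mult_ac powi_minus_one_add scale_add_right
          is_lin_scale[OF is_lin_list_ops(4)[OF is_lin_id]] is_lin_add[OF is_lin_list_ops(4)[OF is_lin_id]]
          is_lin_scale[OF is_lin_list_ops(3)[OF is_lin_id]] is_lin_add[OF is_lin_list_ops(3)[OF is_lin_id]] add_ac)
  qed
qed (use t in auto)

lemma dif_free: "x \<in> free_cmp G n d \<Longrightarrow> dif \<delta> x \<in> free_cmp G n (d - 1)"
  by (rule free_cmp_linI) (auto simp: dest: diff_free(1))

lemma dif_tcomp:
  assumes x: "x \<in> free_cmp G n d" and y: "y \<in> free_cmp G m e" and i: "1 \<le> i" "i \<le> n"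
  shows "dif \<delta> (x \<circ>[i] y) = dif \<delta> x \<circ>[i] y + scale ((-1) powi d) (x \<circ>[i] dif \<delta> y)"
proof (rule free_eqI[OF x])
  fix s assume s: "tree_over G s" "leaves s = n" "tree_deg s = d"
  show "dif \<delta> (bas s \<circ>[i] y) = dif \<delta> (bas s) \<circ>[i] y + scale ((-1) powi d) (bas s \<circ>[i] dif \<delta> y)"
  proof (rule free_eqI[OF y])
    fix t assume t: "tree_over G t" "leaves t = m" "tree_deg t = e"
    show "dif \<delta> (bas s \<circ>[i] bas t) = dif \<delta> (bas s) \<circ>[i] bas t + scale ((-1) powi d) (bas s \<circ>[i] dif \<delta> (bas t))"
      using diff_graft(1)[of t s i] s t i by (simp add: dif_def tcomp_bas)
  qed (intro lin_intros)+
qed (intro lin_intros)+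

text \<open>The square of an odd derivation is again a derivation, as the two mixed terms cancel. It
  therefore has to be examined on generators only.\<close>

lemma dif_dif_tcomp:
  assumes "x \<in> free_cmp G n d" "y \<in> free_cmp G m e" "1 \<le> i" "i \<le> n"
  shows "dif \<delta> (dif \<delta> (x \<circ>[i] y)) = dif \<delta> (dif \<delta> x) \<circ>[i] y + x \<circ>[i] dif \<delta> (dif \<delta> y)"
proof -
  have s: "(-1 :: 'k) powi d * (-1) powi d = 1" "(-1 :: 'k) powi (d - 1) = - ((-1) powi d)"
    by (simp_all add: powi_minus_one)
  show ?thesis
    using dif_tcomp[OF assms] dif_tcomp[OF dif_free[OF assms(1)] assms(2-)]
      dif_tcomp[OF assms(1) dif_free[OF assms(2)] assms(3-)]
    by (simp add: is_lin_add[OF is_lin_dif] is_lin_scale[OF is_lin_dif] s scale_add_right scale_minus_left)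
qed

end


section \<open>Operads presented by generators and relations\<close>

lemma in_ideal_free: "in_ideal G R n d x \<Longrightarrow> x \<in> free_cmp G n d"
  by (induction rule: in_ideal.induct) (auto intro: free_cmp_add free_cmp_scale free_cmp_tcomp[unfolded One_nat_def])

lemma in_ideal_uminus: "in_ideal G R n d x \<Longrightarrow> in_ideal G R n d (- x)"
  using in_ideal.scale[of G R n d x "-1"] by simp

lemma in_ideal_diff: "\<lbrakk>in_ideal G R n d x; in_ideal G R n d y\<rbrakk> \<Longrightarrow> in_ideal G R n d (x - y)"
  using in_ideal.add[OF _ in_ideal_uminus, of G R n d x y] by simp

lemma in_ideal_sum: "(\<And>a. a \<in> S \<Longrightarrow> in_ideal G R n d (f a)) \<Longrightarrow> in_ideal G R n d (sum f S)"
  by (induction S rule: infinite_finite_induct) (auto intro: in_ideal.add in_ideal.zero)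

lemma in_ideal_cong: "\<lbrakk>in_ideal G R n d x; n = n'; d = d'; x = x'\<rbrakk> \<Longrightarrow> in_ideal G R n' d' x'"
  by simp

lemma in_ideal_linI:
  assumes "x \<in> free_cmp G n d" "is_lin f"
    "\<And>s. \<lbrakk>tree_over G s; leaves s = n; tree_deg s = d\<rbrakk> \<Longrightarrow> in_ideal G' R n' d' (f (bas s))"
  shows "in_ideal G' R n' d' (f x)"
  unfolding is_lin_lin_ext[OF assms(2), of x] unfolding lin_ext_def
  using free_cmp_keysD[OF assms(1)] assms(3) by (intro in_ideal_sum in_ideal.scale) blast

section \<open>Trees as iterated composites of corollas\<close>

lemma graft_list_append:
  "sum_list (map leaves rs) < i \<Longrightarrow>
    graft_list (rs @ ss) i t = rs @ graft_list ss (i - sum_list (map leaves rs)) t"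
  "sum_list (map leaves rs) < i \<Longrightarrow>
    deg_after_list (rs @ ss) i = deg_after_list ss (i - sum_list (map leaves rs))"
  by (induction rs arbitrary: i) auto

lemma sum_list_tree_deg_Leaf [simp]: "sum_list (map tree_deg (replicate n Leaf)) = 0"
  by (induction n) auto

text \<open>The children are plugged in from left to right, so only bare leaves stand after the slot
  being filled and no sign occurs.\<close>

lemma plug_node:
  "plug (bas (Node g (rs @ replicate (length ts) Leaf))) (1 + sum_list (map leaves rs)) ts = bas (Node g (rs @ ts))"
proof (induction ts arbitrary: rs)
  case (Cons t ts)
  then show ?case using Cons[of "rs @ [t]"] sum_list_tree_deg_Leaf[of "length ts"]
    by (simp add: tcomp_bas graft_list_append add_ac del: sum_list_tree_deg_Leaf)
qed simp

lemma plug_corolla: "length ts = gen_arity g \<Longrightarrow> plug (corolla g) 1 ts = bas (Node g ts)"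
  using plug_node[of g "[]" ts] by (simp add: corolla_def)

lemma plug_replicate_Leaf: "plug x p (replicate n Leaf) = x"
  by (induction n arbitrary: p) (auto simp: tcomp_id_right[unfolded tree_id_def])

lemma diff_list_replicate_Leaf: "diff_list \<delta> (replicate n Leaf) = 0"
  by (induction n) (auto simp: diff_list_Cons cons_left_def cons_right_def)

lemma dif_corolla: "dif \<delta> (corolla g) = \<delta> g"
  by (simp add: corolla_def diff_tree_Node plug_replicate_Leaf diff_list_replicate_Leaf node_ext_def)

lemma corolla_free: "g \<in> G \<Longrightarrow> corolla g \<in> free_cmp G (gen_arity g) (gen_deg g)"
  unfolding corolla_def by (rule free_cmp_single) (auto simp: sum_list_replicate)

text \<open>The conditions under which a derivation descends to a differential of the quotient:
  preserving the ideal is tested on relators, squaring to zero modulo the ideal on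
  generators.\<close>

locale operad_presentation = free_derivation G \<delta>
  for G :: "gen set" and \<delta> :: "gen \<Rightarrow> (tree \<Rightarrow>\<^sub>0 'k::field)" +
  fixes R :: "(tree \<Rightarrow>\<^sub>0 'k) set"
  assumes rel_closed: "\<And>r n d. \<lbrakk>r \<in> R; r \<in> free_cmp G n d\<rbrakk> \<Longrightarrow> in_ideal G R n (d - 1) (dif \<delta> r)"
    and gen_square: "\<And>g. g \<in> G \<Longrightarrow> in_ideal G R (gen_arity g) (gen_deg g - 2) (dif \<delta> (\<delta> g))"
begin

lemma dif_ideal: "in_ideal G R n d x \<Longrightarrow> in_ideal G R n (d - 1) (dif \<delta> x)"
proof (induction rule: in_ideal.induct)
  case (comp_left n d x y m e i)
  have "in_ideal G R (n + m - 1) (d + e - 1) (dif \<delta> x \<circ>[i] y)"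
    by (rule in_ideal_cong[OF in_ideal.comp_left[OF comp_left(5,2-4)]]) auto
  moreover have "in_ideal G R (n + m - 1) (d + e - 1) (x \<circ>[i] dif \<delta> y)"
    by (rule in_ideal_cong[OF in_ideal.comp_left[OF comp_left(1) dif_free[OF comp_left(2)] comp_left(3,4)]]) auto
  ultimately show ?case
    unfolding dif_tcomp[OF in_ideal_free[OF comp_left(1)] comp_left(2-4)]
    by (intro in_ideal.add in_ideal.scale)
next
  case (comp_right x n d m e y i)
  have "in_ideal G R (n + m - 1) (d + e - 1) (dif \<delta> x \<circ>[i] y)"
    by (rule in_ideal_cong[OF in_ideal.comp_right[OF dif_free[OF comp_right(1)] comp_right(2-4)]]) auto
  moreover have "in_ideal G R (n + m - 1) (d + e - 1) (x \<circ>[i] dif \<delta> y)"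
    by (rule in_ideal_cong[OF in_ideal.comp_right[OF comp_right(1,5,3,4)]]) auto
  ultimately show ?case
    unfolding dif_tcomp[OF comp_right(1) in_ideal_free[OF comp_right(2)] comp_right(3,4)]
    by (intro in_ideal.add in_ideal.scale)
qed (auto simp: is_lin_add[OF is_lin_dif] is_lin_scale[OF is_lin_dif] is_lin_zero[OF is_lin_dif]
    intro: in_ideal.add in_ideal.scale in_ideal.zero rel_closed)

lemma dif_dif_tcomp_ideal:
  assumes "x \<in> free_cmp G n d" "y \<in> free_cmp G m e" "1 \<le> i" "i \<le> n"
    "in_ideal G R n (d - 2) (dif \<delta> (dif \<delta> x))" "in_ideal G R m (e - 2) (dif \<delta> (dif \<delta> y))"
  shows "in_ideal G R (n + m - 1) (d + e - 2) (dif \<delta> (dif \<delta> (x \<circ>[i] y)))"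
  unfolding dif_dif_tcomp[OF assms(1-4)]
  by (intro in_ideal.add in_ideal_cong[OF in_ideal.comp_left[OF assms(5,2-4)]]
      in_ideal_cong[OF in_ideal.comp_right[OF assms(1,6,3,4)]]) auto

lemma dif_dif_plug:
  assumes "x \<in> free_cmp G n d" "in_ideal G R n (d - 2) (dif \<delta> (dif \<delta> x))" "1 \<le> p" "p - 1 + length ts \<le> n"
    "\<forall>t\<in>set ts. tree_over G t \<and> in_ideal G R (leaves t) (tree_deg t - 2) (dif \<delta> (dif \<delta> (bas t)))"
  shows "in_ideal G R (n - length ts + sum_list (map leaves ts)) (d + sum_list (map tree_deg ts) - 2)
    (dif \<delta> (dif \<delta> (plug x p ts)))"
  using assms
proof (induction ts arbitrary: x p n d)
  case (Cons t ts)
  have 1: "x \<circ>[p] bas t \<in> free_cmp G (n + leaves t - 1) (d + tree_deg t)"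
    using Cons.prems by (intro free_cmp_tcomp bas_free) auto
  have 2: "in_ideal G R (n + leaves t - 1) (d + tree_deg t - 2) (dif \<delta> (dif \<delta> (x \<circ>[p] bas t)))"
    using Cons.prems by (intro dif_dif_tcomp_ideal bas_free) auto
  from Cons.IH[OF 1 2, of "p + leaves t"] show ?case
    using Cons.prems by (auto simp: algebra_simps elim: in_ideal_cong)
qed simp

text \<open>A tree is its root corolla with the children plugged in, and plugging preserves the
  property because the square of the derivation is a derivation.\<close>

lemma dif_dif_tree: "tree_over G t \<Longrightarrow> in_ideal G R (leaves t) (tree_deg t - 2) (dif \<delta> (dif \<delta> (bas t)))"
proof (induction t)
  case Leaf
  then show ?case using is_lin_zero[OF is_lin_dif, of \<delta>] by (simp add: in_ideal.zero)
next
  case (Node g ts)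
  then have g: "g \<in> G" "length ts = gen_arity g" by auto
  have "in_ideal G R (gen_arity g - length ts + sum_list (map leaves ts)) (gen_deg g + sum_list (map tree_deg ts) - 2)
    (dif \<delta> (dif \<delta> (plug (corolla g) 1 ts)))"
    using Node g gen_square[OF g(1)] by (intro dif_dif_plug corolla_free) (auto simp: dif_corolla)
  then show ?case unfolding plug_corolla[OF g(2)] using g by simp
qed

lemma dif_dif_ideal:
  assumes "x \<in> free_cmp G n d"
  shows "in_ideal G R n (d - 2) (dif \<delta> (dif \<delta> x))"
  by (rule in_ideal_linI[OF assms, of "\<lambda>x. dif \<delta> (dif \<delta> x)"]) (auto intro!: lin_intros dest!: dif_dif_tree)

section \<open>The quotient operad computed on representatives\<close>

abbreviation cl :: "nat \<Rightarrow> int \<Rightarrow> (tree \<Rightarrow>\<^sub>0 'k) \<Rightarrow> (tree \<Rightarrow>\<^sub>0 'k) set"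
  where "cl n d x \<equiv> ideal_rel G R n d `` {x}"

abbreviation P where "P \<equiv> presented_operad G R \<delta>"

lemma equiv_ideal: "equiv (free_cmp G n d) (ideal_rel G R n d)"
proof (intro equivI)
  show "sym (ideal_rel G R n d)"
    using in_ideal_uminus by (fastforce simp: sym_def ideal_rel_def)
  show "trans (ideal_rel G R n d)"
    using in_ideal.add by (fastforce simp: trans_def ideal_rel_def)
qed (auto simp: refl_on_def ideal_rel_def in_ideal.zero)

lemma cl_eq_iff:
  "\<lbrakk>x \<in> free_cmp G n d; y \<in> free_cmp G n d\<rbrakk> \<Longrightarrow> cl n d x = cl n d y \<longleftrightarrow> in_ideal G R n d (x - y)"
  using eq_equiv_class_iff[OF equiv_ideal, of x n d y] by (simp add: ideal_rel_def)

lemma ideal_rel_iff: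
  "(x, y) \<in> ideal_rel G R n d \<longleftrightarrow> x \<in> free_cmp G n d \<and> y \<in> free_cmp G n d \<and> in_ideal G R n d (x - y)"
  by (simp add: ideal_rel_def)

lemma self_cl: "x \<in> free_cmp G n d \<Longrightarrow> x \<in> cl n d x"
  by (simp add: ideal_rel_iff in_ideal.zero)

lemma carrier_cmp: "carrier (cmp P n d) = cl n d ` free_cmp G n d"
  by (auto simp: presented_operad_def quotient_def)

text \<open>The operations of the quotient are defined as unions over all representatives; when the
  value does not depend on the representative, the union collapses to this value.\<close>

lemma UN_cl:
  assumes "x \<in> free_cmp G n d" "\<And>x'. \<lbrakk>x' \<in> free_cmp G n d; in_ideal G R n d (x - x')\<rbrakk> \<Longrightarrow> F x' = F x"
  shows "(\<Union>x'\<in>cl n d x. F x') = F x"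
proof -
  have "(\<Union>x'\<in>cl n d x. F x') = (\<Union>x'\<in>cl n d x. F x)"
    by (intro SUP_cong refl assms(2)) (simp_all add: ideal_rel_iff)
  then show ?thesis using self_cl[OF assms(1)] by auto
qed

lemma add_cl:
  assumes "x \<in> free_cmp G n d" "y \<in> free_cmp G n d"
  shows "cl n d x \<oplus>\<^bsub>cmp P n d\<^esub> cl n d y = cl n d (x + y)"
proof -
  have "(\<Union>x'\<in>cl n d x. \<Union>y'\<in>cl n d y. cl n d (x' + y')) = (\<Union>y'\<in>cl n d y. cl n d (x + y'))"
  proof (rule UN_cl[OF assms(1)], intro SUP_cong refl)
    fix x' y' assume "x' \<in> free_cmp G n d" "in_ideal G R n d (x - x')" "y' \<in> cl n d y"
    then show "cl n d (x' + y') = cl n d (x + y')" using assms in_ideal_uminus[of G R n d "x - x'"]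
      by (subst cl_eq_iff) (auto simp: ideal_rel_iff intro: free_cmp_add)
  qed
  also have "\<dots> = cl n d (x + y)"
    using assms in_ideal_uminus[of G R n d "y - _"]
    by (intro UN_cl, simp, subst cl_eq_iff) (auto intro: free_cmp_add)
  finally show ?thesis by (simp add: presented_operad_def)
qed

lemma smult_cl:
  assumes "x \<in> free_cmp G n d"
  shows "c \<odot>\<^bsub>cmp P n d\<^esub> cl n d x = cl n d (scale c x)"
proof -
  have "(\<Union>x'\<in>cl n d x. cl n d (scale c x')) = cl n d (scale c x)"
  proof (rule UN_cl[OF assms])
    fix x' assume x': "x' \<in> free_cmp G n d" "in_ideal G R n d (x - x')"
    then show "cl n d (scale c x') = cl n d (scale c x)"
      using assms in_ideal.scale[OF x'(2), of "-c"]
      by (subst cl_eq_iff) (auto simp: scale_diff_right scale_minus_left intro: free_cmp_scale)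
  qed
  then show ?thesis by (simp add: presented_operad_def)
qed

lemma zero_cl: "\<zero>\<^bsub>cmp P n d\<^esub> = cl n d 0"
  by (simp add: presented_operad_def)

lemma bdry_cl:
  assumes "x \<in> free_cmp G n d"
  shows "bdry P n d (cl n d x) = cl n (d - 1) (dif \<delta> x)"
proof -
  have "(\<Union>x'\<in>cl n d x. cl n (d - 1) (dif \<delta> x')) = cl n (d - 1) (dif \<delta> x)"
  proof (rule UN_cl[OF assms])
    fix x' assume x': "x' \<in> free_cmp G n d" "in_ideal G R n d (x - x')"
    then show "cl n (d - 1) (dif \<delta> x') = cl n (d - 1) (dif \<delta> x)"
      using assms dif_ideal[OF in_ideal_uminus[OF x'(2)]]
      by (subst cl_eq_iff) (auto simp: is_lin_diff[OF is_lin_dif] intro: dif_free)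
  qed
  then show ?thesis by (simp add: presented_operad_def dif_def)
qed

lemma pcomp_cl:
  assumes x: "x \<in> free_cmp G n d" and y: "y \<in> free_cmp G m e" and i: "1 \<le> i" "i \<le> n"
  shows "pcomp P n d m e i (cl n d x) (cl m e y) = cl (n + m - 1) (d + e) (x \<circ>[i] y)"
proof -
  have "(\<Union>x'\<in>cl n d x. \<Union>y'\<in>cl m e y. cl (n + m - 1) (d + e) (x' \<circ>[i] y'))
    = (\<Union>y'\<in>cl m e y. cl (n + m - 1) (d + e) (x \<circ>[i] y'))"
  proof (rule UN_cl[OF x], intro SUP_cong refl)
    fix x' y' assume x': "x' \<in> free_cmp G n d" "in_ideal G R n d (x - x')" and y': "y' \<in> cl m e y"
    then have "y' \<in> free_cmp G m e" by (simp add: ideal_rel_iff)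
    from in_ideal.comp_left[OF in_ideal_uminus[OF x'(2)] this i]
    show "cl (n + m - 1) (d + e) (x' \<circ>[i] y') = cl (n + m - 1) (d + e) (x \<circ>[i] y')"
      using x x' y' i by (subst cl_eq_iff) (auto simp: ideal_rel_iff tcomp_diff_left intro: free_cmp_tcomp[unfolded One_nat_def])
  qed
  also have "\<dots> = cl (n + m - 1) (d + e) (x \<circ>[i] y)"
  proof (rule UN_cl[OF y])
    fix y' assume y': "y' \<in> free_cmp G m e" "in_ideal G R m e (y - y')"
    from in_ideal.comp_right[OF x in_ideal_uminus[OF y'(2)] i]
    show "cl (n + m - 1) (d + e) (x \<circ>[i] y') = cl (n + m - 1) (d + e) (x \<circ>[i] y)"
      using x y y' i by (subst cl_eq_iff) (auto simp: tcomp_diff_right intro: free_cmp_tcomp[unfolded One_nat_def])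
  qed
  finally show ?thesis by (simp add: presented_operad_def)
qed

lemma op_id_cl: "op_id P = cl 1 0 tree_id"
  by (simp add: presented_operad_def)

end

lemma cring_ground_field: "cring (ground_field :: 'k::field ring)"
  by (rule cringI)
    (auto simp: ground_field_def algebra_simps intro!: abelian_groupI comm_monoidI exI[of _ "- _"])

context operad_presentation
begin

lemma abelian_group_cmp: "abelian_group (cmp P n d)"
proof (rule abelian_groupI)
  fix X assume "X \<in> carrier (cmp P n d)"
  then obtain x where x: "x \<in> free_cmp G n d" "X = cl n d x" by (auto simp: carrier_cmp)
  then have "cl n d (- x) \<in> carrier (cmp P n d)" "cl n d (- x) \<oplus>\<^bsub>cmp P n d\<^esub> X = \<zero>\<^bsub>cmp P n d\<^esub>"
    by (auto simp: carrier_cmp add_cl free_cmp_uminus zero_cl)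
  then show "\<exists>Y\<in>carrier (cmp P n d). Y \<oplus>\<^bsub>cmp P n d\<^esub> X = \<zero>\<^bsub>cmp P n d\<^esub>" by blast
qed (auto simp: carrier_cmp zero_cl add_cl free_cmp_add add_ac)

lemma module_cmp: "module ground_field (cmp P n d)"
proof (intro module.intro module_axioms.intro cring_ground_field abelian_group_cmp)
qed (auto simp: carrier_cmp smult_cl add_cl free_cmp_scale free_cmp_add ground_field_def
    scale_add_left scale_add_right)

lemma linear_map_clI:
  assumes "is_lin f" "\<And>x. x \<in> free_cmp G n d \<Longrightarrow> f x \<in> free_cmp G m e"
    "\<And>x. x \<in> free_cmp G n d \<Longrightarrow> F (cl n d x) = cl m e (f x)"
  shows "linear_map (cmp P n d) (cmp P m e) F"
  unfolding linear_map_def carrier_cmp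
  using assms by (auto simp: add_cl smult_cl free_cmp_add free_cmp_scale is_lin_add is_lin_scale)

theorem dg_ns_operad_presented: "dg_ns_operad P"
proof (rule dg_ns_operad.intro)
  fix n :: nat and d :: int show "module ground_field (cmp P n d)" by (rule module_cmp)
next
  show "op_id P \<in> carrier (cmp P 1 0)"
    using tree_id_free by (auto simp: carrier_cmp op_id_cl)
next
  fix n m i :: nat and d e :: int and Y assume i: "1 \<le> i" "i \<le> n" and "Y \<in> carrier (cmp P m e)"
  then obtain y where y: "y \<in> free_cmp G m e" "Y = cl m e y" by (auto simp: carrier_cmp)
  show "linear_map (cmp P n d) (cmp P (n + m - 1) (d + e)) (\<lambda>x. pcomp P n d m e i x Y)"
    by (rule linear_map_clI[where f = "\<lambda>x. x \<circ>[i] y"])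
      (use i y in \<open>auto simp: pcomp_cl intro: free_cmp_tcomp[unfolded One_nat_def]\<close>)
next
  fix n m i :: nat and d e :: int and X assume i: "1 \<le> i" "i \<le> n" and "X \<in> carrier (cmp P n d)"
  then obtain x where x: "x \<in> free_cmp G n d" "X = cl n d x" by (auto simp: carrier_cmp)
  show "linear_map (cmp P m e) (cmp P (n + m - 1) (d + e)) (\<lambda>y. pcomp P n d m e i X y)"
    by (rule linear_map_clI[where f = "\<lambda>y. x \<circ>[i] y"])
      (use i x in \<open>auto simp: pcomp_cl intro: free_cmp_tcomp[unfolded One_nat_def]\<close>)
next
  fix n :: nat and d :: int and X assume "X \<in> carrier (cmp P n d)"
  then obtain x where x: "x \<in> free_cmp G n d" "X = cl n d x" by (auto simp: carrier_cmp)
  show "pcomp P 1 0 n d 1 (op_id P) X = X"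
    using pcomp_cl[OF tree_id_free x(1), of 1] tcomp_id_left[of x] x by (simp add: op_id_cl)
next
  fix n i :: nat and d :: int and X assume i: "1 \<le> i" "i \<le> n" and "X \<in> carrier (cmp P n d)"
  then obtain x where x: "x \<in> free_cmp G n d" "X = cl n d x" by (auto simp: carrier_cmp)
  show "pcomp P n d 1 0 i X (op_id P) = X"
    using pcomp_cl[OF x(1) tree_id_free i] tcomp_id_right[of x] x by (simp add: op_id_cl)
next
  fix l m n i j :: nat and d e f :: int and X Y Z
  assume i: "1 \<le> i" "i \<le> l" "1 \<le> j" "j \<le> m"
    and "X \<in> carrier (cmp P l d)" "Y \<in> carrier (cmp P m e)" "Z \<in> carrier (cmp P n f)"
  then obtain x y z where x: "x \<in> free_cmp G l d" "X = cl l d x" and y: "y \<in> free_cmp G m e" "Y = cl m e y"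
    and z: "z \<in> free_cmp G n f" "Z = cl n f z" by (auto simp: carrier_cmp)
  have j: "1 \<le> i - 1 + j" "i - 1 + j \<le> l + m - 1" using i by auto
  have "pcomp P (l + m - 1) (d + e) n f (i - 1 + j) (pcomp P l d m e i X Y) Z
    = cl (l + m - 1 + n - 1) (d + e + f) ((x \<circ>[i] y) \<circ>[i - 1 + j] z)"
    unfolding x y z pcomp_cl[OF x(1) y(1) i(1,2)]
    by (rule pcomp_cl[OF free_cmp_tcomp[OF x(1) y(1) i(1,2)] z(1) j])
  also have "\<dots> = cl (l + (m + n - 1) - 1) (d + (e + f)) (x \<circ>[i] (y \<circ>[j] z))"
    using tcomp_sequential[OF x(1) y(1) i] i by (simp add: add_ac)
  also have "\<dots> = pcomp P l d (m + n - 1) (e + f) i X (pcomp P m e n f j Y Z)"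
    unfolding x y z pcomp_cl[OF y(1) z(1) i(3,4)]
    by (rule pcomp_cl[OF x(1) free_cmp_tcomp[OF y(1) z(1) i(3,4)] i(1,2), symmetric])
  finally show "pcomp P (l + m - 1) (d + e) n f (i - 1 + j) (pcomp P l d m e i X Y) Z
    = pcomp P l d (m + n - 1) (e + f) i X (pcomp P m e n f j Y Z)" .
next
  fix l m n i k :: nat and d e f :: int and X Y Z
  assume i: "1 \<le> i" "i < k" "k \<le> l"
    and "X \<in> carrier (cmp P l d)" "Y \<in> carrier (cmp P m e)" "Z \<in> carrier (cmp P n f)"
  then obtain x y z where x: "x \<in> free_cmp G l d" "X = cl l d x" and y: "y \<in> free_cmp G m e" "Y = cl m e y"
    and z: "z \<in> free_cmp G n f" "Z = cl n f z" by (auto simp: carrier_cmp)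
  have k: "1 \<le> k - 1 + m" "k - 1 + m \<le> l + m - 1" "1 \<le> k" "k \<le> l" "1 \<le> i" "i \<le> l" "i \<le> l + n - 1"
    using i by auto
  have "pcomp P (l + m - 1) (d + e) n f (k - 1 + m) (pcomp P l d m e i X Y) Z
    = cl (l + m - 1 + n - 1) (d + e + f) ((x \<circ>[i] y) \<circ>[k - 1 + m] z)"
    unfolding x y z pcomp_cl[OF x(1) y(1) k(5,6)]
    by (rule pcomp_cl[OF free_cmp_tcomp[OF x(1) y(1) k(5,6)] z(1) k(1,2)])
  also have "\<dots> = cl (l + m + n - 2) (d + e + f) (scale ((-1) powi (e * f)) ((x \<circ>[k] z) \<circ>[i] y))"
    using tcomp_parallel[OF x(1) y(1) z(1) i] i by (simp add: numeral_2_eq_2)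
  also have "\<dots> = ((-1) powi (e * f)) \<odot>\<^bsub>cmp P (l + m + n - 2) (d + e + f)\<^esub>
      cl (l + m + n - 2) (d + e + f) ((x \<circ>[k] z) \<circ>[i] y)"
  proof (rule smult_cl[symmetric])
    have "(x \<circ>[k] z) \<circ>[i] y \<in> free_cmp G (l + n - 1 + m - 1) (d + f + e)"
      by (intro free_cmp_tcomp[OF free_cmp_tcomp] x y z k)
    then show "(x \<circ>[k] z) \<circ>[i] y \<in> free_cmp G (l + m + n - 2) (d + e + f)"
      using i by (simp add: add_ac numeral_2_eq_2)
  qed
  also have "cl (l + m + n - 2) (d + e + f) ((x \<circ>[k] z) \<circ>[i] y)
      = cl (l + n - 1 + m - 1) (d + f + e) ((x \<circ>[k] z) \<circ>[i] y)"
    using i by (simp add: add_ac numeral_2_eq_2)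
  also have "\<dots> = pcomp P (l + n - 1) (d + f) m e i (pcomp P l d n f k X Z) Y"
    unfolding x y z pcomp_cl[OF x(1) z(1) k(3,4)]
    by (rule pcomp_cl[OF free_cmp_tcomp[OF x(1) z(1) k(3,4)] y(1) k(5,7), symmetric])
  finally show "pcomp P (l + m - 1) (d + e) n f (k - 1 + m) (pcomp P l d m e i X Y) Z =
      ((-1) powi (e * f)) \<odot>\<^bsub>cmp P (l + m + n - 2) (d + e + f)\<^esub>
        pcomp P (l + n - 1) (d + f) m e i (pcomp P l d n f k X Z) Y" .
next
  fix n :: nat and d :: int show "linear_map (cmp P n d) (cmp P n (d - 1)) (bdry P n d)"
    by (rule linear_map_clI[where f = "dif \<delta>"]) (auto simp: bdry_cl dif_free)
next
  fix n :: nat and d :: int and X assume "X \<in> carrier (cmp P n d)"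
  then obtain x where x: "x \<in> free_cmp G n d" "X = cl n d x" by (auto simp: carrier_cmp)
  then show "bdry P n (d - 1) (bdry P n d X) = \<zero>\<^bsub>cmp P n (d - 2)\<^esub>"
    using dif_dif_ideal[OF x(1)] dif_free[OF dif_free[OF x(1)]]
    by (simp add: bdry_cl dif_free zero_cl cl_eq_iff)
next
  fix n m i :: nat and d e :: int and X Y assume i: "1 \<le> i" "i \<le> n" and "X \<in> carrier (cmp P n d)" "Y \<in> carrier (cmp P m e)"
  then obtain x y where x: "x \<in> free_cmp G n d" "X = cl n d x" and y: "y \<in> free_cmp G m e" "Y = cl m e y"
    by (auto simp: carrier_cmp)
  have eqs: "d - 1 + e = d + e - 1" "d + (e - 1) = d + e - 1" by auto
  have dx: "dif \<delta> x \<circ>[i] y \<in> free_cmp G (n + m - 1) (d + e - 1)"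
    using free_cmp_tcomp[OF dif_free[OF x(1)] y(1) i] by (simp add: eqs)
  have dy: "x \<circ>[i] dif \<delta> y \<in> free_cmp G (n + m - 1) (d + e - 1)"
    using free_cmp_tcomp[OF x(1) dif_free[OF y(1)] i] by (simp add: eqs)
  have "bdry P (n + m - 1) (d + e) (pcomp P n d m e i X Y)
    = cl (n + m - 1) (d + e - 1) (dif \<delta> x \<circ>[i] y + scale ((-1) powi d) (x \<circ>[i] dif \<delta> y))"
    unfolding x y pcomp_cl[OF x(1) y(1) i] bdry_cl[OF free_cmp_tcomp[OF x(1) y(1) i]]
    by (simp add: dif_tcomp[OF x(1) y(1) i])
  then show "bdry P (n + m - 1) (d + e) (pcomp P n d m e i X Y) =
      pcomp P n (d - 1) m e i (bdry P n d X) Y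
        \<oplus>\<^bsub>cmp P (n + m - 1) (d + e - 1)\<^esub>
      ((-1) powi d) \<odot>\<^bsub>cmp P (n + m - 1) (d + e - 1)\<^esub> pcomp P n d m (e - 1) i X (bdry P m e Y)"
    unfolding x y bdry_cl[OF x(1)] bdry_cl[OF y(1)] pcomp_cl[OF dif_free[OF x(1)] y(1) i]
      pcomp_cl[OF x(1) dif_free[OF y(1)] i] eqs smult_cl[OF dy] add_cl[OF dx free_cmp_scale[OF dy]] .
qed

lemma mem_cycles:
  "x \<in> free_cmp G n d \<Longrightarrow> cl n d x \<in> cycles P n d \<longleftrightarrow> in_ideal G R n (d - 1) (dif \<delta> x)"
  by (simp add: cycles_def carrier_cmp bdry_cl zero_cl cl_eq_iff dif_free)

lemma cycles_cl: "cycles P n d = cl n d ` {x \<in> free_cmp G n d. in_ideal G R n (d - 1) (dif \<delta> x)}"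
  using mem_cycles by (auto simp: cycles_def carrier_cmp)

lemma boundaries_cl: "boundaries P n d = (\<lambda>x. cl n d (dif \<delta> x)) ` free_cmp G n (d + 1)"
  by (simp add: boundaries_def carrier_cmp image_image bdry_cl cong: image_cong)

end


section \<open>A criterion for quasi-isomorphisms\<close>

text \<open>The first isomorphism theorem for \<open>H1\<close> mapping to \<open>H2 Mod B2\<close>:
  \<open>inj\<close> identifies the kernel with \<open>B1\<close>, and \<open>surj\<close> says that
  every coset is hit. The map is written as a union over a coset in order to match
  \<open>homology_map\<close>; on a coset all members of the union coincide.\<close>

lemma A_Mod_iso:
  assumes g1: "comm_group H1" and g2: "comm_group H2" and B1: "subgroup B1 H1" and B2: "subgroup B2 H2"
    and h: "h \<in> hom H1 H2"
    and inj: "\<And>x. x \<in> carrier H1 \<Longrightarrow> h x \<in> B2 \<longleftrightarrow> x \<in> B1"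
    and surj: "\<And>y. y \<in> carrier H2 \<Longrightarrow> \<exists>x\<in>carrier H1. \<exists>b\<in>B2. y = b \<otimes>\<^bsub>H2\<^esub> h x"
  shows "(\<lambda>C. \<Union>x\<in>C. B2 #>\<^bsub>H2\<^esub> h x) \<in> iso (H1 Mod B1) (H2 Mod B2)"
proof -
  interpret H1: comm_group H1 by (rule g1)
  interpret H2: comm_group H2 by (rule g2)
  interpret N2: normal B2 H2 by (rule H2.subgroup_imp_normal[OF B2])
  define k where "k x = B2 #>\<^bsub>H2\<^esub> h x" for x
  have hc: "h x \<in> carrier H2" if "x \<in> carrier H1" for x using h that by (auto simp: hom_def)
  have k: "k \<in> hom H1 (H2 Mod B2)"
  proof (rule homI)
    fix x assume x: "x \<in> carrier H1"
    then show "k x \<in> carrier (H2 Mod B2)" using hc[OF x] by (auto simp: carrier_FactGroup k_def)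
    fix y assume y: "y \<in> carrier H1"
    show "k (x \<otimes>\<^bsub>H1\<^esub> y) = k x \<otimes>\<^bsub>H2 Mod B2\<^esub> k y"
      using N2.rcos_sum[OF hc[OF x] hc[OF y]] by (simp add: k_def hom_mult[OF h x y])
  qed
  interpret k: group_hom H1 "H2 Mod B2" k
    by (intro group_hom.intro group_hom_axioms.intro k N2.factorgroup_is_group H1.is_group)
  have "k x = B2 \<longleftrightarrow> h x \<in> B2" if "x \<in> carrier H1" for x
    unfolding k_def using H2.coset_join1[OF _ hc[OF that] B2] H2.coset_join2[OF hc[OF that] B2] by blast
  then have ker: "kernel H1 (H2 Mod B2) k = B1"
    using subgroup.subset[OF B1] inj by (auto simp: kernel_def)
  have "k ` carrier H1 = carrier (H2 Mod B2)"
  proof (intro equalityI subsetI)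
    fix C assume "C \<in> carrier (H2 Mod B2)"
    then obtain y where y: "y \<in> carrier H2" "C = B2 #>\<^bsub>H2\<^esub> y" by (auto simp: FactGroup_def RCOSETS_def)
    then obtain x b where x: "x \<in> carrier H1" "b \<in> B2" "y = b \<otimes>\<^bsub>H2\<^esub> h x" using surj by blast
    have "B2 #>\<^bsub>H2\<^esub> y = (B2 #>\<^bsub>H2\<^esub> b) #>\<^bsub>H2\<^esub> h x"
      unfolding x(3) by (rule H2.coset_mult_assoc[OF subgroup.subset[OF B2] _ hc[OF x(1)], symmetric])
        (rule subgroup.mem_carrier[OF B2 x(2)])
    then have "C = k x"
      using y H2.coset_join2[OF subgroup.mem_carrier[OF B2 x(2)] B2 x(2)] by (simp add: k_def)
    then show "C \<in> k ` carrier H1" using x by blast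
  qed (use hom_in_carrier[OF k] in blast)
  from k.FactGroup_iso_set[OF this] have iso: "(\<lambda>X. the_elem (k ` X)) \<in> iso (H1 Mod B1) (H2 Mod B2)"
    unfolding ker .
  have eq: "(\<Union>x\<in>C. B2 #>\<^bsub>H2\<^esub> h x) = the_elem (k ` C)" if C: "C \<in> carrier (H1 Mod B1)" for C
  proof -
    obtain g where g: "g \<in> carrier H1" "C = B1 #>\<^bsub>H1\<^esub> g" using C by (auto simp: carrier_FactGroup)
    have "k x = k g" if xC: "x \<in> C" for x
    proof -
      obtain b where b: "b \<in> B1" "x = b \<otimes>\<^bsub>H1\<^esub> g" using xC unfolding g(2) r_coset_def by blast
      then have "b \<in> kernel H1 (H2 Mod B2) k" using ker by simp
      then have bc: "b \<in> carrier H1" and kb: "k b = \<one>\<^bsub>H2 Mod B2\<^esub>" by (auto simp: kernel_def)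
      show ?thesis unfolding b(2) k.hom_mult[OF bc g(1)] kb
        by (rule k.H.l_one[OF k.hom_closed[OF g(1)]])
    qed
    moreover have "g \<in> C" using g H1.rcos_self[OF g(1) B1] by simp
    ultimately have "k ` C = {k g}" by blast
    then show ?thesis by (simp add: k_def)
  qed
  have m1: "monoid (H1 Mod B1)"
    by (rule group.is_monoid[OF normal.factorgroup_is_group[OF H1.subgroup_imp_normal[OF B1]]])
  have ih: "(\<lambda>X. the_elem (k ` X)) \<in> hom (H1 Mod B1) (H2 Mod B2)" using iso by (simp add: iso_def)
  have "(\<lambda>C. \<Union>x\<in>C. B2 #>\<^bsub>H2\<^esub> h x) \<in> hom (H1 Mod B1) (H2 Mod B2)"
    by (rule homI, unfold eq monoid.m_closed[OF m1, THEN eq])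
      (use hom_in_carrier[OF ih] hom_mult[OF ih] in blast)+
  moreover have "bij_betw (\<lambda>C. \<Union>x\<in>C. B2 #>\<^bsub>H2\<^esub> h x) (carrier (H1 Mod B1)) (carrier (H2 Mod B2)) \<longleftrightarrow>
      bij_betw (\<lambda>X. the_elem (k ` X)) (carrier (H1 Mod B1)) (carrier (H2 Mod B2))"
    by (rule bij_betw_cong) (rule eq)
  ultimately show ?thesis using iso by (simp add: iso_def)
qed

context operad_presentation
begin

section \<open>Cycles and boundaries as subgroups\<close>

abbreviation AP where "AP n d \<equiv> add_monoid (cmp P n d)"

lemma comm_group_AP: "comm_group (AP n d)"
  by (rule abelian_group.a_comm_group[OF abelian_group_cmp])

lemma AP_simps: "carrier (AP n d) = cl n d ` free_cmp G n d" "\<one>\<^bsub>AP n d\<^esub> = cl n d 0"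
  by (simp_all add: carrier_cmp zero_cl)

lemma mult_AP: "\<lbrakk>x \<in> free_cmp G n d; y \<in> free_cmp G n d\<rbrakk> \<Longrightarrow> cl n d x \<otimes>\<^bsub>AP n d\<^esub> cl n d y = cl n d (x + y)"
  by (simp add: add_cl)

lemma inv_AP: "x \<in> free_cmp G n d \<Longrightarrow> inv\<^bsub>AP n d\<^esub> (cl n d x) = cl n d (- x)"
proof (rule group.inv_equality[OF comm_group.axioms(2)[OF comm_group_AP]])
  assume x: "x \<in> free_cmp G n d"
  then show "cl n d (- x) \<otimes>\<^bsub>AP n d\<^esub> cl n d x = \<one>\<^bsub>AP n d\<^esub>"
    by (subst mult_AP) (auto simp: AP_simps free_cmp_uminus zero_cl)
qed (auto simp: AP_simps carrier_cmp free_cmp_uminus)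

lemma subgroup_cl:
  assumes "Z \<subseteq> free_cmp G n d" "0 \<in> Z" "\<And>x y. \<lbrakk>x \<in> Z; y \<in> Z\<rbrakk> \<Longrightarrow> x + y \<in> Z" "\<And>x. x \<in> Z \<Longrightarrow> - x \<in> Z"
  shows "subgroup (cl n d ` Z) (AP n d)"
proof (rule group.subgroupI[OF comm_group.axioms(2)[OF comm_group_AP]])
  fix X Y assume "X \<in> cl n d ` Z" "Y \<in> cl n d ` Z"
  then obtain x y where xy: "x \<in> Z" "y \<in> Z" "X = cl n d x" "Y = cl n d y" by blast
  have "X \<otimes>\<^bsub>AP n d\<^esub> Y = cl n d (x + y)"
    unfolding xy(3,4) by (rule mult_AP) (use xy assms(1) in auto)
  then show "X \<otimes>\<^bsub>AP n d\<^esub> Y \<in> cl n d ` Z" using assms(3) xy by blast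
next
  fix X assume "X \<in> cl n d ` Z"
  then obtain x where x: "x \<in> Z" "X = cl n d x" by blast
  have "inv\<^bsub>AP n d\<^esub> X = cl n d (- x)"
    unfolding x(2) by (rule inv_AP) (use x assms(1) in auto)
  then show "inv\<^bsub>AP n d\<^esub> X \<in> cl n d ` Z" using assms(4) x by blast
qed (use assms in \<open>auto simp: AP_simps carrier_cmp\<close>)

lemma subgroup_cycles: "subgroup (cycles P n d) (AP n d)"
  unfolding cycles_cl
  by (rule subgroup_cl)
    (auto simp: is_lin_add[OF is_lin_dif] is_lin_minus[OF is_lin_dif] is_lin_zero[OF is_lin_dif]
      intro: free_cmp_add free_cmp_uminus in_ideal.add in_ideal_uminus in_ideal.zero)

lemma dif_free': "x \<in> free_cmp G n (d + 1) \<Longrightarrow> dif \<delta> x \<in> free_cmp G n d"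
  using dif_free[of x n "d + 1"] by simp

lemma subgroup_boundaries: "subgroup (boundaries P n d) (AP n d)"
proof -
  have "boundaries P n d = cl n d ` dif \<delta> ` free_cmp G n (d + 1)"
    by (auto simp: boundaries_cl)
  also have "subgroup \<dots> (AP n d)"
  proof (rule subgroup_cl)
    fix x y assume "x \<in> dif \<delta> ` free_cmp G n (d + 1)" "y \<in> dif \<delta> ` free_cmp G n (d + 1)"
    then show "x + y \<in> dif \<delta> ` free_cmp G n (d + 1)"
      by (auto simp: is_lin_add[OF is_lin_dif, symmetric] intro: free_cmp_add)
  next
    fix x assume "x \<in> dif \<delta> ` free_cmp G n (d + 1)"
    then show "- x \<in> dif \<delta> ` free_cmp G n (d + 1)"
      by (auto simp: is_lin_minus[OF is_lin_dif, symmetric] intro: free_cmp_uminus)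
  next
    show "0 \<in> dif \<delta> ` free_cmp G n (d + 1)"
      using is_lin_zero[OF is_lin_dif, of \<delta>] by (intro image_eqI[of _ _ 0]) auto
  qed (use dif_free' in blast)
  finally show ?thesis .
qed

lemma boundaries_subset_cycles: "boundaries P n d \<subseteq> cycles P n d"
proof
  fix X assume "X \<in> boundaries P n d"
  then obtain x where x: "x \<in> free_cmp G n (d + 1)" "X = cl n d (dif \<delta> x)" by (auto simp: boundaries_cl)
  then show "X \<in> cycles P n d" using dif_dif_ideal[OF x(1)] dif_free'[OF x(1)]
    by (simp add: mem_cycles)
qed

abbreviation HP where "HP n d \<equiv> (AP n d)\<lparr>carrier := cycles P n d\<rparr>"

lemma comm_group_HP: "comm_group (HP n d)"
proof (rule group.group_comm_groupI)
  show "group (HP n d)"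
    by (rule subgroup.subgroup_is_group[OF subgroup_cycles comm_group.axioms(2)[OF comm_group_AP]])
  fix X Y assume "X \<in> carrier (HP n d)" "Y \<in> carrier (HP n d)"
  then show "X \<otimes>\<^bsub>HP n d\<^esub> Y = Y \<otimes>\<^bsub>HP n d\<^esub> X"
    using comm_monoid.m_comm[OF comm_group.axioms(1)[OF comm_group_AP], of X n d Y]
    by (simp add: cycles_def)
qed

lemma subgroup_HP: "subgroup (boundaries P n d) (HP n d)"
  using boundaries_subset_cycles subgroup_boundaries subgroup_cycles
    group.subgroup_incl[OF comm_group.axioms(2)[OF comm_group_AP]] by blast

lemma homology_eq: "homology P n d = HP n d Mod boundaries P n d"
  by (simp add: homology_def A_FactGroup_def)

end

text \<open>A criterion in terms of representatives in the free operads: ideals and differentials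
  have to be respected modulo ideals only, and \<open>inj\<close> and \<open>surj\<close> are
  injectivity and surjectivity on homology for lifts of cycles.\<close>

theorem quasi_iso_step_presented:
  fixes F :: "tree \<Rightarrow> (tree \<Rightarrow>\<^sub>0 'k::field)"
  assumes pres: "operad_presentation G \<delta> R" "operad_presentation G' \<delta>' R'"
    and F_Leaf: "F Leaf = bas Leaf"
    and F_free: "\<And>t. tree_over G t \<Longrightarrow> F t \<in> free_cmp G' (leaves t) (tree_deg t)"
    and F_comp: "\<And>x n d y m e i. \<lbrakk>x \<in> free_cmp G n d; y \<in> free_cmp G m e; 1 \<le> i; i \<le> n\<rbrakk> \<Longrightarrow>
      lin_ext F (x \<circ>[i] y) = lin_ext F x \<circ>[i] lin_ext F y"
    and F_ideal: "\<And>n d x. in_ideal G R n d x \<Longrightarrow> in_ideal G' R' n d (lin_ext F x)"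
    and F_dif: "\<And>n d x. x \<in> free_cmp G n d \<Longrightarrow>
      in_ideal G' R' n (d - 1) (lin_ext F (dif \<delta> x) - dif \<delta>' (lin_ext F x))"
    and inj: "\<And>n d x y. \<lbrakk>x \<in> free_cmp G n d; in_ideal G R n (d - 1) (dif \<delta> x);
      y \<in> free_cmp G' n (d + 1); in_ideal G' R' n d (lin_ext F x - dif \<delta>' y)\<rbrakk> \<Longrightarrow>
      \<exists>z\<in>free_cmp G n (d + 1). in_ideal G R n d (x - dif \<delta> z)"
    and surj: "\<And>n d y. \<lbrakk>y \<in> free_cmp G' n d; in_ideal G' R' n (d - 1) (dif \<delta>' y)\<rbrakk> \<Longrightarrow>
      \<exists>x\<in>free_cmp G n d. in_ideal G R n (d - 1) (dif \<delta> x) \<and>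
        (\<exists>z\<in>free_cmp G' n (d + 1). in_ideal G' R' n d (y - (dif \<delta>' z + lin_ext F x)))"
  shows "quasi_iso_step (presented_operad G R \<delta>) (presented_operad G' R' \<delta>')"
proof -
  interpret P1: operad_presentation G \<delta> R by (rule pres)
  interpret P2: operad_presentation G' \<delta>' R' by (rule pres)
  define f where "f n d X = (\<Union>x\<in>X. P2.cl n d (lin_ext F x))" for n d X
  have free: "lin_ext F x \<in> free_cmp G' n d" if "x \<in> free_cmp G n d" for x n d
    by (rule free_cmp_linI[OF that]) (auto dest: F_free)
  have f: "f n d (P1.cl n d x) = P2.cl n d (lin_ext F x)" if x: "x \<in> free_cmp G n d" for n d x
    unfolding f_def
  proof (rule P1.UN_cl[OF x])
    fix x' assume x': "x' \<in> free_cmp G n d" "in_ideal G R n d (x - x')"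
    then show "P2.cl n d (lin_ext F x') = P2.cl n d (lin_ext F x)"
      using F_ideal[OF in_ideal_uminus[OF x'(2)]] free x
      by (subst P2.cl_eq_iff) (auto simp: is_lin_diff[OF is_lin_lin_extI])
  qed
  have mor: "dg_operad_morphism P1.P P2.P f"
  proof
    fix n d
    show "linear_map (cmp P1.P n d) (cmp P2.P n d) (f n d)"
      unfolding linear_map_def P1.carrier_cmp P2.carrier_cmp
      using free by (auto simp: f P1.add_cl P2.add_cl P1.smult_cl P2.smult_cl free_cmp_add free_cmp_scale
          lin_ext_add lin_ext_scale)
  next
    show "f 1 0 (op_id P1.P) = op_id P2.P"
      unfolding P1.op_id_cl f[OF tree_id_free] by (simp add: P2.op_id_cl tree_id_def F_Leaf)
  next
    fix n m i :: nat and d e :: int and X Y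
    assume i: "1 \<le> i" "i \<le> n" and "X \<in> carrier (cmp P1.P n d)" "Y \<in> carrier (cmp P1.P m e)"
    then obtain x y where x: "x \<in> free_cmp G n d" "X = P1.cl n d x" and y: "y \<in> free_cmp G m e" "Y = P1.cl m e y"
      by (auto simp: P1.carrier_cmp)
    show "f (n + m - 1) (d + e) (pcomp P1.P n d m e i X Y) = pcomp P2.P n d m e i (f n d X) (f m e Y)"
      unfolding x y P1.pcomp_cl[OF x(1) y(1) i] f[OF x(1)] f[OF y(1)] f[OF free_cmp_tcomp[OF x(1) y(1) i]]
        P2.pcomp_cl[OF free[OF x(1)] free[OF y(1)] i] F_comp[OF x(1) y(1) i] ..
  next
    fix n :: nat and d :: int and X assume "X \<in> carrier (cmp P1.P n d)"
    then obtain x where x: "x \<in> free_cmp G n d" "X = P1.cl n d x" by (auto simp: P1.carrier_cmp)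
    show "f n (d - 1) (bdry P1.P n d X) = bdry P2.P n d (f n d X)"
      unfolding x P1.bdry_cl[OF x(1)] f[OF x(1)] f[OF P1.dif_free[OF x(1)]] P2.bdry_cl[OF free[OF x(1)]]
      using F_dif[OF x(1)] x(1) free P1.dif_free P2.dif_free by (subst P2.cl_eq_iff) auto
  qed
  have "homology_map P2.P f n d \<in> iso (homology P1.P n d) (homology P2.P n d)" for n d
  proof -
    have cyc: "f n d X \<in> cycles P2.P n d" if "X \<in> cycles P1.P n d" for X
    proof -
      from that obtain x where x: "x \<in> free_cmp G n d" "in_ideal G R n (d - 1) (dif \<delta> x)" "X = P1.cl n d x"
        by (auto simp: P1.cycles_cl)
      have "in_ideal G' R' n (d - 1) (dif \<delta>' (lin_ext F x))"
        using in_ideal_diff[OF F_ideal[OF x(2)] F_dif[OF x(1)]] by simp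
      then show ?thesis using x free[OF x(1)] by (simp add: f P2.mem_cycles)
    qed
    have "(\<lambda>C. \<Union>x\<in>C. boundaries P2.P n d #>\<^bsub>P2.HP n d\<^esub> f n d x) \<in>
        iso (P1.HP n d Mod boundaries P1.P n d) (P2.HP n d Mod boundaries P2.P n d)"
    proof (rule A_Mod_iso[OF P1.comm_group_HP P2.comm_group_HP P1.subgroup_HP P2.subgroup_HP])
      show "f n d \<in> hom (P1.HP n d) (P2.HP n d)"
      proof (rule homI)
        fix X Y assume "X \<in> carrier (P1.HP n d)" "Y \<in> carrier (P1.HP n d)"
        then obtain x y where x: "x \<in> free_cmp G n d" "X = P1.cl n d x" and y: "y \<in> free_cmp G n d" "Y = P1.cl n d y"
          by (auto simp: P1.cycles_cl)
        then show "f n d (X \<otimes>\<^bsub>P1.HP n d\<^esub> Y) = f n d X \<otimes>\<^bsub>P2.HP n d\<^esub> f n d Y"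
          using free by (simp add: f P1.add_cl P2.add_cl free_cmp_add lin_ext_add)
      qed (use cyc in simp)
    next
      fix X assume "X \<in> carrier (P1.HP n d)"
      then obtain x where x: "x \<in> free_cmp G n d" "in_ideal G R n (d - 1) (dif \<delta> x)" "X = P1.cl n d x"
        by (auto simp: P1.cycles_cl)
      show "f n d X \<in> boundaries P2.P n d \<longleftrightarrow> X \<in> boundaries P1.P n d"
      proof
        assume "f n d X \<in> boundaries P2.P n d"
        then obtain y where y: "y \<in> free_cmp G' n (d + 1)" "P2.cl n d (lin_ext F x) = P2.cl n d (dif \<delta>' y)"
          using x by (auto simp: P2.boundaries_cl f)
        then have "in_ideal G' R' n d (lin_ext F x - dif \<delta>' y)"
          using P2.cl_eq_iff[OF free[OF x(1)] P2.dif_free'[OF y(1)]] by simp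
        from inj[OF x(1,2) y(1) this] obtain z where z: "z \<in> free_cmp G n (d + 1)" "in_ideal G R n d (x - dif \<delta> z)"
          by blast
        then have "X = P1.cl n d (dif \<delta> z)" using x P1.cl_eq_iff[OF x(1) P1.dif_free'[OF z(1)]] by simp
        then show "X \<in> boundaries P1.P n d" using z by (auto simp: P1.boundaries_cl)
      next
        assume "X \<in> boundaries P1.P n d"
        then obtain z where z: "z \<in> free_cmp G n (d + 1)" "X = P1.cl n d (dif \<delta> z)"
          by (auto simp: P1.boundaries_cl)
        have "in_ideal G' R' n d (lin_ext F (dif \<delta> z) - dif \<delta>' (lin_ext F z))"
          using F_dif[OF z(1)] by simp
        then have "f n d X = P2.cl n d (dif \<delta>' (lin_ext F z))"
          unfolding z f[OF P1.dif_free'[OF z(1)]]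
          using free[OF P1.dif_free'[OF z(1)]] P2.dif_free'[OF free[OF z(1)]] by (subst P2.cl_eq_iff)
        then show "f n d X \<in> boundaries P2.P n d" using free[OF z(1)] by (auto simp: P2.boundaries_cl)
      qed
    next
      fix Y assume "Y \<in> carrier (P2.HP n d)"
      then obtain y where y: "y \<in> free_cmp G' n d" "in_ideal G' R' n (d - 1) (dif \<delta>' y)" "Y = P2.cl n d y"
        by (auto simp: P2.cycles_cl)
      from surj[OF y(1,2)] obtain x z where x: "x \<in> free_cmp G n d" "in_ideal G R n (d - 1) (dif \<delta> x)"
        and z: "z \<in> free_cmp G' n (d + 1)" "in_ideal G' R' n d (y - (dif \<delta>' z + lin_ext F x))" by blast
      have X: "P1.cl n d x \<in> carrier (P1.HP n d)" using x by (auto simp: P1.cycles_cl)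
      have B: "P2.cl n d (dif \<delta>' z) \<in> boundaries P2.P n d" using z by (auto simp: P2.boundaries_cl)
      have "Y = P2.cl n d (dif \<delta>' z + lin_ext F x)"
        unfolding y(3) using z y(1) free[OF x(1)] P2.dif_free'[OF z(1)]
        by (subst P2.cl_eq_iff) (auto intro: free_cmp_add)
      also have "\<dots> = P2.cl n d (dif \<delta>' z) \<otimes>\<^bsub>P2.HP n d\<^esub> f n d (P1.cl n d x)"
        using free[OF x(1)] P2.dif_free'[OF z(1)] by (simp add: f[OF x(1)] P2.add_cl)
      finally show "\<exists>X\<in>carrier (P1.HP n d). \<exists>B\<in>boundaries P2.P n d. Y = B \<otimes>\<^bsub>P2.HP n d\<^esub> f n d X"
        using X B by blast
    qed
    then show ?thesis
      unfolding P1.homology_eq P2.homology_eq homology_map_def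
      by (simp add: a_r_coset_def r_coset_def cong: SUP_cong)
  qed
  then show ?thesis
    unfolding quasi_iso_step_def using mor P1.dg_ns_operad_presented P2.dg_ns_operad_presented by blast
qed

section \<open>Normal forms for the homotopy quotient\<close>

text \<open>
  The normal monomials of the homotopy quotient: \<open>Dl\<close>, \<open>Ak k\<close> and \<open>Pr\<close> stand for
  \<open>\<Delta>\<close>, \<open>a\<^sub>k\<^sub>+\<^sub>1\<close> and \<open>m\<close>; the bracket is eliminated by \<open>b = [\<Delta>, m]\<close>.
  The remaining relations become rewrite rules with left hand sides \<open>\<Delta>\<Delta>\<close>,
  \<open>m \<circ>\<^sub>1 m\<close> and \<open>m \<circ>\<^sub>1 (\<Delta> \<circ>\<^sub>1 m)\<close>, and \<open>mulb\<close> computes the normal form of a product.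
\<close>

datatype nt = Lf | Dl nt | Ak nat nt | Pr nt nt

fun nlv :: "nt \<Rightarrow> nat" where
  "nlv Lf = 1"
| "nlv (Dl w) = nlv w"
| "nlv (Ak k w) = nlv w"
| "nlv (Pr w v) = nlv w + nlv v"

fun ndeg :: "nt \<Rightarrow> nat" where
  "ndeg Lf = 0"
| "ndeg (Dl w) = Suc (ndeg w)"
| "ndeg (Ak k w) = 2 * Suc k + ndeg w"
| "ndeg (Pr w v) = ndeg w + ndeg v"

fun is_Dl :: "nt \<Rightarrow> bool" where
  "is_Dl (Dl w) = True"
| "is_Dl _ = False"

fun is_Pr :: "nt \<Rightarrow> bool" where
  "is_Pr (Pr w v) = True"
| "is_Pr _ = False"

fun reducible_left :: "nt \<Rightarrow> bool" where
  "reducible_left (Pr w v) = True"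
| "reducible_left (Dl w) = is_Pr w"
| "reducible_left _ = False"

fun nrm :: "nt \<Rightarrow> bool" where
  "nrm Lf = True"
| "nrm (Dl w) = (nrm w \<and> \<not> is_Dl w)"
| "nrm (Ak k w) = nrm w"
| "nrm (Pr w v) = (nrm w \<and> nrm v \<and> \<not> reducible_left w)"

definition sg :: "nt \<Rightarrow> 'k::field" where "sg w = (-1) ^ ndeg w"

definition PP :: "(nt \<Rightarrow>\<^sub>0 'k::field) \<Rightarrow> nt \<Rightarrow>\<^sub>0 'k"
  where "PP = lin_ext (\<lambda>w. scale (sg w) (bas w))"

fun Dlb :: "nt \<Rightarrow> nt \<Rightarrow>\<^sub>0 'k::field" where
  "Dlb (Dl w) = 0"
| "Dlb w = bas (Dl w)"

definition DD :: "(nt \<Rightarrow>\<^sub>0 'k::field) \<Rightarrow> nt \<Rightarrow>\<^sub>0 'k" where "DD = lin_ext Dlb"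

text \<open>The operator \<open>AA k\<close> is \<open>a_k\<close>, including the identity
  \<open>a_0\<close>, while the constructor \<open>Ak j\<close> stands for \<open>a_(j+1)\<close>;
  with this shift the telescoping sums below start at index 0.\<close>

definition AA :: "nat \<Rightarrow> (nt \<Rightarrow>\<^sub>0 'k::field) \<Rightarrow> nt \<Rightarrow>\<^sub>0 'k"
  where "AA k x = (case k of 0 \<Rightarrow> x | Suc j \<Rightarrow> lin_ext (\<lambda>w. bas (Ak j w)) x)"

definition PrL :: "nt \<Rightarrow> (nt \<Rightarrow>\<^sub>0 'k::field) \<Rightarrow> nt \<Rightarrow>\<^sub>0 'k" where "PrL w = lin_ext (\<lambda>v. bas (Pr w v))"

text \<open>The second clause is \<open>b(x,y)z = b(x,yz)\<close> with both brackets expanded and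
  the terms containing \<open>\<Delta> x\<close> cancelled, solved for \<open>\<Delta>(xy)z\<close>.
  The conditional in its last term is \<open>\<Delta>\<Delta> = 0\<close>.\<close>

fun mulb :: "nt \<Rightarrow> nt \<Rightarrow> nt \<Rightarrow>\<^sub>0 'k::field" where
  "mulb (Pr w v') v = PrL w (mulb v' v)"
| "mulb (Dl (Pr w v')) v = DD (PrL w (mulb v' v)) - scale (sg w) (PrL w (DD (mulb v' v)))
    + scale (sg w) (PrL w (if is_Dl v' then 0 else mulb (Dl v') v))"
| "mulb s v = bas (Pr s v)"

definition mm :: "(nt \<Rightarrow>\<^sub>0 'k::field) \<Rightarrow> (nt \<Rightarrow>\<^sub>0 'k) \<Rightarrow> nt \<Rightarrow>\<^sub>0 'k"
  where "mm x y = lin_ext (\<lambda>s. lin_ext (mulb s) y) x"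

definition BB :: "(nt \<Rightarrow>\<^sub>0 'k::field) \<Rightarrow> (nt \<Rightarrow>\<^sub>0 'k) \<Rightarrow> nt \<Rightarrow>\<^sub>0 'k"
  where "BB x y = DD (mm x y) - mm (DD x) y - mm (PP x) (DD y)"

lemma is_lin_PP [lin_intros, simp]: "is_lin PP" by (simp add: PP_def)
lemma is_lin_DD [lin_intros, simp]: "is_lin DD" by (simp add: DD_def)
lemma is_lin_PrL [lin_intros, simp]: "is_lin (PrL w)" by (simp add: PrL_def)
lemma is_lin_AA [lin_intros, simp]: "is_lin (AA k)" by (cases k) (simp_all add: AA_def[abs_def] is_lin_id)
lemma is_lin_mm_left [lin_intros, simp]: "is_lin (\<lambda>x. mm x y)" by (simp add: mm_def)
lemma is_lin_mm_right [lin_intros, simp]: "is_lin (\<lambda>y. mm x y)" unfolding mm_def by (intro lin_intros)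

lemma is_lin_comps [lin_intros]:
  "is_lin f \<Longrightarrow> is_lin (\<lambda>x. PP (f x))" "is_lin f \<Longrightarrow> is_lin (\<lambda>x. DD (f x))"
  "is_lin f \<Longrightarrow> is_lin (\<lambda>x. PrL w (f x))" "is_lin f \<Longrightarrow> is_lin (\<lambda>x. AA k (f x))"
  "is_lin f \<Longrightarrow> is_lin (\<lambda>x. mm (f x) y)" "is_lin f \<Longrightarrow> is_lin (\<lambda>x. mm y (f x))"
  by (simp_all add: is_lin_comp is_lin_comp[OF is_lin_mm_left] is_lin_comp[OF is_lin_mm_right])

lemma is_lin_BB [lin_intros]:
  "is_lin f \<Longrightarrow> is_lin (\<lambda>x. BB (f x) y)" "is_lin f \<Longrightarrow> is_lin (\<lambda>x. BB y (f x))"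
  unfolding BB_def by (intro lin_intros | assumption)+

lemmas PP_simps [simp] = is_lin_add[OF is_lin_PP] is_lin_diff[OF is_lin_PP] is_lin_minus[OF is_lin_PP]
  is_lin_zero[OF is_lin_PP] is_lin_scale[OF is_lin_PP]
lemmas DD_simps [simp] = is_lin_add[OF is_lin_DD] is_lin_diff[OF is_lin_DD] is_lin_minus[OF is_lin_DD]
  is_lin_zero[OF is_lin_DD] is_lin_scale[OF is_lin_DD]
lemmas PrL_simps [simp] = is_lin_add[OF is_lin_PrL] is_lin_diff[OF is_lin_PrL] is_lin_minus[OF is_lin_PrL]
  is_lin_zero[OF is_lin_PrL] is_lin_scale[OF is_lin_PrL]
lemmas AA_simps [simp] = is_lin_add[OF is_lin_AA] is_lin_diff[OF is_lin_AA] is_lin_minus[OF is_lin_AA]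
  is_lin_zero[OF is_lin_AA] is_lin_scale[OF is_lin_AA]
lemmas mm_simps [simp] = is_lin_add[OF is_lin_mm_left] is_lin_diff[OF is_lin_mm_left] is_lin_minus[OF is_lin_mm_left]
  is_lin_zero[OF is_lin_mm_left] is_lin_scale[OF is_lin_mm_left]
  is_lin_add[OF is_lin_mm_right] is_lin_diff[OF is_lin_mm_right] is_lin_minus[OF is_lin_mm_right]
  is_lin_zero[OF is_lin_mm_right] is_lin_scale[OF is_lin_mm_right]

lemma bas_simps:
  "PP (bas w) = scale (sg w) (bas w)" "DD (bas w) = Dlb w" "PrL w (bas v) = bas (Pr w v)"
  "AA (Suc k) (bas w) = bas (Ak k w)" "mm (bas s) (bas t) = mulb s t"
  by (simp_all add: PP_def DD_def PrL_def AA_def mm_def)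

lemma AA_0 [simp]: "AA 0 x = x"
  by (simp add: AA_def)

lemma sg_sg [simp]: "sg w * sg w = 1"
  by (simp add: sg_def flip: power_mult_distrib)

lemma DD_DD [simp]: "DD (DD x) = 0"
proof (rule lin_eqI[where x = x and f = "\<lambda>x. DD (DD x)" and g = "\<lambda>x. 0"])
  fix s show "DD (DD (bas s)) = (0 :: nt \<Rightarrow>\<^sub>0 'a)" by (cases s) (simp_all add: bas_simps)
qed (intro lin_intros)+

lemma PP_PP [simp]: "PP (PP x) = x"
  by (rule lin_eqI[where x = x and f = "\<lambda>x. PP (PP x)" and g = "\<lambda>x. x"])
    (auto intro!: lin_intros simp: bas_simps simp del: scale_single)

lemma PP_DD: "PP (DD x) = - DD (PP x)"
proof (rule lin_eqI[where x = x and f = "\<lambda>x. PP (DD x)" and g = "\<lambda>x. - DD (PP x)"])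
  fix s show "PP (DD (bas s)) = - DD (PP (bas s) :: nt \<Rightarrow>\<^sub>0 'a)"
    by (cases s) (simp_all add: bas_simps sg_def scale_minus_left del: scale_single)
qed (intro lin_intros)+

lemma PP_PrL: "PP (PrL w x) = scale (sg w) (PrL w (PP x))"
  by (rule lin_eqI[where x = x and f = "\<lambda>x. PP (PrL w x)" and g = "\<lambda>x. scale (sg w) (PrL w (PP x))"])
    (auto intro!: lin_intros simp: bas_simps sg_def power_add simp del: scale_single)

lemma PP_AA: "PP (AA k x) = AA k (PP x)"
proof (cases k)
  case (Suc j)
  then show ?thesis
    by (intro lin_eqI[where x = x and f = "\<lambda>x. PP (AA k x)" and g = "\<lambda>x. AA k (PP x)"])
      (auto intro!: lin_intros simp: bas_simps sg_def power_add simp del: scale_single)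
qed simp

lemma mm_PrL: "mm (PrL w x) y = PrL w (mm x y)"
proof (rule lin_eqI[where x = x])
  fix s show "mm (PrL w (bas s)) y = PrL w (mm (bas s) y)"
    by (rule lin_eqI[where x = y]) (auto intro!: lin_intros simp: bas_simps)
qed (intro lin_intros)+

text \<open>The second clause of \<open>mulb\<close> extended linearly, with its conditional
  absorbed into \<open>DD\<close>, which already sends \<open>\<Delta>\<Delta>\<close> to
  zero.\<close>

lemma mm_DD_PrL: "mm (DD (PrL w x)) y =
  DD (PrL w (mm x y)) - scale (sg w) (PrL w (DD (mm x y))) + scale (sg w) (PrL w (mm (DD x) y))"
proof (rule lin_eqI[where x = x])
  fix s show "mm (DD (PrL w (bas s))) y =
    DD (PrL w (mm (bas s) y)) - scale (sg w) (PrL w (DD (mm (bas s) y))) + scale (sg w) (PrL w (mm (DD (bas s)) y))"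
  proof (rule lin_eqI[where x = y])
    fix t show "mm (DD (PrL w (bas s))) (bas t) =
      DD (PrL w (mm (bas s) (bas t))) - scale (sg w) (PrL w (DD (mm (bas s) (bas t)))) + scale (sg w) (PrL w (mm (DD (bas s)) (bas t)))"
      by (cases s) (simp_all add: bas_simps)
  qed (intro lin_intros)+
qed (intro lin_intros)+

lemma mulb_irreducible: "\<not> reducible_left s \<Longrightarrow> mulb s t = bas (Pr s t)"
  by (cases s) (auto, rename_tac w, case_tac w, auto)

lemma mm_irreducible: "\<not> reducible_left s \<Longrightarrow> mm (bas s) y = PrL s y"
  by (rule lin_eqI[where x = y]) (auto intro!: lin_intros simp: bas_simps mulb_irreducible)

lemma nt_left_cases:
  obtains (irr) "\<not> reducible_left s" | (Pr) w v where "s = Pr w v" | (DlPr) w v where "s = Dl (Pr w v)"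
  by (cases s rule: reducible_left.cases) (auto, rename_tac w, case_tac w, auto)

text \<open>One half of the confluence of the rewriting system. When the left factor is
  \<open>\<Delta>\<close> of a product of \<open>w\<close> and \<open>v\<close>, the clauses of
  \<open>mulb\<close> lead back to the smaller left factors \<open>v\<close> and
  \<open>\<Delta> v\<close>.\<close>

lemma mm_assoc: "mm (mm x y) z = mm x (mm y z)"
proof (rule lin_eqI[where x = x])
  fix s :: nt
  show "mm (mm (bas s) y) z = mm (bas s) (mm y z)"
  proof (induction "size s" arbitrary: s y z rule: less_induct)
    case less
    show ?case
    proof (cases s rule: nt_left_cases)
      case irr
      then show ?thesis by (simp add: mm_irreducible mm_PrL)
    next
      case (Pr w v)
      then have "bas s = PrL w (bas v :: nt \<Rightarrow>\<^sub>0 'a)" by (simp add: bas_simps)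
      then show ?thesis using less[of v] Pr by (simp add: mm_PrL)
    next
      case (DlPr w v)
      then have s: "bas s = DD (PrL w (bas v :: nt \<Rightarrow>\<^sub>0 'a))" by (simp add: bas_simps)
      \<comment> \<open>If \<open>v\<close> itself starts with \<open>\<Delta>\<close>, the left
        factor is zero; otherwise it is \<open>Dl v\<close>, which is smaller than
        \<open>s\<close>.\<close>
      have "mm (mm (DD (bas v)) y) z = mm (DD (bas v)) (mm y z)"
        using less[of "Dl v"] DlPr by (cases v) (simp_all add: bas_simps)
      then show ?thesis using less[of v] DlPr unfolding s
        by (simp add: mm_DD_PrL mm_PrL)
    qed
  qed
qed (intro lin_intros)+

text \<open>The other half of confluence: the rule for \<open>\<Delta>(xy)z\<close>, built into
  \<open>mulb\<close> for an irreducible first factor, extends to all arguments. By associativity it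
  amounts to \<open>b(x,y)z = b(x,yz)\<close> for the bracket \<open>BB\<close>.\<close>

lemma DD_mm_mm:
  "mm (DD (mm x y)) z = DD (mm x (mm y z)) - mm (PP x) (DD (mm y z)) + mm (PP x) (mm (DD y) z)"
proof (rule lin_eqI[where x = x])
  fix s :: nt
  show "mm (DD (mm (bas s) y)) z =
    DD (mm (bas s) (mm y z)) - mm (PP (bas s)) (DD (mm y z)) + mm (PP (bas s)) (mm (DD y) z)"
  proof (induction "size s" arbitrary: s y z rule: less_induct)
    case less
    show ?case
    proof (cases s rule: nt_left_cases)
      case irr
      then show ?thesis by (simp add: mm_irreducible mm_DD_PrL bas_simps(1) del: scale_single)
    next
      case (Pr w v)
      then have s: "bas s = PrL w (bas v :: nt \<Rightarrow>\<^sub>0 'a)" by (simp add: bas_simps)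
      have "mm (DD (mm (bas v) y)) z = DD (mm (bas v) (mm y z)) - mm (PP (bas v)) (DD (mm y z)) + mm (PP (bas v)) (mm (DD y) z)"
        using less[of v] Pr by simp
      then show ?thesis unfolding s
        by (simp add: mm_PrL mm_DD_PrL mm_assoc PP_PrL scale_add_right scale_diff_right)
    next
      case (DlPr w v)
      then have s: "bas s = DD (PrL w (bas v :: nt \<Rightarrow>\<^sub>0 'a))" by (simp add: bas_simps)
      have 1: "mm (DD (mm (bas v) y)) z = DD (mm (bas v) (mm y z)) - mm (PP (bas v)) (DD (mm y z)) + mm (PP (bas v)) (mm (DD y) z)"
        using less[of v] DlPr by simp
      have 2: "mm (DD (mm (DD (bas v)) y)) z
        = DD (mm (DD (bas v)) (mm y z)) - mm (PP (DD (bas v))) (DD (mm y z)) + mm (PP (DD (bas v))) (mm (DD y) z)"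
        using less[of "Dl v"] DlPr by (cases v) (simp_all add: bas_simps del: scale_single)
      show ?thesis unfolding s
        by (simp add: mm_PrL mm_DD_PrL mm_assoc PP_PrL PP_DD scale_add_right scale_diff_right scale_minus_right 1 2)
    qed
  qed
qed (intro lin_intros)+


subsection \<open>Supports\<close>

definition supp :: "('b \<Rightarrow> bool) \<Rightarrow> ('b \<Rightarrow>\<^sub>0 'k::field) \<Rightarrow> bool"
  where "supp Q x \<longleftrightarrow> (\<forall>u\<in>Poly_Mapping.keys x. Q u)"

lemma supp_zero [simp]: "supp Q 0"
  by (simp add: supp_def)

lemma supp_add: "supp Q x \<Longrightarrow> supp Q y \<Longrightarrow> supp Q (x + y)"
  using keys_add[of x y] by (auto simp: supp_def)

lemma supp_scale: "supp Q x \<Longrightarrow> supp Q (scale c x)"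
  using keys_scale[of c x] by (auto simp: supp_def)

lemma supp_uminus: "supp Q x \<Longrightarrow> supp Q (- x)"
  by (simp add: supp_def)

lemma supp_diff: "supp Q x \<Longrightarrow> supp Q y \<Longrightarrow> supp Q (x - y)"
  using supp_add[OF _ supp_uminus, of Q x y] by simp

lemma supp_sum: "(\<And>a. a \<in> S \<Longrightarrow> supp Q (f a)) \<Longrightarrow> supp Q (sum f S)"
  by (induction S rule: infinite_finite_induct) (auto intro: supp_add)

lemma supp_bas: "Q u \<Longrightarrow> supp Q (bas u)"
  by (simp add: supp_def)

lemma supp_linI:
  assumes "supp Q x" "is_lin f" "\<And>u. Q u \<Longrightarrow> supp Q' (f (bas u))"
  shows "supp Q' (f x)"
  unfolding is_lin_lin_ext[OF assms(2), of x] unfolding lin_ext_def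
  using assms(1,3) by (intro supp_sum supp_scale) (auto simp: supp_def)

lemma supp_mono: "supp Q x \<Longrightarrow> (\<And>u. Q u \<Longrightarrow> Q' u) \<Longrightarrow> supp Q' x"
  by (auto simp: supp_def)

lemmas supp_intros = supp_add supp_scale supp_uminus supp_diff

lemma supp_eqI:
  assumes "supp Q x" "is_lin f" "is_lin g" "\<And>u. Q u \<Longrightarrow> f (bas u) = g (bas u)"
  shows "f x = g x"
  by (rule lin_eqI[OF assms(2,3)]) (use assms(1,4) in \<open>auto simp: supp_def\<close>)

definition gr :: "nat \<Rightarrow> nat \<Rightarrow> nt \<Rightarrow> bool" where "gr n d u \<longleftrightarrow> nlv u = n \<and> ndeg u = d"

lemma supp_gr_DD: "supp (gr n d) x \<Longrightarrow> supp (gr n (Suc d)) (DD x)"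
  by (rule supp_linI[OF _ is_lin_DD], assumption, rename_tac u, case_tac u) (auto simp: bas_simps gr_def intro!: supp_bas)

lemma supp_gr_PrL: "supp (gr n d) x \<Longrightarrow> supp (gr (nlv w + n) (ndeg w + d)) (PrL w x)"
  by (rule supp_linI[OF _ is_lin_PrL], assumption) (auto simp: bas_simps gr_def intro!: supp_bas)

lemma supp_gr_mulb: "supp (gr (nlv s + nlv t) (ndeg s + ndeg t)) (mulb s t)"
proof (induction s t rule: mulb.induct)
  case (1 w v' v)
  then show ?case using supp_gr_PrL[OF 1, of w] by (simp add: add_ac)
next
  case (2 w v' v)
  have "supp (gr (nlv w + nlv v' + nlv v) (Suc (ndeg w + ndeg v' + ndeg v))) (PrL w (if is_Dl v' then 0 else mulb (Dl v') v) :: nt \<Rightarrow>\<^sub>0 'a)"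
  proof (cases "is_Dl v'")
    case False
    then show ?thesis using supp_gr_PrL[OF 2(3)[OF False], of w] by (simp add: add_ac)
  qed simp
  moreover have "supp (gr (nlv w + nlv v' + nlv v) (Suc (ndeg w + ndeg v' + ndeg v))) (DD (PrL w (mulb v' v)) :: nt \<Rightarrow>\<^sub>0 'a)"
    using supp_gr_DD[OF supp_gr_PrL[OF 2(1), of w]] by (simp add: add_ac)
  moreover have "supp (gr (nlv w + nlv v' + nlv v) (Suc (ndeg w + ndeg v' + ndeg v))) (PrL w (DD (mulb v' v)) :: nt \<Rightarrow>\<^sub>0 'a)"
    using supp_gr_PrL[OF supp_gr_DD[OF 2(1)], of w] by (simp add: add_ac)
  ultimately show ?case by (simp add: supp_intros)
qed (auto simp: gr_def intro!: supp_bas)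

lemma supp_gr_mm: "supp (gr n d) x \<Longrightarrow> supp (gr m e) y \<Longrightarrow> supp (gr (n + m) (d + e)) (mm x y)"
proof (erule supp_linI[OF _ is_lin_mm_left])
  fix s assume s: "gr n d s" and "supp (gr m e) y"
  then show "supp (gr (n + m) (d + e)) (mm (bas s) y)"
  proof (elim supp_linI[OF _ is_lin_mm_right])
    fix t assume "gr m e t"
    then show "supp (gr (n + m) (d + e)) (mm (bas s) (bas t) :: nt \<Rightarrow>\<^sub>0 'a)"
      using s supp_gr_mulb[of s t] by (simp add: bas_simps gr_def)
  qed
qed

lemma supp_gr_AA: "supp (gr n d) x \<Longrightarrow> supp (gr n (2 * k + d)) (AA k x)"
proof (cases k)
  case (Suc j)
  assume "supp (gr n d) x"
  then show ?thesis unfolding Suc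
    by (rule supp_linI[OF _ is_lin_AA]) (auto simp: bas_simps gr_def intro!: supp_bas)
qed simp

lemma PP_gr: "supp (gr n d) x \<Longrightarrow> PP x = scale ((-1) ^ d) x"
  by (rule supp_eqI[of "gr n d" x PP "scale ((-1) ^ d)"])
    (auto intro!: lin_intros simp: bas_simps gr_def sg_def simp del: scale_single)

lemma supp_gr_PP: "supp (gr n d) x \<Longrightarrow> supp (gr n d) (PP x)"
  by (simp add: PP_gr supp_scale)

lemma supp_gr_BB: "supp (gr n d) x \<Longrightarrow> supp (gr m e) y \<Longrightarrow> supp (gr (n + m) (Suc (d + e))) (BB x y)"
  unfolding BB_def
  using supp_gr_DD[OF supp_gr_mm[of n d x m e y]] supp_gr_mm[OF supp_gr_DD[of n d x], of m e y]
    supp_gr_mm[OF supp_gr_PP[of n d x] supp_gr_DD[of m e y]]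
  by (auto intro!: supp_diff)

lemma PP_mm: "PP (mm x y) = mm (PP x) (PP y)"
proof (rule lin_eqI[where x = x])
  fix s :: nt show "PP (mm (bas s) y) = mm (PP (bas s)) (PP y)"
  proof (rule lin_eqI[where x = y])
    fix t :: nt show "PP (mm (bas s) (bas t)) = mm (PP (bas s)) (PP (bas t :: nt \<Rightarrow>\<^sub>0 'a))"
      using PP_gr[OF supp_gr_mulb[of s t]]
      by (simp add: bas_simps sg_def power_add mult.commute del: scale_single)
  qed (intro lin_intros)+
qed (intro lin_intros)+

lemma PP_BB: "PP (BB x y) = - BB (PP x) (PP y)"
  by (simp add: BB_def PP_DD PP_mm)

lemma supp_nrm_DD: "supp nrm x \<Longrightarrow> supp nrm (DD x)"
  by (rule supp_linI[OF _ is_lin_DD], assumption, rename_tac u, case_tac u) (auto simp: bas_simps intro!: supp_bas)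

lemma supp_nrm_PrL: "supp nrm x \<Longrightarrow> nrm w \<Longrightarrow> \<not> reducible_left w \<Longrightarrow> supp nrm (PrL w x)"
  by (rule supp_linI[OF _ is_lin_PrL], assumption) (auto simp: bas_simps intro!: supp_bas)

lemma supp_nrm_mulb: "nrm s \<Longrightarrow> nrm t \<Longrightarrow> supp nrm (mulb s t)"
proof (induction s t rule: mulb.induct)
  case (2 w v' v)
  then show ?case by (auto intro!: supp_intros supp_nrm_DD supp_nrm_PrL)
qed (auto intro!: supp_bas supp_nrm_PrL)

lemma supp_nrm_mm: "supp nrm x \<Longrightarrow> supp nrm y \<Longrightarrow> supp nrm (mm x y)"
  by (erule supp_linI[OF _ is_lin_mm_left], erule supp_linI[OF _ is_lin_mm_right])
    (simp add: bas_simps supp_nrm_mulb)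

lemma supp_nrm_AA: "supp nrm x \<Longrightarrow> supp nrm (AA k x)"
proof (cases k)
  case (Suc j)
  assume "supp nrm x"
  then show ?thesis unfolding Suc
    by (rule supp_linI[OF _ is_lin_AA]) (auto simp: bas_simps intro!: supp_bas)
qed simp

lemma supp_nrm_PP: "supp nrm x \<Longrightarrow> supp nrm (PP x)"
  by (rule supp_linI[of nrm x, OF _ is_lin_PP]) (auto simp: bas_simps intro!: supp_scale supp_bas simp del: scale_single)

lemma supp_nrm_BB: "supp nrm x \<Longrightarrow> supp nrm y \<Longrightarrow> supp nrm (BB x y)"
  by (simp add: BB_def supp_diff supp_nrm_DD supp_nrm_mm supp_nrm_PP)

subsection \<open>Evaluation of trees on normal forms\<close>

definition PPp :: "int \<Rightarrow> (nt \<Rightarrow>\<^sub>0 'k::field) \<Rightarrow> nt \<Rightarrow>\<^sub>0 'k" where "PPp e x = (if even e then x else PP x)"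

definition gop1 :: "gen \<Rightarrow> (nt \<Rightarrow>\<^sub>0 'k::field) \<Rightarrow> nt \<Rightarrow>\<^sub>0 'k"
  where "gop1 g x = (case g of Delta \<Rightarrow> DD x | A k \<Rightarrow> AA k x | _ \<Rightarrow> 0)"

definition gop2 :: "gen \<Rightarrow> (nt \<Rightarrow>\<^sub>0 'k::field) \<Rightarrow> (nt \<Rightarrow>\<^sub>0 'k) \<Rightarrow> nt \<Rightarrow>\<^sub>0 'k"
  where "gop2 g x y = (case g of Prod \<Rightarrow> mm x y | Brk \<Rightarrow> BB x y | _ \<Rightarrow> 0)"

text \<open>
  The parity involution \<open>PP\<close> produces the Koszul signs, so that the arguments in \<open>vs\<close> need not be
  homogeneous.
\<close>

fun evl :: "tree \<Rightarrow> (nt \<Rightarrow>\<^sub>0 'k::field) list \<Rightarrow> nt \<Rightarrow>\<^sub>0 'k" where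
  "evl Leaf vs = hd vs"
| "evl (Node g [s]) vs = gop1 g (evl s vs)"
| "evl (Node g [s, t]) vs =
    gop2 g (evl s (map (PPp (tree_deg t)) (take (leaves s) vs))) (evl t (drop (leaves s) vs))"
| "evl _ vs = 0"

lemma is_lin_gop [lin_intros]:
  "is_lin f \<Longrightarrow> is_lin (\<lambda>x. gop1 g (f x))"
  "is_lin f \<Longrightarrow> is_lin (\<lambda>x. gop2 g (f x) y)" "is_lin f \<Longrightarrow> is_lin (\<lambda>x. gop2 g y (f x))"
  by (cases g; simp add: gop1_def gop2_def is_lin_comps is_lin_BB is_lin_const0)+

lemma is_lin_PPp [lin_intros]: "is_lin f \<Longrightarrow> is_lin (\<lambda>x. PPp e (f x))"
  by (cases "even e") (simp_all add: PPp_def is_lin_comps)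

lemma PPp_PPp: "PPp d (PPp e x) = PPp (d + e) x"
  by (auto simp: PPp_def)

lemma PPp_comp: "PPp d \<circ> PPp e = PPp (d + e)"
  by (simp add: fun_eq_iff PPp_PPp)

lemma gop_PPp:
  "gop1 g (PPp e x) = scale ((-1) powi (e * gen_deg g)) (PPp e (gop1 g x))"
  "gop2 g (PPp e x) (PPp e y) = scale ((-1) powi (e * gen_deg g)) (PPp e (gop2 g x y))"
  by (cases g; simp add: gop1_def gop2_def PPp_def PP_DD PP_AA PP_mm PP_BB powi_minus_one)+

text \<open>Only unary and binary vertices act on normal forms, and all others evaluate to zero;
  with this case distinction evaluation can be studied for arbitrary trees.\<close>

lemma tree_shape_induct [case_names Leaf Node1 Node2 other]:
  assumes "P Leaf" "\<And>g s. P s \<Longrightarrow> P (Node g [s])" "\<And>g s t. \<lbrakk>P s; P t\<rbrakk> \<Longrightarrow> P (Node g [s, t])"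
    "\<And>g ts. length ts \<notin> {1, 2} \<Longrightarrow> P (Node g ts)"
  shows "P t"
proof (induction t)
  case (Node g ts)
  consider s where "ts = [s]" | s t where "ts = [s, t]" | "length ts \<notin> {1, 2}"
    by (cases ts; cases "tl ts"; cases "tl (tl ts)") auto
  then show ?case by cases (use Node assms in auto)
qed (rule assms)

lemma evl_other: "length ts \<notin> {1, 2} \<Longrightarrow> evl (Node g ts) vs = 0"
  by (cases "(Node g ts, vs)" rule: evl.cases) auto

lemma evl_Node2:
  "length xs = leaves s \<Longrightarrow>
    evl (Node g [s, t]) (xs @ ys) = gop2 g (evl s (map (PPp (tree_deg t)) xs)) (evl t ys)"
  by simp

text \<open>Operations of even degree commute with the parity involution, those of odd degree
  anticommute with it.\<close>

lemma evl_PPp: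
  "length vs = leaves t \<Longrightarrow> evl t (map (PPp e) vs) = scale ((-1) powi (e * tree_deg t)) (PPp e (evl t vs))"
proof (induction t arbitrary: vs rule: tree_shape_induct)
  case Leaf
  then show ?case by (cases vs) auto
next
  case (Node1 g s)
  then show ?case
    by (simp add: gop_PPp distrib_left powi_minus_one_add is_lin_scale[OF is_lin_gop(1)[OF is_lin_id]] mult.commute)
next
  case (Node2 g s t)
  define xs ys where "xs = take (leaves s) vs" and "ys = drop (leaves s) vs"
  have vs: "vs = xs @ ys" "length xs = leaves s" "length ys = leaves t"
    using Node2.prems by (auto simp: xs_def ys_def)
  have "map (PPp (tree_deg t)) (map (PPp e) xs) = map (PPp e) (map (PPp (tree_deg t)) xs)"
    by (simp add: PPp_PPp add.commute)
  then show ?case using Node2.IH(1)[of "map (PPp (tree_deg t)) xs"] Node2.IH(2)[of ys] vs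
    by (simp add: evl_Node2 gop_PPp distrib_left powi_minus_one_add mult_ac del: map_map evl.simps(3)
        add: is_lin_scale[OF is_lin_gop(2)[OF is_lin_id]] is_lin_scale[OF is_lin_gop(3)[OF is_lin_id]])
next
  case (other g ts)
  then show ?case by (simp add: evl_other PPp_def)
qed

lemma is_lin_evl: "length us + 1 + length ws = leaves t \<Longrightarrow> is_lin f \<Longrightarrow> is_lin (\<lambda>v. evl t (us @ f v # ws))"
proof (induction t arbitrary: us ws f rule: tree_shape_induct)
  case Leaf
  then show ?case by simp
next
  case (Node1 g s)
  then show ?case by (simp add: is_lin_gop)
next
  case (Node2 g s t)
  show ?case
  proof (cases "length us < leaves s")
    case True
    then obtain ws1 ws2 where ws: "ws = ws1 @ ws2" "length us + 1 + length ws1 = leaves s"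
      using Node2.prems by (intro that[of "take (leaves s - length us - 1) ws" "drop (leaves s - length us - 1) ws"]) auto
    have eq: "evl (Node g [s, t]) (us @ f v # ws) = gop2 g (evl s (map (PPp (tree_deg t)) us @ PPp (tree_deg t) (f v) # map (PPp (tree_deg t)) ws1)) (evl t ws2)" for v
      using evl_Node2[of "us @ f v # ws1" s g t ws2] ws by simp
    show ?thesis unfolding eq
      using ws Node2.prems by (intro is_lin_gop(2) Node2.IH is_lin_PPp) auto
  next
    case False
    then obtain us1 us2 where us: "us = us1 @ us2" "length us1 = leaves s"
      by (intro that[of "take (leaves s) us" "drop (leaves s) us"]) auto
    have eq: "evl (Node g [s, t]) (us @ f v # ws) = gop2 g (evl s (map (PPp (tree_deg t)) us1)) (evl t (us2 @ f v # ws))" for v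
      using evl_Node2[of "us1" s g t "us2 @ f v # ws"] us by simp
    show ?thesis unfolding eq
      using us Node2.prems by (intro is_lin_gop(3) Node2.IH) auto
  qed
next
  case (other g ts)
  then show ?case by (simp add: evl_other is_lin_const0)
qed

text \<open>Evaluation turns grafting into substitution. On the left stands the sign of the grafting
  in the free operad; on the right \<open>t\<close> has moved past the arguments \<open>us\<close>
  in front of it.\<close>

lemma evl_graft:
  assumes "1 \<le> i" "i \<le> leaves s" "length us = i - 1" "length vs = leaves t" "length ws = leaves s - i"
  shows "scale ((-1) powi (deg_after s i * tree_deg t)) (evl (graft s i t) (us @ vs @ ws)) =
    evl s (map (PPp (tree_deg t)) us @ evl t vs # ws)"
  using assms
proof (induction s arbitrary: i us vs ws rule: tree_shape_induct)
  case Leaf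
  then show ?case by simp
next
  case (Node1 g s)
  then show ?case using Node1.IH[of i us vs ws]
    by (simp add: is_lin_scale[OF is_lin_gop(1)[OF is_lin_id], symmetric])
next
  case (Node2 g s1 s2)
  let ?P = "PPp (tree_deg s2)"
  show ?case
  proof (cases "i \<le> leaves s1")
    case True
    define ws1 ws2 where "ws1 = take (leaves s1 - i) ws" and "ws2 = drop (leaves s1 - i) ws"
    have ws: "ws = ws1 @ ws2" "length ws1 = leaves s1 - i" "length ws2 = leaves s2"
      using Node2.prems True by (auto simp: ws1_def ws2_def)
    have len: "length (us @ vs @ ws1) = leaves (graft s1 i t)"
      using Node2.prems True ws leaves_graft(1)[of i s1 t] by simp
    have 1: "evl (graft (Node g [s1, s2]) i t) (us @ vs @ ws)
      = gop2 g (evl (graft s1 i t) (map ?P us @ map ?P vs @ map ?P ws1)) (evl s2 ws2)"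
      using evl_Node2[OF len, of g s2 ws2] True ws by simp
    \<comment> \<open>The arguments of \<open>t\<close> lie under \<open>s1\<close> and are twisted
      by the degree of \<open>s2\<close>. Pulling the twist out of \<open>evl t\<close> gives a sign
      that cancels the contribution of \<open>s2\<close> to \<open>deg_after\<close>.\<close>
    have 2: "evl t (map ?P vs) = scale ((-1) powi (tree_deg s2 * tree_deg t)) (?P (evl t vs))"
      by (rule evl_PPp) (use Node2.prems in simp)
    have 3: "evl (Node g [s1, s2]) (map (PPp (tree_deg t)) us @ evl t vs # ws)
      = gop2 g (evl s1 (map (PPp (tree_deg t)) (map ?P us) @ ?P (evl t vs) # map ?P ws1)) (evl s2 ws2)"
      using evl_Node2[of "map (PPp (tree_deg t)) us @ evl t vs # ws1" s1 g s2 ws2] True Node2.prems ws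
      by (simp add: PPp_comp add.commute Suc_diff_le)
    have 4: "scale ((-1) powi (deg_after s1 i * tree_deg t)) (evl (graft s1 i t) (map ?P us @ map ?P vs @ map ?P ws1))
      = evl s1 (map (PPp (tree_deg t)) (map ?P us) @ evl t (map ?P vs) # map ?P ws1)"
      by (rule Node2.IH(1)) (use Node2.prems True ws in auto)
    have 5: "evl s1 (map (PPp (tree_deg t)) (map ?P us) @ evl t (map ?P vs) # map ?P ws1)
      = scale ((-1) powi (tree_deg s2 * tree_deg t)) (evl s1 (map (PPp (tree_deg t)) (map ?P us) @ ?P (evl t vs) # map ?P ws1))"
      unfolding 2 by (rule is_lin_scale[OF is_lin_evl[OF _ is_lin_id]]) (use Node2.prems True ws in auto)
    have "scale ((-1) powi (deg_after (Node g [s1, s2]) i * tree_deg t)) (evl (graft (Node g [s1, s2]) i t) (us @ vs @ ws))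
      = scale ((-1) powi (tree_deg s2 * tree_deg t)) (gop2 g (scale ((-1) powi (deg_after s1 i * tree_deg t))
          (evl (graft s1 i t) (map ?P us @ map ?P vs @ map ?P ws1))) (evl s2 ws2))"
      unfolding 1 using True
      by (simp add: is_lin_scale[OF is_lin_gop(2)[OF is_lin_id]] distrib_left powi_minus_one_add mult_ac)
    then show ?thesis unfolding 3 4 5
      by (simp add: is_lin_scale[OF is_lin_gop(2)[OF is_lin_id]] powi_minus_one)
  next
    case False
    define j where "j = i - leaves s1"
    define us1 us2 where "us1 = take (leaves s1) us" and "us2 = drop (leaves s1) us"
    have us: "us = us1 @ us2" "length us1 = leaves s1" "length us2 = j - 1"
      using Node2.prems False by (auto simp: us1_def us2_def j_def)
    have j: "1 \<le> j" "j \<le> leaves s2" "length ws = leaves s2 - j" using Node2.prems False by (auto simp: j_def)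
    have deg: "tree_deg (graft s2 j t) = tree_deg s2 + tree_deg t" using j by (simp add: tree_deg_graft)
    have g: "graft (Node g [s1, s2]) i t = Node g [s1, graft s2 j t]"
      "deg_after (Node g [s1, s2]) i = deg_after s2 j"
      using j False by (auto simp: j_def)
    have "evl (graft (Node g [s1, s2]) i t) (us @ vs @ ws)
      = gop2 g (evl s1 (map ?P (map (PPp (tree_deg t)) us1))) (evl (graft s2 j t) (us2 @ vs @ ws))"
      unfolding g(1) using evl_Node2[OF us(2), of g "graft s2 j t" "us2 @ vs @ ws"] us(1)
      by (simp add: deg PPp_comp del: evl.simps)
    moreover have "evl (Node g [s1, s2]) (map (PPp (tree_deg t)) us @ evl t vs # ws)
      = gop2 g (evl s1 (map ?P (map (PPp (tree_deg t)) us1))) (evl s2 (map (PPp (tree_deg t)) us2 @ evl t vs # ws))"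
      using evl_Node2[of "map (PPp (tree_deg t)) us1" s1 g s2 "map (PPp (tree_deg t)) us2 @ evl t vs # ws"] us by simp
    ultimately show ?thesis unfolding g(2)
      using Node2.IH(2)[of j us2 vs ws] us j Node2.prems
      by (simp add: is_lin_scale[OF is_lin_gop(3)[OF is_lin_id], symmetric] del: graft.simps evl.simps)
  qed
next
  case (other g ts)
  then show ?case by (simp add: evl_other)
qed

definition evx :: "(tree \<Rightarrow>\<^sub>0 'k::field) \<Rightarrow> (nt \<Rightarrow>\<^sub>0 'k) list \<Rightarrow> nt \<Rightarrow>\<^sub>0 'k"
  where "evx x vs = lin_ext (\<lambda>t. evl t vs) x"

lemma is_lin_evx [lin_intros, simp]: "is_lin (\<lambda>x. evx x vs)"
  by (simp add: evx_def)

lemma evx_bas [simp]: "evx (bas t) vs = evl t vs"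
  by (simp add: evx_def)

lemma is_lin_evx_arg:
  assumes "x \<in> free_cmp G n d" "length us + 1 + length ws = n" "is_lin f"
  shows "is_lin (\<lambda>v. evx x (us @ f v # ws))"
proof -
  have "is_lin (\<lambda>v. evl t (us @ f v # ws))" if "t \<in> Poly_Mapping.keys x" for t
    using is_lin_evl[OF _ assms(3), of us ws t] free_cmp_keysD[OF assms(1) that] assms(2) by simp
  then show ?thesis
    unfolding is_lin_def evx_def lin_ext_def by (auto simp: scale_add_right sum.distrib scale_sum mult.commute)
qed

lemma evx_tcomp:
  assumes x: "x \<in> free_cmp G n d" and y: "y \<in> free_cmp G m e" and i: "1 \<le> i" "i \<le> n"
    and l: "length us = i - 1" "length vs = m" "length ws = n - i"
  shows "evx (x \<circ>[i] y) (us @ vs @ ws) = evx x (map (PPp e) us @ evx y vs # ws)"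
proof (rule free_eqI[OF x])
  fix s assume s: "tree_over G s" "leaves s = n" "tree_deg s = d"
  show "evx (bas s \<circ>[i] y) (us @ vs @ ws) = evx (bas s) (map (PPp e) us @ evx y vs # ws)"
  proof (rule free_eqI[OF y])
    fix t assume t: "tree_over G t" "leaves t = m" "tree_deg t = e"
    show "evx (bas s \<circ>[i] bas t) (us @ vs @ ws) = evx (bas s) (map (PPp e) us @ evx (bas t) vs # ws)"
      using evl_graft[of i s us vs t ws] s t i l by (simp add: tcomp_bas evx_def)
  next
    show "is_lin (\<lambda>y. evx (bas s) (map (PPp e) us @ evx y vs # ws))"
      by (rule is_lin_evx_arg[OF bas_free[OF s(1)]]) (use s i l in auto)
  next
    show "is_lin (\<lambda>y. evx (bas s \<circ>[i] y) (us @ vs @ ws))"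
      by (rule is_lin_comp[OF is_lin_evx]) simp
  qed
next
  show "is_lin (\<lambda>x. evx (x \<circ>[i] y) (us @ vs @ ws))"
    by (rule is_lin_comp[OF is_lin_evx]) simp
qed simp

text \<open>Relators are required to vanish on arbitrary arguments because elements of the ideal
  contain them with further operations composed into their inputs.\<close>

lemma evx_ideal:
  assumes R: "\<And>r n d vs. \<lbrakk>r \<in> R; r \<in> free_cmp G n d; length vs = n\<rbrakk> \<Longrightarrow> evx r vs = 0"
  shows "in_ideal G R n d x \<Longrightarrow> length vs = n \<Longrightarrow> evx x vs = 0"
proof (induction arbitrary: vs rule: in_ideal.induct)
  case (comp_left n d x y m e i)
  define us vm ws where "us = take (i - 1) vs" and "vm = take m (drop (i - 1) vs)" and "ws = drop m (drop (i - 1) vs)"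
  have vs: "vs = us @ vm @ ws" "length us = i - 1" "length vm = m" "length ws = n - i"
    using comp_left.prems comp_left.hyps by (simp_all only: us_def vm_def ws_def append_take_drop_id) auto
  have "evx (x \<circ>[i] y) vs = evx x (map (PPp e) us @ evx y vm # ws)"
    unfolding vs(1) by (rule evx_tcomp[OF in_ideal_free[OF comp_left(1)]]) (use comp_left.hyps vs in auto)
  then show ?case using comp_left.IH comp_left.hyps vs by simp
next
  case (comp_right x n d m e y i)
  define us vm ws where "us = take (i - 1) vs" and "vm = take m (drop (i - 1) vs)" and "ws = drop m (drop (i - 1) vs)"
  have vs: "vs = us @ vm @ ws" "length us = i - 1" "length vm = m" "length ws = n - i"
    using comp_right.prems comp_right.hyps by (simp_all only: us_def vm_def ws_def append_take_drop_id) auto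
  have "evx (x \<circ>[i] y) vs = evx x (map (PPp e) us @ evx y vm # ws)"
    unfolding vs(1) by (rule evx_tcomp[OF comp_right(1) in_ideal_free[OF comp_right(2)]]) (use comp_right.hyps vs in auto)
  also have "\<dots> = evx x (map (PPp e) us @ 0 # ws)" using comp_right.IH vs by simp
  also have "\<dots> = 0"
    by (rule is_lin_zero[OF is_lin_evx_arg[OF comp_right(1) _ is_lin_id]]) (use comp_right.hyps vs in auto)
  finally show ?case .
qed (auto simp: R is_lin_add[OF is_lin_evx] is_lin_scale[OF is_lin_evx] is_lin_zero[OF is_lin_evx])


subsection \<open>The relators\<close>

definition hq_gens :: "gen set" where "hq_gens = ncBV_gens \<union> {A k | k. 1 \<le> k}"

lemma hq_gens: "Prod \<in> hq_gens" "Brk \<in> hq_gens" "Delta \<in> hq_gens" "A (Suc k) \<in> hq_gens"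
  by (auto simp: hq_gens_def ncBV_gens_def)

lemma hq_gens_cases:
  assumes "g \<in> hq_gens"
  obtains "g = Prod" | "g = Brk" | "g = Delta" | k where "g = A (Suc k)"
  using assms unfolding hq_gens_def ncBV_gens_def by (auto dest: Suc_le_D)

lemma corolla_comps:
  "corolla Delta \<circ>[1] corolla Delta = bas (Node Delta [Node Delta [Leaf]])"
  "corolla Prod \<circ>[1] corolla Prod = bas (Node Prod [Node Prod [Leaf, Leaf], Leaf])"
  "corolla Prod \<circ>[2] corolla Prod = bas (Node Prod [Leaf, Node Prod [Leaf, Leaf]])"
  "corolla Prod \<circ>[1] corolla Brk = bas (Node Prod [Node Brk [Leaf, Leaf], Leaf])"
  "corolla Prod \<circ>[2] corolla Brk = bas (Node Prod [Leaf, Node Brk [Leaf, Leaf]])"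
  "corolla Brk \<circ>[1] corolla Prod = bas (Node Brk [Node Prod [Leaf, Leaf], Leaf])"
  "corolla Brk \<circ>[2] corolla Prod = bas (Node Brk [Leaf, Node Prod [Leaf, Leaf]])"
  "corolla Brk \<circ>[1] corolla Brk = bas (Node Brk [Node Brk [Leaf, Leaf], Leaf])"
  "corolla Brk \<circ>[2] corolla Brk = bas (Node Brk [Leaf, Node Brk [Leaf, Leaf]])"
  "corolla Delta \<circ>[1] corolla Prod = bas (Node Delta [Node Prod [Leaf, Leaf]])"
  "corolla Prod \<circ>[1] corolla Delta = bas (Node Prod [Node Delta [Leaf], Leaf])"
  "corolla Prod \<circ>[2] corolla Delta = bas (Node Prod [Leaf, Node Delta [Leaf]])"
  "corolla Delta \<circ>[1] corolla Brk = bas (Node Delta [Node Brk [Leaf, Leaf]])"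
  "corolla Brk \<circ>[1] corolla Delta = bas (Node Brk [Node Delta [Leaf], Leaf])"
  "corolla Brk \<circ>[2] corolla Delta = bas (Node Brk [Leaf, Node Delta [Leaf]])"
  by (simp_all add: corolla_def tcomp_bas numeral_2_eq_2)

lemma corolla_Brk: "corolla Brk = bas (Node Brk [Leaf, Leaf])"
  by (simp add: corolla_def numeral_2_eq_2)

lemma ncBV_relators_eq: "ncBV_relators =
  {bas (Node Delta [Node Delta [Leaf]]),
   bas (Node Prod [Node Prod [Leaf, Leaf], Leaf]) - bas (Node Prod [Leaf, Node Prod [Leaf, Leaf]]),
   bas (Node Prod [Node Brk [Leaf, Leaf], Leaf]) - bas (Node Brk [Leaf, Node Prod [Leaf, Leaf]]),
   bas (Node Brk [Node Prod [Leaf, Leaf], Leaf]) - bas (Node Prod [Leaf, Node Brk [Leaf, Leaf]]),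
   bas (Node Brk [Node Brk [Leaf, Leaf], Leaf]) + bas (Node Brk [Leaf, Node Brk [Leaf, Leaf]]),
   bas (Node Delta [Node Prod [Leaf, Leaf]]) - bas (Node Prod [Node Delta [Leaf], Leaf])
     - bas (Node Prod [Leaf, Node Delta [Leaf]]) - bas (Node Brk [Leaf, Leaf]),
   bas (Node Delta [Node Brk [Leaf, Leaf]]) + bas (Node Brk [Node Delta [Leaf], Leaf])
     + bas (Node Brk [Leaf, Node Delta [Leaf]])}"
  unfolding ncBV_relators_def Let_def corolla_comps unfolding corolla_Brk ..

lemma ncBV_relators_free:
  "bas (Node Delta [Node Delta [Leaf]]) \<in> free_cmp hq_gens 1 2"
  "bas (Node Prod [Node Prod [Leaf, Leaf], Leaf]) - bas (Node Prod [Leaf, Node Prod [Leaf, Leaf]]) \<in> free_cmp hq_gens 3 0"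
  "bas (Node Prod [Node Brk [Leaf, Leaf], Leaf]) - bas (Node Brk [Leaf, Node Prod [Leaf, Leaf]]) \<in> free_cmp hq_gens 3 1"
  "bas (Node Brk [Node Prod [Leaf, Leaf], Leaf]) - bas (Node Prod [Leaf, Node Brk [Leaf, Leaf]]) \<in> free_cmp hq_gens 3 1"
  "bas (Node Brk [Node Brk [Leaf, Leaf], Leaf]) + bas (Node Brk [Leaf, Node Brk [Leaf, Leaf]]) \<in> free_cmp hq_gens 3 2"
  "bas (Node Delta [Node Prod [Leaf, Leaf]]) - bas (Node Prod [Node Delta [Leaf], Leaf])
     - bas (Node Prod [Leaf, Node Delta [Leaf]]) - bas (Node Brk [Leaf, Leaf]) \<in> free_cmp hq_gens 2 1"
  "bas (Node Delta [Node Brk [Leaf, Leaf]]) + bas (Node Brk [Node Delta [Leaf], Leaf])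
     + bas (Node Brk [Leaf, Node Delta [Leaf]]) \<in> free_cmp hq_gens 2 2"
  by (intro free_cmp_diff free_cmp_add free_cmp_single; simp add: hq_gens)+

lemma free_cmp_unique: "x \<in> free_cmp G n d \<Longrightarrow> x \<in> free_cmp G' m e \<Longrightarrow> x \<noteq> 0 \<Longrightarrow> n = m"
  by (metis free_cmp_keysD all_not_in_conv keys_eq_empty)

lemma evx_ncBV_relators:
  assumes "r \<in> ncBV_relators" "r \<in> free_cmp hq_gens n d" "length vs = n"
  shows "evx r vs = 0"
\<comment> \<open>Zero belongs to every component; the arity, and with it the length of
  \<open>vs\<close>, can be read off from a nonzero relator only.\<close>
proof (cases "r = 0")
  case False
  note ex = is_lin_add[OF is_lin_evx] is_lin_diff[OF is_lin_evx] gop1_def gop2_def PPp_def BB_def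
    mm_assoc DD_mm_mm PP_mm PP_DD
  from assms(1) show ?thesis unfolding ncBV_relators_eq
  proof (elim insertE emptyE)
    assume r: "r = bas (Node Delta [Node Delta [Leaf]])"
    then have "length vs = 1" using ncBV_relators_free(1) assms free_cmp_unique False by metis
    then show ?thesis by (simp add: r gop1_def)
  next
    assume r: "r = bas (Node Prod [Node Prod [Leaf, Leaf], Leaf]) - bas (Node Prod [Leaf, Node Prod [Leaf, Leaf]])"
    then have "length vs = 3" using ncBV_relators_free(2) assms free_cmp_unique False by metis
    then obtain a b c where "vs = [a, b, c]" by (auto simp: length_Suc_conv numeral_3_eq_3)
    then show ?thesis by (simp add: r ex)
  next
    assume r: "r = bas (Node Prod [Node Brk [Leaf, Leaf], Leaf]) - bas (Node Brk [Leaf, Node Prod [Leaf, Leaf]])"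
    then have "length vs = 3" using ncBV_relators_free(3) assms free_cmp_unique False by metis
    then obtain a b c where "vs = [a, b, c]" by (auto simp: length_Suc_conv numeral_3_eq_3)
    then show ?thesis by (simp add: r ex)
  next
    assume r: "r = bas (Node Brk [Node Prod [Leaf, Leaf], Leaf]) - bas (Node Prod [Leaf, Node Brk [Leaf, Leaf]])"
    then have "length vs = 3" using ncBV_relators_free(4) assms free_cmp_unique False by metis
    then obtain a b c where "vs = [a, b, c]" by (auto simp: length_Suc_conv numeral_3_eq_3)
    then show ?thesis by (simp add: r ex)
  next
    assume r: "r = bas (Node Brk [Node Brk [Leaf, Leaf], Leaf]) + bas (Node Brk [Leaf, Node Brk [Leaf, Leaf]])"
    then have "length vs = 3" using ncBV_relators_free(5) assms free_cmp_unique False by metis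
    then obtain a b c where "vs = [a, b, c]" by (auto simp: length_Suc_conv numeral_3_eq_3)
    then show ?thesis by (simp add: r ex)
  next
    assume r: "r = bas (Node Delta [Node Prod [Leaf, Leaf]]) - bas (Node Prod [Node Delta [Leaf], Leaf])
     - bas (Node Prod [Leaf, Node Delta [Leaf]]) - bas (Node Brk [Leaf, Leaf])"
    then have "length vs = 2" using ncBV_relators_free(6) assms free_cmp_unique False by metis
    then obtain a b where "vs = [a, b]" by (auto simp: length_Suc_conv numeral_2_eq_2)
    then show ?thesis by (simp add: r ex)
  next
    assume r: "r = bas (Node Delta [Node Brk [Leaf, Leaf]]) + bas (Node Brk [Node Delta [Leaf], Leaf])
     + bas (Node Brk [Leaf, Node Delta [Leaf]])"
    then have "length vs = 2" using ncBV_relators_free(7) assms free_cmp_unique False by metis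
    then obtain a b where "vs = [a, b]" by (auto simp: length_Suc_conv numeral_2_eq_2)
    then show ?thesis by (simp add: r ex)
  qed
qed (simp add: evx_def)

text \<open>For a nonsymmetric operad the free algebra on one generator of degree 0 is the direct
  sum of all components, so evaluating every leaf at the same \<open>Lf\<close> loses no
  information.\<close>

definition nf :: "tree \<Rightarrow> nt \<Rightarrow>\<^sub>0 'k::field" where "nf t = evl t (replicate (leaves t) (bas Lf))"

definition NF :: "(tree \<Rightarrow>\<^sub>0 'k::field) \<Rightarrow> nt \<Rightarrow>\<^sub>0 'k" where "NF = lin_ext nf"

lemma is_lin_NF [lin_intros, simp]: "is_lin NF"
  by (simp add: NF_def)

lemmas NF_simps [simp] = is_lin_add[OF is_lin_NF] is_lin_diff[OF is_lin_NF] is_lin_minus[OF is_lin_NF]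
  is_lin_zero[OF is_lin_NF] is_lin_scale[OF is_lin_NF]

lemma NF_bas [simp]: "NF (bas t) = nf t"
  by (simp add: NF_def)

lemma PPp_Lf [simp]: "PPp e (bas Lf) = bas Lf"
  by (simp add: PPp_def bas_simps sg_def)

lemma nf_simps:
  "nf Leaf = bas Lf" "nf (Node g [s]) = gop1 g (nf s)" "nf (Node g [s, t]) = gop2 g (nf s) (nf t)"
  by (simp_all add: nf_def)

lemma NF_ideal:
  assumes "in_ideal hq_gens ncBV_relators n d x"
  shows "NF x = 0"
proof -
  have "NF x = evx x (replicate n (bas Lf))"
    by (rule free_eqI[OF in_ideal_free[OF assms]]) (auto simp: nf_def)
  then show ?thesis using evx_ideal[OF evx_ncBV_relators assms] by simp
qed

subsection \<open>Every tree is congruent to its normal form\<close>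

definition homog :: "nat \<Rightarrow> int \<Rightarrow> (tree \<Rightarrow>\<^sub>0 'k::field) \<Rightarrow> tree \<Rightarrow>\<^sub>0 'k"
  where "homog n d = lin_ext (\<lambda>t. if leaves t = n \<and> tree_deg t = d then bas t else 0)"

lemma is_lin_homog [simp]: "is_lin (homog n d)"
  by (simp add: homog_def)

lemma homog_free:
  assumes "x \<in> free_cmp G m e"
  shows "homog n d x = (if n = m \<and> d = e then x else 0)"
proof -
  have "homog n d x = lin_ext (\<lambda>t. if n = m \<and> d = e then bas t else 0) x"
    unfolding homog_def by (rule lin_ext_cong) (auto dest: free_cmp_keysD[OF assms])
  then show ?thesis by (cases "n = m \<and> d = e") auto
qed

text \<open>The sum of all components of the ideal. Congruences can be added here without tracking
  arity and degree, and \<open>hideal_in_ideal\<close> returns to the graded ideal for homogeneous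
  elements.\<close>

inductive_set hideal :: "gen set \<Rightarrow> (tree \<Rightarrow>\<^sub>0 'k::field) set \<Rightarrow> (tree \<Rightarrow>\<^sub>0 'k) set" for G R where
  base: "in_ideal G R n d x \<Longrightarrow> x \<in> hideal G R"
| add: "\<lbrakk>x \<in> hideal G R; y \<in> hideal G R\<rbrakk> \<Longrightarrow> x + y \<in> hideal G R"

lemma hideal_homog: "x \<in> hideal G R \<Longrightarrow> in_ideal G R n d (homog n d x)"
proof (induction rule: hideal.induct)
  case (base m e x)
  then show ?case by (auto simp: homog_free[OF in_ideal_free] in_ideal.zero)
qed (auto simp: is_lin_add[OF is_lin_homog] in_ideal.add)

lemma hideal_in_ideal: "\<lbrakk>x \<in> hideal G R; x \<in> free_cmp G n d\<rbrakk> \<Longrightarrow> in_ideal G R n d x"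
  using hideal_homog[of x G R n d] homog_free[of x G n d n d] by simp

lemma hideal_zero [simp]: "0 \<in> hideal G R"
  by (rule hideal.base[OF in_ideal.zero])

lemma hideal_linI:
  assumes "x \<in> hideal G R" "is_lin f" "\<And>n d x. in_ideal G R n d x \<Longrightarrow> f x \<in> hideal G' R'"
  shows "f x \<in> hideal G' R'"
  using assms(1) by (induction rule: hideal.induct) (auto simp: is_lin_add[OF assms(2)] assms(3) intro: hideal.add)

lemma hideal_scale: "x \<in> hideal G R \<Longrightarrow> scale c x \<in> hideal G R"
  by (erule hideal_linI) (auto intro!: lin_intros hideal.base[OF in_ideal.scale])

lemma hideal_uminus: "x \<in> hideal G R \<Longrightarrow> - x \<in> hideal G R"
  using hideal_scale[of x G R "-1"] by simp

lemma hideal_diff: "\<lbrakk>x \<in> hideal G R; y \<in> hideal G R\<rbrakk> \<Longrightarrow> x - y \<in> hideal G R"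
  using hideal.add[OF _ hideal_uminus, of x G R y] by simp

lemma hideal_sum: "(\<And>a. a \<in> S \<Longrightarrow> f a \<in> hideal G R) \<Longrightarrow> sum f S \<in> hideal G R"
  by (induction S rule: infinite_finite_induct) (auto intro: hideal.add)

lemma hideal_lin_ext: "(\<And>s. s \<in> Poly_Mapping.keys x \<Longrightarrow> f s \<in> hideal G R) \<Longrightarrow> lin_ext f x \<in> hideal G R"
  unfolding lin_ext_def by (intro hideal_sum hideal_scale)

section \<open>Tree contexts and instances of the relators\<close>

definition op1 :: "gen \<Rightarrow> (tree \<Rightarrow>\<^sub>0 'k::field) \<Rightarrow> tree \<Rightarrow>\<^sub>0 'k"
  where "op1 g = lin_ext (\<lambda>s. bas (Node g [s]))"

definition op2 :: "gen \<Rightarrow> (tree \<Rightarrow>\<^sub>0 'k::field) \<Rightarrow> (tree \<Rightarrow>\<^sub>0 'k) \<Rightarrow> tree \<Rightarrow>\<^sub>0 'k"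
  where "op2 g x y = lin_ext (\<lambda>s. lin_ext (\<lambda>t. bas (Node g [s, t])) y) x"

lemma is_lin_op [lin_intros]:
  "is_lin f \<Longrightarrow> is_lin (\<lambda>x. op1 g (f x))"
  "is_lin f \<Longrightarrow> is_lin (\<lambda>x. op2 g (f x) y)" "is_lin f \<Longrightarrow> is_lin (\<lambda>x. op2 g y (f x))"
  unfolding op1_def op2_def by (intro lin_intros | assumption)+

lemmas op1_simps [simp] = is_lin_add[OF is_lin_op(1)[OF is_lin_id]] is_lin_diff[OF is_lin_op(1)[OF is_lin_id]]
  is_lin_minus[OF is_lin_op(1)[OF is_lin_id]] is_lin_zero[OF is_lin_op(1)[OF is_lin_id]] is_lin_scale[OF is_lin_op(1)[OF is_lin_id]]
lemmas op2_simps [simp] = is_lin_add[OF is_lin_op(2)[OF is_lin_id]] is_lin_diff[OF is_lin_op(2)[OF is_lin_id]]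
  is_lin_minus[OF is_lin_op(2)[OF is_lin_id]] is_lin_zero[OF is_lin_op(2)[OF is_lin_id]] is_lin_scale[OF is_lin_op(2)[OF is_lin_id]]
  is_lin_add[OF is_lin_op(3)[OF is_lin_id]] is_lin_diff[OF is_lin_op(3)[OF is_lin_id]]
  is_lin_minus[OF is_lin_op(3)[OF is_lin_id]] is_lin_zero[OF is_lin_op(3)[OF is_lin_id]] is_lin_scale[OF is_lin_op(3)[OF is_lin_id]]

lemma op_bas: "op1 g (bas s) = bas (Node g [s])" "op2 g (bas s) (bas t) = bas (Node g [s, t])"
  by (simp_all add: op1_def op2_def)

abbreviation HJ :: "(tree \<Rightarrow>\<^sub>0 'k::field) set" where "HJ \<equiv> hideal hq_gens ncBV_relators"

lemma HJ_op1:
  assumes "g \<in> hq_gens" "gen_arity g = 1" "x \<in> HJ"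
  shows "op1 g x \<in> HJ"
proof (rule hideal_linI[OF assms(3)])
  fix n d and x :: "tree \<Rightarrow>\<^sub>0 'a" assume x: "in_ideal hq_gens ncBV_relators n d x"
  have "op1 g x = corolla g \<circ>[1] x"
    by (rule lin_eqI) (auto intro!: lin_intros simp: op_bas corolla_def tcomp_bas assms(2))
  then show "op1 g x \<in> HJ"
    using hideal.base[OF in_ideal.comp_right[OF corolla_free[OF assms(1)] x, of 1]] assms(2) by simp
qed (intro lin_intros)

text \<open>Composing \<open>x\<close> into the first input of a binary vertex moves it past the
  second subtree, which costs one common sign on a homogeneous element.\<close>

lemma HJ_op2_left:
  assumes "g \<in> hq_gens" "gen_arity g = 2" "x \<in> HJ" "tree_over hq_gens t"
  shows "op2 g x (bas t) \<in> HJ"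
proof (rule hideal_linI[OF assms(3)])
  fix n d and x :: "tree \<Rightarrow>\<^sub>0 'a" assume x: "in_ideal hq_gens ncBV_relators n d x"
  have "bas (Node g [Leaf, t]) \<circ>[1] x = scale ((-1) powi (tree_deg t * d)) (op2 g x (bas t))"
    by (rule free_eqI[OF in_ideal_free[OF x]]) (auto intro!: lin_intros simp: op_bas tcomp_bas)
  then have "op2 g x (bas t) = scale ((-1) powi (tree_deg t * d)) (bas (Node g [Leaf, t]) \<circ>[1] x)"
    by (simp add: powi_minus_one)
  moreover have b: "(bas (Node g [Leaf, t]) :: tree \<Rightarrow>\<^sub>0 'a) \<in> free_cmp hq_gens (1 + leaves t) (gen_deg g + tree_deg t)"
    using assms by (intro free_cmp_single) auto
  ultimately show "op2 g x (bas t) \<in> HJ"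
    using hideal_scale[OF hideal.base[OF in_ideal.comp_right[OF b x]]] by simp
qed (intro lin_intros)

lemma HJ_op2_right:
  assumes "g \<in> hq_gens" "gen_arity g = 2" "x \<in> HJ" "tree_over hq_gens t"
  shows "op2 g (bas t) x \<in> HJ"
proof (rule hideal_linI[OF assms(3)])
  fix n d and x :: "tree \<Rightarrow>\<^sub>0 'a" assume x: "in_ideal hq_gens ncBV_relators n d x"
  have "bas (Node g [t, Leaf]) \<circ>[leaves t + 1] x = op2 g (bas t) x"
    by (rule lin_eqI) (auto intro!: lin_intros simp: op_bas tcomp_bas)
  moreover have b: "(bas (Node g [t, Leaf]) :: tree \<Rightarrow>\<^sub>0 'a) \<in> free_cmp hq_gens (leaves t + 1) (gen_deg g + tree_deg t)"
    using assms by (intro free_cmp_single) auto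
  ultimately show "op2 g (bas t) x \<in> HJ"
    using hideal.base[OF in_ideal.comp_right[OF b x, of "leaves t + 1"]] by simp
qed (intro lin_intros)

lemma HJ_op2_poly:
  assumes "g \<in> hq_gens" "gen_arity g = 2" "x \<in> HJ" "supp (tree_over hq_gens) y"
  shows "op2 g x y \<in> HJ" "op2 g y x \<in> HJ"
proof -
  have "op2 g x y = lin_ext (\<lambda>t. op2 g x (bas t)) y"
    by (rule is_lin_lin_ext[of "op2 g x"]) (rule is_lin_op(3)[OF is_lin_id])
  then show "op2 g x y \<in> HJ"
    using assms by (auto simp: supp_def intro!: hideal_lin_ext HJ_op2_left)
  have "op2 g y x = lin_ext (\<lambda>t. op2 g (bas t) x) y"
    by (rule is_lin_lin_ext[of "\<lambda>y. op2 g y x"]) (rule is_lin_op(2)[OF is_lin_id])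
  then show "op2 g y x \<in> HJ"
    using assms by (auto simp: supp_def intro!: hideal_lin_ext HJ_op2_right)
qed

lemma in_ideal_tcomp_bas:
  "\<lbrakk>in_ideal G R n d x; tree_over G t; 1 \<le> i; i \<le> n; m = n + leaves t - 1\<rbrakk> \<Longrightarrow>
    in_ideal G R m (d + tree_deg t) (x \<circ>[i] bas t)"
  by (simp add: in_ideal.comp_left[OF _ bas_free, unfolded One_nat_def])

text \<open>The trees are inserted from right to left, so that the slots 2 and 1 keep their
  numbers.\<close>

lemma relator_instance3:
  assumes "in_ideal G R 3 d r" "tree_over G a" "tree_over G b" "tree_over G c"
  shows "((r \<circ>[3] bas c) \<circ>[2] bas b) \<circ>[1] bas a \<in> hideal G R"
proof -
  have "in_ideal G R (2 + leaves c) (d + tree_deg c) (r \<circ>[3] bas c)"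
    by (rule in_ideal_tcomp_bas[OF assms(1,4)]) auto
  then have "in_ideal G R (1 + leaves b + leaves c) (d + tree_deg c + tree_deg b) ((r \<circ>[3] bas c) \<circ>[2] bas b)"
    by (rule in_ideal_tcomp_bas[OF _ assms(3)]) auto
  then have "in_ideal G R (leaves a + leaves b + leaves c) (d + tree_deg c + tree_deg b + tree_deg a) (((r \<circ>[3] bas c) \<circ>[2] bas b) \<circ>[1] bas a)"
    by (rule in_ideal_tcomp_bas[OF _ assms(2)]) auto
  then show ?thesis by (rule hideal.base)
qed

lemma relator_instance2:
  assumes "in_ideal G R 2 d r" "tree_over G a" "tree_over G b"
  shows "(r \<circ>[2] bas b) \<circ>[1] bas a \<in> hideal G R"
proof -
  have "in_ideal G R (1 + leaves b) (d + tree_deg b) (r \<circ>[2] bas b)"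
    by (rule in_ideal_tcomp_bas[OF assms(1,3)]) auto
  then have "in_ideal G R (leaves a + leaves b) (d + tree_deg b + tree_deg a) ((r \<circ>[2] bas b) \<circ>[1] bas a)"
    by (rule in_ideal_tcomp_bas[OF _ assms(2)]) auto
  then show ?thesis by (rule hideal.base)
qed

lemma hideal_scale_iff: "c \<noteq> 0 \<Longrightarrow> scale c x \<in> hideal G R \<longleftrightarrow> x \<in> hideal G R"
  using hideal_scale[of x G R c] hideal_scale[of "scale c x" G R "inverse c"] by auto

lemma powi_minus_one_nz: "(-1 :: 'k::field) powi e \<noteq> 0"
  by (simp add: powi_minus_one)

lemmas tree_comps = tcomp_def lin_ext_add lin_ext_scale is_lin_diff[OF is_lin_lin_extI]

lemma HJ_square: "tree_over hq_gens a \<Longrightarrow> bas (Node Delta [Node Delta [a]]) \<in> (HJ :: (tree \<Rightarrow>\<^sub>0 'k::field) set)"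
proof -
  assume a: "tree_over hq_gens a"
  have "in_ideal hq_gens ncBV_relators 1 2 (bas (Node Delta [Node Delta [Leaf]]) :: tree \<Rightarrow>\<^sub>0 'k)"
    by (rule in_ideal.relator[OF _ ncBV_relators_free(1)]) (simp add: ncBV_relators_eq)
  from hideal.base[OF in_ideal_tcomp_bas[OF this a, of 1 "leaves a"]]
  show ?thesis by (simp add: tree_comps)
qed

lemma HJ_assoc:
  assumes "tree_over hq_gens a" "tree_over hq_gens b" "tree_over hq_gens c"
  shows "bas (Node Prod [Node Prod [a, b], c]) - bas (Node Prod [a, Node Prod [b, c]]) \<in> (HJ :: (tree \<Rightarrow>\<^sub>0 'k::field) set)"
proof -
  let ?r = "bas (Node Prod [Node Prod [Leaf, Leaf], Leaf]) - bas (Node Prod [Leaf, Node Prod [Leaf, Leaf]]) :: tree \<Rightarrow>\<^sub>0 'k"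
  have "in_ideal hq_gens ncBV_relators 3 0 ?r"
    by (rule in_ideal.relator[OF _ ncBV_relators_free(2)]) (simp add: ncBV_relators_eq)
  from relator_instance3[OF this assms]
  \<comment> \<open>Inserting \<open>c\<close>, \<open>b\<close>, \<open>a\<close> in this order
    costs the sign of their reordering, which is common to both terms.\<close>
  have "scale ((-1) powi (tree_deg c * tree_deg b + (tree_deg b + tree_deg c) * tree_deg a))
    (bas (Node Prod [Node Prod [a, b], c]) - bas (Node Prod [a, Node Prod [b, c]])) \<in> (HJ :: (tree \<Rightarrow>\<^sub>0 'k) set)"
    by (simp add: tree_comps scale_diff_right powi_minus_one_add distrib_left distrib_right mult_ac)
  then show ?thesis by (simp only: hideal_scale_iff[OF powi_minus_one_nz])
qed

lemma HJ_Prod_Brk: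
  assumes "tree_over hq_gens a" "tree_over hq_gens b" "tree_over hq_gens c"
  shows "bas (Node Prod [Node Brk [a, b], c]) - bas (Node Brk [a, Node Prod [b, c]]) \<in> (HJ :: (tree \<Rightarrow>\<^sub>0 'k::field) set)"
proof -
  let ?r = "bas (Node Prod [Node Brk [Leaf, Leaf], Leaf]) - bas (Node Brk [Leaf, Node Prod [Leaf, Leaf]]) :: tree \<Rightarrow>\<^sub>0 'k"
  have "in_ideal hq_gens ncBV_relators 3 1 ?r"
    by (rule in_ideal.relator[OF _ ncBV_relators_free(3)]) (simp add: ncBV_relators_eq)
  from relator_instance3[OF this assms]
  have "scale ((-1) powi (tree_deg c * tree_deg b + (tree_deg b + tree_deg c) * tree_deg a))
    (bas (Node Prod [Node Brk [a, b], c]) - bas (Node Brk [a, Node Prod [b, c]])) \<in> (HJ :: (tree \<Rightarrow>\<^sub>0 'k) set)"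
    by (simp add: tree_comps scale_diff_right powi_minus_one_add distrib_left distrib_right mult_ac)
  then show ?thesis by (simp only: hideal_scale_iff[OF powi_minus_one_nz])
qed

lemma HJ_Brk:
  assumes "tree_over hq_gens a" "tree_over hq_gens b"
  shows "bas (Node Delta [Node Prod [a, b]]) - bas (Node Prod [Node Delta [a], b])
    - scale ((-1) powi tree_deg a) (bas (Node Prod [a, Node Delta [b]])) - bas (Node Brk [a, b]) \<in> (HJ :: (tree \<Rightarrow>\<^sub>0 'k::field) set)"
proof -
  let ?r = "bas (Node Delta [Node Prod [Leaf, Leaf]]) - bas (Node Prod [Node Delta [Leaf], Leaf])
     - bas (Node Prod [Leaf, Node Delta [Leaf]]) - bas (Node Brk [Leaf, Leaf]) :: tree \<Rightarrow>\<^sub>0 'k"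
  have "in_ideal hq_gens ncBV_relators 2 1 ?r"
    by (rule in_ideal.relator[OF _ ncBV_relators_free(6)]) (simp add: ncBV_relators_eq)
  from relator_instance2[OF this assms]
  \<comment> \<open>Besides the common sign, the term with \<open>\<Delta>\<close> on the second
    input acquires the sign of \<open>\<Delta>\<close> passing \<open>a\<close>.\<close>
  have "scale ((-1) powi (tree_deg b * tree_deg a)) (bas (Node Delta [Node Prod [a, b]]) - bas (Node Prod [Node Delta [a], b])
    - scale ((-1) powi tree_deg a) (bas (Node Prod [a, Node Delta [b]])) - bas (Node Brk [a, b])) \<in> (HJ :: (tree \<Rightarrow>\<^sub>0 'k) set)"
    by (simp add: tree_comps scale_diff_right powi_minus_one_add distrib_left distrib_right mult_ac)
  then show ?thesis by (simp only: hideal_scale_iff[OF powi_minus_one_nz])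
qed

section \<open>Congruence modulo the ideal and normal forms as representatives\<close>

definition cong :: "(tree \<Rightarrow>\<^sub>0 'k::field) \<Rightarrow> (tree \<Rightarrow>\<^sub>0 'k) \<Rightarrow> bool" (infix \<open>\<approx>\<close> 50)
  where "x \<approx> y \<longleftrightarrow> x - y \<in> HJ"

lemma cong_refl [simp]: "x \<approx> x"
  by (simp add: cong_def)

lemma cong_sym: "x \<approx> y \<Longrightarrow> y \<approx> x"
  unfolding cong_def using hideal_uminus by fastforce

lemma cong_trans [trans]: "x \<approx> y \<Longrightarrow> y \<approx> z \<Longrightarrow> x \<approx> z"
  unfolding cong_def using hideal.add by fastforce

lemma cong_eq_trans [trans]: "x \<approx> y \<Longrightarrow> y = z \<Longrightarrow> x \<approx> z" "x = y \<Longrightarrow> y \<approx> z \<Longrightarrow> x \<approx> z"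
  by simp_all

lemma cong_add: "x \<approx> y \<Longrightarrow> x' \<approx> y' \<Longrightarrow> x + x' \<approx> y + y'"
  unfolding cong_def using hideal.add[of "x - y" _ _ "x' - y'"] by (simp add: algebra_simps)

lemma cong_diff: "x \<approx> y \<Longrightarrow> x' \<approx> y' \<Longrightarrow> x - x' \<approx> y - y'"
  unfolding cong_def using hideal_diff[of "x - y" _ _ "x' - y'"] by (simp add: algebra_simps)

lemma cong_scale: "x \<approx> y \<Longrightarrow> scale c x \<approx> scale c y"
  unfolding cong_def using hideal_scale[of "x - y" _ _ c] by (simp add: scale_diff_right)

lemma cong_op1: "g \<in> hq_gens \<Longrightarrow> gen_arity g = 1 \<Longrightarrow> x \<approx> y \<Longrightarrow> op1 g x \<approx> op1 g y"
  unfolding cong_def using HJ_op1[of g "x - y"] by simp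

lemma cong_op2:
  assumes "g \<in> hq_gens" "gen_arity g = 2" "x \<approx> x'" "y \<approx> y'" "supp (tree_over hq_gens) y" "supp (tree_over hq_gens) x'"
  shows "op2 g x y \<approx> op2 g x' y'"
proof -
  have "op2 g x y \<approx> op2 g x' y" unfolding cong_def
    using HJ_op2_poly(1)[OF assms(1,2), of "x - x'" y] assms by (simp add: cong_def)
  also have "op2 g x' y \<approx> op2 g x' y'" unfolding cong_def
    using HJ_op2_poly(2)[OF assms(1,2), of "y - y'" x'] assms by (simp add: cong_def)
  finally show ?thesis .
qed

lemma cong_linI:
  assumes "is_lin f" "is_lin g" "supp Q x" "\<And>s. Q s \<Longrightarrow> f (bas s) \<approx> g (bas s)"
  shows "f x \<approx> g x"
proof -
  have "f x - g x = lin_ext (\<lambda>s. f (bas s) - g (bas s)) x"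
    using is_lin_lin_ext[OF is_lin_diffI[OF assms(1,2)], of x] .
  then show ?thesis unfolding cong_def
    using assms(3,4) by (auto simp: supp_def cong_def intro!: hideal_lin_ext)
qed

fun tr :: "nt \<Rightarrow> tree" where
  "tr Lf = Leaf"
| "tr (Dl w) = Node Delta [tr w]"
| "tr (Ak k w) = Node (A (Suc k)) [tr w]"
| "tr (Pr w v) = Node Prod [tr w, tr v]"

definition EM :: "(nt \<Rightarrow>\<^sub>0 'k::field) \<Rightarrow> tree \<Rightarrow>\<^sub>0 'k" where "EM = lin_ext (\<lambda>u. bas (tr u))"

lemma is_lin_EM [lin_intros, simp]: "is_lin EM" by (simp add: EM_def)

lemma is_lin_EM_comp [lin_intros]: "is_lin f \<Longrightarrow> is_lin (\<lambda>x. EM (f x))"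
  by (rule is_lin_comp) simp_all

lemmas EM_simps [simp] = is_lin_add[OF is_lin_EM] is_lin_diff[OF is_lin_EM] is_lin_minus[OF is_lin_EM]
  is_lin_zero[OF is_lin_EM] is_lin_scale[OF is_lin_EM]

lemma EM_bas: "EM (bas u) = bas (tr u)"
  by (simp add: EM_def)

lemma tr_over: "tree_over hq_gens (tr u)"
  by (induction u) (auto simp: hq_gens)

lemma leaves_tr: "leaves (tr u) = nlv u"
  by (induction u) auto

lemma tree_deg_tr: "tree_deg (tr u) = int (ndeg u)"
  by (induction u) auto

lemma supp_EM: "supp (tree_over hq_gens) (EM x)"
proof -
  have "supp (\<lambda>_. True) x" by (simp add: supp_def)
  then show ?thesis by (rule supp_linI) (auto simp: EM_bas tr_over intro: supp_bas)
qed

lemma EM_PrL: "EM (PrL w x) = op2 Prod (bas (tr w)) (EM x)"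
  by (rule lin_eqI) (auto intro!: lin_intros simp: EM_bas op_bas bas_simps)

lemma EM_AA: "EM (AA (Suc k) x) = op1 (A (Suc k)) (EM x)"
  by (rule lin_eqI) (auto intro!: lin_intros simp: EM_bas op_bas bas_simps)

lemma supp_True: "supp (\<lambda>_. True) x"
  by (simp add: supp_def)

lemma EM_DD: "op1 Delta (EM x) \<approx> EM (DD x)"
proof (rule cong_linI[of "\<lambda>x. op1 Delta (EM x)" "\<lambda>x. EM (DD x)", OF _ _ supp_True])
  fix s show "op1 Delta (EM (bas s)) \<approx> EM (DD (bas s) :: nt \<Rightarrow>\<^sub>0 'a)"
    by (cases s) (simp_all add: EM_bas op_bas bas_simps HJ_square tr_over cong_def)
qed (intro lin_intros)+

text \<open>The compatibility of the bracket with the product, in which both brackets are replaced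
  by commutators of \<open>\<Delta>\<close> with the product; associativity then cancels the terms
  containing \<open>\<Delta> a\<close>.\<close>

lemma cong_b3:
  assumes "tree_over hq_gens a" "tree_over hq_gens b" "tree_over hq_gens c"
  shows "bas (Node Prod [Node Delta [Node Prod [a, b]], c]) \<approx>
    bas (Node Delta [Node Prod [a, Node Prod [b, c]]])
    - scale ((-1) powi tree_deg a) (bas (Node Prod [a, Node Delta [Node Prod [b, c]]]))
    + scale ((-1) powi tree_deg a) (bas (Node Prod [a, Node Prod [Node Delta [b], c]]) :: tree \<Rightarrow>\<^sub>0 'k::field)"
proof -
  let ?e = "(-1 :: 'k) powi tree_deg a"
  note o = hq_gens tree_over.simps assms
  have 1: "op2 Prod (bas (Node Delta [Node Prod [a, b]]) - bas (Node Prod [Node Delta [a], b])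
    - scale ?e (bas (Node Prod [a, Node Delta [b]])) - bas (Node Brk [a, b])) (bas c) \<in> HJ"
    by (rule HJ_op2_left[OF _ _ HJ_Brk]) (use o in auto)
  have 2: "bas (Node Delta [Node Prod [a, Node Prod [b, c]]]) - bas (Node Prod [Node Delta [a], Node Prod [b, c]])
    - scale ?e (bas (Node Prod [a, Node Delta [Node Prod [b, c]]])) - bas (Node Brk [a, Node Prod [b, c]]) \<in> HJ"
    by (rule HJ_Brk) (use o in auto)
  have 3: "bas (Node Prod [Node Brk [a, b], c]) - bas (Node Brk [a, Node Prod [b, c]]) \<in> (HJ :: (tree \<Rightarrow>\<^sub>0 'k) set)"
    by (rule HJ_Prod_Brk) (use o in auto)
  have 4: "bas (Node Prod [Node Prod [Node Delta [a], b], c]) - bas (Node Prod [Node Delta [a], Node Prod [b, c]]) \<in> (HJ :: (tree \<Rightarrow>\<^sub>0 'k) set)"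
    by (rule HJ_assoc) (use o in auto)
  have 5: "scale ?e (bas (Node Prod [Node Prod [a, Node Delta [b]], c]) - bas (Node Prod [a, Node Prod [Node Delta [b], c]])) \<in> HJ"
    by (rule hideal_scale, rule HJ_assoc) (use o in auto)
  show ?thesis unfolding cong_def
    using hideal_diff[OF hideal.add[OF hideal.add[OF hideal.add[OF 1 3] 4] 5] 2]
    by (simp add: op_bas scale_diff_right algebra_simps del: scale_single)
qed

text \<open>The induction mirrors the recursion of \<open>mulb\<close>: every clause is one
  application of a rewrite rule, followed by the induction hypothesis in the context of a product or
  of \<open>\<Delta>\<close>.\<close>

lemma cong_mulb: "op2 Prod (bas (tr s)) (bas (tr t)) \<approx> (EM (mulb s t) :: tree \<Rightarrow>\<^sub>0 'k::field)"
proof (induction "size s" arbitrary: s rule: less_induct)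
  case less
  have Pr_ctx: "op2 Prod (bas (tr w)) x \<approx> op2 Prod (bas (tr w)) y"
    if "x \<approx> y" "supp (tree_over hq_gens) x" for w and x y :: "tree \<Rightarrow>\<^sub>0 'k"
    by (rule cong_op2) (use that hq_gens tr_over in \<open>auto intro: supp_bas\<close>)
  have D_ctx: "op1 Delta x \<approx> op1 Delta y" if "x \<approx> y" for x y :: "tree \<Rightarrow>\<^sub>0 'k"
    by (rule cong_op1) (use that hq_gens in auto)
  show ?case
  proof (cases s rule: nt_left_cases)
    case irr
    then show ?thesis by (simp add: mulb_irreducible EM_bas op_bas)
  next
    case (Pr w v)
    have "op2 Prod (bas (tr s)) (bas (tr t)) \<approx> op2 Prod (bas (tr w)) (op2 Prod (bas (tr v)) (bas (tr t)) :: tree \<Rightarrow>\<^sub>0 'k)"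
      using HJ_assoc[of "tr w" "tr v" "tr t"] by (simp add: Pr op_bas cong_def tr_over)
    also have "\<dots> \<approx> op2 Prod (bas (tr w)) (EM (mulb v t))"
      by (rule Pr_ctx) (use less[of v] Pr tr_over[of "Pr v t"] in \<open>auto simp: op_bas intro!: supp_bas\<close>)
    finally show ?thesis by (simp add: Pr EM_PrL)
  next
    case (DlPr w v)
    let ?e = "(-1 :: 'k) powi int (ndeg w)"
    have IH: "op2 Prod (bas (tr v)) (bas (tr t)) \<approx> (EM (mulb v t) :: tree \<Rightarrow>\<^sub>0 'k)" using less[of v] DlPr by simp
    have IH2: "bas (Node Prod [Node Delta [tr v], tr t]) \<approx> (EM (if is_Dl v then 0 else mulb (Dl v) t) :: tree \<Rightarrow>\<^sub>0 'k)"
    proof (cases "is_Dl v")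
      case True
      then obtain u where "v = Dl u" by (cases v) auto
      then show ?thesis
        using HJ_op2_left[OF _ _ HJ_square[of "tr u"], of Prod "tr t"] by (simp add: op_bas cong_def hq_gens tr_over)
    next
      case False
      then show ?thesis using less[of "Dl v"] DlPr by (simp add: op_bas)
    qed
    have "op2 Prod (bas (tr s)) (bas (tr t)) \<approx> op1 Delta (op2 Prod (bas (tr w)) (bas (Node Prod [tr v, tr t])))
      - scale ?e (op2 Prod (bas (tr w)) (op1 Delta (bas (Node Prod [tr v, tr t]))))
      + scale ?e (op2 Prod (bas (tr w)) (bas (Node Prod [Node Delta [tr v], tr t])))"
      using cong_b3[of "tr w" "tr v" "tr t"] by (simp add: DlPr op_bas tr_over tree_deg_tr del: scale_single)
    also have "\<dots> \<approx> EM (DD (PrL w (mulb v t :: nt \<Rightarrow>\<^sub>0 'k))) - scale ?e (EM (PrL w (DD (mulb v t :: nt \<Rightarrow>\<^sub>0 'k))))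
      + scale ?e (EM (PrL w (if is_Dl v then 0 else mulb (Dl v) t :: nt \<Rightarrow>\<^sub>0 'k)))"
    proof (intro cong_add cong_diff cong_scale)
      have "op1 Delta (op2 Prod (bas (tr w)) (bas (Node Prod [tr v, tr t]))) \<approx> op1 Delta (op2 Prod (bas (tr w)) (EM (mulb v t :: nt \<Rightarrow>\<^sub>0 'k)))"
        by (intro D_ctx Pr_ctx) (use IH tr_over[of "Pr v t"] in \<open>auto simp: op_bas intro!: supp_bas\<close>)
      also have "\<dots> \<approx> EM (DD (PrL w (mulb v t :: nt \<Rightarrow>\<^sub>0 'k)))" unfolding EM_PrL[symmetric] by (rule EM_DD)
      finally show "op1 Delta (op2 Prod (bas (tr w)) (bas (Node Prod [tr v, tr t]))) \<approx> EM (DD (PrL w (mulb v t :: nt \<Rightarrow>\<^sub>0 'k)))" .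
      have "op1 Delta (bas (Node Prod [tr v, tr t])) \<approx> op1 Delta (EM (mulb v t :: nt \<Rightarrow>\<^sub>0 'k))"
        by (rule D_ctx) (use IH in \<open>simp add: op_bas\<close>)
      also have "\<dots> \<approx> EM (DD (mulb v t :: nt \<Rightarrow>\<^sub>0 'k))" by (rule EM_DD)
      finally show "op2 Prod (bas (tr w)) (op1 Delta (bas (Node Prod [tr v, tr t]))) \<approx> EM (PrL w (DD (mulb v t :: nt \<Rightarrow>\<^sub>0 'k)))"
        unfolding EM_PrL by (rule Pr_ctx) (use tr_over[of "Dl (Pr v t)"] in \<open>auto simp: op_bas intro!: supp_bas\<close>)
      show "op2 Prod (bas (tr w)) (bas (Node Prod [Node Delta [tr v], tr t])) \<approx> EM (PrL w (if is_Dl v then 0 else mulb (Dl v) t :: nt \<Rightarrow>\<^sub>0 'k))"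
        unfolding EM_PrL by (rule Pr_ctx[OF IH2]) (use tr_over[of "Pr (Dl v) t"] in \<open>auto intro!: supp_bas\<close>)
    qed
    also have "\<dots> = EM (mulb s t)" by (simp add: DlPr sg_def power_int_def)
    finally show ?thesis .
  qed
qed

lemma EM_mm: "op2 Prod (EM x) (EM y) \<approx> EM (mm x y)"
proof (rule cong_linI[OF _ _ supp_True, of "\<lambda>x. op2 Prod (EM x) (EM y)" "\<lambda>x. EM (mm x y)"])
  fix s show "op2 Prod (EM (bas s)) (EM y) \<approx> EM (mm (bas s) y)"
    by (rule cong_linI[OF _ _ supp_True]) (auto intro!: lin_intros simp: EM_bas bas_simps cong_mulb)
qed (intro lin_intros)+

lemma cong_op_Brk:
  assumes "x \<in> free_cmp hq_gens n d" "supp (tree_over hq_gens) y"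
  shows "op2 Brk x y \<approx> op1 Delta (op2 Prod x y) - op2 Prod (op1 Delta x) y - scale ((-1) powi d) (op2 Prod x (op1 Delta y))"
proof (rule cong_linI[where Q = "\<lambda>s. tree_over hq_gens s \<and> tree_deg s = d" and x = x])
  fix s assume s: "tree_over hq_gens s \<and> tree_deg s = d"
  show "op2 Brk (bas s) y \<approx> op1 Delta (op2 Prod (bas s) y) - op2 Prod (op1 Delta (bas s)) y - scale ((-1) powi d) (op2 Prod (bas s) (op1 Delta y))"
  proof (rule cong_linI[OF _ _ assms(2)])
    fix t assume "tree_over hq_gens t"
    then show "op2 Brk (bas s) (bas t) \<approx> op1 Delta (op2 Prod (bas s) (bas t)) - op2 Prod (op1 Delta (bas s)) (bas t) - scale ((-1) powi d) (op2 Prod (bas s) (op1 Delta (bas t)))"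
      using cong_sym[of _ "bas (Node Brk [s, t])"] HJ_Brk[of s t] s by (simp add: op_bas cong_def del: scale_single)
  qed (intro lin_intros)+
qed (use assms(1) in \<open>auto intro!: lin_intros simp: supp_def free_cmp_def\<close>)

lemma hq_tree_induct [consumes 1, case_names Leaf Prod Brk Delta A]:
  assumes "tree_over hq_gens t"
    and "P Leaf" "\<And>s t. \<lbrakk>tree_over hq_gens s; tree_over hq_gens t; P s; P t\<rbrakk> \<Longrightarrow> P (Node Prod [s, t])"
    "\<And>s t. \<lbrakk>tree_over hq_gens s; tree_over hq_gens t; P s; P t\<rbrakk> \<Longrightarrow> P (Node Brk [s, t])"
    "\<And>s. \<lbrakk>tree_over hq_gens s; P s\<rbrakk> \<Longrightarrow> P (Node Delta [s])"
    "\<And>s k. \<lbrakk>tree_over hq_gens s; P s\<rbrakk> \<Longrightarrow> P (Node (A (Suc k)) [s])"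
  shows "P t"
  using assms(1)
proof (induction t)
  case (Node g ts)
  then have g: "g \<in> hq_gens" "length ts = gen_arity g" by auto
  from g(1) show ?case
    by (cases g rule: hq_gens_cases) (use g(2) Node assms in \<open>auto simp: length_Suc_conv numeral_2_eq_2\<close>)
qed (rule assms)

lemma nf_gr:
  assumes "tree_over hq_gens t"
  shows "\<exists>d. tree_deg t = int d \<and> supp (gr (leaves t) d) (nf t :: nt \<Rightarrow>\<^sub>0 'k::field) \<and> supp nrm (nf t :: nt \<Rightarrow>\<^sub>0 'k)"
  using assms
proof (induction rule: hq_tree_induct)
  case Leaf
  then show ?case by (auto simp: nf_simps gr_def intro!: supp_bas)
next
  case (Prod s t)
  then obtain d e where "tree_deg s = int d" "supp (gr (leaves s) d) (nf s :: nt \<Rightarrow>\<^sub>0 'k)" "supp nrm (nf s :: nt \<Rightarrow>\<^sub>0 'k)"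
    "tree_deg t = int e" "supp (gr (leaves t) e) (nf t :: nt \<Rightarrow>\<^sub>0 'k)" "supp nrm (nf t :: nt \<Rightarrow>\<^sub>0 'k)" by blast
  then show ?case by (intro exI[of _ "d + e"]) (simp add: nf_simps gop2_def supp_gr_mm supp_nrm_mm)
next
  case (Brk s t)
  then obtain d e where "tree_deg s = int d" "supp (gr (leaves s) d) (nf s :: nt \<Rightarrow>\<^sub>0 'k)" "supp nrm (nf s :: nt \<Rightarrow>\<^sub>0 'k)"
    "tree_deg t = int e" "supp (gr (leaves t) e) (nf t :: nt \<Rightarrow>\<^sub>0 'k)" "supp nrm (nf t :: nt \<Rightarrow>\<^sub>0 'k)" by blast
  then show ?case by (intro exI[of _ "Suc (d + e)"]) (simp add: nf_simps gop2_def supp_gr_BB supp_nrm_BB)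
next
  case (Delta s)
  then obtain d where "tree_deg s = int d" "supp (gr (leaves s) d) (nf s :: nt \<Rightarrow>\<^sub>0 'k)" "supp nrm (nf s :: nt \<Rightarrow>\<^sub>0 'k)" by blast
  then show ?case by (intro exI[of _ "Suc d"]) (simp add: nf_simps gop1_def supp_gr_DD supp_nrm_DD)
next
  case (A s k)
  then obtain d where "tree_deg s = int d" "supp (gr (leaves s) d) (nf s :: nt \<Rightarrow>\<^sub>0 'k)" "supp nrm (nf s :: nt \<Rightarrow>\<^sub>0 'k)" by blast
  then show ?case using supp_gr_AA[of "leaves s" d "nf s" "Suc k"]
    by (intro exI[of _ "2 * Suc k + d"]) (simp add: nf_simps gop1_def supp_nrm_AA)
qed

lemma cong_nf:
  assumes "tree_over hq_gens t"
  shows "bas t \<approx> (EM (nf t) :: tree \<Rightarrow>\<^sub>0 'k::field)"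
  using assms
proof (induction rule: hq_tree_induct)
  case Leaf
  then show ?case by (simp add: nf_simps EM_bas)
next
  case (Prod s t)
  have "bas (Node Prod [s, t]) = op2 Prod (bas s) (bas t :: tree \<Rightarrow>\<^sub>0 'k)" by (simp add: op_bas)
  also have "\<dots> \<approx> op2 Prod (EM (nf s)) (EM (nf t))"
    by (rule cong_op2) (use Prod hq_gens in \<open>auto intro: supp_EM supp_bas\<close>)
  also have "\<dots> \<approx> EM (mm (nf s) (nf t))" by (rule EM_mm)
  finally show ?case by (simp add: nf_simps gop2_def)
next
  case (Brk s t)
  let ?x = "EM (nf s) :: tree \<Rightarrow>\<^sub>0 'k" and ?y = "EM (nf t) :: tree \<Rightarrow>\<^sub>0 'k"
  obtain d where d: "tree_deg s = int d" "supp (gr (leaves s) d) (nf s :: nt \<Rightarrow>\<^sub>0 'k)"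
    using nf_gr[OF Brk(1)] by blast
  have "?x \<in> free_cmp hq_gens (leaves s) (int d)"
    using supp_linI[OF d(2) is_lin_EM, of "\<lambda>t. tree_over hq_gens t \<and> leaves t = leaves s \<and> tree_deg t = int d"]
    by (auto simp: EM_bas gr_def tr_over leaves_tr tree_deg_tr supp_def free_cmp_def)
  note b = cong_op_Brk[OF this supp_EM, of "nf t"]
  have PP: "PP (nf s) = scale ((-1) powi int d) (nf s :: nt \<Rightarrow>\<^sub>0 'k)"
    using PP_gr[OF d(2)] by simp
  have "bas (Node Brk [s, t]) = op2 Brk (bas s) (bas t :: tree \<Rightarrow>\<^sub>0 'k)" by (simp add: op_bas)
  also have "\<dots> \<approx> op2 Brk ?x ?y"
    by (rule cong_op2) (use Brk hq_gens in \<open>auto intro: supp_EM supp_bas\<close>)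
  also have "\<dots> \<approx> op1 Delta (op2 Prod ?x ?y) - op2 Prod (op1 Delta ?x) ?y - scale ((-1) powi int d) (op2 Prod ?x (op1 Delta ?y))"
    by (rule b)
  also have "\<dots> \<approx> EM (DD (mm (nf s) (nf t))) - EM (mm (DD (nf s)) (nf t)) - scale ((-1) powi int d) (EM (mm (nf s) (DD (nf t))))"
  proof (intro cong_diff cong_scale)
    have "op1 Delta (op2 Prod ?x ?y) \<approx> op1 Delta (EM (mm (nf s) (nf t)))"
      by (rule cong_op1[OF _ _ EM_mm]) (auto simp: hq_gens)
    also have "\<dots> \<approx> EM (DD (mm (nf s) (nf t)))" by (rule EM_DD)
    finally show "op1 Delta (op2 Prod ?x ?y) \<approx> EM (DD (mm (nf s) (nf t)))" .
    have "op2 Prod (op1 Delta ?x) ?y \<approx> op2 Prod (EM (DD (nf s))) ?y"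
      by (rule cong_op2[OF _ _ EM_DD]) (auto simp: hq_gens supp_EM)
    also have "\<dots> \<approx> EM (mm (DD (nf s)) (nf t))" by (rule EM_mm)
    finally show "op2 Prod (op1 Delta ?x) ?y \<approx> EM (mm (DD (nf s)) (nf t))" .
    have "op2 Prod ?x (op1 Delta ?y) \<approx> op2 Prod ?x (EM (DD (nf t)))"
    proof (rule cong_op2[OF _ _ cong_refl EM_DD])
      show "supp (tree_over hq_gens) (op1 Delta ?y)"
        by (rule supp_linI[OF supp_EM]) (auto intro!: lin_intros supp_bas simp: op_bas hq_gens)
    qed (auto simp: hq_gens supp_EM)
    also have "\<dots> \<approx> EM (mm (nf s) (DD (nf t)))" by (rule EM_mm)
    finally show "op2 Prod ?x (op1 Delta ?y) \<approx> EM (mm (nf s) (DD (nf t)))" .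
  qed
  also have "\<dots> = EM (nf (Node Brk [s, t]))" by (simp add: nf_simps gop2_def BB_def PP)
  finally show ?case .
next
  case (Delta s)
  have "bas (Node Delta [s]) = op1 Delta (bas s :: tree \<Rightarrow>\<^sub>0 'k)" by (simp add: op_bas)
  also have "\<dots> \<approx> op1 Delta (EM (nf s))" by (rule cong_op1[OF _ _ Delta(2)]) (auto simp: hq_gens)
  also have "\<dots> \<approx> EM (DD (nf s))" by (rule EM_DD)
  finally show ?case by (simp add: nf_simps gop1_def)
next
  case (A s k)
  have "bas (Node (A (Suc k)) [s]) = op1 (A (Suc k)) (bas s :: tree \<Rightarrow>\<^sub>0 'k)" by (simp add: op_bas)
  also have "\<dots> \<approx> op1 (A (Suc k)) (EM (nf s))" by (rule cong_op1[OF _ _ A(2)]) (auto simp: hq_gens)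
  finally show ?case by (simp add: nf_simps gop1_def EM_AA)
qed

lemma supp_free: "x \<in> free_cmp G n d \<Longrightarrow> supp (tree_over G) x"
  by (simp add: supp_def free_cmp_def)

lemma cong_NF: "x \<in> free_cmp hq_gens n d \<Longrightarrow> x \<approx> EM (NF x)"
  by (rule cong_linI[OF _ _ supp_free]) (auto intro!: lin_intros simp: cong_nf)

text \<open>The solution of the word problem: evaluation respects the relations, so
  \<open>NF\<close> kills the ideal, and conversely every element is congruent to its normal form.
  Together with \<open>nf_tr\<close> this makes the normal monomials a basis of the
  quotient.\<close>

theorem in_ideal_iff_NF:
  assumes "x \<in> free_cmp hq_gens n d"
  shows "in_ideal hq_gens ncBV_relators n d x \<longleftrightarrow> NF x = 0"
  using NF_ideal[of n d x] cong_NF[OF assms] hideal_in_ideal[OF _ assms] by (auto simp: cong_def)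

lemma nf_tr: "nrm u \<Longrightarrow> nf (tr u) = bas u"
proof (induction u)
  case (Dl w)
  then show ?case by (cases w) (auto simp: nf_simps gop1_def bas_simps)
qed (auto simp: nf_simps gop1_def gop2_def bas_simps mulb_irreducible)

lemma NF_EM: "supp nrm x \<Longrightarrow> NF (EM x) = x"
  by (rule supp_eqI[of nrm x "\<lambda>x. NF (EM x)" "\<lambda>x. x"]) (auto intro!: lin_intros is_lin_comp[OF is_lin_NF] simp: EM_bas nf_tr)

lemma EM_free: "supp (gr n d) x \<Longrightarrow> EM x \<in> free_cmp hq_gens n (int d)"
  using supp_linI[of "gr n d" x EM "\<lambda>t. tree_over hq_gens t \<and> leaves t = n \<and> tree_deg t = int d"]
  by (auto simp: EM_bas gr_def tr_over leaves_tr tree_deg_tr supp_def free_cmp_def)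

lemma NF_gr: "x \<in> free_cmp hq_gens n (int d) \<Longrightarrow> supp (\<lambda>u. gr n d u \<and> nrm u) (NF x)"
proof (rule supp_linI[where Q = "\<lambda>t. tree_over hq_gens t \<and> leaves t = n \<and> tree_deg t = int d"])
  fix t assume "tree_over hq_gens t \<and> leaves t = n \<and> tree_deg t = int d"
  then show "supp (\<lambda>u. gr n d u \<and> nrm u) (NF (bas t))"
    using nf_gr[of t] by (auto simp: supp_def)
qed (auto simp: supp_def free_cmp_def)

section \<open>The operations of ncHyperCom on the homotopy quotient\<close>

text \<open>
  Written for a single argument \<open>t\<close>, the recursion defines series \<open>L\<close>, \<open>\<theta>\<close>, \<open>u = 1 / (1 - \<theta>)\<close>
  and \<open>E\<^sub>j = L (u L)\<^sup>j\<close> by the equations \<open>\<Sum>\<^sub>j a\<^sub>j E\<^sub>j = t\<close> and \<open>\<theta> = \<Sum>\<^sub>j a\<^sub>j\<^sub>+\<^sub>1 E\<^sub>j\<close>, and the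
  operation \<open>\<nu>\<close> is \<open>\<Sum>\<^sub>j a\<^sub>j\<^sub>-\<^sub>1 E\<^sub>j\<close>. Here the arguments are kept apart in a list; \<open>EE j\<close> is
  \<open>E\<^sub>j\<close> and \<open>GG j\<close> is \<open>(u L)\<^sup>j\<^sup>+\<^sup>1\<close>.
\<close>

function EE GG :: "('v \<Rightarrow> 'v \<Rightarrow> 'v::ab_group_add) \<Rightarrow> (nat \<Rightarrow> 'v \<Rightarrow> 'v) \<Rightarrow> nat \<Rightarrow> 'v list \<Rightarrow> 'v" where
  "EE mul a 0 vs = (if length vs = 1 then hd vs else 0) - (\<Sum>l\<in>{1..<length vs}. a l (EE mul a l vs))"
| "EE mul a (Suc j) vs = (\<Sum>i\<in>{1..<length vs}. mul (EE mul a 0 (take i vs)) (GG mul a j (drop i vs)))"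
| "GG mul a j vs = EE mul a j vs +
    (\<Sum>i\<in>{1..<length vs}. mul (\<Sum>l<i. a (Suc l) (EE mul a l (take i vs))) (GG mul a j (drop i vs)))"
  by pat_completeness auto
termination
  \<comment> \<open>Calls on a proper sublist decrease the length. On the whole list,
    \<open>GG\<close> calls only \<open>EE\<close>, and \<open>EE\<close> at index 0 calls
    \<open>EE\<close> at positive indices only.\<close>
  by (relation "measures [\<lambda>x. case x of Inl (_, _, _, vs) \<Rightarrow> length vs | Inr (_, _, _, vs) \<Rightarrow> length vs,
      \<lambda>x. case x of Inl (_, _, j, _) \<Rightarrow> if j = 0 then 1 else 0 | Inr _ \<Rightarrow> 2]") auto

declare EE.simps [simp del] GG.simps [simp del]

definition NN :: "('v \<Rightarrow> 'v \<Rightarrow> 'v::ab_group_add) \<Rightarrow> (nat \<Rightarrow> 'v \<Rightarrow> 'v) \<Rightarrow> 'v list \<Rightarrow> 'v"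
  where "NN mul a vs = (\<Sum>l\<in>{1..<length vs}. a (l - 1) (EE mul a l vs))"

section \<open>The recursion over an abelian group\<close>

lemma sum_shift:
  fixes f :: "nat \<Rightarrow> 'v::ab_group_add"
  shows "0 < M \<Longrightarrow> (\<Sum>l<M. f l) = f 0 + (\<Sum>l\<in>{1..<M}. f l)"
  by (simp add: lessThan_atLeast0 sum.atLeast_Suc_lessThan)

text \<open>Associativity is split off because the recursion is run twice: on trees, where the
  product of the free operad is not associative, and on normal forms, where it is.\<close>

locale additive_ops =
  fixes mul :: "'v \<Rightarrow> 'v \<Rightarrow> 'v::ab_group_add" and a :: "nat \<Rightarrow> 'v \<Rightarrow> 'v"
  assumes mul_add_left: "mul (x + y) z = mul x z + mul y z"
    and mul_add_right: "mul x (y + z) = mul x y + mul x z"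
    and a_add: "a k (x + y) = a k x + a k y"
    and a_0: "a 0 x = x"
begin

lemma mul_zero [simp]: "mul 0 x = 0" "mul x 0 = 0"
  using mul_add_left[of 0 0 x] mul_add_right[of x 0 0] by simp_all

lemma mul_uminus: "mul (- x) y = - mul x y" "mul x (- y) = - mul x y"
  using mul_add_left[of x "- x" y] mul_add_right[of x y "- y"] by (simp_all add: eq_neg_iff_add_eq_0 add.commute)

lemma mul_diff: "mul (x - y) z = mul x z - mul y z" "mul x (y - z) = mul x y - mul x z"
  using mul_add_left[of x "- y" z] mul_add_right[of x y "- z"] by (simp_all add: mul_uminus)

lemma mul_sum: "mul (sum f S) y = (\<Sum>i\<in>S. mul (f i) y)" "mul y (sum f S) = (\<Sum>i\<in>S. mul y (f i))"
  by (induction S rule: infinite_finite_induct) (simp_all add: mul_add_left mul_add_right)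

lemma a_zero [simp]: "a k 0 = 0"
  using a_add[of k 0 0] by simp

lemma a_uminus: "a k (- x) = - a k x"
  using a_add[of k x "- x"] by (simp add: eq_neg_iff_add_eq_0 add.commute)

lemma a_diff: "a k (x - y) = a k x - a k y"
  using a_add[of k x "- y"] by (simp add: a_uminus)

lemma a_sum: "a k (sum f S) = (\<Sum>i\<in>S. a k (f i))"
  by (induction S rule: infinite_finite_induct) (simp_all add: a_add)

abbreviation E where "E \<equiv> EE mul a"
abbreviation G where "G \<equiv> GG mul a"
abbreviation N where "N \<equiv> NN mul a"

definition tt :: "'v list \<Rightarrow> 'v" where "tt vs = (if length vs = 1 then hd vs else 0)"

definition TH :: "'v list \<Rightarrow> 'v" where "TH vs = (\<Sum>l<length vs. a (Suc l) (E l vs))"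

definition conv :: "('v list \<Rightarrow> 'v) \<Rightarrow> ('v list \<Rightarrow> 'v) \<Rightarrow> 'v list \<Rightarrow> 'v"
  where "conv f g vs = (\<Sum>i\<in>{1..<length vs}. mul (f (take i vs)) (g (drop i vs)))"

lemma E_Suc: "E (Suc j) vs = conv (E 0) (G j) vs"
  by (simp add: EE.simps(2) conv_def)

lemma G_eq: "G j vs = E j vs + conv TH (G j) vs"
  unfolding GG.simps[of mul a j vs] conv_def TH_def by (auto intro!: sum.cong)

lemma E_Nil [simp]: "E 0 [] = 0"
  by (subst EE.simps(1)) simp

text \<open>Every unit of the index splits off at least one argument, so \<open>E_j\<close> and
  \<open>G_j\<close> need more than \<open>j\<close> arguments. All sums over the index may
  therefore be cut off at any large bound.\<close>

lemma vanish: "length vs \<le> j \<Longrightarrow> E j vs = 0 \<and> G j vs = 0"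
proof (induction j arbitrary: vs)
  case 0
  have "G 0 [] = 0" by (subst GG.simps) simp
  then show ?case using 0 by simp
next
  case (Suc j)
  have E: "E (Suc j) vs = 0" if "length vs \<le> Suc j" for vs
    unfolding E_Suc conv_def using Suc.IH that by (intro sum.neutral) auto
  have "G (Suc j) vs = 0" if "length vs \<le> Suc j" for vs
    using that
  proof (induction "length vs" arbitrary: vs rule: less_induct)
    case less
    then show ?case unfolding G_eq[of _ vs] conv_def by (auto simp: E intro!: sum.neutral)
  qed
  then show ?case using E Suc.prems by blast
qed

lemma E_vanish: "length vs \<le> j \<Longrightarrow> E j vs = 0"
  using vanish by blast

lemma sum_a_E: "length vs \<le> M \<Longrightarrow> (\<Sum>l<M. a l (E l vs)) = tt vs"
proof -
  assume M: "length vs \<le> M"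
  have "(\<Sum>l<M. a l (E l vs)) = (\<Sum>l<length vs. a l (E l vs))"
    by (rule sum.mono_neutral_right) (use M in \<open>auto simp: E_vanish\<close>)
  also have "\<dots> = tt vs"
  proof (cases "length vs")
    case (Suc n)
    then have "(\<Sum>l<length vs. a l (E l vs)) = E 0 vs + (\<Sum>l\<in>{1..<length vs}. a l (E l vs))"
      using sum_shift[of "length vs" "\<lambda>l. a l (E l vs)"] by (simp add: a_0)
    then show ?thesis by (simp add: EE.simps(1)[of mul a vs] tt_def)
  qed (simp add: tt_def)
  finally show ?thesis .
qed

lemma E_0: "length vs \<le> M \<Longrightarrow> E 0 vs = tt vs - (\<Sum>l\<in>{1..<M}. a l (E l vs))"
proof (cases M)
  case (Suc m)
  assume "length vs \<le> M"
  then have "tt vs = E 0 vs + (\<Sum>l\<in>{1..<M}. a l (E l vs))"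
    using sum_a_E[of vs M] Suc sum_shift[of M "\<lambda>l. a l (E l vs)"] by (simp add: a_0)
  then show ?thesis by simp
qed (simp add: tt_def)

lemma TH_eq: "length vs \<le> M \<Longrightarrow> TH vs = (\<Sum>l<M. a (Suc l) (E l vs))"
  unfolding TH_def by (rule sum.mono_neutral_left) (auto simp: E_vanish)

lemma N_eq: "length vs \<le> Suc M \<Longrightarrow> N vs = (\<Sum>l<M. a l (E (Suc l) vs))"
proof -
  assume M: "length vs \<le> Suc M"
  have "N vs = (\<Sum>l\<in>{1..<Suc M}. a (l - 1) (E l vs))"
    unfolding NN_def by (rule sum.mono_neutral_left) (use M in \<open>auto simp: E_vanish\<close>)
  also have "\<dots> = (\<Sum>l<M. a l (E (Suc l) vs))"
    by (rule sum.reindex_bij_witness[of _ Suc "\<lambda>l. l - 1"]) auto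
  finally show ?thesis .
qed

lemma N_single [simp]: "N [y] = 0"
  by (simp add: NN_def)

lemma E_single: "E j [y] = (if j = 0 then y else 0)"
  by (cases j) (simp_all add: EE.simps(1,2)[where vs = "[y]"])

lemma G_single: "G j [y] = (if j = 0 then y else 0)"
  by (subst G_eq) (simp add: conv_def E_single)

lemma conv_add_left: "conv (\<lambda>vs. f vs + f' vs) g vs = conv f g vs + conv f' g vs"
  by (simp add: conv_def mul_add_left sum.distrib)

lemma conv_cong:
  assumes "\<And>vs'. length vs' < length vs \<Longrightarrow> f vs' = f' vs'" "\<And>vs'. length vs' < length vs \<Longrightarrow> g vs' = g' vs'"
  shows "conv f g vs = conv f' g' vs"
  unfolding conv_def by (rule sum.cong) (use assms in auto)

lemma sum_triangle:
  fixes h :: "nat \<Rightarrow> nat \<Rightarrow> 'v" and n :: nat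
  shows "(\<Sum>k<n. \<Sum>i\<in>{1..k}. h i (k - i)) = (\<Sum>i\<in>{1..n}. \<Sum>k<n - i. h i k)"
proof -
  have "(\<Sum>k<n. \<Sum>i\<in>{1..k}. h i (k - i)) = (\<Sum>(k, i)\<in>Sigma {..<n} (\<lambda>k. {1..k}). h i (k - i))"
    by (subst sum.Sigma) auto
  also have "\<dots> = (\<Sum>(i, k)\<in>Sigma {1..n} (\<lambda>i. {..<n - i}). h i k)"
    by (rule sum.reindex_bij_witness[of _ "\<lambda>(i, k). (i + k, i)" "\<lambda>(k, i). (i, k - i)"]) auto
  also have "\<dots> = (\<Sum>i\<in>{1..n}. \<Sum>k<n - i. h i k)"
    by (subst sum.Sigma) auto
  finally show ?thesis .
qed

text \<open>A cut either leaves the marked argument \<open>z\<close> in the second block or puts it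
  into the first.\<close>

lemma conv_marked:
  "conv f g (U @ [z] @ V) = (\<Sum>i\<in>{1..length U}. mul (f (take i U)) (g (drop i U @ [z] @ V)))
    + (\<Sum>i<length V. mul (f (U @ [z] @ take i V)) (g (drop i V)))"
proof -
  have "{1..<length (U @ [z] @ V)} = {1..length U} \<union> {length U + 1..<length U + 1 + length V}" by auto
  then have "conv f g (U @ [z] @ V) =
    (\<Sum>i\<in>{1..length U}. mul (f (take i (U @ [z] @ V))) (g (drop i (U @ [z] @ V))))
    + (\<Sum>i\<in>{length U + 1..<length U + 1 + length V}. mul (f (take i (U @ [z] @ V))) (g (drop i (U @ [z] @ V))))"
    unfolding conv_def by (simp only:) (rule sum.union_disjoint; auto)
  also have "(\<Sum>i\<in>{1..length U}. mul (f (take i (U @ [z] @ V))) (g (drop i (U @ [z] @ V))))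
    = (\<Sum>i\<in>{1..length U}. mul (f (take i U)) (g (drop i U @ [z] @ V)))"
    by (rule sum.cong) auto
  also have "(\<Sum>i\<in>{length U + 1..<length U + 1 + length V}. mul (f (take i (U @ [z] @ V))) (g (drop i (U @ [z] @ V))))
    = (\<Sum>i<length V. mul (f (U @ [z] @ take i V)) (g (drop i V)))"
    by (rule sum.reindex_bij_witness[of _ "\<lambda>i. length U + 1 + i" "\<lambda>i. i - (length U + 1)"])
      (auto simp: take_Cons' drop_Cons')
  finally show ?thesis .
qed

end

section \<open>Associative products and the quadratic relations of \<open>\<nu>\<close>\<close>

locale assoc_ops = additive_ops mul a for mul :: "'v \<Rightarrow> 'v \<Rightarrow> 'v::ab_group_add" and a +
  assumes mul_assoc: "mul (mul x y) z = mul x (mul y z)"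
begin

lemma conv_assoc: "conv (conv f g) h vs = conv f (conv g h) vs"
proof -
  let ?n = "length vs"
  have "conv (conv f g) h vs = (\<Sum>k\<in>{1..<?n}. \<Sum>i\<in>{1..<k}. mul (f (take i vs)) (mul (g (drop i (take k vs))) (h (drop k vs))))"
    unfolding conv_def mul_sum
    by (intro sum.cong refl) (auto simp: mul_assoc min_def intro!: sum.cong)
  also have "\<dots> = (\<Sum>(k, i)\<in>Sigma {1..<?n} (\<lambda>k. {1..<k}). mul (f (take i vs)) (mul (g (drop i (take k vs))) (h (drop k vs))))"
    by (subst sum.Sigma) auto
  also have "\<dots> = (\<Sum>(i, k)\<in>Sigma {1..<?n} (\<lambda>i. {1..<?n - i}). mul (f (take i vs)) (mul (g (take k (drop i vs))) (h (drop k (drop i vs)))))"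
    by (rule sum.reindex_bij_witness[of _ "\<lambda>(i, k). (i + k, i)" "\<lambda>(k, i). (i, k - i)"])
      (auto simp: take_drop add.commute)
  also have "\<dots> = conv f (conv g h) vs"
    unfolding conv_def mul_sum by (subst sum.Sigma) (auto intro!: sum.cong)
  finally show ?thesis .
qed

text \<open>In one variable this is \<open>(uL)^(j+2) = (uL)(uL)^(j+1)\<close>. Both sides solve
  \<open>X = E_(j+1) + \<theta> X\<close>, an equation with a unique solution by induction on the
  length of the list.\<close>

lemma G_Suc: "G (Suc j) vs = conv (G 0) (G j) vs"
proof (induction "length vs" arbitrary: vs rule: less_induct)
  case less
  have "conv (G 0) (G j) vs = conv (\<lambda>vs. E 0 vs + conv TH (G 0) vs) (G j) vs"
    by (rule conv_cong) (auto simp flip: G_eq)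
  also have "\<dots> = E (Suc j) vs + conv TH (conv (G 0) (G j)) vs"
    by (simp add: conv_add_left E_Suc conv_assoc)
  also have "conv TH (conv (G 0) (G j)) vs = conv TH (G (Suc j)) vs"
    by (rule conv_cong) (auto simp flip: less)
  finally show ?case by (simp flip: G_eq)
qed

lemma E_Suc_Suc: "E (Suc (Suc j)) vs = conv (E 1) (G j) vs"
proof -
  have "E (Suc (Suc j)) vs = conv (E 0) (conv (G 0) (G j)) vs"
    unfolding E_Suc by (rule conv_cong) (auto simp: G_Suc)
  also have "\<dots> = conv (conv (E 0) (G 0)) (G j) vs" by (simp add: conv_assoc)
  also have "\<dots> = conv (E 1) (G j) vs" by (rule conv_cong) (auto simp: E_Suc)
  finally show ?thesis .
qed

text \<open>
  \<open>Df f U y V\<close> is the difference of the two derivatives of \<open>f\<close>, at the argument \<open>y\<close> between the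
  arguments \<open>U\<close> and \<open>V\<close>, in the directions \<open>\<nu>(U'', y)\<close> and \<open>\<nu>(y, V')\<close>.
\<close>

definition Df :: "('v list \<Rightarrow> 'v) \<Rightarrow> 'v list \<Rightarrow> 'v \<Rightarrow> 'v list \<Rightarrow> 'v"
  where "Df f U y V = (\<Sum>k<length U. f (take k U @ [N (drop k U @ [y])] @ V))
    - (\<Sum>k\<in>{1..length V}. f (U @ [N (y # take k V)] @ drop k V))"

lemma Df_cong:
  assumes "\<And>vs. length vs \<le> length U + length V + 1 \<Longrightarrow> f vs = g vs"
  shows "Df f U y V = Df g U y V"
  unfolding Df_def by (intro arg_cong2[where f = "(-)"] sum.cong refl) (auto intro!: assms)

lemma Df_add: "Df (\<lambda>vs. f vs + g vs) U y V = Df f U y V + Df g U y V"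
  by (simp add: Df_def sum.distrib)

lemma Df_diff: "Df (\<lambda>vs. f vs - g vs) U y V = Df f U y V - Df g U y V"
  by (simp add: Df_def sum_subtractf)

lemma Df_a: "Df (\<lambda>vs. a k (f vs)) U y V = a k (Df f U y V)"
  by (simp add: Df_def a_sum a_diff)

lemma Df_sum: "Df (\<lambda>vs. \<Sum>i\<in>S. f i vs) U y V = (\<Sum>i\<in>S. Df (f i) U y V)"
  by (induction S rule: infinite_finite_induct) (simp_all add: Df_add, simp_all add: Df_def)

text \<open>A Leibniz rule: the block contracted to \<open>\<nu>\<close> lies in one of the two
  factors. Reindexing a triangle exchanges the choice of the block with the choice of the
  cut.\<close>

lemma Df_conv: "Df (conv f g) U y V = (\<Sum>i\<in>{1..length U}. mul (f (take i U)) (Df g (drop i U) y V))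
    + (\<Sum>i<length V. mul (Df f U y (take i V)) (g (drop i V)))"
proof -
  have "(\<Sum>k<length U. conv f g (take k U @ [N (drop k U @ [y])] @ V)) =
    (\<Sum>k<length U. \<Sum>i\<in>{1..k}. mul (f (take i U)) (g (drop i (take (i + (k - i)) U) @ [N (drop (i + (k - i)) U @ [y])] @ V)))
    + (\<Sum>k<length U. \<Sum>i<length V. mul (f (take k U @ [N (drop k U @ [y])] @ take i V)) (g (drop i V)))"
    unfolding conv_marked sum.distrib
    by (intro arg_cong2[where f = "(+)"] sum.cong refl) (auto simp: min_def)
  also have "(\<Sum>k<length U. \<Sum>i\<in>{1..k}. mul (f (take i U)) (g (drop i (take (i + (k - i)) U) @ [N (drop (i + (k - i)) U @ [y])] @ V)))
    = (\<Sum>i\<in>{1..length U}. \<Sum>k<length U - i. mul (f (take i U)) (g (drop i (take (i + k) U) @ [N (drop (i + k) U @ [y])] @ V)))"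
    by (rule sum_triangle)
  also have "\<dots> = (\<Sum>i\<in>{1..length U}. mul (f (take i U)) (\<Sum>k<length (drop i U). g (take k (drop i U) @ [N (drop k (drop i U) @ [y])] @ V)))"
    by (simp add: mul_sum take_drop add.commute)
  also have "(\<Sum>k<length U. \<Sum>i<length V. mul (f (take k U @ [N (drop k U @ [y])] @ take i V)) (g (drop i V)))
    = (\<Sum>i<length V. mul (\<Sum>k<length U. f (take k U @ [N (drop k U @ [y])] @ take i V)) (g (drop i V)))"
    by (subst sum.swap) (simp add: mul_sum)
  finally have 1: "(\<Sum>k<length U. conv f g (take k U @ [N (drop k U @ [y])] @ V)) =
    (\<Sum>i\<in>{1..length U}. mul (f (take i U)) (\<Sum>k<length (drop i U). g (take k (drop i U) @ [N (drop k (drop i U) @ [y])] @ V)))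
    + (\<Sum>i<length V. mul (\<Sum>k<length U. f (take k U @ [N (drop k U @ [y])] @ take i V)) (g (drop i V)))" .
  have "(\<Sum>k\<in>{1..length V}. conv f g (U @ [N (y # take k V)] @ drop k V)) =
    (\<Sum>k\<in>{1..length V}. \<Sum>i\<in>{1..length U}. mul (f (take i U)) (g (drop i U @ [N (y # take k V)] @ drop k V)))
    + (\<Sum>k\<in>{1..length V}. \<Sum>i<length V - k. mul (f (U @ [N (y # take k V)] @ take i (drop k V))) (g (drop i (drop k V))))"
    unfolding conv_marked sum.distrib by simp
  also have "(\<Sum>k\<in>{1..length V}. \<Sum>i\<in>{1..length U}. mul (f (take i U)) (g (drop i U @ [N (y # take k V)] @ drop k V)))
    = (\<Sum>i\<in>{1..length U}. mul (f (take i U)) (\<Sum>k\<in>{1..length V}. g (drop i U @ [N (y # take k V)] @ drop k V)))"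
    by (subst sum.swap) (simp add: mul_sum)
  also have "(\<Sum>k\<in>{1..length V}. \<Sum>i<length V - k. mul (f (U @ [N (y # take k V)] @ take i (drop k V))) (g (drop i (drop k V))))
    = (\<Sum>i<length V. \<Sum>k\<in>{1..i}. mul (f (U @ [N (y # take k V)] @ take (i - k) (drop k V))) (g (drop (i - k) (drop k V))))"
    by (rule sum_triangle[symmetric])
  also have "\<dots> = (\<Sum>i<length V. mul (\<Sum>k\<in>{1..length (take i V)}. f (U @ [N (y # take k (take i V))] @ drop k (take i V))) (g (drop i V)))"
    unfolding mul_sum by (intro sum.cong refl) (auto simp: min_def drop_take intro!: sum.cong)
  finally have 2: "(\<Sum>k\<in>{1..length V}. conv f g (U @ [N (y # take k V)] @ drop k V)) =
    (\<Sum>i\<in>{1..length U}. mul (f (take i U)) (\<Sum>k\<in>{1..length V}. g (drop i U @ [N (y # take k V)] @ drop k V)))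
    + (\<Sum>i<length V. mul (\<Sum>k\<in>{1..length (take i V)}. f (U @ [N (y # take k (take i V))] @ drop k (take i V))) (g (drop i V)))" .
  show ?thesis unfolding Df_def[of "conv f g"] 1 2 unfolding Df_def
    by (simp only: mul_diff sum_subtractf) (simp add: algebra_simps)
qed

lemma conv_snoc: "conv f g (U @ [y]) = (\<Sum>i\<in>{1..length U}. mul (f (take i U)) (g (drop i U @ [y])))"
  using conv_marked[of f g U y "[]"] by simp

lemma conv_Cons: "conv f g (y # V) = (\<Sum>i<length V. mul (f (y # take i V)) (g (drop i V)))"
  using conv_marked[of f g "[]" y V] by simp

lemma sum_first: "V \<noteq> [] \<Longrightarrow> (\<Sum>i<length V. if take i V = [] then f i else 0) = (f 0 :: 'v)"
  by (subst sum.mono_neutral_right[of _ "{0}"]) auto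

lemma Df_tt: "Df tt U y V = (if V = [] then N (U @ [y]) else 0) - (if U = [] then N (y # V) else 0)"
proof -
  have "(\<Sum>k<length U. tt (take k U @ [N (drop k U @ [y])] @ V)) = (if V = [] then N (U @ [y]) else 0)"
  proof (cases "V = [] \<and> U \<noteq> []")
    case True
    then show ?thesis by (subst sum.mono_neutral_right[of _ "{0}"]) (auto simp: tt_def)
  next
    case False
    then show ?thesis by (auto simp: tt_def intro!: sum.neutral)
  qed
  moreover have "(\<Sum>k\<in>{1..length V}. tt (U @ [N (y # take k V)] @ drop k V)) = (if U = [] then N (y # V) else 0)"
  proof (cases "U = [] \<and> V \<noteq> []")
    case True
    then show ?thesis by (subst sum.mono_neutral_right[of _ "{length V}"]) (auto simp: tt_def Suc_le_eq)
  next
    case False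
    then show ?thesis by (cases U) (auto simp: tt_def intro!: sum.neutral)
  qed
  ultimately show ?thesis by (simp add: Df_def)
qed

text \<open>The defining equations of \<open>E_0\<close>, \<open>\<theta>\<close> and
  \<open>G\<close> are differentiated together, by induction on the number of arguments. Since
  \<open>\<nu>\<close> is the sum of all \<open>a_l E_(l+1)\<close>, the derivative of the equation
  for \<open>E_0\<close> collapses to \<open>E_1\<close>, and products then raise the index; all
  contributions away from the ends of the list cancel, except in \<open>G\<close>.\<close>

lemma Df_E_G:
  "(\<forall>j. Df (E j) U y V = (if V = [] then E (Suc j) (U @ [y]) else 0) - (if U = [] then E (Suc j) (y # V) else 0)) \<and>
   (\<forall>j. Df (G j) U y V = (if V = [] then G (Suc j) (U @ [y]) else - mul (G 0 (U @ [y])) (G j V))) \<and>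
   Df TH U y V = (if U = [] then E 0 (y # V) else 0) - (if V = [] then E 0 (U @ [y]) else 0)"
proof (induction "length U + length V" arbitrary: U V rule: less_induct)
  case less
  have IHG: "Df (G j) (drop i U) y V = (if V = [] then G (Suc j) (drop i U @ [y]) else - mul (G 0 (drop i U @ [y])) (G j V))"
    if "i \<in> {1..length U}" for i j
    using less[of "drop i U" V] that by auto
  have IHE: "Df (E j) U y (take i V) = (if take i V = [] then E (Suc j) (U @ [y]) else 0) - (if U = [] then E (Suc j) (y # take i V) else 0)"
    if "i < length V" for i j
    using less[of U "take i V"] that by auto
  have IHT: "Df TH U y (take i V) = (if U = [] then E 0 (y # take i V) else 0) - (if take i V = [] then E 0 (U @ [y]) else 0)"
    if "i < length V" for i
    using less[of U "take i V"] that by auto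
  \<comment> \<open>Only the cut directly after \<open>y\<close>, with no argument of
    \<open>V\<close> on the left, contributes.\<close>
  have fst: "(\<Sum>i<length V. mul (if take i V = [] then c else 0) (G j (drop i V))) = (if V = [] then 0 else mul c (G j V))" for c j
  proof (cases "V = []")
    case False
    have "(\<Sum>i<length V. mul (if take i V = [] then c else 0) (G j (drop i V)))
        = (\<Sum>i<length V. if take i V = [] then mul c (G j (drop i V)) else 0)"
      by (rule sum.cong) auto
    then show ?thesis using False sum_first[OF False, of "\<lambda>i. mul c (G j (drop i V))"] by simp
  qed simp
  have left: "(\<Sum>i\<in>{1..length U}. mul (f (take i U)) (Df (G j) (drop i U) y V))
      = (if V = [] then conv f (G (Suc j)) (U @ [y]) else - mul (conv f (G 0) (U @ [y])) (G j V))" for f j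
  proof -
    have "(\<Sum>i\<in>{1..length U}. mul (f (take i U)) (Df (G j) (drop i U) y V)) =
      (\<Sum>i\<in>{1..length U}. mul (f (take i U)) (if V = [] then G (Suc j) (drop i U @ [y]) else - mul (G 0 (drop i U @ [y])) (G j V)))"
      by (rule sum.cong) (auto simp only: IHG)
    then show ?thesis by (simp add: conv_snoc mul_sum mul_assoc mul_uminus sum_negf)
  qed
  have ES: "Df (E (Suc j)) U y V = (if V = [] then E (Suc (Suc j)) (U @ [y]) else 0) - (if U = [] then E (Suc (Suc j)) (y # V) else 0)" for j
  proof -
    have "(\<Sum>i<length V. mul (Df (E 0) U y (take i V)) (G j (drop i V))) =
      (\<Sum>i<length V. mul (if take i V = [] then E 1 (U @ [y]) else 0) (G j (drop i V)))
      - (\<Sum>i<length V. mul (if U = [] then E 1 (y # take i V) else 0) (G j (drop i V)))"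
      unfolding sum_subtractf[symmetric] by (rule sum.cong) (auto simp: IHE mul_diff)
    also have "\<dots> = (if V = [] then 0 else mul (E 1 (U @ [y])) (G j V)) - (if U = [] then E (Suc (Suc j)) (y # V) else 0)"
      unfolding fst E_Suc_Suc[of j "y # V"] conv_Cons by simp
    finally have "Df (conv (E 0) (G j)) U y V = (if V = [] then E (Suc (Suc j)) (U @ [y]) else 0) - (if U = [] then E (Suc (Suc j)) (y # V) else 0)"
      unfolding Df_conv left by (simp add: E_Suc[symmetric])
    then show ?thesis by (simp add: E_Suc[abs_def])
  qed
  define M where "M = length U + length V + 2"
  have E0: "Df (E 0) U y V = (if V = [] then E 1 (U @ [y]) else 0) - (if U = [] then E 1 (y # V) else 0)"
  proof -
    \<comment> \<open>Of all summands \<open>a_l E_(l+1)\<close> of \<open>N\<close> only the one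
      with \<open>l = 0\<close> is kept.\<close>
    have N: "N vs - (\<Sum>l\<in>{1..<M}. a l (E (Suc l) vs)) = E 1 vs" if "length vs \<le> M" for vs
      using N_eq[of vs M] that sum_shift[of M "\<lambda>l. a l (E (Suc l) vs)"] by (simp add: M_def a_0)
    have "Df (E 0) U y V = Df (\<lambda>vs. tt vs - (\<Sum>l\<in>{1..<M}. a l (E l vs))) U y V"
      by (rule Df_cong) (rule E_0, simp add: M_def)
    also have "\<dots> = Df tt U y V - (\<Sum>l\<in>{1..<M}. a l (Df (E l) U y V))"
      by (simp only: Df_diff Df_sum Df_a)
    also have "(\<Sum>l\<in>{1..<M}. a l (Df (E l) U y V)) = (\<Sum>l\<in>{1..<M}. a l ((if V = [] then E (Suc l) (U @ [y]) else 0) - (if U = [] then E (Suc l) (y # V) else 0)))"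
    proof (rule sum.cong[OF refl])
      fix l assume "l \<in> {1..<M}"
      then obtain l' where "l = Suc l'" by (cases l) auto
      then show "a l (Df (E l) U y V) = a l ((if V = [] then E (Suc l) (U @ [y]) else 0) - (if U = [] then E (Suc l) (y # V) else 0))"
        using ES[of l'] by simp
    qed
    also have "\<dots> = (if V = [] then \<Sum>l\<in>{1..<M}. a l (E (Suc l) (U @ [y])) else 0) - (if U = [] then \<Sum>l\<in>{1..<M}. a l (E (Suc l) (y # V)) else 0)"
      by (simp add: a_diff sum_subtractf a_uminus sum_negf)
    finally show ?thesis unfolding Df_tt using N[of "U @ [y]"] N[of "y # V"]
      by (cases "V = []"; cases "U = []"; simp add: M_def algebra_simps)
  qed
  have EA: "Df (E j) U y V = (if V = [] then E (Suc j) (U @ [y]) else 0) - (if U = [] then E (Suc j) (y # V) else 0)" for j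
    using ES E0 by (cases j) auto
  have T: "Df TH U y V = (if U = [] then E 0 (y # V) else 0) - (if V = [] then E 0 (U @ [y]) else 0)"
  proof -
    have S: "(\<Sum>l<M. a (Suc l) (E (Suc l) vs)) = tt vs - E 0 vs" if "length vs \<le> M" for vs
    proof -
      have "tt vs = E 0 vs + (\<Sum>l<M. a (Suc l) (E (Suc l) vs))"
        using sum_a_E[of vs "Suc M"] that by (simp add: sum.lessThan_Suc_shift a_0 del: sum.lessThan_Suc)
      then show ?thesis by simp
    qed
    have "Df TH U y V = Df (\<lambda>vs. \<Sum>l<M. a (Suc l) (E l vs)) U y V"
      by (rule Df_cong) (rule TH_eq, simp add: M_def)
    also have "\<dots> = (\<Sum>l<M. a (Suc l) ((if V = [] then E (Suc l) (U @ [y]) else 0) - (if U = [] then E (Suc l) (y # V) else 0)))"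
      by (simp only: Df_sum Df_a EA)
    also have "\<dots> = (if V = [] then \<Sum>l<M. a (Suc l) (E (Suc l) (U @ [y])) else 0) - (if U = [] then \<Sum>l<M. a (Suc l) (E (Suc l) (y # V)) else 0)"
      by (simp add: a_diff sum_subtractf a_uminus sum_negf)
    finally show ?thesis using S[of "U @ [y]"] S[of "y # V"]
      by (cases "V = []"; cases "U = []"; simp add: M_def tt_def)
  qed
  have GA: "Df (G j) U y V = (if V = [] then G (Suc j) (U @ [y]) else - mul (G 0 (U @ [y])) (G j V))" for j
  proof -
    have "(\<Sum>i<length V. mul (Df TH U y (take i V)) (G j (drop i V))) =
      (\<Sum>i<length V. mul (if U = [] then E 0 (y # take i V) else 0) (G j (drop i V)))
      - (\<Sum>i<length V. mul (if take i V = [] then E 0 (U @ [y]) else 0) (G j (drop i V)))"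
      unfolding sum_subtractf[symmetric] by (rule sum.cong) (auto simp: IHT mul_diff)
    also have "\<dots> = (if U = [] then E (Suc j) (y # V) else 0) - (if V = [] then 0 else mul (E 0 (U @ [y])) (G j V))"
      unfolding fst E_Suc[of j "y # V"] conv_Cons by simp
    finally have "Df (\<lambda>vs. E j vs + conv TH (G j) vs) U y V =
      (if V = [] then E (Suc j) (U @ [y]) + conv TH (G (Suc j)) (U @ [y])
        else - mul (E 0 (U @ [y]) + conv TH (G 0) (U @ [y])) (G j V))"
      unfolding Df_add Df_conv left EA by (simp add: mul_add_left)
    then show ?thesis by (simp flip: G_eq)
  qed
  show ?case using EA GA T by blast
qed

text \<open>At an inner argument all derivatives of the \<open>E_j\<close> vanish, and
  \<open>N\<close> is a combination of the \<open>E_j\<close>. The two sums run over the inner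
  blocks that end, respectively begin, with \<open>y\<close>, as in a relator of ncHyperCom.\<close>

theorem N_relation:
  assumes "U \<noteq> []" "V \<noteq> []"
  shows "(\<Sum>k<length U. N (take k U @ [N (drop k U @ [y])] @ V))
    = (\<Sum>k\<in>{1..length V}. N (U @ [N (y # take k V)] @ drop k V))"
proof -
  have "Df N U y V = Df (\<lambda>vs. \<Sum>l<length U + length V. a l (E (Suc l) vs)) U y V"
    by (rule Df_cong) (simp add: N_eq)
  also have "\<dots> = 0" unfolding Df_sum Df_a using Df_E_G[of U y V] assms by simp
  finally show ?thesis by (simp add: Df_def)
qed

end

text \<open>The recursion is natural in additive maps that commute with product and operators. Both
  the normal form map and the parity involution are of this kind.\<close>

lemma EE_GG_hom:
  assumes h: "\<And>x y. h (x + y) = h x + h (y :: 'v::ab_group_add)"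
    "\<And>x y. h (mul x y) = (mul' (h x) (h y) :: 'w::ab_group_add)" "\<And>k x. h (a k x) = a' k (h x)"
  shows "h (EE mul a j vs) = EE mul' a' j (map h vs)" "h (GG mul a j vs) = GG mul' a' j (map h vs)"
proof -
  have h0: "h 0 = 0" using h(1)[of 0 0] by simp
  have hm: "h (- x) = - h x" for x using h(1)[of x "- x"] by (simp add: h0 eq_neg_iff_add_eq_0 add.commute)
  have hd': "h (x - y) = h x - h y" for x y using h(1)[of x "- y"] by (simp add: hm)
  have hs: "h (sum f S) = (\<Sum>i\<in>S. h (f i))" for f :: "nat \<Rightarrow> 'v" and S
    by (induction S rule: infinite_finite_induct) (simp_all add: h0 h(1))
  have "h (EE mul a j vs) = EE mul' a' j (map h vs) \<and> h (GG mul a j vs) = GG mul' a' j (map h vs)"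
  proof (induction "length vs" arbitrary: j vs rule: less_induct)
    case less
    have ES: "h (EE mul a (Suc j) vs) = EE mul' a' (Suc j) (map h vs)" for j
      unfolding EE.simps(2) hs h(2) by (rule sum.cong) (auto simp: less take_map drop_map)
    have E0: "h (EE mul a 0 vs) = EE mul' a' 0 (map h vs)"
    proof -
      have "(\<Sum>l\<in>{1..<length vs}. a' l (h (EE mul a l vs))) = (\<Sum>l\<in>{1..<length vs}. a' l (EE mul' a' l (map h vs)))"
      proof (rule sum.cong[OF refl])
        fix l assume "l \<in> {1..<length vs}"
        then obtain l' where "l = Suc l'" by (cases l) auto
        then show "a' l (h (EE mul a l vs)) = a' l (EE mul' a' l (map h vs))" using ES by simp
      qed
      moreover have "h (if length vs = 1 then hd vs else 0) = (if length vs = 1 then hd (map h vs) else 0)"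
        by (cases vs) (auto simp: h0)
      ultimately show ?thesis unfolding EE.simps(1) hd' hs h(3) by simp
    qed
    have EA: "h (EE mul a j vs) = EE mul' a' j (map h vs)" for j using ES E0 by (cases j) auto
    have "h (GG mul a j vs) = GG mul' a' j (map h vs)" for j
      unfolding GG.simps[of mul a j vs] GG.simps[of mul' a' j "map h vs"] h(1) hs h(2) EA h(3)
      by (intro arg_cong2[where f = "(+)"] refl sum.cong arg_cong2[where f = mul'])
        (auto simp: less take_map drop_map)
    then show ?case using EA by blast
  qed
  then show "h (EE mul a j vs) = EE mul' a' j (map h vs)" "h (GG mul a j vs) = GG mul' a' j (map h vs)" by auto
qed

lemma NN_hom:
  assumes "\<And>x y. h (x + y) = h x + h (y :: 'v::ab_group_add)"
    "\<And>x y. h (mul x y) = (mul' (h x) (h y) :: 'w::ab_group_add)" "\<And>k x. h (a k x) = a' k (h x)"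
  shows "h (NN mul a vs) = NN mul' a' (map h vs)"
proof -
  have h0: "h 0 = 0" using assms(1)[of 0 0] by simp
  have "h (sum f S) = (\<Sum>i\<in>S. h (f i))" for f :: "nat \<Rightarrow> 'v" and S
    by (induction S rule: infinite_finite_induct) (simp_all add: h0 assms(1))
  then show ?thesis
    by (simp add: NN_def assms(3) EE_GG_hom[of h mul mul' a a', OF assms])
qed

subsection \<open>The morphism on trees\<close>

definition aT :: "nat \<Rightarrow> (tree \<Rightarrow>\<^sub>0 'k::field) \<Rightarrow> tree \<Rightarrow>\<^sub>0 'k"
  where "aT k x = (case k of 0 \<Rightarrow> x | Suc _ \<Rightarrow> op1 (A k) x)"

abbreviation mT :: "(tree \<Rightarrow>\<^sub>0 'k::field) \<Rightarrow> (tree \<Rightarrow>\<^sub>0 'k) \<Rightarrow> tree \<Rightarrow>\<^sub>0 'k" where "mT \<equiv> op2 Prod"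

interpretation T: additive_ops mT aT
  by unfold_locales (auto simp: aT_def split: nat.split)

interpretation V: assoc_ops mm AA
  by unfold_locales (auto simp: mm_assoc)

lemma NF_mT: "NF (mT x y) = mm (NF x) (NF y)"
proof (rule lin_eqI[where x = x])
  fix s show "NF (mT (bas s) y) = mm (NF (bas s)) (NF y)"
    by (rule lin_eqI[where x = y]) (auto intro!: lin_intros is_lin_comp[OF is_lin_NF] simp: op_bas nf_simps gop2_def)
qed (auto intro!: lin_intros is_lin_comp[OF is_lin_NF])

lemma NF_aT: "NF (aT k x) = AA k (NF x)"
proof (cases k)
  case (Suc j)
  have "NF (op1 (A k) x) = AA k (NF x)"
    by (rule lin_eqI[where x = x]) (auto intro!: lin_intros is_lin_comp[OF is_lin_NF] simp: op_bas nf_simps gop1_def)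
  then show ?thesis by (simp add: aT_def Suc)
qed (simp add: aT_def)

text \<open>The recursion is run on the images of the subtrees rather than by composing them into a
  fixed element; that this agrees with operadic composition is \<open>nuF_graft\<close>. The label
  is ignored because over \<open>nu_gens\<close> it is determined by the number of children.\<close>

fun nuF :: "tree \<Rightarrow> tree \<Rightarrow>\<^sub>0 'k::field" where
  "nuF Leaf = bas Leaf"
| "nuF (Node g ts) = NN mT aT (map nuF ts)"

declare nuF.simps(2) [simp del]

lemma NF_E_G:
  "NF (EE mT aT j vs) = EE mm AA j (map NF vs)" "NF (GG mT aT j vs) = GG mm AA j (map NF vs)"
  by (rule EE_GG_hom; simp add: NF_mT NF_aT)+

definition nfF :: "tree \<Rightarrow> nt \<Rightarrow>\<^sub>0 'k::field" where "nfF t = NF (nuF t)"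

lemma nfF_simps: "nfF Leaf = bas Lf" "nfF (Node g ts) = NN mm AA (map nfF ts)"
proof -
  show "nfF (Node g ts) = NN mm AA (map nfF ts)"
    unfolding nfF_def nuF.simps by (subst NN_hom[where mul' = mm and a' = AA]) (simp_all add: NF_mT NF_aT comp_def)
qed (simp add: nfF_def nf_simps)

definition nu_gens :: "gen set" where "nu_gens = {Nu k | k. 2 \<le> k}"

lemma nu_tree_induct [consumes 1, case_names Leaf Node]:
  assumes "tree_over nu_gens t" "P Leaf"
    "\<And>k ts. \<lbrakk>2 \<le> k; length ts = k; \<forall>t\<in>set ts. tree_over nu_gens t; \<forall>t\<in>set ts. P t\<rbrakk> \<Longrightarrow> P (Node (Nu k) ts)"
  shows "P t"
  using assms(1)
proof (induction t)
  case (Node g ts)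
  then obtain k where "g = Nu k" "2 \<le> k" by (auto simp: nu_gens_def)
  then show ?case using Node by (auto intro!: assms(3))
qed (rule assms(2))

section \<open>Arity and degree of the images\<close>

lemma mT_free:
  assumes "x \<in> free_cmp hq_gens n d" "y \<in> free_cmp hq_gens m e"
  shows "mT x y \<in> free_cmp hq_gens (n + m) (d + e)"
proof (rule free_cmp_linI[OF assms(1)])
  fix s assume s: "tree_over hq_gens s" "leaves s = n" "tree_deg s = d"
  show "mT (bas s) y \<in> free_cmp hq_gens (n + m) (d + e)"
    by (rule free_cmp_linI[OF assms(2)]) (use s in \<open>auto intro!: lin_intros free_cmp_single simp: op_bas hq_gens\<close>)
qed (intro lin_intros)

lemma aT_free:
  assumes "x \<in> free_cmp hq_gens n d" "e = d + 2 * int k"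
  shows "aT k x \<in> free_cmp hq_gens n e"
proof (cases k)
  case (Suc j)
  have "op1 (A k) x \<in> free_cmp hq_gens n e"
    by (rule free_cmp_linI[OF assms(1)]) (use assms(2) in \<open>auto intro!: lin_intros free_cmp_single simp: op_bas hq_gens Suc\<close>)
  then show ?thesis by (simp add: aT_def Suc)
qed (use assms in \<open>simp add: aT_def\<close>)

text \<open>In every term of \<open>E_j\<close> or \<open>G_j\<close> on \<open>n\<close> arguments
  the indices of the operators \<open>a_k\<close> add up to \<open>n - 1 - j\<close>. For
  \<open>\<nu>\<close> this leaves the sum \<open>n - 2\<close>, in agreement with the degree
  \<open>2n - 4\<close> of the generator.\<close>

lemma E_G_free:
  assumes "\<forall>t\<in>set ts. (f t :: tree \<Rightarrow>\<^sub>0 'k::field) \<in> free_cmp hq_gens (leaves t) (tree_deg t)"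
  shows "EE mT aT j (map f ts) \<in> free_cmp hq_gens (sum_list (map leaves ts)) (sum_list (map tree_deg ts) + 2 * (int (length ts) - 1 - int j)) \<and>
    GG mT aT j (map f ts) \<in> free_cmp hq_gens (sum_list (map leaves ts)) (sum_list (map tree_deg ts) + 2 * (int (length ts) - 1 - int j))"
  using assms
proof (induction "length ts" arbitrary: ts j rule: less_induct)
  case less
  define Q where "Q ts j = (free_cmp hq_gens (sum_list (map leaves ts)) (sum_list (map tree_deg ts) + 2 * (int (length ts) - 1 - int j)) :: (tree \<Rightarrow>\<^sub>0 'k) set)" for ts j
  have sub: "\<forall>t\<in>set (take i ts). f t \<in> free_cmp hq_gens (leaves t) (tree_deg t)"
    "\<forall>t\<in>set (drop i ts). f t \<in> free_cmp hq_gens (leaves t) (tree_deg t)" for i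
    using less.prems by (auto dest: in_set_takeD in_set_dropD)
  have IH: "EE mT aT j (map f (take i ts)) \<in> Q (take i ts) j" "GG mT aT j (map f (drop i ts)) \<in> Q (drop i ts) j"
    if "i \<in> {1..<length ts}" for i j
    using less.hyps[of "take i ts" j] less.hyps[of "drop i ts" j] sub that by (auto simp: Q_def)
  have split: "sum_list (map leaves (take i ts)) + sum_list (map leaves (drop i ts)) = sum_list (map leaves ts)"
    "sum_list (map tree_deg (take i ts)) + sum_list (map tree_deg (drop i ts)) = sum_list (map tree_deg ts)" for i
    by (simp_all flip: sum_list_append map_append)
  have mul: "mT x y \<in> Q ts j" if "i \<in> {1..<length ts}"
    "x \<in> free_cmp hq_gens (sum_list (map leaves (take i ts))) (sum_list (map tree_deg (take i ts)) + d)"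
    "y \<in> free_cmp hq_gens (sum_list (map leaves (drop i ts))) (sum_list (map tree_deg (drop i ts)) + e)"
    "d + e = 2 * (int (length ts) - 1 - int j)" for x y i d e j
    using mT_free[OF that(2,3)] split[of i] that(4)
    by (simp add: Q_def) (metis (no_types, lifting) add.assoc add.left_commute)
  have ES: "EE mT aT (Suc j) (map f ts) \<in> Q ts (Suc j)" for j
    unfolding T.E_Suc T.conv_def Q_def
  proof (intro free_cmp_sum, fold Q_def)
    fix i assume i: "i \<in> {1..<length (map f ts)}"
    show "mT (EE mT aT 0 (take i (map f ts))) (GG mT aT j (drop i (map f ts))) \<in> Q ts (Suc j)"
      using IH[of i 0] IH[of i j] i unfolding take_map drop_map Q_def[of "take i ts"] Q_def[of "drop i ts"]
      by (intro mul[of i]) auto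
  qed
  have E0: "EE mT aT 0 (map f ts) \<in> Q ts 0"
    unfolding EE.simps(1)[of mT aT "map f ts"] Q_def
  proof (intro free_cmp_diff free_cmp_sum)
    show "(if length (map f ts) = 1 then hd (map f ts) else 0)
      \<in> free_cmp hq_gens (sum_list (map leaves ts)) (sum_list (map tree_deg ts) + 2 * (int (length ts) - 1 - int 0))"
      using less.prems by (cases ts) auto
    fix l assume l: "l \<in> {1..<length (map f ts)}"
    then obtain j where "l = Suc j" by (cases l) auto
    then show "aT l (EE mT aT l (map f ts))
      \<in> free_cmp hq_gens (sum_list (map leaves ts)) (sum_list (map tree_deg ts) + 2 * (int (length ts) - 1 - int 0))"
      using ES[of j] unfolding Q_def by (auto elim!: aT_free)
  qed
  have EA: "EE mT aT j (map f ts) \<in> Q ts j" for j using ES E0 by (cases j) auto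
  have "GG mT aT j (map f ts) \<in> Q ts j" for j
    unfolding T.G_eq[of j "map f ts"] unfolding Q_def
  proof (intro free_cmp_add, fold Q_def, rule EA)
    show "T.conv T.TH (GG mT aT j) (map f ts) \<in> Q ts j"
      unfolding T.conv_def Q_def
    proof (intro free_cmp_sum, fold Q_def)
      fix i assume i: "i \<in> {1..<length (map f ts)}"
      have "T.TH (map f (take i ts)) \<in> free_cmp hq_gens (sum_list (map leaves (take i ts))) (sum_list (map tree_deg (take i ts)) + 2 * int i)"
        unfolding T.TH_def
      proof (intro free_cmp_sum)
        fix l
        show "aT (Suc l) (EE mT aT l (map f (take i ts)))
          \<in> free_cmp hq_gens (sum_list (map leaves (take i ts))) (sum_list (map tree_deg (take i ts)) + 2 * int i)"
          using IH(1)[of i l] i unfolding Q_def by (auto elim!: aT_free)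
      qed
      then show "mT (T.TH (take i (map f ts))) (GG mT aT j (drop i (map f ts))) \<in> Q ts j"
        using IH[of i j] i unfolding take_map drop_map Q_def[of "drop i ts"]
        by (intro mul[of i]) auto
    qed
  qed
  then show ?case using EA by (simp add: Q_def)
qed

lemma NN_free:
  assumes "\<forall>t\<in>set ts. (f t :: tree \<Rightarrow>\<^sub>0 'k::field) \<in> free_cmp hq_gens (leaves t) (tree_deg t)"
  shows "NN mT aT (map f ts) \<in> free_cmp hq_gens (sum_list (map leaves ts)) (sum_list (map tree_deg ts) + 2 * (int (length ts) - 2))"
  unfolding NN_def
proof (intro free_cmp_sum)
  fix l assume "l \<in> {1..<length (map f ts)}"
  then show "aT (l - 1) (EE mT aT l (map f ts))
    \<in> free_cmp hq_gens (sum_list (map leaves ts)) (sum_list (map tree_deg ts) + 2 * (int (length ts) - 2))"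
    using conjunct1[OF E_G_free[OF assms, of l]] by (elim aT_free) auto
qed

lemma nuF_free: "tree_over nu_gens t \<Longrightarrow> nuF t \<in> free_cmp hq_gens (leaves t) (tree_deg t)"
proof (induction rule: nu_tree_induct)
  case (Node k ts)
  then show ?case using NN_free[of ts nuF] by (simp add: nuF.simps algebra_simps)
qed (simp add: free_cmp_single)

text \<open>Because all operations of ncHyperCom are even, no Koszul signs appear when their images
  are composed.\<close>

lemma even_nu_deg: "tree_over nu_gens t \<Longrightarrow> even (tree_deg t)"
proof (induction rule: nu_tree_induct)
  case (Node k ts)
  have "even (sum_list (map tree_deg ts))" using Node(4) by (induction ts) auto
  then show ?case by simp
qed simp

section \<open>Compatibility of the images with composition\<close>

lemma mT_tcomp_left:
  assumes x: "supp (\<lambda>t. leaves t = n) x" and y: "supp (\<lambda>t. even (tree_deg t)) y" and "i \<le> n"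
  shows "mT x z \<circ>[i] y = mT (x \<circ>[i] y) z"
proof (rule supp_eqI[OF x])
  fix s :: tree assume s: "leaves s = n"
  show "mT (bas s) z \<circ>[i] y = mT (bas s \<circ>[i] y) z"
  proof (rule supp_eqI[OF y])
    fix u assume u: "even (tree_deg u)"
    show "mT (bas s) z \<circ>[i] bas u = mT (bas s \<circ>[i] bas u) z"
      by (rule lin_eqI[where x = z]) (use s u \<open>i \<le> n\<close> in \<open>auto intro!: lin_intros simp: op_bas tcomp_bas powi_minus_one\<close>)
  qed (intro lin_intros)+
qed (intro lin_intros)+

lemma mT_tcomp_right:
  assumes x: "supp (\<lambda>t. leaves t = n) x" and z: "supp (\<lambda>t. leaves t = m) z" and "n < i" "i \<le> n + m"
  shows "mT x z \<circ>[i] y = mT x (z \<circ>[i - n] y)"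
proof (rule supp_eqI[OF x])
  fix s :: tree assume s: "leaves s = n"
  show "mT (bas s) z \<circ>[i] y = mT (bas s) (z \<circ>[i - n] y)"
  proof (rule supp_eqI[OF z])
    fix t :: tree assume t: "leaves t = m"
    show "mT (bas s) (bas t) \<circ>[i] y = mT (bas s) (bas t \<circ>[i - n] y)"
      by (rule lin_eqI[where x = y]) (use s t \<open>n < i\<close> \<open>i \<le> n + m\<close> in
        \<open>auto intro!: lin_intros simp: op_bas tcomp_bas op2_def\<close>)
  qed (intro lin_intros)+
qed (intro lin_intros)+

lemma aT_tcomp:
  assumes x: "supp (\<lambda>t. leaves t = n) x" and "i \<le> n"
  shows "aT l x \<circ>[i] y = aT l (x \<circ>[i] y)"
proof (cases l)
  case (Suc k)
  have "op1 (A l) x \<circ>[i] y = op1 (A l) (x \<circ>[i] y)"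
  proof (rule supp_eqI[OF x])
    fix s :: tree assume s: "leaves s = n"
    show "op1 (A l) (bas s) \<circ>[i] y = op1 (A l) (bas s \<circ>[i] y)"
      by (rule lin_eqI[where x = y]) (use s \<open>i \<le> n\<close> in
        \<open>auto intro!: lin_intros simp: op_bas tcomp_bas op1_def\<close>)
  qed (intro lin_intros)+
  then show ?thesis by (simp add: aT_def Suc)
qed (simp add: aT_def)

lemma free_cmp_leaves: "x \<in> free_cmp G n d \<Longrightarrow> supp (\<lambda>t. leaves t = n) x"
  by (auto simp: supp_def free_cmp_def)

lemma E_G_leaves:
  assumes "\<forall>t\<in>set ts. tree_over nu_gens t"
  shows "supp (\<lambda>t. leaves t = sum_list (map leaves ts)) (EE mT aT j (map nuF ts))"
    "supp (\<lambda>t. leaves t = sum_list (map leaves ts)) (GG mT aT j (map nuF ts))"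
    "supp (\<lambda>t. leaves t = sum_list (map leaves ts)) (T.TH (map nuF ts))"
proof -
  show *: "supp (\<lambda>t. leaves t = sum_list (map leaves ts)) (EE mT aT j (map nuF ts))"
    "supp (\<lambda>t. leaves t = sum_list (map leaves ts)) (GG mT aT j (map nuF ts))" for j
    using E_G_free[of ts nuF j] assms nuF_free free_cmp_leaves by blast+
  show "supp (\<lambda>t. leaves t = sum_list (map leaves ts)) (T.TH (map nuF ts))"
    unfolding T.TH_def
  proof (rule supp_sum)
    fix l
    show "supp (\<lambda>t. leaves t = sum_list (map leaves ts)) (aT (Suc l) (EE mT aT l (map nuF ts)))"
      by (simp add: aT_def, rule supp_linI[OF *(1)])
        (auto intro!: lin_intros supp_bas simp: op_bas)
  qed
qed

text \<open>The argument \<open>nuF x\<close> occurs exactly once in every term of the recursion, so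
  composition at one of its leaves passes termwise through products and operators.\<close>

lemma E_G_tcomp:
  fixes y :: "tree \<Rightarrow>\<^sub>0 'k::field"
  assumes y: "supp (\<lambda>t. even (tree_deg t)) y" and "tree_over nu_gens x" "1 \<le> k" "k \<le> leaves x"
  shows "\<lbrakk>\<forall>t\<in>set us. tree_over nu_gens t; \<forall>t\<in>set ws. tree_over nu_gens t\<rbrakk> \<Longrightarrow>
    EE mT aT j (map nuF us @ (nuF x \<circ>[k] y) # map nuF ws) = EE mT aT j (map nuF us @ nuF x # map nuF ws) \<circ>[sum_list (map leaves us) + k] y \<and>
    GG mT aT j (map nuF us @ (nuF x \<circ>[k] y) # map nuF ws) = GG mT aT j (map nuF us @ nuF x # map nuF ws) \<circ>[sum_list (map leaves us) + k] y"
proof (induction "length us + length ws" arbitrary: us ws j rule: less_induct)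
  case less
  let ?n = "\<lambda>us. sum_list (map leaves us) :: nat"
  let ?x' = "nuF x \<circ>[k] y"
  have split: "?n (take i us) + ?n (drop i us) = ?n us" for i us
    by (simp flip: sum_list_append map_append)
  have sub: "\<forall>t\<in>set (take i us). tree_over nu_gens t" "\<forall>t\<in>set (drop i us). tree_over nu_gens t"
    "\<forall>t\<in>set (take i ws). tree_over nu_gens t" "\<forall>t\<in>set (drop i ws). tree_over nu_gens t" for i
    using less.prems by (auto dest: in_set_takeD in_set_dropD)
  have lv: "supp (\<lambda>t. leaves t = ?n us + leaves x + ?n ws) (EE mT aT j (map nuF us @ nuF x # map nuF ws) :: tree \<Rightarrow>\<^sub>0 'k)"
    "supp (\<lambda>t. leaves t = ?n us + leaves x + ?n ws) (GG mT aT j (map nuF us @ nuF x # map nuF ws) :: tree \<Rightarrow>\<^sub>0 'k)"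
    "supp (\<lambda>t. leaves t = ?n us + leaves x + ?n ws) (T.TH (map nuF us @ nuF x # map nuF ws) :: tree \<Rightarrow>\<^sub>0 'k)"
    if "\<forall>t\<in>set us. tree_over nu_gens t" "\<forall>t\<in>set ws. tree_over nu_gens t" for us ws j
    using E_G_leaves[of "us @ x # ws"] that assms(2) by (simp_all add: add.assoc ball_Un)
  have conv: "T.conv f (GG mT aT j) (map nuF us @ ?x' # map nuF ws) =
      T.conv f (GG mT aT j) (map nuF us @ nuF x # map nuF ws) \<circ>[?n us + k] y"
    if f: "\<And>ts. \<forall>t\<in>set ts. tree_over nu_gens t \<Longrightarrow> supp (\<lambda>t. leaves t = ?n ts) (f (map nuF ts))"
      and fx: "\<And>i. i < length ws \<Longrightarrow> f (map nuF us @ ?x' # map nuF (take i ws)) =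
        f (map nuF us @ nuF x # map nuF (take i ws)) \<circ>[?n us + k] y" for f j
  proof -
    have 1: "mT (f (map nuF (take i us))) (GG mT aT j (map nuF (drop i us) @ ?x' # map nuF ws))
      = mT (f (map nuF (take i us))) (GG mT aT j (map nuF (drop i us) @ nuF x # map nuF ws)) \<circ>[?n us + k] y"
      if "i \<in> {1..length us}" for i
    proof -
      have "GG mT aT j (map nuF (drop i us) @ ?x' # map nuF ws)
        = GG mT aT j (map nuF (drop i us) @ nuF x # map nuF ws) \<circ>[?n us + k - ?n (take i us)] y"
      proof -
        have "?n us + k - ?n (take i us) = ?n (drop i us) + k" using split[of i us] by linarith
        moreover have "length (drop i us) + length ws < length us + length ws" using that by auto
        ultimately show ?thesis using less.hyps[OF _ sub(2) less.prems(2)] by metis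
      qed
      moreover have "mT (f (map nuF (take i us))) (GG mT aT j (map nuF (drop i us) @ nuF x # map nuF ws)) \<circ>[?n us + k] y
        = mT (f (map nuF (take i us))) (GG mT aT j (map nuF (drop i us) @ nuF x # map nuF ws) \<circ>[?n us + k - ?n (take i us)] y)"
        by (rule mT_tcomp_right[OF f[OF sub(1)] lv(2)[OF sub(2) less.prems(2)]])
          (use split[of i us] assms(3,4) in auto)
      ultimately show ?thesis by simp
    qed
    have 2: "mT (f (map nuF us @ ?x' # map nuF (take i ws))) (GG mT aT j (map nuF (drop i ws)))
      = mT (f (map nuF us @ nuF x # map nuF (take i ws))) (GG mT aT j (map nuF (drop i ws))) \<circ>[?n us + k] y"
      if "i < length ws" for i
    proof -
      have s: "supp (\<lambda>t. leaves t = ?n us + leaves x + ?n (take i ws)) (f (map nuF us @ nuF x # map nuF (take i ws)))"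
        using f[of "us @ x # take i ws"] less.prems(1) sub(3)[of i] assms(2) by (simp add: add.assoc ball_Un)
      show ?thesis
        unfolding fx[OF that] by (rule mT_tcomp_left[OF s y, symmetric]) (use assms(4) in simp)
    qed
    show ?thesis
      unfolding T.conv_marked[of _ _ _ _ "map nuF ws", unfolded append_Cons append_Nil] is_lin_add[OF is_lin_tcomp_left] is_lin_sum[OF is_lin_tcomp_left]
      using 1 2 by (intro arg_cong2[where f = "(+)"] sum.cong refl) (auto simp: take_map drop_map)
  qed
  have EE0: "EE mT aT (Suc j) (map nuF us @ ?x' # map nuF ws) = EE mT aT (Suc j) (map nuF us @ nuF x # map nuF ws) \<circ>[?n us + k] y" for j
    unfolding T.E_Suc by (rule conv) (use E_G_leaves less.hyps less.prems sub in auto)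
  have a: "aT l (EE mT aT l (map nuF us @ ?x' # map nuF ws)) = aT l (EE mT aT l (map nuF us @ nuF x # map nuF ws)) \<circ>[?n us + k] y"
    if "l \<noteq> 0" for l
  proof -
    obtain j where "l = Suc j" using \<open>l \<noteq> 0\<close> by (cases l) auto
    then show ?thesis using EE0[of j] aT_tcomp[OF lv(1)[OF less.prems, of l], of "?n us + k" l y] assms(4) by simp
  qed
  have E0: "EE mT aT 0 (map nuF us @ ?x' # map nuF ws) = EE mT aT 0 (map nuF us @ nuF x # map nuF ws) \<circ>[?n us + k] y"
  proof -
    have "T.tt (map nuF us @ ?x' # map nuF ws) = T.tt (map nuF us @ nuF x # map nuF ws) \<circ>[?n us + k] y"
      by (auto simp: T.tt_def is_lin_zero[OF is_lin_tcomp_left])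
    then show ?thesis
      by (subst (1 2) T.E_0[of _ "Suc (length us + length ws)"])
        (simp_all add: is_lin_diff[OF is_lin_tcomp_left] is_lin_add[OF is_lin_tcomp_left] is_lin_sum[OF is_lin_tcomp_left] a)
  qed
  have EA: "EE mT aT j (map nuF us @ ?x' # map nuF ws) = EE mT aT j (map nuF us @ nuF x # map nuF ws) \<circ>[?n us + k] y" for j
    using EE0 E0 by (cases j) auto
  have "GG mT aT j (map nuF us @ ?x' # map nuF ws) = GG mT aT j (map nuF us @ nuF x # map nuF ws) \<circ>[?n us + k] y" for j
  proof -
    have TH: "T.TH (map nuF us @ ?x' # map nuF (take i ws)) = T.TH (map nuF us @ nuF x # map nuF (take i ws)) \<circ>[?n us + k] y"
      if "i < length ws" for i
    proof -
      have "EE mT aT l (map nuF us @ ?x' # map nuF (take i ws)) = EE mT aT l (map nuF us @ nuF x # map nuF (take i ws)) \<circ>[?n us + k] y" for l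
        using less.hyps[of us "take i ws" l] that less.prems sub by simp
      then show ?thesis
        unfolding T.TH_def
        by (auto simp: is_lin_sum[OF is_lin_tcomp_left] is_lin_add[OF is_lin_tcomp_left] aT_tcomp[OF lv(1)[OF less.prems(1) sub(3)]] assms(4) trans_le_add1 intro!: sum.cong)
    qed
    have "T.conv T.TH (GG mT aT j) (map nuF us @ ?x' # map nuF ws) =
        T.conv T.TH (GG mT aT j) (map nuF us @ nuF x # map nuF ws) \<circ>[?n us + k] y"
      by (rule conv) (use E_G_leaves TH in auto)
    then show ?thesis
      by (subst (1 2) T.G_eq) (simp add: EA is_lin_add[OF is_lin_tcomp_left])
  qed
  then show ?case using EA by blast
qed

lemma graft_list_split:
  "\<lbrakk>1 \<le> i; i \<le> sum_list (map leaves ts)\<rbrakk> \<Longrightarrow>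
    \<exists>us x ws k. ts = us @ x # ws \<and> i = sum_list (map leaves us) + k \<and> 1 \<le> k \<and> k \<le> leaves x \<and>
      graft_list ts i t = us @ graft x k t # ws"
proof (induction ts arbitrary: i)
  case (Cons s ts)
  show ?case
  proof (cases "i \<le> leaves s")
    case True
    then show ?thesis using Cons.prems by (intro exI[of _ "[]"]) auto
  next
    case False
    have "1 \<le> i - leaves s" "i - leaves s \<le> sum_list (map leaves ts)" using Cons.prems False by auto
    from Cons.IH[OF this] obtain us x ws k where "ts = us @ x # ws" "i - leaves s = sum_list (map leaves us) + k" "1 \<le> k" "k \<le> leaves x"
      "graft_list ts (i - leaves s) t = us @ graft x k t # ws" by blast
    then show ?thesis using False
      by (intro exI[of _ "s # us"] exI[of _ x] exI[of _ ws] exI[of _ k]) auto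
  qed
qed simp

lemma nuF_even: "tree_over nu_gens t \<Longrightarrow> supp (\<lambda>t. even (tree_deg t)) (nuF t)"
  using nuF_free[of t] even_nu_deg[of t] by (auto simp: supp_def free_cmp_def)

lemma nuF_graft:
  assumes "tree_over nu_gens t"
  shows "tree_over nu_gens s \<Longrightarrow> 1 \<le> i \<Longrightarrow> i \<le> leaves s \<Longrightarrow> nuF (graft s i t) = nuF s \<circ>[i] nuF t"
proof (induction arbitrary: i rule: nu_tree_induct)
  case Leaf
  then show ?case using tcomp_id_left[of "nuF t :: tree \<Rightarrow>\<^sub>0 'a"] by (simp add: tree_id_def)
next
  case (Node k ts)
  obtain us x ws q where s: "ts = us @ x # ws" "i = sum_list (map leaves us) + q" "1 \<le> q" "q \<le> leaves x"
    "graft_list ts i t = us @ graft x q t # ws"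
    using graft_list_split[of i ts t] Node.prems by auto
  have over: "tree_over nu_gens x" "\<forall>t\<in>set us. tree_over nu_gens t" "\<forall>t\<in>set ws. tree_over nu_gens t"
    using Node(3) s by auto
  have x: "nuF (graft x q t) = (nuF x \<circ>[q] nuF t :: tree \<Rightarrow>\<^sub>0 'a)" using Node(4) s by auto
  have "supp (\<lambda>t. leaves t = sum_list (map leaves ts)) (EE mT aT l (map nuF ts) :: tree \<Rightarrow>\<^sub>0 'a)" for l
    by (rule E_G_leaves[OF Node(3)])
  then have "aT (l - 1) (EE mT aT l (map nuF ts)) \<circ>[i] nuF t = aT (l - 1) (EE mT aT l (map nuF ts) \<circ>[i] (nuF t :: tree \<Rightarrow>\<^sub>0 'a))" for l
    using Node.prems by (intro aT_tcomp) auto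
  then have "aT (l - 1) (EE mT aT l (map nuF (us @ graft x q t # ws)))
    = aT (l - 1) (EE mT aT l (map nuF (us @ x # ws))) \<circ>[i] (nuF t :: tree \<Rightarrow>\<^sub>0 'a)" for l
    using E_G_tcomp[OF nuF_even[OF assms, where 'a = 'a] over(1) s(3,4) over(2,3), of l] by (simp add: x s(1,2))
  then show ?case
    by (simp add: nuF.simps NN_def s(5) is_lin_sum[OF is_lin_tcomp_left]) (simp add: s(1))
qed

lemma nuF_tcomp:
  assumes x: "x \<in> free_cmp nu_gens n d" and y: "y \<in> free_cmp nu_gens m e" and i: "1 \<le> i" "i \<le> n"
  shows "lin_ext nuF (x \<circ>[i] y) = lin_ext nuF x \<circ>[i] lin_ext nuF y"
proof (rule free_eqI[OF x])
  fix s assume s: "tree_over nu_gens s" "leaves s = n" "tree_deg s = d"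
  show "lin_ext nuF (bas s \<circ>[i] y) = lin_ext nuF (bas s) \<circ>[i] lin_ext nuF y"
    by (rule free_eqI[OF y]) (use s i even_nu_deg in \<open>auto intro!: lin_intros simp: tcomp_bas powi_minus_one nuF_graft\<close>)
qed (intro lin_intros)+

subsection \<open>The differential\<close>

text \<open>The boundary is taken on trees and normalized afterwards. That the result depends on the
  normal form only is established in \<open>NFd_eq_ddx\<close>, after the boundary is known to
  preserve the ideal.\<close>

definition NFd :: "(tree \<Rightarrow>\<^sub>0 'k::field) \<Rightarrow> nt \<Rightarrow>\<^sub>0 'k" where "NFd x = NF (dif hq_diff x)"

lemma is_lin_NFd [lin_intros, simp]: "is_lin NFd"
  unfolding NFd_def[abs_def] by (rule is_lin_comp[OF is_lin_NF is_lin_dif])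

lemma is_lin_NFd_comp [lin_intros]: "is_lin f \<Longrightarrow> is_lin (\<lambda>x. NFd (f x))"
  by (rule is_lin_comp) simp_all

lemmas NFd_simps [simp] = is_lin_add[OF is_lin_NFd] is_lin_diff[OF is_lin_NFd] is_lin_minus[OF is_lin_NFd]
  is_lin_zero[OF is_lin_NFd] is_lin_scale[OF is_lin_NFd]

text \<open>It lets the Leibniz signs of trees be expressed by the involution on normal
  forms.\<close>

lemma PP_nf: "PP (nf t :: nt \<Rightarrow>\<^sub>0 'k::field) = scale ((-1) powi tree_deg t) (nf t)"
proof (induction t rule: tree_shape_induct)
  case (Node1 g s)
  have "PP (gop1 g (nf s)) = scale ((-1) powi gen_deg g) (gop1 g (PP (nf s :: nt \<Rightarrow>\<^sub>0 'k)))"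
    using gop_PPp(1)[of g 1 "nf s :: nt \<Rightarrow>\<^sub>0 'k"] by (simp add: PPp_def flip: power_int_mult_distrib)
  then show ?case
    by (simp add: Node1 nf_simps is_lin_scale[OF is_lin_gop(1)[OF is_lin_id]] powi_minus_one_add)
next
  case (Node2 g s t)
  have "PP (gop2 g (nf s) (nf t)) = scale ((-1) powi gen_deg g) (gop2 g (PP (nf s)) (PP (nf t :: nt \<Rightarrow>\<^sub>0 'k)))"
    using gop_PPp(2)[of g 1 "nf s :: nt \<Rightarrow>\<^sub>0 'k" "nf t"] by (simp add: PPp_def flip: power_int_mult_distrib)
  then show ?case
    by (simp add: Node2 nf_simps is_lin_scale[OF is_lin_gop(2)[OF is_lin_id]] is_lin_scale[OF is_lin_gop(3)[OF is_lin_id]]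
      powi_minus_one_add mult_ac)
qed (simp_all add: nf_def evl_other bas_simps sg_def)

lemma plug_zero [simp]: "plug 0 p ts = 0"
  by (rule is_lin_zero[OF is_lin_plug[OF is_lin_id]])

lemma node_ext_cons:
  "node_ext g (cons_left x []) = op1 g x" "node_ext g (cons_left x [t]) = op2 g x (bas t)"
  "node_ext g (cons_right s (cons_left x [])) = op2 g (bas s) x"
  by (rule lin_eqI[where x = x]; auto intro!: lin_intros simp: node_ext_def cons_left_def cons_right_def op_bas)+

lemmas list_op_simps = is_lin_zero[OF is_lin_list_ops(1)[OF is_lin_id]] is_lin_zero[OF is_lin_list_ops(3)[OF is_lin_id]]
  is_lin_add[OF is_lin_list_ops(1)[OF is_lin_id]] is_lin_scale[OF is_lin_list_ops(1)[OF is_lin_id]]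

lemma NFd_op1: "NFd (bas (Node Delta [s])) = - DD (NFd (bas s) :: nt \<Rightarrow>\<^sub>0 'k::field)"
proof -
  have *: "NF (op1 Delta x) = DD (NF x :: nt \<Rightarrow>\<^sub>0 'k)" for x
    by (rule lin_eqI[where x = x]) (auto intro!: lin_intros is_lin_comp[OF is_lin_NF] simp: op_bas nf_simps gop1_def)
  show ?thesis
    by (simp add: NFd_def diff_tree_Node diff_list_Cons list_op_simps node_ext_cons *)
qed

lemma NFd_mT: "NFd (mT x y) = mm (NFd x) (NF y) + mm (PP (NF x)) (NFd y)"
proof (rule lin_eqI[where x = x])
  fix s show "NFd (mT (bas s) y) = mm (NFd (bas s)) (NF y) + mm (PP (NF (bas s))) (NFd y)"
  proof (rule lin_eqI[where x = y])
    fix t show "NFd (mT (bas s) (bas t)) = mm (NFd (bas s)) (NF (bas t)) + mm (PP (NF (bas s))) (NFd (bas t))"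
      by (simp add: NFd_def op_bas diff_tree_Node diff_list_Cons list_op_simps node_ext_cons NF_mT PP_nf)
  qed (intro lin_intros is_lin_comp[OF is_lin_mm_right is_lin_NF])+
qed (intro lin_intros is_lin_comp[OF is_lin_PP is_lin_NF] is_lin_NF)+

lemma hq_diff_A:
  "hq_diff (A (Suc k)) = bas (if k = 0 then Node Delta [Leaf] else Node (A k) [Node Delta [Leaf]])"
  by (cases k) (simp_all add: corolla_def tree_id_def tcomp_bas)

declare hq_diff.simps(1) [simp del]

lemma NFd_aT: "NFd (aT (Suc k) x) = AA k (DD (NF x)) + AA (Suc k) (NFd x)"
proof (rule lin_eqI[where x = x])
  fix s
  have "NF (plug (hq_diff (A (Suc k))) 1 [s]) = AA k (DD (nf s :: nt \<Rightarrow>\<^sub>0 'a))"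
    by (cases k) (simp_all add: hq_diff_A tcomp_bas nf_simps gop1_def)
  then show "NFd (aT (Suc k) (bas s)) = AA k (DD (NF (bas s))) + AA (Suc k) (NFd (bas s) :: nt \<Rightarrow>\<^sub>0 'a)"
    using NF_aT[of "Suc k" "diff_tree hq_diff s :: tree \<Rightarrow>\<^sub>0 'a"]
    by (simp add: NFd_def aT_def op_bas diff_tree_Node diff_list_Cons list_op_simps node_ext_cons powi_minus_one)
qed (auto intro!: lin_intros simp: aT_def)

text \<open>The second order rule for \<open>\<Delta>\<close>, summed over all cuts of the argument
  list into three blocks; evenness of \<open>f\<close> removes its sign.\<close>

lemma conv_DD_conv:
  assumes "\<And>vs. PP (f vs) = f vs"
  shows "V.conv (\<lambda>vs. DD (V.conv f g vs)) h vs =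
    DD (V.conv f (V.conv g h) vs) - V.conv f (\<lambda>vs. DD (V.conv g h vs)) vs + V.conv f (V.conv (\<lambda>vs. DD (g vs)) h) vs"
proof -
  let ?n = "length vs"
  let ?T = "\<lambda>x y z. DD (mm x (mm y z)) - mm x (DD (mm y z)) + mm x (mm (DD y) z)"
  have "V.conv (\<lambda>vs. DD (V.conv f g vs)) h vs =
    (\<Sum>k\<in>{1..<?n}. \<Sum>i\<in>{1..<k}. ?T (f (take i vs)) (g (drop i (take k vs))) (h (drop k vs)))"
    unfolding V.conv_def is_lin_sum[OF is_lin_DD] V.mul_sum
    by (intro sum.cong refl) (auto simp: DD_mm_mm assms min_def intro!: sum.cong)
  also have "\<dots> = (\<Sum>(k, i)\<in>Sigma {1..<?n} (\<lambda>k. {1..<k}). ?T (f (take i vs)) (g (drop i (take k vs))) (h (drop k vs)))"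
    by (subst sum.Sigma) auto
  also have "\<dots> = (\<Sum>(i, k)\<in>Sigma {1..<?n} (\<lambda>i. {1..<?n - i}). ?T (f (take i vs)) (g (take k (drop i vs))) (h (drop k (drop i vs))))"
    by (rule sum.reindex_bij_witness[of _ "\<lambda>(i, k). (i + k, i)" "\<lambda>(k, i). (i, k - i)"])
      (auto simp: take_drop add.commute)
  also have "\<dots> = (\<Sum>i\<in>{1..<?n}. \<Sum>k\<in>{1..<?n - i}. ?T (f (take i vs)) (g (take k (drop i vs))) (h (drop k (drop i vs))))"
    by (subst sum.Sigma) auto
  also have "\<dots> = DD (V.conv f (V.conv g h) vs) - V.conv f (\<lambda>vs. DD (V.conv g h vs)) vs + V.conv f (V.conv (\<lambda>vs. DD (g vs)) h) vs"
    unfolding V.conv_def is_lin_sum[OF is_lin_DD] V.mul_sum sum.distrib sum_subtractf by simp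
  finally show ?thesis .
qed

lemma PP_E:
  assumes "\<forall>w\<in>set ws. PP w = w"
  shows "PP (EE mm AA j ws) = EE mm AA j ws" "PP (V.TH ws) = V.TH ws"
proof -
  have ws: "map PP ws = ws" using assms by (simp add: map_idI)
  show *: "PP (EE mm AA j ws) = EE mm AA j ws" for j
    using EE_GG_hom(1)[of PP mm mm AA AA j ws] by (simp add: PP_mm PP_AA ws)
  show "PP (V.TH ws) = V.TH ws"
    by (simp add: V.TH_def is_lin_sum[OF is_lin_PP] PP_AA *)
qed

lemma sum_telescope:
  fixes f :: "nat \<Rightarrow> 'v::ab_group_add"
  shows "(\<Sum>l<M. f l - f (Suc l)) = f 0 - f M"
  by (induction M) auto

lemma NF_TH: "NF (T.TH vs) = V.TH (map NF vs)"
  by (simp add: T.TH_def V.TH_def is_lin_sum[OF is_lin_NF] NF_aT NF_E_G)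

text \<open>With convolution written as a product, \<open>\<partial>(E_0 G_j) = - \<Delta>(E_1) G_j
  + E_0 \<partial>G_j\<close>; applying the second order rule to
  \<open>\<Delta>(E_0 G_0) G_j\<close> cancels everything but \<open>- \<Delta> E_(j+2)\<close>. The
  formulas for \<open>E_0\<close> and \<open>\<theta>\<close> telescope, since
  \<open>\<partial>(a_(l+1) x) = a_l \<Delta> x + a_(l+1) \<partial>x\<close>; that for
  \<open>G\<close> follows like the one for \<open>E\<close>.\<close>

lemma NFd_E_G:
  assumes "\<forall>v\<in>set vs. NFd v = 0 \<and> PP (NF v) = NF v"
  shows "NFd (EE mT aT j vs) = - DD (EE mm AA (Suc j) (map NF vs)) \<and>
    NFd (GG mT aT j vs) = V.conv (\<lambda>ws. DD (GG mm AA 0 ws)) (GG mm AA j) (map NF vs) - DD (GG mm AA (Suc j) (map NF vs))"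
  using assms
proof (induction "length vs" arbitrary: vs j rule: less_induct)
  case less
  let ?ws = "map NF vs"
  let ?E = "EE mm AA" and ?G = "GG mm AA"
  \<comment> \<open>The second order rule asks for even values on every list. Setting
    \<open>g\<close> to zero on lists with other arguments achieves this and does not change
    convolutions over \<open>?ws\<close>.\<close>
  define f where "f g ws = (if \<forall>w\<in>set ws. PP w = w then g ws else (0 :: nt \<Rightarrow>\<^sub>0 'a))" for g and ws :: "(nt \<Rightarrow>\<^sub>0 'a) list"
  have sub: "\<forall>v\<in>set (take i vs). NFd v = 0 \<and> PP (NF v) = NF v" "\<forall>v\<in>set (drop i vs). NFd v = 0 \<and> PP (NF v) = NF v" for i
    using less.prems by (auto dest: in_set_takeD in_set_dropD)
  have ws: "\<forall>w\<in>set ?ws. PP w = w" "\<forall>w\<in>set (take i ?ws). PP w = w" for i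
    using less.prems by (auto simp: take_map dest: in_set_takeD)
  have f: "PP (f (?E 0) us) = f (?E 0) us" "PP (f V.TH us) = f V.TH us" for us
    by (auto simp: f_def PP_E)
  have conv_f: "V.conv (f g) h ?ws = V.conv g h ?ws" "V.conv (\<lambda>vs. DD (V.conv (f g) k vs)) h ?ws = V.conv (\<lambda>vs. DD (V.conv g k vs)) h ?ws" for g h k
  proof -
    have "\<forall>w\<in>set (take l (take i ?ws)). PP w = w" for l i using ws(1) by (meson in_set_takeD)
    then show "V.conv (f g) h ?ws = V.conv g h ?ws" "V.conv (\<lambda>vs. DD (V.conv (f g) k vs)) h ?ws = V.conv (\<lambda>vs. DD (V.conv g k vs)) h ?ws"
      using ws by (auto simp: V.conv_def f_def intro!: sum.cong arg_cong2[where f = mm] arg_cong[where f = DD])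
  qed
  have IH: "NFd (EE mT aT j (take i vs)) = - DD (?E (Suc j) (take i ?ws))"
    "NFd (GG mT aT j (drop i vs)) = V.conv (\<lambda>ws. DD (?G 0 ws)) (?G j) (drop i ?ws) - DD (?G (Suc j) (drop i ?ws))"
    if "i \<in> {1..<length vs}" for i j
    using less.hyps[of "take i vs" j] less.hyps[of "drop i vs" j] sub that by (auto simp: take_map drop_map)
  have G1: "V.conv (?G 0) (?G j) = ?G (Suc j)" for j by (rule ext) (simp add: V.G_Suc)
  have E1: "V.conv (?E 0) (?G j) = ?E (Suc j)" for j by (rule ext) (simp add: V.E_Suc)
  have conv: "NFd (T.conv g (GG mT aT j) vs) = V.conv (\<lambda>ws. D ws) (?G j) ?ws + V.conv h (V.conv (\<lambda>ws. DD (?G 0 ws)) (?G j)) ?ws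
      - V.conv h (\<lambda>ws. DD (?G (Suc j) ws)) ?ws"
    if "\<And>i. i \<in> {1..<length vs} \<Longrightarrow> NFd (g (take i vs)) = D (take i ?ws)" "\<And>us. NF (g us) = h (map NF us)"
      "\<And>i. PP (h (take i ?ws)) = h (take i ?ws)" for g h D j
    unfolding T.conv_def V.conv_def is_lin_sum[OF is_lin_NFd] sum.distrib[symmetric] sum_subtractf[symmetric]
    by (rule sum.cong) (auto simp: NFd_mT that(1,2) that(3)[unfolded take_map] IH NF_E_G V.conv_def take_map drop_map)
  have ES: "NFd (EE mT aT (Suc j) vs) = - DD (?E (Suc (Suc j)) ?ws)" for j
  proof -
    have "NFd (EE mT aT (Suc j) vs) = V.conv (\<lambda>ws. - DD (?E 1 ws)) (?G j) ?ws
      + V.conv (?E 0) (V.conv (\<lambda>ws. DD (?G 0 ws)) (?G j)) ?ws - V.conv (?E 0) (\<lambda>ws. DD (?G (Suc j) ws)) ?ws"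
      unfolding T.E_Suc by (rule conv) (simp_all add: IH NF_E_G PP_E ws)
    also have "V.conv (\<lambda>ws. - DD (?E 1 ws)) (?G j) ?ws = - V.conv (\<lambda>ws. DD (V.conv (?E 0) (?G 0) ws)) (?G j) ?ws"
      by (simp add: E1) (simp add: V.conv_def sum_negf V.mul_uminus)
    also have "V.conv (\<lambda>ws. DD (V.conv (?E 0) (?G 0) ws)) (?G j) ?ws = DD (V.conv (?E 0) (?G (Suc j)) ?ws)
      - V.conv (?E 0) (\<lambda>ws. DD (?G (Suc j) ws)) ?ws + V.conv (?E 0) (V.conv (\<lambda>ws. DD (?G 0 ws)) (?G j)) ?ws"
      using conv_DD_conv[of "f (?E 0)" "?G 0" "?G j" ?ws] f unfolding conv_f G1 by simp
    finally show ?thesis by (simp add: E1)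
  qed
  define M where "M = Suc (length vs)"
  have E0: "NFd (EE mT aT 0 vs) = - DD (?E 1 ?ws)"
  proof -
    have "NFd (T.tt vs) = 0" using less.prems by (cases vs) (auto simp: T.tt_def)
    then have "NFd (EE mT aT 0 vs) = - (\<Sum>l\<in>{1..<M}. NFd (aT l (EE mT aT l vs)))"
      by (subst T.E_0[of _ M]) (simp_all add: M_def is_lin_sum[OF is_lin_NFd])
    also have "(\<Sum>l\<in>{1..<M}. NFd (aT l (EE mT aT l vs))) = (\<Sum>l<length vs. NFd (aT (Suc l) (EE mT aT (Suc l) vs)))"
      by (rule sum.reindex_bij_witness[of _ Suc "\<lambda>l. l - 1"]) (auto simp: M_def)
    also have "\<dots> = (\<Sum>l<length vs. AA l (DD (?E (Suc l) ?ws)) - AA (Suc l) (DD (?E (Suc (Suc l)) ?ws)))"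
      by (simp add: NFd_aT NF_E_G ES)
    also have "\<dots> = DD (?E 1 ?ws)"
      by (subst sum_telescope) (simp add: V.E_vanish)
    finally show ?thesis .
  qed
  have EA: "NFd (EE mT aT j vs) = - DD (?E (Suc j) ?ws)" for j using ES E0 by (cases j) auto
  have "NFd (GG mT aT j vs) = V.conv (\<lambda>ws. DD (?G 0 ws)) (?G j) ?ws - DD (?G (Suc j) ?ws)" for j
  proof -
    have TH: "NFd (T.TH (take i vs)) = DD (?E 0 (take i ?ws))" if i: "i \<in> {1..<length vs}" for i
    proof -
      have "NFd (T.TH (take i vs)) = (\<Sum>l<i. AA l (DD (?E l (take i ?ws))) - AA (Suc l) (DD (?E (Suc l) (take i ?ws))))"
        unfolding T.TH_def is_lin_sum[OF is_lin_NFd]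
        using i by (intro sum.cong) (auto simp: NFd_aT NF_E_G IH take_map)
      then show ?thesis by (subst (asm) sum_telescope) (simp add: V.E_vanish)
    qed
    have 1: "NFd (GG mT aT j vs) = - DD (?E (Suc j) ?ws) + (V.conv (\<lambda>ws. DD (?E 0 ws)) (?G j) ?ws
      + V.conv V.TH (V.conv (\<lambda>ws. DD (?G 0 ws)) (?G j)) ?ws - V.conv V.TH (\<lambda>ws. DD (?G (Suc j) ws)) ?ws)"
      unfolding T.G_eq[of j vs] NFd_simps(1) EA
      by (rule arg_cong2[where f = "(+)", OF refl conv]) (simp_all add: TH NF_TH PP_E ws)
    have "V.conv (\<lambda>ws. DD (?G 0 ws)) (?G j) ?ws
      = V.conv (\<lambda>ws. DD (?E 0 ws) + DD (V.conv V.TH (?G 0) ws)) (?G j) ?ws"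
      by (rule V.conv_cong) (simp_all flip: V.G_eq DD_simps(1))
    also have "\<dots> = V.conv (\<lambda>ws. DD (?E 0 ws)) (?G j) ?ws + (DD (V.conv V.TH (?G (Suc j)) ?ws)
      - V.conv V.TH (\<lambda>ws. DD (?G (Suc j) ws)) ?ws + V.conv V.TH (V.conv (\<lambda>ws. DD (?G 0 ws)) (?G j)) ?ws)"
      unfolding V.conv_add_left
      using conv_DD_conv[of "f V.TH" "?G 0" "?G j" ?ws] f unfolding conv_f G1 by simp
    finally show ?thesis
      unfolding 1 V.G_eq[of "Suc j" ?ws] by (simp add: algebra_simps)
  qed
  then show ?case using EA by blast
qed

lemma NFd_N:
  assumes "\<forall>v\<in>set vs. NFd v = 0 \<and> PP (NF v) = NF v"
  shows "NFd (NN mT aT vs) = 0"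
proof -
  let ?E = "\<lambda>j. EE mm AA j (map NF vs)" and ?n = "length vs"
  have "NFd (NN mT aT vs) = (\<Sum>l<Suc ?n. NFd (aT l (EE mT aT (Suc l) vs)))"
    by (simp only: T.N_eq[of vs "Suc ?n", OF le_SucI[OF le_SucI[OF order_refl]]] is_lin_sum[OF is_lin_NFd])
  also have "\<dots> = NFd (EE mT aT 1 vs) + (\<Sum>l<?n. NFd (aT (Suc l) (EE mT aT (Suc (Suc l)) vs)))"
    by (simp add: sum.lessThan_Suc_shift aT_def del: sum.lessThan_Suc)
  also have "\<dots> = - DD (?E 2) + (\<Sum>l<?n. AA l (DD (?E (Suc (Suc l)))) - AA (Suc l) (DD (?E (Suc (Suc (Suc l))))))"
    using NFd_E_G[OF assms] by (simp add: NFd_aT NF_E_G numeral_2_eq_2)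
  also have "\<dots> = 0"
    by (subst sum_telescope) (simp add: V.E_vanish numeral_2_eq_2)
  finally show ?thesis .
qed

lemma NFd_nuF: "tree_over nu_gens t \<Longrightarrow> NFd (nuF t :: tree \<Rightarrow>\<^sub>0 'k) = 0 \<and> PP (nfF t) = (nfF t :: nt \<Rightarrow>\<^sub>0 'k::field)"
proof (induction rule: nu_tree_induct)
  case (Node k ts)
  have "PP (NN mm AA (map nfF ts)) = NN mm AA (map PP (map nfF ts :: (nt \<Rightarrow>\<^sub>0 'k) list))"
    by (rule NN_hom) (simp_all add: PP_mm PP_AA)
  also have "map PP (map nfF ts) = (map nfF ts :: (nt \<Rightarrow>\<^sub>0 'k) list)" using Node by auto
  finally show ?case
    using NFd_N[of "map nuF ts :: (tree \<Rightarrow>\<^sub>0 'k) list"] Node by (simp add: nfF_simps nuF.simps(2) flip: nfF_def)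
qed (simp add: nfF_def nf_simps bas_simps sg_def NFd_def)


subsection \<open>The presentations\<close>

lemma diff_tree_zero:
  assumes "\<forall>g\<in>H. \<delta> g = 0"
  shows "tree_over H t \<Longrightarrow> diff_tree \<delta> t = 0" "\<forall>t\<in>set ts. tree_over H t \<Longrightarrow> diff_list \<delta> ts = 0"
  by (induction t and ts rule: tree_list_induct)
    (use assms in \<open>auto simp: diff_tree_Node diff_list_Cons list_op_simps cons_left_def\<close>)

lemma dif_zero:
  assumes "\<forall>g\<in>H. \<delta> g = 0" "supp (tree_over H) x"
  shows "dif \<delta> x = 0"
  by (rule supp_eqI[OF assms(2), of "dif \<delta>" "\<lambda>_. 0"]) (auto intro!: lin_intros diff_tree_zero[OF assms(1)])

lemma free_cmp_supp: "x \<in> free_cmp G n d \<Longrightarrow> supp (tree_over G) x"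
  by (auto simp: supp_def free_cmp_def)

interpretation nu: operad_presentation nu_gens "\<lambda>_. 0 :: tree \<Rightarrow>\<^sub>0 'k::field" ncHyperCom_relators
  by unfold_locales (auto simp: dif_zero[of nu_gens] dest!: free_cmp_supp intro: in_ideal.zero)

lemma hq_derivation: "free_derivation hq_gens (hq_diff :: gen \<Rightarrow> tree \<Rightarrow>\<^sub>0 'k::field)"
proof
  fix g assume "g \<in> hq_gens"
  then show "hq_diff g \<in> (free_cmp hq_gens (gen_arity g) (gen_deg g - 1) :: (tree \<Rightarrow>\<^sub>0 'k) set)"
  proof (cases rule: hq_gens_cases)
    case (4 k)
    then show ?thesis
      by (cases k) (auto simp: hq_diff_A hq_gens intro!: free_cmp_single)
  qed auto
qed

interpretation hq: operad_presentation hq_gens "hq_diff :: gen \<Rightarrow> tree \<Rightarrow>\<^sub>0 'k::field" ncBV_relators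
proof -
  interpret free_derivation hq_gens "hq_diff :: gen \<Rightarrow> tree \<Rightarrow>\<^sub>0 'k" by (rule hq_derivation)
  show "operad_presentation hq_gens (hq_diff :: gen \<Rightarrow> tree \<Rightarrow>\<^sub>0 'k) ncBV_relators"
  proof
    fix r :: "tree \<Rightarrow>\<^sub>0 'k" and n d assume "r \<in> ncBV_relators"
    then have "supp (tree_over ncBV_gens) r"
      unfolding ncBV_relators_eq by (auto simp: ncBV_gens_def intro!: supp_intros supp_bas)
    then have "dif hq_diff r = 0" by (intro dif_zero) (auto simp: ncBV_gens_def)
    then show "in_ideal hq_gens ncBV_relators n (d - 1) (dif hq_diff r)" by (simp add: in_ideal.zero)
  next
    fix g assume g: "g \<in> hq_gens"
    \<comment> \<open>The second boundary of \<open>a_(k+1)\<close> is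
      \<open>a_(k-1) \<Delta>\<Delta>\<close> for positive \<open>k\<close>, which is zero only
      modulo the relators; hence the test on normal forms.\<close>
    have "NFd (hq_diff g) = (0 :: nt \<Rightarrow>\<^sub>0 'k)"
      using g
    proof (cases rule: hq_gens_cases)
      case (4 k)
      have Delta: "NFd (bas (Node Delta [Leaf])) = (0 :: nt \<Rightarrow>\<^sub>0 'k)"
        unfolding NFd_op1 by (simp add: NFd_def)
      show ?thesis
      proof (cases k)
        case 0
        then show ?thesis using 4 Delta by (simp add: hq_diff_A)
      next
        case (Suc j)
        have "hq_diff g = aT k (bas (Node Delta [Leaf]) :: tree \<Rightarrow>\<^sub>0 'k)"
          using 4 Suc by (simp add: hq_diff_A aT_def op_bas)
        then show ?thesis using Delta by (simp add: Suc NFd_aT nf_simps gop1_def)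
      qed
    qed simp_all
    moreover have "dif hq_diff (hq_diff g :: tree \<Rightarrow>\<^sub>0 'k) \<in> free_cmp hq_gens (gen_arity g) (gen_deg g - 2)"
      using dif_free[OF gen_closed[OF g]] by simp
    ultimately show "in_ideal hq_gens ncBV_relators (gen_arity g) (gen_deg g - 2) (dif hq_diff (hq_diff g :: tree \<Rightarrow>\<^sub>0 'k))"
      by (simp add: in_ideal_iff_NF NFd_def)
  qed
qed


subsection \<open>The relators of ncHyperCom\<close>

lemma graft_list_replicate:
  "\<lbrakk>1 \<le> q; q \<le> p\<rbrakk> \<Longrightarrow> graft_list (replicate p Leaf) q t = replicate (q - 1) Leaf @ t # replicate (p - q) Leaf"
proof (induction p arbitrary: q)
  case (Suc p)
  show ?case
  proof (cases "q = 1")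
    case False
    then obtain q' where "q = Suc q'" "1 \<le> q'" using Suc.prems by (cases q) auto
    then show ?thesis using Suc.IH[of q'] Suc.prems by (cases q') auto
  qed simp
qed simp

lemma corolla_Nu_comp:
  assumes "1 \<le> q" "q \<le> p"
  shows "corolla (Nu p) \<circ>[q] corolla (Nu j) =
    bas (Node (Nu p) (replicate (q - 1) Leaf @ Node (Nu j) (replicate j Leaf) # replicate (p - q) Leaf))"
  using assms by (simp add: corolla_def tcomp_bas graft_list_replicate powi_minus_one sum_list_replicate)

lemma NF_corolla_Nu_comp:
  assumes "1 \<le> q" "q \<le> p"
  shows "NF (lin_ext nuF (corolla (Nu p) \<circ>[q] corolla (Nu j))) =
    NN mm AA (replicate (q - 1) (bas Lf) @ NN mm AA (replicate j (bas Lf)) # replicate (p - q) (bas Lf))"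
  unfolding corolla_Nu_comp[OF assms] by (simp add: nfF_simps flip: nfF_def)

text \<open>The instance of \<open>N_relation\<close> in which all arguments are \<open>Lf\<close>
  and \<open>y\<close> is input \<open>i\<close>; the bounds on \<open>i\<close> say that this input
  is neither the first nor the last.\<close>

lemma NF_nuF_relators:
  assumes "r \<in> ncHyperCom_relators"
  shows "NF (lin_ext nuF r) = (0 :: nt \<Rightarrow>\<^sub>0 'k::field)"
proof -
  from assms obtain n i where r: "r = (\<Sum>j = 2..i. corolla (Nu (n - j + 1)) \<circ>[i - j + 1] corolla (Nu j)) -
     (\<Sum>k = 2..n - i + 1. corolla (Nu (n - k + 1)) \<circ>[i] corolla (Nu k))"
    and ni: "3 \<le> n" "2 \<le> i" "i \<le> n - 1"
    unfolding ncHyperCom_relators_def by blast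
  let ?r = "\<lambda>k. replicate k (bas Lf :: nt \<Rightarrow>\<^sub>0 'k)" and ?N = "NN mm AA :: (nt \<Rightarrow>\<^sub>0 'k) list \<Rightarrow> nt \<Rightarrow>\<^sub>0 'k"
  let ?U = "?r (i - 1)" and ?V = "?r (n - i)"
  have "(\<Sum>j = 2..i. NF (lin_ext nuF (corolla (Nu (n - j + 1)) \<circ>[i - j + 1] corolla (Nu j))))
    = (\<Sum>j = 2..i. ?N (?r (i - j) @ ?N (?r j) # ?r (n - i)))"
    by (rule sum.cong) (use ni in \<open>auto simp: NF_corolla_Nu_comp simp del: One_nat_def\<close>)
  also have "\<dots> = (\<Sum>k<length ?U. ?N (take k ?U @ [?N (drop k ?U @ [bas Lf])] @ ?V))"
    by (rule sum.reindex_bij_witness[of _ "\<lambda>k. i - k" "\<lambda>j. i - j"])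
      (auto simp: replicate_append_same min_def simp flip: replicate_Suc, (simp add: Suc_diff_le)?)
  also have "\<dots> = (\<Sum>k\<in>{1..length ?V}. ?N (?U @ [?N (bas Lf # take k ?V)] @ drop k ?V))"
    by (rule V.N_relation) (use ni in auto)
  also have "\<dots> = (\<Sum>k = 2..n - i + 1. ?N (?r (i - 1) @ ?N (?r k) # ?r (n - k + 1 - i)))"
    by (rule sum.reindex_bij_witness[of _ "\<lambda>k. k - 1" "\<lambda>k. k + 1"])
      (use ni in \<open>auto simp: min_def add.commute simp flip: replicate_Suc\<close>)
  also have "\<dots> = (\<Sum>k = 2..n - i + 1. NF (lin_ext nuF (corolla (Nu (n - k + 1)) \<circ>[i] corolla (Nu k))))"
    by (rule sum.cong) (use ni in \<open>auto simp: NF_corolla_Nu_comp simp del: One_nat_def\<close>)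
  finally show ?thesis
    unfolding r is_lin_diff[OF is_lin_lin_extI] is_lin_sum[OF is_lin_lin_extI] NF_simps(2) is_lin_sum[OF is_lin_NF]
    by (simp only: diff_self)
qed

lemma lin_ext_nuF_free: "x \<in> free_cmp nu_gens n d \<Longrightarrow> lin_ext nuF x \<in> free_cmp hq_gens n d"
  by (erule free_cmp_linI) (auto dest: nuF_free)

lemma nuF_ideal: "in_ideal nu_gens ncHyperCom_relators n d x \<Longrightarrow> in_ideal hq_gens ncBV_relators n d (lin_ext nuF x)"
proof (induction rule: in_ideal.induct)
  case (relator r n d)
  then show ?case by (simp add: in_ideal_iff_NF[OF lin_ext_nuF_free] NF_nuF_relators)
next
  case (comp_left n d x y m e i)
  then show ?case
    using nuF_tcomp[OF in_ideal_free[OF comp_left(1)], of y m e i]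
    by (auto intro: in_ideal.comp_left[unfolded One_nat_def] lin_ext_nuF_free)
next
  case (comp_right x n d m e y i)
  then show ?case
    using nuF_tcomp[OF comp_right(1) in_ideal_free[OF comp_right(2)], of i]
    by (auto intro: in_ideal.comp_right[unfolded One_nat_def] lin_ext_nuF_free)
qed (auto simp: lin_ext_add lin_ext_scale intro: in_ideal.intros)

section \<open>A perfect matching up to critical monomials\<close>

subsection \<open>The order on normal monomials\<close>

fun spine_length :: "nt \<Rightarrow> nat" where
  "spine_length Lf = 0"
| "spine_length (Dl w) = spine_length w"
| "spine_length (Ak k w) = spine_length w"
| "spine_length (Pr w v) = Suc (spine_length w)"

text \<open>The letters are ordered as \<open>... < a_2 < a_1 < \<Delta> < m < leaf\<close>, so that
  trading \<open>a_(k+1)\<close> for \<open>a_k \<Delta>\<close> enlarges the word at the first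
  letter where it changes.\<close>

fun spine_word :: "nt \<Rightarrow> int list" where
  "spine_word Lf = [2]"
| "spine_word (Dl w) = 0 # spine_word w"
| "spine_word (Ak k w) = (- 1 - int k) # spine_word w"
| "spine_word (Pr w v) = 1 # spine_word w"

fun factor_word :: "nt \<Rightarrow> int list" where
  "factor_word Lf = []"
| "factor_word (Dl w) = factor_word w"
| "factor_word (Ak k w) = factor_word w"
| "factor_word (Pr w v) = factor_word w @ (int (spine_length v) # spine_word v @ factor_word v)"

text \<open>
  Monomials are compared by the number of products on the left spine, then by the word of
  operations along this spine, then by the right factors starting with the innermost one.
\<close>

definition key :: "nt \<Rightarrow> int list" where "key u = int (spine_length u) # spine_word u @ factor_word u"

text \<open>Each letter determines its constructor and the leaf closes the word, so no spine word is
  a proper prefix of another.\<close>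

lemma spine_word_prefix_free: "spine_word u @ y = spine_word w @ z \<Longrightarrow> spine_word u = spine_word w \<and> y = z"
proof (induction u arbitrary: w)
  case Lf then show ?case by (cases w) auto
next
  case (Dl u) then show ?case by (cases w) auto
next
  case (Ak k u) then show ?case by (cases w) auto
next
  case (Pr u v) then show ?case by (cases w) auto
qed

lemma factor_word_prefix_free: "\<lbrakk>spine_word u = spine_word w; factor_word u @ y = factor_word w @ z\<rbrakk> \<Longrightarrow> u = w \<and> y = z"
proof (induction u arbitrary: w y z)
  case Lf
  then show ?case by (cases w) auto
next
  case (Dl u)
  obtain w' where "w = Dl w'" "spine_word u = spine_word w'" "factor_word u @ y = factor_word w' @ z" using Dl.prems by (cases w) auto
  then show ?case using Dl.IH by blast
next
  case (Ak k u)
  obtain w' where "w = Ak k w'" "spine_word u = spine_word w'" "factor_word u @ y = factor_word w' @ z" using Ak.prems by (cases w) auto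
  then show ?case using Ak.IH by blast
next
  case (Pr u v)
  obtain w' v' where w: "w = Pr w' v'" "spine_word u = spine_word w'" "factor_word u @ int (spine_length v) # spine_word v @ factor_word v @ y = factor_word w' @ int (spine_length v') # spine_word v' @ factor_word v' @ z"
    using Pr.prems by (cases w) auto
  have 1: "u = w'" "spine_word v @ factor_word v @ y = spine_word v' @ factor_word v' @ z" using Pr.IH(1)[OF w(2,3)] by simp_all
  have "spine_word v = spine_word v'" "factor_word v @ y = factor_word v' @ z" using spine_word_prefix_free[OF 1(2)] by simp_all
  then have "v = v' \<and> y = z" by (rule Pr.IH(2))
  then show ?case using w(1) 1(1) by blast
qed

text \<open>Beyond injectivity of \<open>key\<close>, this is what lets a strict comparison survive
  when keys are embedded in longer keys.\<close>

lemma key_prefix_free: "key u @ y = key w @ z \<Longrightarrow> u = w"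
  using spine_word_prefix_free[of u "factor_word u @ y" w "factor_word w @ z"] factor_word_prefix_free[of u w y z] by (auto simp: key_def)

lemma list_less_append:
  fixes a b :: "int list"
  shows "a < b \<Longrightarrow> (\<And>c. b \<noteq> a @ c) \<Longrightarrow> a @ y < b @ z"
proof (induction a arbitrary: b)
  case (Cons x a)
  then obtain x' b' where b: "b = x' # b'" by (cases b) auto
  then show ?case using Cons by auto
qed auto

lemma key_append: "key a < key b \<Longrightarrow> key a @ y < key b @ z"
  by (rule list_less_append) (use key_prefix_free[of b "[]" a] in auto)

lemma list_less_cancel: "(a @ y < a @ z) = (y < (z :: int list))"
  by (induction a) auto

lemma key_Pr: "key (Pr a y) = int (Suc (spine_length a)) # 1 # spine_word a @ factor_word a @ key y"
  by (simp add: key_def)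

lemma key_Pr_left: "key a < key b \<Longrightarrow> key (Pr a y) < key (Pr b z)"
  using key_append[of a b "key y" "key z"] unfolding key_Pr by (auto simp: key_def)

lemma key_Ak_left: "key a < key b \<Longrightarrow> key (Ak k a) < key (Ak k b)"
  by (auto simp: key_def)

lemma key_Pr_right: "key y < key z \<Longrightarrow> key (Pr a y) < key (Pr a z)"
  unfolding key_Pr by (simp add: list_less_cancel)

lemma spine_length_less: "spine_length u < spine_length w \<Longrightarrow> key u < key w"
  by (simp add: key_def)

lemma key_less_spine_length: "key u < key w \<Longrightarrow> spine_length u \<le> spine_length w"
  by (auto simp: key_def)

lemma nlv_pos: "0 < nlv u"
  by (induction u) auto

text \<open>Each constructor other than \<open>Lf\<close> strictly raises the sum of arity and
  degree, and this sum bounds the index of an \<open>Ak\<close>. Descent along keys therefore ends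
  in every arity and degree.\<close>

lemma finite_nt: "finite {u. nlv u + ndeg u \<le> N}"
proof (induction N)
  case 0
  have "\<not> nlv u + ndeg u \<le> 0" for u using nlv_pos[of u] by simp
  then show ?case by (simp only: Collect_empty_eq[THEN iffD2] finite.emptyI simp_thms)
next
  case (Suc N)
  let ?F = "{u. nlv u + ndeg u \<le> N}"
  have "{u. nlv u + ndeg u \<le> Suc N} \<subseteq> {Lf} \<union> Dl ` ?F \<union> (\<lambda>(k, w). Ak k w) ` ({..N} \<times> ?F) \<union> (\<lambda>(w, v). Pr w v) ` (?F \<times> ?F)"
  proof
    fix u assume u: "u \<in> {u. nlv u + ndeg u \<le> Suc N}"
    show "u \<in> {Lf} \<union> Dl ` ?F \<union> (\<lambda>(k, w). Ak k w) ` ({..N} \<times> ?F) \<union> (\<lambda>(w, v). Pr w v) ` (?F \<times> ?F)"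
    proof (cases u)
      case (Dl w)
      then have "w \<in> ?F" using u by simp
      then show ?thesis using Dl by blast
    next
      case (Ak k w)
      then have "(k, w) \<in> {..N} \<times> ?F" using u by simp
      then show ?thesis using Ak by force
    next
      case (Pr w v)
      then have "(w, v) \<in> ?F \<times> ?F" using u nlv_pos[of w] nlv_pos[of v] by simp
      then show ?thesis using Pr by force
    qed simp
  qed
  then show ?case by (rule finite_subset) (use Suc in auto)
qed


subsection \<open>The differential on normal monomials\<close>

definition ddb :: "nt \<Rightarrow> nt \<Rightarrow>\<^sub>0 'k::field" where "ddb u = NFd (bas (tr u))"

lemma ddb_simps:
  "ddb Lf = (0 :: nt \<Rightarrow>\<^sub>0 'k::field)"
  "ddb (Dl w) = - DD (ddb w :: nt \<Rightarrow>\<^sub>0 'k)"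
  "nrm w \<Longrightarrow> ddb (Ak k w) = AA k (DD (bas w)) + AA (Suc k) (ddb w :: nt \<Rightarrow>\<^sub>0 'k)"
  "nrm w \<Longrightarrow> nrm v \<Longrightarrow> ddb (Pr w v) = mm (ddb w) (bas v) + scale (sg w) (mm (bas w) (ddb v) :: nt \<Rightarrow>\<^sub>0 'k)"
proof -
  show "ddb Lf = (0 :: nt \<Rightarrow>\<^sub>0 'k)" by (simp add: ddb_def NFd_def)
  show "ddb (Dl w) = - DD (ddb w :: nt \<Rightarrow>\<^sub>0 'k)" by (simp add: ddb_def NFd_op1)
  show "ddb (Ak k w) = AA k (DD (bas w)) + AA (Suc k) (ddb w :: nt \<Rightarrow>\<^sub>0 'k)" if "nrm w"
    using NFd_aT[of k "bas (tr w) :: tree \<Rightarrow>\<^sub>0 'k"] that by (simp add: ddb_def aT_def op_bas nf_tr)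
  show "ddb (Pr w v) = mm (ddb w) (bas v) + scale (sg w) (mm (bas w) (ddb v) :: nt \<Rightarrow>\<^sub>0 'k)" if "nrm w" "nrm v"
    using NFd_mT[of "bas (tr w) :: tree \<Rightarrow>\<^sub>0 'k" "bas (tr v)"] that
    by (simp add: ddb_def op_bas nf_tr bas_simps(1) del: scale_single)
qed

abbreviation fil :: "nat \<Rightarrow> (nt \<Rightarrow>\<^sub>0 'k::field) \<Rightarrow> bool" where "fil k \<equiv> supp (\<lambda>u. spine_length u \<le> k)"

lemma fil_mono: "fil k x \<Longrightarrow> k \<le> l \<Longrightarrow> fil l x"
  by (erule supp_mono) simp

lemma fil_DD: "fil k x \<Longrightarrow> fil k (DD x)"
  by (rule supp_linI[OF _ is_lin_DD], assumption, rename_tac u, case_tac u) (auto simp: bas_simps intro!: supp_bas)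

lemma fil_AA: "fil k x \<Longrightarrow> fil k (AA l x)"
  by (cases l) (auto simp: bas_simps elim!: supp_linI intro!: supp_bas)

lemma fil_PrL: "fil (Suc (spine_length w)) (PrL w x)"
  by (rule supp_linI[of "\<lambda>_. True"]) (auto simp: supp_def bas_simps)

text \<open>Rewriting at a reducible left factor moves the second argument into a right factor, so
  that the spine does not grow; only an irreducible \<open>s\<close> gains a product. This gap is
  what makes rewritten terms lower.\<close>

lemma fil_mulb: "fil (if reducible_left s then spine_length s else Suc (spine_length s)) (mulb s t)"
proof (cases s rule: nt_left_cases)
  case irr
  then show ?thesis by (simp add: mulb_irreducible supp_bas)
next
  case (Pr w v)
  then show ?thesis by (simp add: fil_PrL)
next
  case (DlPr w v)
  then show ?thesis by (auto intro!: supp_intros fil_DD fil_PrL)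
qed

lemma fil_mm: "fil k x \<Longrightarrow> fil (Suc k) (mm x y)"
proof (erule supp_linI[OF _ is_lin_mm_left])
  fix u assume u: "spine_length u \<le> k"
  show "fil (Suc k) (mm (bas u) y)"
  proof (rule supp_linI[of "\<lambda>_. True" y, OF _ is_lin_mm_right])
    fix t show "fil (Suc k) (mm (bas u) (bas t) :: nt \<Rightarrow>\<^sub>0 'a)"
      unfolding bas_simps by (rule fil_mono[OF fil_mulb]) (use u in auto)
  qed (simp add: supp_def)
qed

lemma fil_ddb: "nrm u \<Longrightarrow> fil (spine_length u) (ddb u)"
proof (induction u)
  case (Pr w v)
  then have "mm (bas w) (ddb v) = (PrL w (ddb v) :: nt \<Rightarrow>\<^sub>0 'a)" by (simp add: mm_irreducible)
  then show ?case using Pr by (auto simp: ddb_simps intro!: supp_add supp_scale fil_mm fil_PrL)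
qed (auto simp: ddb_simps supp_bas intro!: supp_add supp_uminus fil_AA fil_DD)


subsection \<open>Leading terms\<close>

abbreviation below :: "nt \<Rightarrow> (nt \<Rightarrow>\<^sub>0 'k::field) \<Rightarrow> bool" where "below p \<equiv> supp (\<lambda>u. key u < key p)"

definition lead :: "nt \<Rightarrow> (nt \<Rightarrow>\<^sub>0 'k::field) \<Rightarrow> bool"
  where "lead p x \<longleftrightarrow> (\<exists>c r. c \<noteq> 0 \<and> x = scale c (bas p) + r \<and> below p r)"

lemma lead_add:
  assumes "lead p x" "below p y"
  shows "lead p (x + y)"
proof -
  obtain c r where "c \<noteq> 0" "x = scale c (bas p) + r" "below p r" using assms(1) unfolding lead_def by blast
  then show ?thesis
    unfolding lead_def using assms(2) by (intro exI[of _ c] exI[of _ "r + y"]) (simp add: supp_add add.assoc)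
qed

lemma lead_scale:
  assumes "lead p x" "c \<noteq> 0"
  shows "lead p (scale c x)"
proof -
  obtain e r where "e \<noteq> 0" "x = scale e (bas p) + r" "below p r" using assms(1) unfolding lead_def by blast
  then show ?thesis
    unfolding lead_def using assms(2)
    by (intro exI[of _ "c * e"] exI[of _ "scale c r"]) (simp add: supp_scale scale_add_right)
qed

lemma lead_linI:
  assumes "lead p x" "is_lin f" "lead q (f (bas p))" "\<And>u. key u < key p \<Longrightarrow> below q (f (bas u))"
  shows "lead q (f x)"
proof -
  obtain c r where cr: "c \<noteq> 0" "x = scale c (bas p) + r" "below p r" using assms(1) unfolding lead_def by blast
  have "below q (f r)" by (rule supp_linI[OF cr(3) assms(2,4)])
  then show ?thesis
    unfolding cr(2) is_lin_add[OF assms(2)] is_lin_scale[OF assms(2)]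
    by (intro lead_add lead_scale[OF assms(3) cr(1)])
qed

lemma lead_bas: "lead p (bas p)"
  unfolding lead_def by (intro exI[of _ 1] exI[of _ 0]) auto

lemma fil_below: "fil k x \<Longrightarrow> k < spine_length p \<Longrightarrow> below p x"
  by (erule supp_mono) (auto intro!: spine_length_less)

lemma below_PrL: "below p x \<Longrightarrow> below (Pr w p) (PrL w x)"
  by (erule supp_linI[OF _ is_lin_PrL]) (auto simp: bas_simps supp_bas key_Pr_right)

lemma lead_PrL: "lead p x \<Longrightarrow> lead (Pr w p) (PrL w x)"
  by (rule lead_linI[OF _ is_lin_PrL]) (auto simp: bas_simps supp_bas key_Pr_right lead_bas)

lemma below_PrL_key: "key w < key w' \<Longrightarrow> below (Pr w' v) (PrL w x)"
  by (rule supp_linI[of "\<lambda>_. True", OF _ is_lin_PrL]) (auto simp: bas_simps supp_bas supp_def[of "\<lambda>_. True"] key_Pr_left)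

text \<open>For reducible \<open>u\<close> the spine of the product is no longer than that of
  \<open>u\<close>, hence shorter than that of \<open>Pr w v\<close>; for irreducible
  \<open>u\<close> the product is normal already and compares by its left factor.\<close>

lemma mulb_below: "key u < key w \<Longrightarrow> below (Pr w v) (mulb u t)"
proof (cases "reducible_left u")
  case True
  assume "key u < key w"
  then show ?thesis using fil_mulb[of u t] True key_less_spine_length[of u w] by (intro fil_below[of "spine_length u"]) auto
qed (simp add: mulb_irreducible supp_bas key_Pr_left)

lemma lead_mm: "lead w x \<Longrightarrow> \<not> reducible_left w \<Longrightarrow> lead (Pr w v) (mm x (bas v))"
  by (rule lead_linI[OF _ is_lin_mm_left]) (auto simp: bas_simps mulb_irreducible lead_bas mulb_below)

lemma below_mm_AA: "below w x \<Longrightarrow> below (Pr (Ak 0 w) v) (mm (AA 1 x) y)"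
proof (erule supp_linI[OF _ is_lin_comp[OF is_lin_mm_left is_lin_AA]])
  fix u assume u: "key u < key w"
  have "mm (AA 1 (bas u)) y = PrL (Ak 0 u) y"
    unfolding One_nat_def bas_simps by (rule mm_irreducible) simp
  then show "below (Pr (Ak 0 w) v) (mm (AA 1 (bas u)) y)"
    using u below_PrL_key[of "Ak 0 u" "Ak 0 w" v y] key_Ak_left by simp
qed

lemma lead_mm_AA: "lead w x \<Longrightarrow> lead v y \<Longrightarrow> lead (Pr (Ak 0 w) v) (mm (AA 1 x) y)"
proof (erule lead_linI[OF _ is_lin_comp[OF is_lin_mm_left is_lin_AA]])
  assume "lead v y"
  then show "lead (Pr (Ak 0 w) v) (mm (AA 1 (bas w)) y)"
    unfolding One_nat_def bas_simps by (simp add: mm_irreducible lead_PrL)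
qed (simp add: below_mm_AA[unfolded One_nat_def] supp_bas)


subsection \<open>Critical monomials and the matching\<close>

text \<open>These are the combs \<open>m(a_1 m(... a_1 m(Lf, v_1) ..., v_(r-1)), v_r)\<close> with
  critical \<open>v_i\<close>, the shape in which \<open>\<nu>(Lf, v_1, ..., v_r)\<close> has its
  leading monomial.\<close>

fun critical :: "nt \<Rightarrow> bool" where
  "critical Lf = True"
| "critical (Pr Lf v) = critical v"
| "critical (Pr (Ak 0 w) v) = (is_Pr w \<and> critical w \<and> critical v)"
| "critical _ = False"

text \<open>
  Since \<open>\<partial>(a\<^sub>k\<^sub>+\<^sub>1 w) = a\<^sub>k \<Delta> w \<plusminus> a\<^sub>k\<^sub>+\<^sub>1 \<partial>w\<close>, trading \<open>a\<^sub>k\<^sub>+\<^sub>1\<close> for \<open>a\<^sub>k \<Delta>\<close> at a suitable place gives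
  a partner \<open>t\<close> of \<open>s\<close> which is the largest monomial of \<open>\<partial>s\<close>. The only left factors at which this
  is impossible are \<open>Lf\<close> and \<open>a\<^sub>1 w\<close> with \<open>w\<close> a critical product, because \<open>\<Delta> w\<close> is then reducible
  as a left factor.
\<close>

inductive matched :: "nt \<Rightarrow> nt \<Rightarrow> bool" where
  Ak_0: "\<not> is_Dl w \<Longrightarrow> matched (Ak 0 w) (Dl w)"
| Ak_Suc: "\<not> is_Dl w \<Longrightarrow> matched (Ak (Suc k) w) (Ak k (Dl w))"
| Pr_Lf: "matched v v' \<Longrightarrow> matched (Pr Lf v) (Pr Lf v')"
| Pr_critical: "\<lbrakk>critical w; is_Pr w; matched v v'\<rbrakk> \<Longrightarrow> matched (Pr (Ak 0 w) v) (Pr (Ak 0 w) v')"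
| Pr_Ak: "\<lbrakk>is_Pr w; matched w w'\<rbrakk> \<Longrightarrow> matched (Pr (Ak 0 w) v) (Pr (Ak 0 w') v)"
| Pr_left: "\<lbrakk>matched w w'; \<not> reducible_left w; \<not> reducible_left w'\<rbrakk> \<Longrightarrow> matched (Pr w v) (Pr w' v)"

lemma critical_Pr_cases:
  assumes "critical (Pr w v)"
  obtains "w = Lf" "critical v" | w' where "w = Ak 0 w'" "is_Pr w'" "critical w'" "critical v"
  using assms by (cases "Pr w v" rule: critical.cases) auto

lemma critical_nrm: "critical u \<Longrightarrow> nrm u"
  by (induction u rule: critical.induct) auto

lemma matched_is_Pr: "matched s t \<Longrightarrow> is_Pr s = is_Pr t"
  by (induction rule: matched.induct) auto

lemma matched_not_critical: "matched s t \<Longrightarrow> \<not> critical s \<and> \<not> critical t"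
proof (induction rule: matched.induct)
  case (Pr_left w w' v)
  then show ?case
    by (cases w; cases w') (auto elim!: critical_Pr_cases elim: matched.cases simp: matched_is_Pr)
qed auto

lemma matched_nrm: "matched s t \<Longrightarrow> nrm s = nrm t"
  by (induction rule: matched.induct) auto

lemma matched_gr: "matched s t \<Longrightarrow> nlv s = nlv t \<and> ndeg s = Suc (ndeg t) \<and> spine_length s = spine_length t"
  by (induction rule: matched.induct) auto

lemma matched_Lf: "\<not> matched s Lf" and matched_Ak_Pr: "is_Pr w \<Longrightarrow> \<not> matched s (Ak k w)"
  by (auto elim: matched.cases)

lemma matched_Pr_Lf_inv: "matched s (Pr Lf v) \<Longrightarrow> \<exists>v'. s = Pr Lf v' \<and> matched v' v"
  by (cases rule: matched.cases) (auto simp: matched_Lf)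

lemma matched_Pr_Ak_inv: "\<lbrakk>matched s (Pr (Ak 0 w) v); is_Pr w\<rbrakk> \<Longrightarrow>
    (\<exists>v'. s = Pr (Ak 0 w) v' \<and> critical w \<and> matched v' v) \<or> (\<exists>w'. s = Pr (Ak 0 w') v \<and> matched w' w)"
  by (cases rule: matched.cases) (auto simp: matched_Ak_Pr)

lemma matched_Pr_inv: "matched s (Pr w v) \<Longrightarrow> w = Lf \<or> (\<exists>x. w = Ak 0 x \<and> is_Pr x) \<or> (\<exists>w'. s = Pr w' v \<and> matched w' w)"
  by (cases rule: matched.cases) (auto dest: matched_is_Pr)

text \<open>Two rules with the same target could overlap only if a left factor were critical and
  matched at the same time.\<close>

lemma matched_inj: "matched s t \<Longrightarrow> matched s' t \<Longrightarrow> s = s'"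
proof (induction arbitrary: s' rule: matched.induct)
  case (Ak_0 w)
  then show ?case by (auto elim: matched.cases)
next
  case (Ak_Suc w k)
  then show ?case by (auto elim: matched.cases)
next
  case (Pr_Lf v v')
  then show ?case using matched_Pr_Lf_inv by blast
next
  case (Pr_critical w v v')
  then show ?case using matched_Pr_Ak_inv[OF Pr_critical.prems] matched_not_critical by blast
next
  case (Pr_Ak w w' v)
  then show ?case using matched_Pr_Ak_inv[OF Pr_Ak.prems] matched_is_Pr matched_not_critical by blast
next
  case (Pr_left w w' v)
  then show ?case using matched_Pr_inv[OF Pr_left.prems] matched_Lf matched_Ak_Pr by blast
qed

text \<open>For a product, the left factor either admits a trade at its root, or it is
  \<open>Lf\<close> or \<open>a_1 x\<close> with \<open>x\<close> a product; then the question
  passes to \<open>x\<close> and, if \<open>x\<close> is critical or there is no \<open>x\<close>,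
  to the right factor.\<close>

lemma matched_total: "nrm u \<Longrightarrow> critical u \<or> (\<exists>t. matched u t) \<or> (\<exists>s. matched s u)"
proof (induction "size u" arbitrary: u rule: less_induct)
  case less
  show ?case
  proof (cases u)
    case (Dl w)
    then show ?thesis using less.prems matched.Ak_0[of w] by auto
  next
    case (Ak k w)
    show ?thesis
    proof (cases w)
      case (Dl x)
      then show ?thesis using Ak less.prems matched.Ak_Suc[of x k] by auto
    qed (use Ak matched.Ak_0[of w] matched.Ak_Suc[of w "k - 1"] in \<open>cases k; auto\<close>)+
  next
    case (Pr w v)
    have v: "critical v \<or> (\<exists>t. matched v t) \<or> (\<exists>s. matched s v)" using less.hyps[of v] less.prems Pr by auto
    show ?thesis
    proof (cases w)
      case Lf
      then show ?thesis using v Pr by (auto intro: matched.Pr_Lf)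
    next
      case (Dl x)
      then have "matched (Ak 0 x) w" "\<not> reducible_left w" using less.prems Pr by (auto intro: matched.Ak_0)
      then show ?thesis using Pr matched.Pr_left[of "Ak 0 x" w v] by auto
    next
      case (Ak k x)
      have x: "nrm x" using less.prems Pr Ak by simp
      show ?thesis
      proof (cases "k = 0 \<and> is_Pr x")
        case True
        have "critical x \<or> (\<exists>t. matched x t) \<or> (\<exists>s. matched s x)" using less.hyps[of x] x Pr Ak by auto
        have u: "u = Pr (Ak 0 x) v" using Pr Ak True by simp
        show ?thesis
        proof (cases "critical x")
          case c: True
          then show ?thesis
            using v True matched.Pr_critical[OF c, of v] matched.Pr_critical[OF c, of _ v] unfolding u by (metis critical.simps(3))
        next
          case False
          then show ?thesis
            using \<open>critical x \<or> (\<exists>t. matched x t) \<or> (\<exists>s. matched s x)\<close> True unfolding u by (metis matched.Pr_Ak matched_is_Pr)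
        qed
      next
        case False
        \<comment> \<open>Outside the excluded case both partners stay irreducible as left factors;
          in particular \<open>\<Delta> x\<close> does when \<open>k = 0\<close> and
          \<open>x\<close> is not a product.\<close>
        have "(\<exists>t. matched w t \<and> \<not> reducible_left t) \<or> (\<exists>s. matched s w \<and> \<not> reducible_left s)"
        proof (cases "is_Dl x")
          case True
          then obtain y where "x = Dl y" by (cases x) auto
          then have "matched (Ak (Suc k) y) w" using Ak x by (auto intro: matched.Ak_Suc)
          then show ?thesis by fastforce
        next
          case nD: False
          show ?thesis
          proof (cases k)
            case 0
            then have "matched w (Dl x)" "\<not> reducible_left (Dl x)" using Ak nD False by (auto intro: matched.Ak_0)
            then show ?thesis by blast
          next
            case (Suc l)
            then have "matched w (Ak l (Dl x))" using Ak nD by (auto intro: matched.Ak_Suc)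
            then show ?thesis by fastforce
          qed
        qed
        then show ?thesis using Pr Ak matched.Pr_left[of w _ v] matched.Pr_left[of _ w v] by auto
      qed
    next
      case Pr': (Pr x y)
      then show ?thesis using less.prems Pr by simp
    qed
  qed auto
qed

lemma ddb_Pr_irreducible:
  "nrm (Pr w v) \<Longrightarrow> ddb (Pr w v) = mm (ddb w) (bas v) + scale (sg w) (PrL w (ddb v))"
  by (simp add: ddb_simps mm_irreducible)

text \<open>The term \<open>\<Delta>(w) v\<close> in the boundary of \<open>m(a_1 w, v)\<close> has
  a reducible left factor, so after rewriting its spine is too short to compete.\<close>

lemma below_Dl_mulb:
  assumes "is_Pr w" "spine_length w \<le> spine_length w'"
  shows "below (Pr (Ak 0 w') v') (mm (DD (bas w)) (bas v))"
proof -
  have "DD (bas w) = (bas (Dl w) :: nt \<Rightarrow>\<^sub>0 'a)" using assms(1) by (cases w) (auto simp: bas_simps)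
  then show ?thesis
    using fil_mulb[of "Dl w" v] assms by (intro fil_below[of "spine_length w"]) (auto simp: bas_simps)
qed

text \<open>The one trade that could produce a larger monomial, \<open>a_1 w\<close> for
  \<open>\<Delta> w\<close>, falls into shorter spines. Thus in the rule \<open>Pr_critical\<close>
  the boundary of the left factor cannot outweigh that of the right factor.\<close>

lemma critical_ddb: "critical u \<Longrightarrow> below u (ddb u)"
proof (induction u rule: critical.induct)
  case (2 v)
  then show ?case by (simp add: ddb_simps critical_nrm mm_irreducible below_PrL supp_scale)
next
  case (3 w v)
  then have n: "nrm (Pr (Ak 0 w) v)" "nrm w" using critical_nrm by auto
  show ?case
    unfolding ddb_Pr_irreducible[OF n(1)] ddb_simps(3)[OF n(2)] AA_0 mm_simps
    using 3 by (intro supp_add supp_scale below_PrL below_mm_AA[unfolded One_nat_def] below_Dl_mulb) auto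
qed (auto simp: ddb_simps)

lemma sg_nonzero: "sg w \<noteq> (0 :: 'k::field)"
  by (simp add: sg_def)

lemma matched_key: "matched s t \<Longrightarrow> key s < key t"
proof (induction rule: matched.induct)
  case (Pr_left w w' v)
  then show ?case by (simp add: key_Pr_left)
qed (auto simp: key_Pr_right key_Pr_left key_Ak_left, auto simp: key_def)

text \<open>The Leibniz rule splits the boundary of \<open>s\<close> into the summand containing the
  trade and summands that act elsewhere. The latter are lower because a source has a smaller key
  than its target, because a reducible left factor shortens the spine, or by
  \<open>critical_ddb\<close>.\<close>

lemma matched_lead: "matched s t \<Longrightarrow> nrm s \<Longrightarrow> lead t (ddb s :: nt \<Rightarrow>\<^sub>0 'k::field)"
proof (induction rule: matched.induct)
  case (Ak_0 w)
  have "below (Dl w) (AA (Suc 0) (ddb w) :: nt \<Rightarrow>\<^sub>0 'k)"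
    by (rule supp_linI[OF fil_ddb is_lin_AA]) (use Ak_0 in \<open>auto simp: bas_simps key_def intro!: supp_bas\<close>)
  moreover have "DD (bas w) = (bas (Dl w) :: nt \<Rightarrow>\<^sub>0 'k)" using Ak_0 by (cases w) (auto simp: bas_simps)
  ultimately show ?case using Ak_0 by (simp add: ddb_simps lead_add lead_bas)
next
  case (Ak_Suc w k)
  have "below (Ak k (Dl w)) (AA (Suc (Suc k)) (ddb w) :: nt \<Rightarrow>\<^sub>0 'k)"
    by (rule supp_linI[OF fil_ddb is_lin_AA]) (use Ak_Suc in \<open>auto simp: bas_simps key_def intro!: supp_bas\<close>)
  moreover have "DD (bas w) = (bas (Dl w) :: nt \<Rightarrow>\<^sub>0 'k)" using Ak_Suc by (cases w) (auto simp: bas_simps)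
  ultimately show ?case using Ak_Suc by (simp add: ddb_simps lead_add lead_bas bas_simps)
next
  case (Pr_Lf v v')
  then show ?case by (simp add: ddb_simps mm_irreducible lead_PrL lead_scale sg_nonzero)
next
  case (Pr_critical w v v')
  have n: "nrm w" "nrm v" using Pr_critical by auto
  have "below (Pr (Ak 0 w) v') (mm (ddb (Ak 0 w)) (bas v) :: nt \<Rightarrow>\<^sub>0 'k)"
    unfolding ddb_simps(3)[OF n(1)] AA_0 mm_simps
    using Pr_critical critical_ddb[of w] by (intro supp_add below_mm_AA[unfolded One_nat_def] below_Dl_mulb) auto
  moreover have "lead (Pr (Ak 0 w) v') (scale (sg (Ak 0 w)) (PrL (Ak 0 w) (ddb v)) :: nt \<Rightarrow>\<^sub>0 'k)"
    using Pr_critical by (intro lead_scale lead_PrL sg_nonzero) auto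
  ultimately show ?case
    unfolding ddb_Pr_irreducible[OF Pr_critical.prems] by (subst add.commute) (rule lead_add)
next
  case (Pr_Ak w w' v)
  have n: "nrm w" "nrm v" using Pr_Ak by auto
  have "lead (Pr (Ak 0 w') v) (mm (AA 1 (ddb w)) (bas v) :: nt \<Rightarrow>\<^sub>0 'k)"
    using Pr_Ak n by (intro lead_mm_AA lead_bas) auto
  moreover have "below (Pr (Ak 0 w') v) (mm (DD (bas w)) (bas v) :: nt \<Rightarrow>\<^sub>0 'k)"
    using Pr_Ak matched_gr[of w w'] by (intro below_Dl_mulb) auto
  moreover have "below (Pr (Ak 0 w') v) (scale (sg (Ak 0 w)) (PrL (Ak 0 w) (ddb v)) :: nt \<Rightarrow>\<^sub>0 'k)"
    using Pr_Ak.hyps matched_key[of w w'] matched_gr[of w w'] by (intro supp_scale below_PrL_key) (auto simp: key_def)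
  ultimately have "lead (Pr (Ak 0 w') v) (mm (AA 1 (ddb w)) (bas v) + mm (DD (bas w)) (bas v) + scale (sg (Ak 0 w)) (PrL (Ak 0 w) (ddb v)) :: nt \<Rightarrow>\<^sub>0 'k)"
    by (intro lead_add)
  then show ?case
    unfolding ddb_Pr_irreducible[OF Pr_Ak.prems] ddb_simps(3)[OF n(1)] AA_0 mm_simps by (simp add: add_ac)
next
  case (Pr_left w w' v)
  then have "lead (Pr w' v) (mm (ddb w) (bas v) :: nt \<Rightarrow>\<^sub>0 'k)" by (intro lead_mm) auto
  moreover have "below (Pr w' v) (scale (sg w) (PrL w (ddb v)) :: nt \<Rightarrow>\<^sub>0 'k)"
    using Pr_left matched_key by (intro supp_scale below_PrL_key) auto
  ultimately show ?case
    unfolding ddb_Pr_irreducible[OF Pr_left.prems] by (rule lead_add)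
qed

subsection \<open>Trees of critical monomials\<close>

lemma E_Lf_Suc: "EE mm AA (Suc j) (x # vs) = (\<Sum>i<length vs. mm (EE mm AA 0 (x # take i vs)) (GG mm AA j (drop i vs)))"
  by (simp add: V.E_Suc V.conv_Cons)

text \<open>
  Only \<open>E\<^sub>0\<close> and \<open>E\<^sub>1\<close> reach the maximal number of products on the left spine; hence modulo shorter
  spines \<open>\<nu>(x, vs, v)\<close> is \<open>- m(a\<^sub>1 \<nu>(x, vs), v)\<close>.
\<close>

lemma fil_E:
  "(\<forall>j. fil (length vs) (EE mm AA j (bas Lf # vs))) \<and>
    (vs \<noteq> [] \<longrightarrow> (\<forall>j. fil (length vs - 1) (EE mm AA (Suc (Suc j)) (bas Lf # vs :: (nt \<Rightarrow>\<^sub>0 'k::field) list))))"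
proof (induction "length vs" arbitrary: vs rule: less_induct)
  case less
  have IH: "fil i (EE mm AA 0 (bas Lf # take i vs))" if "i < length vs" for i
    using less[of "take i vs"] that by auto
  have 1: "fil (length vs) (EE mm AA (Suc j) (bas Lf # vs))" for j
    unfolding E_Lf_Suc by (rule supp_sum) (auto intro!: fil_mono[OF fil_mm[OF IH]])
  have 2: "fil (length vs - 1) (EE mm AA (Suc (Suc j)) (bas Lf # vs))" for j
    unfolding E_Lf_Suc
  proof (rule supp_sum)
    fix i assume i: "i \<in> {..<length vs}"
    show "fil (length vs - 1) (mm (EE mm AA 0 (bas Lf # take i vs)) (GG mm AA (Suc j) (drop i vs)))"
    proof (cases "Suc i = length vs")
      case True
      then have "drop i vs = [last vs]" by (metis append_butlast_last_id append_eq_conv_conj diff_Suc_1 length_butlast length_greater_0_conv zero_less_Suc)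
      then show ?thesis by (simp add: V.G_single)
    next
      case False
      then show ?thesis using i by (intro fil_mono[OF fil_mm[OF IH]]) auto
    qed
  qed
  have "fil (length vs) (AA l (EE mm AA l (bas Lf # vs)))" if "l \<noteq> 0" for l
    using 1[of "l - 1"] that by (intro fil_AA) simp
  then have "fil (length vs) (EE mm AA 0 (bas Lf # vs))"
    unfolding V.E_0[OF order_refl[of "length (bas Lf # vs)"]]
    by (intro supp_diff supp_sum) (auto simp: V.tt_def simp del: sum.op_ivl_Suc intro!: supp_bas supp_sum)
  then have "fil (length vs) (EE mm AA j (bas Lf # vs))" for j using 1 by (cases j) auto
  then show ?case using 2 by blast
qed

lemma fil_N:
  fixes v :: "nt \<Rightarrow>\<^sub>0 'k::field"
  assumes "vs \<noteq> []"
  shows "fil (length vs) (NN mm AA (bas Lf # vs @ [v]) + mm (AA 1 (NN mm AA (bas Lf # vs))) v)"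
proof -
  let ?E = "\<lambda>j vs. EE mm AA j (bas Lf # vs) :: nt \<Rightarrow>\<^sub>0 'k" and ?N = "\<lambda>vs. NN mm AA (bas Lf # vs) :: nt \<Rightarrow>\<^sub>0 'k"
  have N: "fil (length us - 1) (?N us - ?E 1 us)" if "us \<noteq> []" for us
  proof -
    have "?N us = ?E 1 us + (\<Sum>l\<in>{1..<length us}. AA l (?E (Suc l) us))"
      using that by (simp add: V.N_eq[of _ "length us"] sum_shift)
    then show ?thesis
      using fil_E[of us] that by (auto intro!: supp_sum fil_AA) (metis Suc_le_D)
  qed
  have E0: "fil (length vs - 1) (?E 0 vs + AA 1 (?E 1 vs))"
  proof -
    have "?E 0 vs = - (\<Sum>l\<in>{1..<Suc (length vs)}. AA l (?E l vs))"
      using assms V.E_0[of "bas Lf # vs" "Suc (length vs)"] by (simp add: V.tt_def)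
    also have "(\<Sum>l\<in>{1..<Suc (length vs)}. AA l (?E l vs)) = AA 1 (?E 1 vs) + (\<Sum>l\<in>{Suc 1..<Suc (length vs)}. AA l (?E l vs))"
      using assms by (intro sum.atLeast_Suc_lessThan) (simp add: Suc_le_eq)
    finally have "?E 0 vs + AA 1 (?E 1 vs) = - (\<Sum>l\<in>{Suc 1..<Suc (length vs)}. AA l (?E l vs))"
      by simp
    moreover have "fil (length vs - 1) (AA l (?E l vs))" if "Suc 1 \<le> l" for l
      using fil_E[of vs] assms that by (intro fil_AA) (metis Suc_le_D Suc_le_mono One_nat_def)
    ultimately show ?thesis by (auto simp del: sum.op_ivl_Suc intro!: supp_uminus supp_sum)
  qed
  have E1: "fil (length vs) (?E 1 (vs @ [v]) - mm (?E 0 vs) v)"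
  proof -
    have "?E 1 (vs @ [v]) - mm (?E 0 vs) v = (\<Sum>i<length vs. mm (?E 0 (take i vs)) (GG mm AA 0 (drop i vs @ [v])))"
      by (simp add: E_Lf_Suc V.G_single)
    moreover have "fil (length vs) (mm (?E 0 (take i vs)) (GG mm AA 0 (drop i vs @ [v])))" if "i < length vs" for i
      using fil_E[of "take i vs"] that by (intro fil_mono[OF fil_mm[of i]]) auto
    ultimately show ?thesis by (auto intro!: supp_sum)
  qed
  have "Suc (length vs - 1) = length vs" using assms by simp
  then have "fil (length vs) (mm (?E 0 vs + AA 1 (?E 1 vs)) v)" "fil (length vs) (mm (AA 1 (?N vs - ?E 1 vs)) v)"
    using fil_mm[OF E0, of v] fil_mm[OF fil_AA[OF N[OF assms]], of 1 v] by auto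
  \<comment> \<open>The four summands pass from \<open>\<nu>\<close> to \<open>E_1\<close>, from
    there to \<open>m(E_0, v)\<close>, then to \<open>- m(a_1 E_1, v)\<close> and finally to
    \<open>- m(a_1 \<nu>, v)\<close>; their sum telescopes to the claim.\<close>
  then have "fil (length vs) ((?N (vs @ [v]) - ?E 1 (vs @ [v])) + (?E 1 (vs @ [v]) - mm (?E 0 vs) v)
    + mm (?E 0 vs + AA 1 (?E 1 vs)) v + mm (AA 1 (?N vs - ?E 1 vs)) v)"
    using N[of "vs @ [v]"] E1 by (intro supp_add) auto
  then show ?thesis by simp
qed

text \<open>A comb \<open>m(a_1 m(... m(Lf, v_1) ...), v_r)\<close> is flattened to a single vertex
  \<open>Nu (r+1)\<close> whose children are a leaf and the trees of the \<open>v_i\<close>. Apart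
  from \<open>Lf\<close>, the value \<open>Leaf\<close> is a dummy for monomials that are not
  critical.\<close>

fun critical_tree :: "nt \<Rightarrow> tree" where
  "critical_tree (Pr Lf v) = Node (Nu 2) [Leaf, critical_tree v]"
| "critical_tree (Pr (Ak 0 w) v) = (case critical_tree w of Node g ts \<Rightarrow> Node (Nu (Suc (length ts))) (ts @ [critical_tree v]) | Leaf \<Rightarrow> Leaf)"
| "critical_tree _ = Leaf"

lemma critical_tree_shape:
  "critical u \<Longrightarrow> tree_over nu_gens (critical_tree u) \<and> leaves (critical_tree u) = nlv u \<and> tree_deg (critical_tree u) = int (ndeg u) \<and>
    (is_Pr u \<longrightarrow> (\<exists>ts. critical_tree u = Node (Nu (Suc (spine_length u))) (Leaf # ts) \<and> length ts = spine_length u))"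
proof (induction u rule: critical.induct)
  case (3 w v)
  then obtain ts where ts: "critical_tree w = Node (Nu (Suc (spine_length w))) (Leaf # ts)" "length ts = spine_length w" by auto
  have t: "critical_tree (Pr (Ak 0 w) v) = Node (Nu (Suc (Suc (spine_length w)))) (Leaf # ts @ [critical_tree v])" using ts by simp
  have "tree_over nu_gens (critical_tree w)" "leaves (critical_tree w) = nlv w" "tree_deg (critical_tree w) = int (ndeg w)"
    "tree_over nu_gens (critical_tree v)" "leaves (critical_tree v) = nlv v" "tree_deg (critical_tree v) = int (ndeg v)" using 3 by auto
  then show ?case unfolding t using ts by (auto simp: nu_gens_def)
qed (auto simp: nu_gens_def)

text \<open>Modulo shorter spines, each child after the second is added by
  \<open>- m(a_1 \<nu>, v)\<close>, so the leading monomial grows along the comb and its coefficient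
  only changes sign.\<close>

lemma critical_tree_lead: "critical u \<Longrightarrow> lead u (nfF (critical_tree u) :: nt \<Rightarrow>\<^sub>0 'k::field)"
proof (induction u rule: critical.induct)
  case 1
  then show ?case by (simp add: nfF_simps lead_bas)
next
  case (2 v)
  have "NN mm AA [bas Lf, nfF (critical_tree v)] = mm (bas Lf) (nfF (critical_tree v) :: nt \<Rightarrow>\<^sub>0 'k)"
    using V.N_eq[of "[bas Lf, nfF (critical_tree v)]" 1] by (simp add: E_Lf_Suc V.E_single V.G_single)
  then show ?case using 2 by (simp add: nfF_simps mm_irreducible lead_PrL)
next
  case (3 w v)
  then obtain ts where ts: "critical_tree w = Node (Nu (Suc (spine_length w))) (Leaf # ts)" "length ts = spine_length w"
    using critical_tree_shape[of w] by auto
  have "ts \<noteq> []" using ts 3(3) by (cases w) auto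
  then have "fil (spine_length w) (nfF (critical_tree (Pr (Ak 0 w) v)) + mm (AA 1 (nfF (critical_tree w))) (nfF (critical_tree v)) :: nt \<Rightarrow>\<^sub>0 'k)"
    using fil_N[of "map nfF ts" "nfF (critical_tree v) :: nt \<Rightarrow>\<^sub>0 'k"] ts by (simp add: nfF_simps del: critical_tree.simps) (simp add: nfF_simps)
  then have "below (Pr (Ak 0 w) v) (nfF (critical_tree (Pr (Ak 0 w) v)) + mm (AA 1 (nfF (critical_tree w))) (nfF (critical_tree v)) :: nt \<Rightarrow>\<^sub>0 'k)"
    by (rule fil_below) simp
  moreover have "lead (Pr (Ak 0 w) v) (scale (- 1) (mm (AA 1 (nfF (critical_tree w))) (nfF (critical_tree v) :: nt \<Rightarrow>\<^sub>0 'k)))"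
    using 3 by (intro lead_scale lead_mm_AA) auto
  ultimately have "lead (Pr (Ak 0 w) v) (scale (- 1) (mm (AA 1 (nfF (critical_tree w))) (nfF (critical_tree v) :: nt \<Rightarrow>\<^sub>0 'k)) +
      (nfF (critical_tree (Pr (Ak 0 w) v)) + mm (AA 1 (nfF (critical_tree w))) (nfF (critical_tree v))))"
    by (intro lead_add)
  then show ?case by simp
qed auto


subsection \<open>The complex of normal monomials\<close>

definition ddx :: "(nt \<Rightarrow>\<^sub>0 'k::field) \<Rightarrow> nt \<Rightarrow>\<^sub>0 'k" where "ddx x = NFd (EM x)"

lemma is_lin_ddx [lin_intros, simp]: "is_lin ddx"
  unfolding ddx_def[abs_def] by (intro lin_intros)

lemmas ddx_simps [simp] = is_lin_add[OF is_lin_ddx] is_lin_diff[OF is_lin_ddx] is_lin_minus[OF is_lin_ddx]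
  is_lin_zero[OF is_lin_ddx] is_lin_scale[OF is_lin_ddx]

lemma ddx_bas: "ddx (bas u) = ddb u"
  by (simp add: ddx_def ddb_def EM_bas)

definition bset :: "nat \<Rightarrow> nat \<Rightarrow> nt \<Rightarrow> bool" where "bset n d u \<longleftrightarrow> gr n d u \<and> nrm u"

lemma finite_bset: "finite {u. bset n d u}"
  by (rule finite_subset[OF _ finite_nt[of "n + d"]]) (auto simp: bset_def gr_def)

lemma EM_bset_free: "supp (bset n d) x \<Longrightarrow> EM x \<in> free_cmp hq_gens n (int d)"
  by (rule EM_free) (auto simp: bset_def elim: supp_mono)

lemma NF_EM_bset: "supp (bset n d) x \<Longrightarrow> NF (EM x) = x"
  by (rule NF_EM) (auto simp: bset_def elim: supp_mono)

lemma NF_bset: "x \<in> free_cmp hq_gens n (int d) \<Longrightarrow> supp (bset n d) (NF x)"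
  unfolding bset_def by (rule NF_gr)

lemma free_cmp_negative:
  assumes "x \<in> free_cmp G n d" "\<And>t. tree_over G t \<Longrightarrow> 0 \<le> tree_deg t" "d < 0"
  shows "x = 0"
proof (rule ccontr)
  assume "x \<noteq> 0"
  then obtain t where "t \<in> Poly_Mapping.keys x" by (metis all_not_in_conv keys_eq_empty)
  then show False using free_cmp_keysD[OF assms(1)] assms(2,3) by fastforce
qed

lemma hq_deg_nonneg: "tree_over hq_gens t \<Longrightarrow> 0 \<le> tree_deg t"
  using nf_gr by fastforce

text \<open>An element and its normal form differ by the ideal, which the boundary preserves; so the
  differential of the quotient acts on normal forms as \<open>ddx\<close>.\<close>

lemma NFd_eq_ddx:
  assumes "x \<in> free_cmp hq_gens n (int d)"
  shows "NFd x = ddx (NF x)"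
proof -
  have "x - EM (NF x) \<in> free_cmp hq_gens n (int d)"
    by (intro free_cmp_diff assms EM_bset_free NF_bset)
  moreover have "NF (x - EM (NF x)) = 0"
    using NF_EM_bset[OF NF_bset[OF assms]] by simp
  ultimately have "in_ideal hq_gens ncBV_relators n (int d) (x - EM (NF x))"
    by (simp add: in_ideal_iff_NF)
  then have "NFd (x - EM (NF x)) = 0"
    unfolding NFd_def by (rule NF_ideal[OF hq.dif_ideal])
  then show ?thesis by (simp add: ddx_def)
qed

lemma supp_ddx:
  assumes "supp (bset n (Suc d)) x"
  shows "supp (bset n d) (ddx x)"
  using NF_bset[of "dif hq_diff (EM x)" n d] hq.dif_free[OF EM_bset_free[OF assms]] by (simp add: ddx_def NFd_def)

lemma ddx_ddx:
  assumes "supp (bset n (Suc d)) x"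
  shows "ddx (ddx x) = 0"
proof -
  have "dif hq_diff (EM x) \<in> free_cmp hq_gens n (int d)"
    using hq.dif_free[OF EM_bset_free[OF assms]] by simp
  then have "ddx (ddx x) = NFd (dif hq_diff (EM x))"
    by (simp add: NFd_eq_ddx) (simp add: ddx_def NFd_def)
  also have "\<dots> = 0"
    unfolding NFd_def by (rule NF_ideal[OF hq.dif_dif_ideal[OF EM_bset_free[OF assms]]])
  finally show ?thesis .
qed

text \<open>The morphism on the spanning trees of ncHyperCom: a critical monomial stands for its
  tree, and the image is expressed in normal monomials.\<close>

definition nux :: "(nt \<Rightarrow>\<^sub>0 'k::field) \<Rightarrow> nt \<Rightarrow>\<^sub>0 'k" where "nux = lin_ext (\<lambda>u. nfF (critical_tree u))"

lemma is_lin_nux [lin_intros, simp]: "is_lin nux"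
  by (simp add: nux_def)

lemmas nux_simps [simp] = is_lin_add[OF is_lin_nux] is_lin_diff[OF is_lin_nux] is_lin_minus[OF is_lin_nux]
  is_lin_zero[OF is_lin_nux] is_lin_scale[OF is_lin_nux]

abbreviation cset :: "nat \<Rightarrow> nat \<Rightarrow> nt \<Rightarrow> bool" where "cset n d u \<equiv> critical u \<and> gr n d u"

lemma nux_bas:
  assumes "cset n d u"
  shows "nux (bas u) = (nfF (critical_tree u) :: nt \<Rightarrow>\<^sub>0 'k::field)" "supp (bset n d) (nux (bas u) :: nt \<Rightarrow>\<^sub>0 'k)"
    "ddx (nux (bas u)) = (0 :: nt \<Rightarrow>\<^sub>0 'k)"
proof -
  show "nux (bas u) = (nfF (critical_tree u) :: nt \<Rightarrow>\<^sub>0 'k)" by (simp add: nux_def)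
  have f: "(nuF (critical_tree u) :: tree \<Rightarrow>\<^sub>0 'k) \<in> free_cmp hq_gens n (int d)"
    using nuF_free[of "critical_tree u"] critical_tree_shape[of u] assms by (auto simp: gr_def)
  show "supp (bset n d) (nux (bas u) :: nt \<Rightarrow>\<^sub>0 'k)"
    using NF_bset[OF f] by (simp add: nux_def nfF_def)
  show "ddx (nux (bas u)) = (0 :: nt \<Rightarrow>\<^sub>0 'k)"
    using NFd_eq_ddx[OF f] NFd_nuF[of "critical_tree u", where 'k = 'k] critical_tree_shape[of u] assms by (simp add: nux_def nfF_def)
qed

lemma ddx_nux: "supp (cset n d) c \<Longrightarrow> ddx (nux c) = 0"
  by (rule supp_eqI[of "cset n d" c "\<lambda>c. ddx (nux c)" "\<lambda>_. 0"])
    (auto intro!: lin_intros is_lin_comp[OF is_lin_ddx is_lin_nux] nux_bas(3))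

section \<open>Splitting the complex along the matching\<close>

definition src :: "nt \<Rightarrow> bool" where "src u \<longleftrightarrow> nrm u \<and> (\<exists>t. matched u t)"

text \<open>The three summands correspond to the sources, the targets and the critical monomials of
  the matching: targets are exchanged for boundaries of their sources, critical monomials for the
  images of their trees.\<close>

definition decomposable :: "nat \<Rightarrow> nat \<Rightarrow> (nt \<Rightarrow>\<^sub>0 'k::field) \<Rightarrow> bool"
  where "decomposable n d x \<longleftrightarrow> (\<exists>s z c. supp src s \<and> supp (bset n (Suc d)) z \<and> supp (cset n d) c \<and> supp (bset n d) s \<and>
    x = s + ddx z + nux c)"

lemma decomposable_add: "decomposable n d x \<Longrightarrow> decomposable n d y \<Longrightarrow> decomposable n d (x + y)"
proof -
  assume "decomposable n d x" "decomposable n d y"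
  then obtain s z c s' z' c' where x: "supp src s" "supp (bset n (Suc d)) z" "supp (cset n d) c" "supp (bset n d) s"
    "x = s + ddx z + nux c" and y: "supp src s'" "supp (bset n (Suc d)) z'" "supp (cset n d) c'" "supp (bset n d) s'"
    "y = s' + ddx z' + nux c'" unfolding decomposable_def by blast
  then show ?thesis unfolding decomposable_def
    by (intro exI[of _ "s + s'"] exI[of _ "z + z'"] exI[of _ "c + c'"]) (simp add: supp_add)
qed

lemma decomposable_scale: "decomposable n d x \<Longrightarrow> decomposable n d (scale a x)"
proof -
  assume "decomposable n d x"
  then obtain s z c where x: "supp src s" "supp (bset n (Suc d)) z" "supp (cset n d) c" "supp (bset n d) s"
    "x = s + ddx z + nux c" unfolding decomposable_def by blast
  then show ?thesis unfolding decomposable_def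
    by (intro exI[of _ "scale a s"] exI[of _ "scale a z"] exI[of _ "scale a c"]) (simp add: supp_scale scale_add_right)
qed

lemma supp_combination:
  assumes "supp Q x" "\<And>u. Q u \<Longrightarrow> D (bas u)" "D 0" "\<And>x y. D x \<Longrightarrow> D y \<Longrightarrow> D (x + y)" "\<And>a x. D x \<Longrightarrow> D (scale a x)"
  shows "D x"
proof -
  have "D (sum f S)" if "\<And>a. a \<in> S \<Longrightarrow> D (f a)" for f and S :: "'a set"
    using that by (induction S rule: infinite_finite_induct) (auto simp: assms)
  then show ?thesis
    by (subst poly_mapping_sum_single) (use assms(1,2,5) in \<open>auto simp: supp_def simp del: scale_single\<close>)
qed

lemma decomposable_0: "decomposable n d 0"
  unfolding decomposable_def by (intro exI[of _ 0]) simp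

text \<open>Triangular elimination along the key: if a decomposable element has leading monomial
  \<open>u\<close>, then \<open>u\<close> is decomposable too, since the remaining monomials are
  lower. Finiteness of each arity and degree bounds the descent.\<close>

lemma decomposable_bas: "bset n d u \<Longrightarrow> decomposable n d (bas u :: nt \<Rightarrow>\<^sub>0 'k::field)"
proof (induction "card {w. bset n d w \<and> key w < key u}" arbitrary: u rule: less_induct)
  case less
  have lower: "decomposable n d r" if "below u r" "supp (bset n d) r" for r :: "nt \<Rightarrow>\<^sub>0 'k"
  proof (rule supp_combination[of "\<lambda>w. bset n d w \<and> key w < key u"])
    fix w assume w: "bset n d w \<and> key w < key u"
    have "{v. bset n d v \<and> key v < key w} \<subset> {v. bset n d v \<and> key v < key u}"
      using w by auto
    then show "decomposable n d (bas w :: nt \<Rightarrow>\<^sub>0 'k)"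
      using w finite_bset[of n d] by (intro less.hyps psubset_card_mono) (auto elim: rev_finite_subset)
  qed (use that in \<open>auto simp: supp_def decomposable_0 decomposable_add decomposable_scale\<close>)
  have solve: "decomposable n d (bas u :: nt \<Rightarrow>\<^sub>0 'k)" if x: "lead u x" "decomposable n d x" "supp (bset n d) x" for x :: "nt \<Rightarrow>\<^sub>0 'k"
  proof -
    obtain c r where c: "c \<noteq> 0" "x = scale c (bas u) + r" "below u r" using x(1) unfolding lead_def by blast
    have "supp (bset n d) (x - scale c (bas u))"
      using x(3) less.prems by (intro supp_diff supp_scale supp_bas)
    then have "decomposable n d r" using c by (intro lower) simp_all
    then have "decomposable n d (scale (1 / c) (x + scale (- 1) r))"
      by (intro decomposable_scale decomposable_add x)
    then show ?thesis using c by simp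
  qed
  have "nrm u" using less.prems by (simp add: bset_def)
  from matched_total[OF this] show ?case
  proof (elim disjE exE)
    assume u: "critical u"
    then have c: "cset n d u" using less.prems by (simp add: bset_def)
    have "decomposable n d (nux (bas u) :: nt \<Rightarrow>\<^sub>0 'k)"
      unfolding decomposable_def by (intro exI[of _ 0] exI[of _ "bas u"]) (use c in \<open>simp add: supp_bas\<close>)
    then show ?thesis using critical_tree_lead[OF u, where 'k = 'k] nux_bas[OF c, where 'k = 'k] by (intro solve) auto
  next
    fix t assume "matched u t"
    then have "src u" using \<open>nrm u\<close> by (auto simp: src_def)
    then show ?thesis unfolding decomposable_def using less.prems
      by (intro exI[of _ "bas u"] exI[of _ 0]) (simp add: supp_bas)
  next
    fix s assume s: "matched s u"
    then have b: "bset n (Suc d) s" using less.prems matched_gr[OF s] matched_nrm[OF s] by (auto simp: bset_def gr_def)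
    have z: "supp (bset n (Suc d)) (bas s :: nt \<Rightarrow>\<^sub>0 'k)" using b by (rule supp_bas)
    have "decomposable n d (ddx (bas s) :: nt \<Rightarrow>\<^sub>0 'k)"
      unfolding decomposable_def by (rule exI[of _ 0], rule exI[of _ "bas s"], rule exI[of _ 0]) (use z in simp)
    then show ?thesis using matched_lead[OF s] b supp_ddx[OF z] by (intro solve[of "ddx (bas s)"]) (auto simp: ddx_bas bset_def)
  qed
qed

lemma decomposable: "supp (bset n d) x \<Longrightarrow> decomposable n d x"
  by (erule supp_combination) (auto intro: decomposable_bas decomposable_0 decomposable_add decomposable_scale)

section \<open>Linear independence from distinct leading monomials\<close>

lemma lead_lookup: "lead p x \<Longrightarrow> Poly_Mapping.lookup x p \<noteq> 0"
  by (auto simp: lead_def supp_def lookup_add in_keys_iff lookup_single)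

lemma lead_lookup_0:
  assumes "lead p x" "key p \<le> key q" "q \<noteq> p"
  shows "Poly_Mapping.lookup x q = 0"
proof -
  obtain c r where c: "x = scale c (bas p) + r" "below p r" using assms(1) unfolding lead_def by blast
  have "q \<notin> Poly_Mapping.keys r" using c(2) assms(2) by (auto simp: supp_def)
  then show ?thesis using assms(3) by (simp add: c(1) lookup_add in_keys_iff lookup_single)
qed

text \<open>Among the leading monomials that occur, the one with the largest key cannot be
  cancelled.\<close>

lemma lead_independent:
  assumes "supp Q x" "\<And>u. Q u \<Longrightarrow> lead (L u) (f u)" "\<And>u w. \<lbrakk>Q u; Q w; L u = L w\<rbrakk> \<Longrightarrow> u = w" "lin_ext f x = 0"
  shows "x = 0"
proof (rule ccontr)
  assume "x \<noteq> 0"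
  let ?K = "Poly_Mapping.keys x"
  have K: "finite ?K" "?K \<noteq> {}" using \<open>x \<noteq> 0\<close> by auto
  have "Max ((\<lambda>u. key (L u)) ` ?K) \<in> (\<lambda>u. key (L u)) ` ?K" using K by (intro Max_in) auto
  then obtain u where u: "u \<in> ?K" "key (L u) = Max ((\<lambda>u. key (L u)) ` ?K)" by auto
  have Q: "Q w" if "w \<in> ?K" for w using assms(1) that by (simp add: supp_def)
  have "Poly_Mapping.lookup (f w) (L u) = 0" if "w \<in> ?K" "w \<noteq> u" for w
  proof (rule lead_lookup_0)
    show "lead (L w) (f w)" using Q assms(2) that by blast
    show "key (L w) \<le> key (L u)" using u K that by simp
    show "L u \<noteq> L w" using assms(3)[OF Q[OF u(1)] Q[OF that(1)]] that(2) by metis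
  qed
  then have "Poly_Mapping.lookup (lin_ext f x) (L u) = Poly_Mapping.lookup x u * Poly_Mapping.lookup (f u) (L u)"
    using u(1) K(1) by (simp add: lin_ext_def lookup_sum lookup_add sum.remove[OF K(1) u(1)])
  then show False
    using assms(4) lead_lookup[OF assms(2)[OF Q[OF u(1)]]] u(1) by (simp add: in_keys_iff)
qed

lemma ddx_lin_ext: "ddx x = lin_ext ddb x"
  using is_lin_lin_ext[OF is_lin_ddx, of x] by (simp add: ddx_bas)

text \<open>Boundaries of sources lead with targets and images of critical trees lead with critical
  monomials; these are pairwise distinct because a target determines its source and is never
  critical.\<close>

lemma src_critical_independent:
  assumes "supp src s" "supp critical c" "ddx s = nux c"
  shows "s = 0" "c = 0"
proof -
  define f where "f u = (if critical u then nfF (critical_tree u) else ddb u :: nt \<Rightarrow>\<^sub>0 'a)" for u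
  \<comment> \<open>A target is chosen for every source; injectivity holds for any choice, since a
    target determines its source.\<close>
  define L where "L u = (if critical u then u else SOME t. matched u t)" for u
  have L: "matched u (L u)" if "src u" for u
    using that someI_ex[of "matched u"] matched_not_critical by (auto simp: L_def src_def)
  have "lin_ext f s = ddx s"
    unfolding ddx_lin_ext using assms(1) matched_not_critical
    by (intro lin_ext_cong) (auto simp: f_def supp_def src_def)
  moreover have "lin_ext f c = nux c"
    unfolding nux_def using assms(2) by (intro lin_ext_cong) (auto simp: f_def supp_def)
  ultimately have 0: "lin_ext f (s - c) = 0"
    using assms(3) by (simp add: is_lin_diff[OF is_lin_lin_extI])
  have "supp (\<lambda>u. src u \<or> critical u) (s - c)"
    using assms by (intro supp_diff) (auto elim: supp_mono)
  then have "s - c = 0"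
  proof (rule lead_independent[OF _ _ _ 0, of _ L])
    fix u assume "src u \<or> critical u"
    then show "lead (L u) (f u)"
    proof (cases "critical u")
      case True
      then show ?thesis using critical_tree_lead[OF True, where 'k = 'a] by (simp add: L_def f_def)
    next
      case False
      then show ?thesis using \<open>src u \<or> critical u\<close> L[of u] matched_lead[of u "L u"] by (auto simp: f_def src_def)
    qed
  next
    fix u w assume "src u \<or> critical u" "src w \<or> critical w" "L u = L w"
    then show "u = w" using L[of u] L[of w] matched_not_critical matched_inj by (metis L_def)
  qed
  then have sc: "s = c" by simp
  \<comment> \<open>The supports of \<open>s\<close> and \<open>c\<close> are disjoint, so
    \<open>s = c\<close> forces both to vanish.\<close>
  have "src u \<Longrightarrow> \<not> critical u" for u using matched_not_critical by (auto simp: src_def)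
  then have "Poly_Mapping.keys c = {}" using assms(1,2) unfolding sc by (auto simp: supp_def)
  then show "s = 0" "c = 0" using sc by (simp_all add: keys_eq_empty)
qed

text \<open>Applying \<open>ddx\<close> to a decomposition of the cycle leaves
  \<open>ddx s = 0\<close>, and the boundaries of sources are independent.\<close>

lemma cycle_decomposition:
  assumes "supp (bset n d) y" "ddx y = 0"
  shows "\<exists>z c. supp (bset n (Suc d)) z \<and> supp (cset n d) c \<and> y = ddx z + nux c"
proof -
  obtain s z c where x: "supp src s" "supp (bset n (Suc d)) z" "supp (cset n d) c" "y = s + ddx z + nux c"
    using decomposable[OF assms(1)] unfolding decomposable_def by blast
  have "ddx s = nux 0" using assms(2) x by (simp add: ddx_ddx ddx_nux)
  then have "s = 0" using src_critical_independent(1)[OF x(1), of 0] by simp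
  then show ?thesis using x by auto
qed

text \<open>Decomposing \<open>z\<close> shows that its boundary is the boundary of its source part,
  and such boundaries meet the span of the images of critical trees only in zero.\<close>

lemma boundary_critical:
  assumes "supp (bset n (Suc d)) z" "supp (cset n d) c" "nux c = ddx z"
  shows "c = 0"
proof -
  obtain s z' c' where x: "supp src s" "supp (bset n (Suc (Suc d))) z'" "supp (cset n (Suc d)) c'" "z = s + ddx z' + nux c'"
    using decomposable[OF assms(1)] unfolding decomposable_def by blast
  have "ddx s = nux c" using assms(3) x by (simp add: ddx_ddx ddx_nux)
  then show ?thesis using src_critical_independent(2)[OF x(1) supp_mono[OF assms(2)]] by blast
qed

section \<open>Spanning trees of ncHyperCom\<close>

lemma plug_append: "plug x p (ts @ us) = plug (plug x p ts) (p + sum_list (map leaves ts)) us"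
  by (induction ts arbitrary: x p) (simp_all add: add.assoc)

lemma graft_list_Leaf: "graft_list (rs @ Leaf # ss) (Suc (sum_list (map leaves rs))) t = rs @ t # ss"
  by (simp add: graft_list_append)

lemma plug_children:
  assumes "\<forall>t\<in>set ws. even (tree_deg t)"
  shows "plug (bas (Node g (rs @ replicate (length ws) Leaf @ ss)) :: tree \<Rightarrow>\<^sub>0 'k::field) (Suc (sum_list (map leaves rs))) ws
    = bas (Node g (rs @ ws @ ss))"
  using assms
proof (induction ws arbitrary: rs)
  case (Cons w ws)
  have "bas (Node g (rs @ Leaf # replicate (length ws) Leaf @ ss)) \<circ>[Suc (sum_list (map leaves rs))] bas w
    = (bas (Node g ((rs @ [w]) @ replicate (length ws) Leaf @ ss)) :: tree \<Rightarrow>\<^sub>0 'k)"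
    using Cons.prems by (simp add: tcomp_bas graft_list_Leaf powi_minus_one)
  then show ?case using Cons.IH[of "rs @ [w]"] Cons.prems by (simp add: add.commute)
qed simp

lemma plug_grandchildren:
  assumes "\<forall>t\<in>set ws. even (tree_deg t)"
  shows "plug (bas (Node g (rs @ Node h (qs @ replicate (length ws) Leaf) # ss)) :: tree \<Rightarrow>\<^sub>0 'k::field)
      (Suc (sum_list (map leaves rs) + sum_list (map leaves qs))) ws
    = bas (Node g (rs @ Node h (qs @ ws) # ss))"
  using assms
proof (induction ws arbitrary: qs)
  case (Cons w ws)
  let ?n = "Suc (sum_list (map leaves rs) + sum_list (map leaves qs))"
  have "graft_list (rs @ Node h (qs @ Leaf # replicate (length ws) Leaf) # ss) ?n w
    = rs @ Node h ((qs @ [w]) @ replicate (length ws) Leaf) # ss"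
    by (simp add: graft_list_append(1) graft_list_Leaf[of qs, simplified])
  then have "bas (Node g (rs @ Node h (qs @ Leaf # replicate (length ws) Leaf) # ss)) \<circ>[?n] bas w
    = (bas (Node g (rs @ Node h ((qs @ [w]) @ replicate (length ws) Leaf) # ss)) :: tree \<Rightarrow>\<^sub>0 'k)"
    using Cons.prems by (simp add: tcomp_bas powi_minus_one)
  then show ?case using Cons.IH[of "qs @ [w]"] Cons.prems by (simp add: ac_simps)
qed simp

text \<open>The inserted trees are even, so no signs occur. The inputs before, inside and after the
  inner vertex are filled as three blocks.\<close>

lemma plug_two_level:
  assumes "\<forall>t\<in>set (us @ vs @ ws). even (tree_deg t)"
  shows "plug (bas (Node g (replicate (length us) Leaf @ Node h (replicate (length vs) Leaf) # replicate (length ws) Leaf))) 1 (us @ vs @ ws)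
    = (bas (Node g (us @ Node h vs # ws)) :: tree \<Rightarrow>\<^sub>0 'k::field)"
  using plug_children[of us g "[]" "Node h (replicate (length vs) Leaf) # replicate (length ws) Leaf", where 'k = 'k]
    plug_grandchildren[of vs g us h "[]" "replicate (length ws) Leaf", where 'k = 'k]
    plug_children[of ws g "us @ [Node h vs]" "[]", where 'k = 'k] assms
  by (simp add: plug_append ball_Un)

lemma in_ideal_plug:
  assumes "in_ideal G R n d x" "1 \<le> p" "p - 1 + length ts \<le> n" "\<forall>t\<in>set ts. tree_over G t"
  shows "in_ideal G R (n - length ts + sum_list (map leaves ts)) (d + sum_list (map tree_deg ts)) (plug x p ts)"
  using assms
proof (induction ts arbitrary: x p n d)
  case (Cons t ts)
  have "in_ideal G R (n + leaves t - 1) (d + tree_deg t) (x \<circ>[p] bas t)"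
    by (rule in_ideal_tcomp_bas[OF Cons.prems(1)]) (use Cons.prems in auto)
  then have "in_ideal G R (n + leaves t - 1 - length ts + sum_list (map leaves ts)) (d + tree_deg t + sum_list (map tree_deg ts))
    (plug (x \<circ>[p] bas t) (p + leaves t) ts)"
    by (rule Cons.IH) (use Cons.prems in auto)
  then show ?case
    by (rule in_ideal_cong) (use Cons.prems in auto)
qed simp

section \<open>Normalization of trees modulo the relators\<close>

fun normal_tree :: "tree \<Rightarrow> bool" where
  "normal_tree Leaf = True"
| "normal_tree (Node g ts) = (ts \<noteq> [] \<and> hd ts = Leaf \<and> (\<forall>t\<in>set ts. normal_tree t))"

abbreviation HC :: "nat \<Rightarrow> int \<Rightarrow> (tree \<Rightarrow>\<^sub>0 'k::field) \<Rightarrow> bool"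
  where "HC \<equiv> in_ideal nu_gens ncHyperCom_relators"

definition nset :: "nat \<Rightarrow> int \<Rightarrow> tree \<Rightarrow> bool"
  where "nset n d t \<longleftrightarrow> tree_over nu_gens t \<and> leaves t = n \<and> tree_deg t = d \<and> normal_tree t"

definition normalizable :: "nat \<Rightarrow> int \<Rightarrow> (tree \<Rightarrow>\<^sub>0 'k::field) \<Rightarrow> bool"
  where "normalizable n d x \<longleftrightarrow> (\<exists>c. supp (nset n d) c \<and> HC n d (x - c))"

lemma normalizable_0: "normalizable n d 0"
  unfolding normalizable_def by (rule exI[of _ 0]) (simp add: in_ideal.zero)

lemma normalizable_add: "normalizable n d x \<Longrightarrow> normalizable n d y \<Longrightarrow> normalizable n d (x + y)"
proof -
  assume "normalizable n d x" "normalizable n d y"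
  then obtain c c' where "supp (nset n d) c" "HC n d (x - c)" "supp (nset n d) c'" "HC n d (y - c')"
    unfolding normalizable_def by blast
  then show ?thesis
    unfolding normalizable_def using in_ideal.add[of nu_gens ncHyperCom_relators n d "x - c" "y - c'"]
    by (intro exI[of _ "c + c'"]) (simp add: supp_add algebra_simps)
qed

lemma normalizable_scale: "normalizable n d x \<Longrightarrow> normalizable n d (scale a x)"
proof -
  assume "normalizable n d x"
  then obtain c where "supp (nset n d) c" "HC n d (x - c)" unfolding normalizable_def by blast
  then show ?thesis
    unfolding normalizable_def using in_ideal.scale[of nu_gens ncHyperCom_relators n d "x - c" a]
    by (intro exI[of _ "scale a c"]) (simp add: supp_scale scale_diff_right)
qed

lemma normalizable_sum: "(\<And>a. a \<in> S \<Longrightarrow> normalizable n d (f a)) \<Longrightarrow> normalizable n d (sum f S)"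
  by (induction S rule: infinite_finite_induct) (auto intro: normalizable_0 normalizable_add)

lemma normalizable_cong: "HC n d (x - y) \<Longrightarrow> normalizable n d y \<Longrightarrow> normalizable n d x"
proof -
  assume h: "HC n d (x - y)" and "normalizable n d y"
  then obtain c where c: "supp (nset n d) c" "HC n d (y - c)" unfolding normalizable_def by blast
  have "HC n d ((x - y) + (y - c))" using h c(2) by (rule in_ideal.add)
  then show ?thesis unfolding normalizable_def using c(1) by auto
qed

lemma normalizable_linI:
  assumes "supp Q c" "is_lin f" "\<And>s. Q s \<Longrightarrow> normalizable n d (f (bas s))"
  shows "normalizable n d (f c)"
  unfolding is_lin_lin_ext[OF assms(2), of c] unfolding lin_ext_def
  using assms(1,3) by (intro normalizable_sum normalizable_scale) (auto simp: supp_def)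

text \<open>Children are normalized from left to right, with \<open>rs\<close> the finished part.
  The current child is exchanged inside a composition with the tree \<open>?Y\<close> that has a
  leaf in its place; evenness keeps this free of signs.\<close>

lemma normalizable_children:
  assumes "2 \<le> k"
  shows "\<lbrakk>length (rs @ ts) = k; rs \<noteq> []; hd rs = Leaf; \<forall>t\<in>set rs. normal_tree t \<and> tree_over nu_gens t;
      \<forall>t\<in>set ts. tree_over nu_gens t \<and> normalizable (leaves t) (tree_deg t) (bas t :: tree \<Rightarrow>\<^sub>0 'k::field);
      n = sum_list (map leaves (rs @ ts)); d = 2 * int k - 4 + sum_list (map tree_deg (rs @ ts))\<rbrakk>
    \<Longrightarrow> normalizable n d (bas (Node (Nu k) (rs @ ts)) :: tree \<Rightarrow>\<^sub>0 'k)"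
proof (induction ts arbitrary: rs n d)
  case Nil
  then have "nset n d (Node (Nu k) rs)" using assms by (auto simp: nset_def nu_gens_def)
  then show ?case unfolding normalizable_def
    by (intro exI[of _ "bas (Node (Nu k) rs)"]) (simp add: supp_bas in_ideal.zero)
next
  case (Cons t ts)
  obtain c where c: "supp (nset (leaves t) (tree_deg t)) c" "HC (leaves t) (tree_deg t) (bas t - c :: tree \<Rightarrow>\<^sub>0 'k)"
    using Cons.prems(5) unfolding normalizable_def by auto
  let ?Y = "Node (Nu k) (rs @ Leaf # ts)" and ?i = "Suc (sum_list (map leaves rs))"
  have Y: "tree_over nu_gens ?Y" using Cons.prems assms by (auto simp: nu_gens_def)
  have comp: "bas ?Y \<circ>[?i] bas s = (bas (Node (Nu k) (rs @ s # ts)) :: tree \<Rightarrow>\<^sub>0 'k)" if "tree_over nu_gens s" for s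
    using even_nu_deg[OF that] by (simp add: tcomp_bas graft_list_Leaf powi_minus_one)
  have "HC (leaves ?Y + leaves t - 1) (tree_deg ?Y + tree_deg t) (bas ?Y \<circ>[?i] (bas t - c))"
    by (rule in_ideal.comp_right[OF bas_free[OF Y] c(2)]) simp_all
  then have "HC n d (bas (Node (Nu k) (rs @ t # ts)) - bas ?Y \<circ>[?i] c)"
    using Cons.prems by (auto elim!: in_ideal_cong simp: comp tcomp_diff_right)
  moreover have "normalizable n d (bas ?Y \<circ>[?i] c)"
  proof (rule normalizable_linI[OF c(1) is_lin_tcomp_right])
    fix s assume s: "nset (leaves t) (tree_deg t) s"
    have "normalizable n d (bas (Node (Nu k) ((rs @ [s]) @ ts)) :: tree \<Rightarrow>\<^sub>0 'k)"
      by (rule Cons.IH) (use Cons.prems s in \<open>auto simp: nset_def\<close>)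
    then show "normalizable n d (bas ?Y \<circ>[?i] bas s :: tree \<Rightarrow>\<^sub>0 'k)"
      using s by (simp add: comp nset_def)
  qed
  ultimately show ?case by (rule normalizable_cong)
qed

lemma nu_leaves_pos: "tree_over nu_gens t \<Longrightarrow> 0 < leaves t"
proof (induction rule: nu_tree_induct)
  case (Node k ts)
  then obtain t ts' where "ts = t # ts'" by (cases ts) auto
  then show ?case using Node by simp
qed simp

lemma nu_deg_nonneg: "tree_over nu_gens t \<Longrightarrow> 0 \<le> tree_deg t"
proof (induction rule: nu_tree_induct)
  case (Node k ts)
  then have "0 \<le> sum_list (map tree_deg ts)" by (intro sum_list_nonneg) auto
  then show ?case using Node by simp
qed simp

lemma leaves_le_sum: "t \<in> set ts \<Longrightarrow> leaves t \<le> sum_list (map leaves ts)"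
  by (rule member_le_sum_list) auto

text \<open>A relator with the trees \<open>ws\<close> plugged into its inputs. The constant is the
  degree of two vertices with \<open>n + 1\<close> inputs altogether,
  \<open>(2(n - j + 1) - 4) + (2j - 4) = 2n - 6\<close>.\<close>

lemma ncHyperCom_relation:
  assumes ws: "length ws = n" "\<forall>t\<in>set ws. tree_over nu_gens t" and "3 \<le> n" "2 \<le> i" "i \<le> n - 1"
  shows "HC (sum_list (map leaves ws)) (2 * int n - 6 + sum_list (map tree_deg ws))
    ((\<Sum>j = 2..i. bas (Node (Nu (n - j + 1)) (take (i - j) ws @ Node (Nu j) (take j (drop (i - j) ws)) # drop i ws)))
    - (\<Sum>k = 2..n - i + 1. bas (Node (Nu (n - k + 1)) (take (i - 1) ws @ Node (Nu k) (take k (drop (i - 1) ws)) # drop (k + (i - 1)) ws)))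
    :: tree \<Rightarrow>\<^sub>0 'k::field)"
proof -
  let ?r = "(\<Sum>j = 2..i. corolla (Nu (n - j + 1)) \<circ>[i - j + 1] corolla (Nu j)) -
     (\<Sum>k = 2..n - i + 1. corolla (Nu (n - k + 1)) \<circ>[i] corolla (Nu k)) :: tree \<Rightarrow>\<^sub>0 'k"
  have even: "\<forall>t\<in>set (us @ vs @ xs). even (tree_deg t)" if "ws = us @ vs @ xs" for us vs xs
    using ws(2) even_nu_deg that by auto
  have two_level: "plug (corolla (Nu (n - j + 1)) \<circ>[q] corolla (Nu j)) 1 ws =
    (bas (Node (Nu (n - j + 1)) (take (q - 1) ws @ Node (Nu j) (take j (drop (q - 1) ws)) # drop (j + (q - 1)) ws)) :: tree \<Rightarrow>\<^sub>0 'k)"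
    and free: "corolla (Nu (n - j + 1)) \<circ>[q] corolla (Nu j) \<in> (free_cmp nu_gens n (2 * int n - 6) :: (tree \<Rightarrow>\<^sub>0 'k) set)"
    if "1 \<le> q" "q \<le> n - j + 1" "2 \<le> j" "j \<le> n - 1" for j q
  proof -
    have nj: "1 \<le> n - j" "j \<le> n" using that by linarith+
    let ?us = "take (q - 1) ws" and ?vs = "take j (drop (q - 1) ws)" and ?xs = "drop (j + (q - 1)) ws"
    have w: "ws = ?us @ ?vs @ ?xs" by (simp flip: drop_drop)
    have l: "length ?us = q - 1" "length ?vs = j" "length ?xs = n - j + 1 - q" using that ws(1) by auto
    show "plug (corolla (Nu (n - j + 1)) \<circ>[q] corolla (Nu j)) 1 ws =
      (bas (Node (Nu (n - j + 1)) (?us @ Node (Nu j) ?vs # ?xs)) :: tree \<Rightarrow>\<^sub>0 'k)"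
      using plug_two_level[OF even[OF w], of "Nu (n - j + 1)" "Nu j", folded w] corolla_Nu_comp[OF that(1,2), of j, where 'a = 'k]
      unfolding l by simp
    have "corolla (Nu (n - j + 1)) \<circ>[q] corolla (Nu j) \<in> (free_cmp nu_gens (n - j + 1 + j - 1) (2 * int (n - j + 1) - 4 + (2 * int j - 4)) :: (tree \<Rightarrow>\<^sub>0 'k) set)"
      using free_cmp_tcomp[OF corolla_free corolla_free, of "Nu (n - j + 1)" nu_gens "Nu j" q] that nj by (simp add: nu_gens_def)
    then show "corolla (Nu (n - j + 1)) \<circ>[q] corolla (Nu j) \<in> (free_cmp nu_gens n (2 * int n - 6) :: (tree \<Rightarrow>\<^sub>0 'k) set)"
      using that nj by (simp add: of_nat_diff)
  qed
  have "?r \<in> free_cmp nu_gens n (2 * int n - 6)"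
    by (intro free_cmp_diff free_cmp_sum free) (use assms in auto)
  moreover have "?r \<in> ncHyperCom_relators" unfolding ncHyperCom_relators_def using assms by blast
  ultimately have "HC n (2 * int n - 6) ?r" by (intro in_ideal.relator)
  then have "HC (n - length ws + sum_list (map leaves ws)) (2 * int n - 6 + sum_list (map tree_deg ws)) (plug ?r 1 ws)"
    by (rule in_ideal_plug) (use ws in auto)
  moreover have "plug ?r 1 ws =
    (\<Sum>j = 2..i. plug (corolla (Nu (n - j + 1)) \<circ>[i - j + 1] corolla (Nu j)) 1 ws) -
     (\<Sum>k = 2..n - i + 1. plug (corolla (Nu (n - k + 1)) \<circ>[i] corolla (Nu k)) 1 ws)"
    unfolding is_lin_diff[OF is_lin_plug[OF is_lin_id]] is_lin_sum[OF is_lin_plug[OF is_lin_id]] ..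
  moreover have "(\<Sum>j = 2..i. plug (corolla (Nu (n - j + 1)) \<circ>[i - j + 1] corolla (Nu j)) 1 ws) =
    (\<Sum>j = 2..i. bas (Node (Nu (n - j + 1)) (take (i - j) ws @ Node (Nu j) (take j (drop (i - j) ws)) # drop i ws)) :: tree \<Rightarrow>\<^sub>0 'k)"
  proof (rule sum.cong[OF refl])
    fix j assume j: "j \<in> {2..i}"
    then have "1 \<le> i - j + 1" "i - j + 1 \<le> n - j + 1" "2 \<le> j" "j \<le> n - 1" using assms by auto
    from two_level[OF this] j show "plug (corolla (Nu (n - j + 1)) \<circ>[i - j + 1] corolla (Nu j)) 1 ws =
      (bas (Node (Nu (n - j + 1)) (take (i - j) ws @ Node (Nu j) (take j (drop (i - j) ws)) # drop i ws)) :: tree \<Rightarrow>\<^sub>0 'k)"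
      by simp
  qed
  moreover have "(\<Sum>k = 2..n - i + 1. plug (corolla (Nu (n - k + 1)) \<circ>[i] corolla (Nu k)) 1 ws) =
    (\<Sum>k = 2..n - i + 1. bas (Node (Nu (n - k + 1)) (take (i - 1) ws @ Node (Nu k) (take k (drop (i - 1) ws)) # drop (k + (i - 1)) ws)) :: tree \<Rightarrow>\<^sub>0 'k)"
    by (rule sum.cong[OF refl], rule two_level) (use assms in auto)
  ultimately show ?thesis using ws(1) by simp
qed

text \<open>
  The summand \<open>j = i\<close> of the relation is the only one whose first child is not a leaf; solving for it
  replaces the first child of a tree by the first child of that child.
\<close>

lemma normalizable_tree:
  "tree_over nu_gens t \<Longrightarrow> normalizable (leaves t) (tree_deg t) (bas t :: tree \<Rightarrow>\<^sub>0 'k::field)"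
\<comment> \<open>Children have fewer leaves than the tree. A rewritten tree keeps the number of
  leaves, but its first child has fewer, as the inner vertex had at least one further child.\<close>
proof (induction t rule: wf_induct[OF wf_measures[of "[leaves, \<lambda>t. case t of Leaf \<Rightarrow> 0 | Node g ts \<Rightarrow> leaves (hd ts)]"]])
  case (1 t)
  have IH: "normalizable (leaves s) (tree_deg s) (bas s :: tree \<Rightarrow>\<^sub>0 'k)"
    if "tree_over nu_gens s" "leaves s < leaves t \<or> leaves s = leaves t \<and>
      (case s of Leaf \<Rightarrow> 0 | Node g ts \<Rightarrow> leaves (hd ts)) < (case t of Leaf \<Rightarrow> 0 | Node g ts \<Rightarrow> leaves (hd ts))" for s
    using 1(1) that by auto
  show ?case
  proof (cases t)
    case Leaf
    then have "nset (leaves t) (tree_deg t) t" by (simp add: nset_def)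
    then show ?thesis unfolding normalizable_def by (intro exI[of _ "bas t"]) (simp add: supp_bas in_ideal.zero)
  next
    case (Node g ss)
    then obtain p where p: "g = Nu p" "2 \<le> p" "length ss = p" "\<forall>s\<in>set ss. tree_over nu_gens s"
      using 1(2) by (auto simp: nu_gens_def)
    then obtain s1 ts where ss: "ss = s1 # ts" by (cases ss) auto
    have ts: "ts \<noteq> []" using p ss by auto
    then have ts_pos: "0 < sum_list (map leaves ts)"
      using p(4) nu_leaves_pos[of "hd ts"] leaves_le_sum[of "hd ts" ts] hd_in_set[OF ts] unfolding ss by fastforce
    show ?thesis
    proof (cases s1)
      case Leaf
      have "normalizable (leaves t) (tree_deg t) (bas (Node (Nu p) ([Leaf] @ ts)) :: tree \<Rightarrow>\<^sub>0 'k)"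
      proof (rule normalizable_children[OF p(2)])
        show "\<forall>s\<in>set ts. tree_over nu_gens s \<and> normalizable (leaves s) (tree_deg s) (bas s :: tree \<Rightarrow>\<^sub>0 'k)"
          using p(4) leaves_le_sum[of _ ts] by (auto simp: ss Node Leaf intro!: IH le_imp_less_Suc)
      qed (use p in \<open>auto simp: Node ss Leaf\<close>)
      then show ?thesis by (simp add: Node p(1) ss Leaf)
    next
      case s1: (Node h us)
      then obtain i where i: "h = Nu i" "2 \<le> i" "length us = i" "\<forall>s\<in>set us. tree_over nu_gens s"
        using p(4) ss by (auto simp: nu_gens_def)
      then obtain u vs where us: "us = u # vs" by (cases us) auto
      have vs: "vs \<noteq> []" using i us by auto
      then have "0 < sum_list (map leaves vs)"
        using i(4) nu_leaves_pos[of "hd vs"] leaves_le_sum[of "hd vs" vs] hd_in_set[OF vs] unfolding us by fastforce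
      then have u_less: "leaves u < leaves s1" by (simp add: s1 us)
      \<comment> \<open>The list \<open>ws\<close> collects the inputs of the root and of its first
        child, so that \<open>t\<close> is the summand \<open>j = i\<close> of the relation on
        \<open>n = p + i - 1\<close> inputs.\<close>
      define ws n where "ws = us @ ts" and "n = p + i - 1"
      have n: "length ws = n" "3 \<le> n" "i \<le> n - 1" using p i ss by (auto simp: ws_def n_def)
      have ws: "\<forall>t\<in>set ws. tree_over nu_gens t" using p(4) i(4) by (auto simp: ws_def ss)
      have lt: "leaves t = sum_list (map leaves ws)" "tree_deg t = 2 * int n - 6 + sum_list (map tree_deg ws)"
        using p i by (auto simp: Node ss s1 ws_def n_def of_nat_diff)
      have good: "normalizable (leaves t) (tree_deg t) (bas (Node (Nu (n - j + 1)) (take q ws @ Node (Nu j) (take j (drop q ws)) # drop (j + q) ws)) :: tree \<Rightarrow>\<^sub>0 'k)"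
        if q: "1 \<le> q" "q + j \<le> n" "2 \<le> j" "j \<le> n - 1" for q j
      proof -
        let ?s = "Node (Nu (n - j + 1)) (take q ws @ Node (Nu j) (take j (drop q ws)) # drop (j + q) ws)"
        have w: "ws = take q ws @ take j (drop q ws) @ drop (j + q) ws" by (simp flip: drop_drop)
        have over: "tree_over nu_gens ?s"
          using q n ws by (auto simp: nu_gens_def dest: in_set_takeD in_set_dropD)
        have ls: "leaves ?s = leaves t" unfolding lt by (subst (4) w) simp
        have "sum_list (map tree_deg ws) = sum_list (map tree_deg (take q ws)) + sum_list (map tree_deg (take j (drop q ws)))
          + sum_list (map tree_deg (drop (j + q) ws))" by (subst w) simp
        then have ds: "tree_deg ?s = tree_deg t" unfolding lt using q by (simp add: of_nat_diff)
        have "hd (take q ws @ Node (Nu j) (take j (drop q ws)) # drop (j + q) ws) = u"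
          using q(1) by (cases q) (auto simp: ws_def us)
        then show ?thesis
          using IH[OF over] ls u_less unfolding ds by (simp add: Node ss)
      qed
      let ?A = "\<lambda>j. bas (Node (Nu (n - j + 1)) (take (i - j) ws @ Node (Nu j) (take j (drop (i - j) ws)) # drop i ws)) :: tree \<Rightarrow>\<^sub>0 'k"
      let ?B = "\<Sum>k = 2..n - i + 1. bas (Node (Nu (n - k + 1)) (take (i - 1) ws @ Node (Nu k) (take k (drop (i - 1) ws)) # drop (k + (i - 1)) ws)) :: tree \<Rightarrow>\<^sub>0 'k"
      have B: "normalizable (leaves t) (tree_deg t) ?B"
        by (intro normalizable_sum good) (use n i in auto)
      have A: "normalizable (leaves t) (tree_deg t) (\<Sum>j = 2..<i. ?A j)"
      proof (rule normalizable_sum)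
        fix j assume "j \<in> {2..<i}"
        moreover have "i \<le> n" using n by simp
        ultimately show "normalizable (leaves t) (tree_deg t) (?A j)" using good[of "i - j" j] n by (simp add: Suc_le_eq)
      qed
      have "?A i = bas t" using i p by (simp add: Node ss s1 ws_def n_def)
      moreover have "(\<Sum>j = 2..i. ?A j) = (\<Sum>j = 2..<i. ?A j) + ?A i"
        using i(2) by (simp add: sum.last_plus add.commute)
      ultimately have "HC (leaves t) (tree_deg t) (bas t - (?B + scale (- 1) (\<Sum>j = 2..<i. ?A j)))"
        using ncHyperCom_relation[OF n(1) ws n(2) i(2) n(3), where 'k = 'k] unfolding lt by (simp add: algebra_simps)
      then show ?thesis
        by (rule normalizable_cong) (intro normalizable_add normalizable_scale A B)
    qed
  qed
qed

text \<open>The flattening is undone by adding the children after the initial leaf one at a time: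
  the first by \<open>m(Lf, v)\<close>, each later one by \<open>m(a_1 w, v)\<close>.\<close>

lemma normal_tree_critical_tree: "tree_over nu_gens t \<Longrightarrow> normal_tree t \<Longrightarrow> \<exists>c. critical c \<and> critical_tree c = t"
proof (induction rule: nu_tree_induct)
  case Leaf
  then show ?case by (intro exI[of _ Lf]) simp
next
  case (Node k ss)
  then obtain ts where "ss = Leaf # ts" by (cases ss) auto
  moreover have "ts \<noteq> []" using calculation Node(1,2) by auto
  ultimately have ss: "ss = Leaf # ts" "ts \<noteq> []" by simp_all
  have "\<forall>t\<in>set ts. \<exists>c. critical c \<and> critical_tree c = t" using Node ss by auto
  from ss(2) this have "\<exists>c. critical c \<and> is_Pr c \<and> critical_tree c = Node (Nu (Suc (length ts))) (Leaf # ts)"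
  proof (induction ts rule: rev_nonempty_induct)
    case (single t)
    then obtain v where "critical v" "critical_tree v = t" by auto
    then show ?case by (intro exI[of _ "Pr Lf v"]) (simp add: numeral_2_eq_2)
  next
    case (snoc t ts)
    then obtain w v where "critical w" "is_Pr w" "critical_tree w = Node (Nu (Suc (length ts))) (Leaf # ts)" "critical v" "critical_tree v = t" by auto
    then show ?case by (intro exI[of _ "Pr (Ak 0 w) v"]) simp
  qed
  then show ?case using Node ss by auto
qed

lemma critical_tree_cset: "cset n d u \<Longrightarrow> tree_over nu_gens (critical_tree u) \<and> leaves (critical_tree u) = n \<and> tree_deg (critical_tree u) = int d"
  using critical_tree_shape[of u] by (auto simp: gr_def)

text \<open>For each normal tree a critical monomial with this tree is chosen; a normalized
  combination of trees then lifts to critical monomials.\<close>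

lemma free_eq_critical:
  assumes "x \<in> free_cmp nu_gens n (int d)"
  shows "\<exists>c. supp (cset n d) c \<and> HC n (int d) (x - lin_ext (\<lambda>u. bas (critical_tree u)) c :: tree \<Rightarrow>\<^sub>0 'k::field)"
proof -
  have "normalizable n (int d) x"
  proof (rule normalizable_linI[of "\<lambda>t. tree_over nu_gens t \<and> leaves t = n \<and> tree_deg t = int d" x "\<lambda>x. x"])
    show "supp (\<lambda>t. tree_over nu_gens t \<and> leaves t = n \<and> tree_deg t = int d) x"
      using assms by (simp add: supp_def free_cmp_def)
    fix t assume "tree_over nu_gens t \<and> leaves t = n \<and> tree_deg t = int d"
    then show "normalizable n (int d) (bas t :: tree \<Rightarrow>\<^sub>0 'k)"
      using normalizable_tree[of t, where 'k = 'k] by simp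
  qed (intro lin_intros)
  then obtain b where b: "supp (nset n (int d)) b" "HC n (int d) (x - b)" unfolding normalizable_def by blast
  have "\<exists>u. critical u \<and> critical_tree u = t" if "nset n (int d) t" for t
    using normal_tree_critical_tree that by (auto simp: nset_def)
  then obtain g where g: "\<And>t. nset n (int d) t \<Longrightarrow> critical (g t) \<and> critical_tree (g t) = t" by metis
  have gc: "cset n d (g t)" if "nset n (int d) t" for t
    using g[OF that] critical_tree_shape[of "g t"] that by (auto simp: gr_def nset_def)
  have "supp (cset n d) (lin_ext (\<lambda>t. bas (g t)) b)"
    by (rule supp_linI[OF b(1)]) (auto simp: gc intro!: supp_bas lin_intros)
  moreover have "lin_ext (\<lambda>u. bas (critical_tree u)) (lin_ext (\<lambda>t. bas (g t)) b) = b"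
    by (rule supp_eqI[OF b(1), of "\<lambda>b. lin_ext (\<lambda>u. bas (critical_tree u)) (lin_ext (\<lambda>t. bas (g t)) b)" "\<lambda>b. b"])
      (auto intro!: lin_intros simp: g)
  ultimately show ?thesis using b(2) by (intro exI[of _ "lin_ext (\<lambda>t. bas (g t)) b"]) simp
qed


section \<open>The quasi-isomorphism\<close>

lemma lin_ext_critical_tree_free:
  assumes "supp (cset n d) c"
  shows "lin_ext (\<lambda>u. bas (critical_tree u)) c \<in> free_cmp nu_gens n (int d)"
  by (rule free_cmp_lin_ext) (use assms critical_tree_cset in \<open>auto simp: supp_def intro!: free_cmp_single\<close>)

lemma NF_nuF_critical_tree: "NF (lin_ext nuF (lin_ext (\<lambda>u. bas (critical_tree u)) c)) = nux c"
  unfolding nux_def lin_ext_lin_ext is_lin_of_lin_ext[OF is_lin_NF] by (simp add: nfF_def)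

lemma dif_nu: "dif (\<lambda>_. 0) x = 0" if "x \<in> free_cmp nu_gens n d"
  using dif_zero[of nu_gens "\<lambda>_. 0" x] free_cmp_supp[OF that] by simp

lemma dif_nuF_ideal:
  assumes "x \<in> free_cmp nu_gens n d"
  shows "in_ideal hq_gens ncBV_relators n (d - 1) (dif hq_diff (lin_ext nuF x) :: tree \<Rightarrow>\<^sub>0 'k::field)"
proof -
  have "NFd (lin_ext nuF x) = (0 :: nt \<Rightarrow>\<^sub>0 'k)"
    by (rule free_eqI[OF assms, of "\<lambda>x. NFd (lin_ext nuF x)" "\<lambda>_. 0"]) (auto intro!: lin_intros simp: NFd_nuF)
  moreover have "dif hq_diff (lin_ext nuF x) \<in> (free_cmp hq_gens n (d - 1) :: (tree \<Rightarrow>\<^sub>0 'k) set)"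
    by (rule hq.dif_free[OF lin_ext_nuF_free[OF assms]])
  ultimately show ?thesis by (simp add: in_ideal_iff_NF NFd_def)
qed

text \<open>Modulo relators, \<open>x\<close> comes from a combination \<open>c\<close> of critical
  monomials. Its image is a boundary, so \<open>c = 0\<close> and \<open>x\<close> lies in the
  ideal; as the differential of ncHyperCom is zero, this is injectivity on homology.\<close>

lemma ncHyperCom_hquot_injective:
  assumes "x \<in> free_cmp nu_gens n d" "y \<in> free_cmp hq_gens n (d + 1)"
    "in_ideal hq_gens ncBV_relators n d (lin_ext nuF x - dif hq_diff y :: tree \<Rightarrow>\<^sub>0 'k::field)"
  shows "HC n d x"
proof (cases "0 \<le> d")
  case True
  then obtain d' where d: "d = int d'" by (metis nonneg_int_cases)
  then obtain c where c: "supp (cset n d') c" "HC n d (x - lin_ext (\<lambda>u. bas (critical_tree u)) c)"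
    using free_eq_critical[of x n d'] assms(1) by auto
  have "NF (lin_ext nuF (x - lin_ext (\<lambda>u. bas (critical_tree u)) c)) = 0"
    by (rule NF_ideal[OF nuF_ideal[OF c(2)]])
  then have "NF (lin_ext nuF x) = nux c" by (simp add: is_lin_diff[OF is_lin_lin_extI] NF_nuF_critical_tree)
  moreover have "NF (lin_ext nuF x - dif hq_diff y) = 0" by (rule NF_ideal[OF assms(3)])
  moreover have y: "y \<in> free_cmp hq_gens n (int (Suc d'))" using assms(2) d by (simp add: add.commute)
  ultimately have "nux c = ddx (NF y)" using NFd_eq_ddx[OF y] by (simp add: NFd_def)
  then have "c = 0" by (rule boundary_critical[OF NF_bset[OF y] c(1)])
  then show ?thesis using c(2) by simp
next
  case False
  \<comment> \<open>Normal monomials carry degrees in \<open>nat\<close>, so negative degrees are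
    treated apart; the free component is zero there.\<close>
  then have "x = 0" using free_cmp_negative[OF assms(1) nu_deg_nonneg] by simp
  then show ?thesis by (simp add: in_ideal.zero)
qed

text \<open>In the decomposition of the normal form of the cycle, the boundary part is realized on
  trees by \<open>EM z\<close> and the rest by critical trees.\<close>

lemma ncHyperCom_hquot_surjective:
  assumes "y \<in> free_cmp hq_gens n d" "in_ideal hq_gens ncBV_relators n (d - 1) (dif hq_diff y :: tree \<Rightarrow>\<^sub>0 'k::field)"
  shows "\<exists>x\<in>free_cmp nu_gens n d. \<exists>z\<in>free_cmp hq_gens n (d + 1).
    in_ideal hq_gens ncBV_relators n d (y - (dif hq_diff z + lin_ext nuF x))"
proof (cases "0 \<le> d")
  case True
  then obtain d' where d: "d = int d'" by (metis nonneg_int_cases)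
  have y: "y \<in> free_cmp hq_gens n (int d')" using assms(1) d by simp
  have "ddx (NF y) = 0" using NFd_eq_ddx[OF y] NF_ideal[OF assms(2)] by (simp add: NFd_def)
  then obtain z c where zc: "supp (bset n (Suc d')) z" "supp (cset n d') c" "NF y = ddx z + nux c"
    using cycle_decomposition[OF NF_bset[OF y]] by blast
  let ?x = "lin_ext (\<lambda>u. bas (critical_tree u)) c"
  have x: "?x \<in> free_cmp nu_gens n d" using lin_ext_critical_tree_free[OF zc(2)] d by simp
  have z: "EM z \<in> free_cmp hq_gens n (d + 1)" using EM_bset_free[OF zc(1)] d by (simp add: add.commute)
  have "NF (y - (dif hq_diff (EM z) + lin_ext nuF ?x)) = 0"
    using zc(3) by (simp add: NF_nuF_critical_tree) (simp add: ddx_def NFd_def)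
  moreover have "y - (dif hq_diff (EM z) + lin_ext nuF ?x) \<in> free_cmp hq_gens n d"
    using hq.dif_free[OF z] by (intro free_cmp_diff free_cmp_add lin_ext_nuF_free x assms(1)) simp
  ultimately have "in_ideal hq_gens ncBV_relators n d (y - (dif hq_diff (EM z) + lin_ext nuF ?x))"
    by (simp only: in_ideal_iff_NF)
  then show ?thesis using x z by blast
next
  case False
  then have "y = 0" using free_cmp_negative[OF assms(1) hq_deg_nonneg] by simp
  then show ?thesis by (intro bexI[of _ 0]) (auto simp: in_ideal.zero is_lin_zero[OF is_lin_dif])
qed

lemma quasi_iso_step_ncHyperCom:
  "quasi_iso_step (ncHyperCom :: ('k::field, (tree \<Rightarrow>\<^sub>0 'k) set) operad_data) ncBV_hquot_Delta"
  unfolding ncHyperCom_def ncBV_hquot_Delta_def nu_gens_def[symmetric] hq_gens_def[symmetric]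
proof (rule quasi_iso_step_presented[where F = nuF])
  show "operad_presentation nu_gens (\<lambda>_. 0 :: tree \<Rightarrow>\<^sub>0 'k) ncHyperCom_relators" by (rule nu.operad_presentation_axioms)
  show "operad_presentation hq_gens (hq_diff :: gen \<Rightarrow> tree \<Rightarrow>\<^sub>0 'k) ncBV_relators" by (rule hq.operad_presentation_axioms)
next
  fix x :: "tree \<Rightarrow>\<^sub>0 'k" and n d assume x: "x \<in> free_cmp nu_gens n d"
  then show "in_ideal hq_gens ncBV_relators n (d - 1) (lin_ext nuF (dif (\<lambda>_. 0) x) - dif hq_diff (lin_ext nuF x))"
    using in_ideal_uminus[OF dif_nuF_ideal[OF x]] by (simp add: dif_nu)
next
  fix x y :: "tree \<Rightarrow>\<^sub>0 'k" and n d
  assume "x \<in> free_cmp nu_gens n d" "y \<in> free_cmp hq_gens n (d + 1)"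
    "in_ideal hq_gens ncBV_relators n d (lin_ext nuF x - dif hq_diff y)"
  then have "HC n d x" by (rule ncHyperCom_hquot_injective)
  then show "\<exists>z\<in>free_cmp nu_gens n (d + 1). HC n d (x - dif (\<lambda>_. 0) z)"
    by (intro bexI[of _ 0]) (auto simp: is_lin_zero[OF is_lin_dif])
next
  fix y :: "tree \<Rightarrow>\<^sub>0 'k" and n d
  assume y: "y \<in> free_cmp hq_gens n d" "in_ideal hq_gens ncBV_relators n (d - 1) (dif hq_diff y)"
  then obtain x z where "x \<in> free_cmp nu_gens n d" "z \<in> free_cmp hq_gens n (d + 1)"
    "in_ideal hq_gens ncBV_relators n d (y - (dif hq_diff z + lin_ext nuF x))"
    using ncHyperCom_hquot_surjective[OF y] by blast
  then show "\<exists>x\<in>free_cmp nu_gens n d. HC n (d - 1) (dif (\<lambda>_. 0) x) \<and>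
      (\<exists>z\<in>free_cmp hq_gens n (d + 1). in_ideal hq_gens ncBV_relators n d (y - (dif hq_diff z + lin_ext nuF x)))"
    by (intro bexI[of _ x] conjI bexI[of _ z]) (simp_all add: dif_nu in_ideal.zero)
qed (auto intro: nuF_free nuF_tcomp nuF_ideal)

theorem theorem7p3p1:
  shows "quasi_isomorphic (ncHyperCom :: ('k::field, (tree \<Rightarrow>\<^sub>0 'k) set) operad_data) ncBV_hquot_Delta"
  using quasi_iso_step_ncHyperCom[where 'k = 'k] r_into_equivclp[of quasi_iso_step "ncHyperCom :: ('k, (tree \<Rightarrow>\<^sub>0 'k) set) operad_data" ncBV_hquot_Delta]
  unfolding quasi_isomorphic_def quasi_iso_step_def[of ncHyperCom ncBV_hquot_Delta] by blast

end
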